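(* Let $\mathbb{K}$ be a field of characteristic zero, $W$ a finite-dimensional $\mathbb{K}$-vector space, and suppose that the pairing $\langle\cdot,\cdot\rangle\colon W\otimes W\to\mathbb{K}$ is skew-symmetric. Then for each $k\geq 1$ the map $$(-1)^k\,\delta^{\mathrm{Ham}_{\langle\cdot,\cdot\rangle},\nabla_W}_k\colon |T(W)|^{\otimes k}\to|T(W)|^{\otimes 2}$$ coincides with the operation $|T(W)|^{\otimes k}\to|T(W)|^{\otimes 2}$ given by the directed labelled ribbon graph $L_k$ (the $k$-cycle with $k$ bivalent vertices and $k$ edges described in the context).
   Context: Conventions. Unadorned tensor products are over $\mathbb{K}$. For a unital associative $\mathbb{K}$-algebra $B$, $|B|=B/[B,B]$ is the quotient by the $\mathbb{K}$-span of commutators, and $|b|$ is the class of $b$. $B^{\mathrm e}=B\otimes B^{\mathrm{op}}$. Modules are left modules; $B^{\mathrm e}$-modules are $B$-bimodules. $\Omega^1B$ is the $B$-bimodule generated by symbols $db$ ($b\in B$) subject to $d$ being $\mathbb{K}$-linear and $d(bb')=(db)b'+b(db')$. For $f\in\mathrm{Der}_{\mathbb K}(B)$ the contraction $i_f\colon\Omega^1B\to B$ is the bimodule map with $i_f(db)=f(b)$, and the Lie derivative is $L_f(b\,db')=f(b)\,db'+b\,d(f(b'))$. A connection on a $B$-module $M$ is a $\mathbb{K}$-linear map $\nabla\colon M\to\Omega^1B\otimes_BM$ with $\nabla(bm)=db\otimes m+b\nabla(m)$. For $M$ finitely generated projective, $\mathrm{Tr}\colon\mathrm{End}_B(M)\cong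 M^*\otimes_BM\to|B|$, $\mu\otimes m\mapsto|\mu(m)|$, where $M^*=\mathrm{Hom}_B(M,B)$. The map $\delta_k$. Let $A=T(W)$ be the tensor algebra, $B=A^{\mathrm e}$, $M=\Omega^1A$ (a free $A^{\mathrm e}$-module of finite rank, a basis being $dw$ for $w$ in a basis of $W$). For $f\in\mathrm{Der}_{\mathbb K}(A)$ put $\varphi(f)=f\otimes\mathrm{id}+\mathrm{id}\otimes f\in\mathrm{Der}_{\mathbb K}(A^{\mathrm e})$ and $\rho(f)=L_f\in\mathrm{End}_{\mathbb K}(\Omega^1A)$. The canonical flat connection $\nabla_W$ on the $A^{\mathrm e}$-module $\Omega^1A$ is determined by $\nabla_W(dw)=0$ for all $w\in W$. Define $c_{\nabla_W}(f)=(i_{\varphi(f)}\otimes\mathrm{id})\circ\nabla_W-\rho(f)\in\mathrm{End}_{A^{\mathrm e}}(\Omega^1A)$ and $$\mathrm{Div}_k^{\nabla_W}(f_1,\dots,f_k)=\mathrm{Tr}\big(c_{\nabla_W}(f_1)\circ\cdots\circ c_{\nabla_W}(f_k)\big)\in|A^{\mathrm e}|\cong|A|^{\otimes 2},$$ where the class of $a\otimes b$ corresponds to $|a|\otimes|b|$. Extend the pairing to $T(W)\otimes T(W)\to T(W)\otimes T(W)$ by, for $u_i,w_j\in W$, $$\langle u_1\cdots u_r,w_1\cdots w_s\rangle=\sum_{i,j}\langle u_i,w_j\rangle\,w_1\cdots w_{j-1}u_{i+1}\cdots u_r\otimes u_1\cdots u_{i-1}w_{j+1}\cdots w_s.$$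 The Hamiltonian flow $\mathrm{Ham}_{\langle\cdot,\cdot\rangle}\colon|T(W)|\to\mathrm{Der}_{\mathbb K}(T(W))$ sends $a$ to the map $b\mapsto$ (product of the two tensor factors of $\langle a,b\rangle$); thus for a cyclic word $\mathbf w=w_1\cdots w_r$ and $w\in W$, $\mathrm{Ham}_{\langle\cdot,\cdot\rangle}(\mathbf w)(w)=\sum_{s}\langle w_s,w\rangle\,w_{s+1}\cdots w_r w_1\cdots w_{s-1}$. Finally $\delta_k^{\mathrm{Ham}_{\langle\cdot,\cdot\rangle},\nabla_W}=\mathrm{Div}^{\nabla_W}_k\circ(\mathrm{Ham}_{\langle\cdot,\cdot\rangle})^{\otimes k}$. Ribbon graphs. A ribbon graph without isolated vertices is a finite non-empty set $H$ of half-edges with a fixed-point-free involution $\tau_1$ and a bijection $\tau_0$; vertices are the $\tau_0$-orbits (each cyclically ordered by $\tau_0$), edges are the $\tau_1$-orbits, boundary components are the orbits of $\tau_1^{-1}\circ\tau_0$. It is directed if every edge $\{h,\tau_1(h)\}$ is given a total order, and labelled if its $n$ vertices are numbered $1,\dots,n$, its edges are numbered, and its $m$ boundary components are numbered $\bar 1,\dots,\bar m$. The graph $L_k$ is the planar $k$-cycle with vertices $1,2,\dots,k$ placed counterclockwise on a circle, directed edges $1\to2\to\cdots\to k\to1$, cyclic orders at vertices counterclockwise, inner boundary labelled $\bar1$ and outer boundary labelled $\bar2$. Explicitly: $H=\{o_i,t_i:1\le i\le k\}$ (indices mod $k$), $\tau_1$ exchanges $o_i$ and $t_{i+1}$ with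 direction $o_i<t_{i+1}$, $\tau_0$ exchanges $o_i$ and $t_i$, vertex $i$ is $\{o_i,t_i\}$, boundary $\bar 1$ is the orbit $\{o_1,\dots,o_k\}$, boundary $\bar2$ is the orbit $\{t_1,\dots,t_k\}$. (The edge labelling is irrelevant.) Operation of a directed labelled ribbon graph $\Gamma$ with $n$ vertices and $m$ boundaries: it is the linear map $|T(W)|^{\otimes n}\to|T(W)|^{\otimes m}$ whose value on cyclic words $\mathbf w_i=w^{(i)}_1\cdots w^{(i)}_{r_i}$ is computed as follows. (1) Let $H(i)\subset H$ be the set of half-edges at vertex $i$, and choose for each $i$ a cyclic-order-preserving injection $q_i\colon H(i)\to\{1,\dots,r_i\}$, where $\{1,\dots,r_i\}$ has its standard cyclic order; this arranges the letters of $\mathbf w_i$ cyclically around the vertex $i$, with $w^{(i)}_{q_i(h)}$ on the half-edge $h$ and the other letters in between. If no such injection exists the value is $0$. (2) For each directed edge $h<\tau_1(h)$ from vertex $i$ to vertex $i'$ take the scalar $\langle w^{(i)}_{q_i(h)},w^{(i')}_{q_{i'}(\tau_1(h))}\rangle$; let $\lambda$ be the product of these over all edges. (3) Let $\mathbf w'_l$ be the cyclic word obtained by collecting the unpaired letters along the $l$-th boundary: going through the orbit $h\mapsto\tau_1^{-1}\tau_0(h)\mapsto\cdots$, one writes for each $h$ in turn the letters lying strictly between the positions of $h$ and of $\tau_0(h)$ in the cyclic order at their vertex. (4) The value is the sum of $\lambda\,\mathbf w'_1\otimes\cdots\otimes\mathbf w'_m$ over all choices of $(q_i)_i$. *)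

theory Defs
  imports "HOL-Algebra.AbelCoset" "HOL-Algebra.Module"
begin

section \<open>Modules given by generators and relations\<close>

text \<open>
  The library locale for modules requires a commutative base ring, while the modules below also
  live over noncommutative rings (such as enveloping algebras). The record of the library is used
  throughout: a left module over \<open>R\<close> is a \<open>module\<close> record, whose ring multiplication and unit are
  irrelevant, and an algebra over \<open>K\<close> is a \<open>module\<close> record over \<open>K\<close> carrying its ring structure.
  Linear maps are extensional, so that they are determined by their values on the carrier.
\<close>

definition linear_maps ::
    "('r, 'p) ring_scheme \<Rightarrow> ('r, 'm, 'q) module_scheme \<Rightarrow> ('r, 'n, 's) module_scheme \<Rightarrow> ('m \<Rightarrow> 'n) set"
  where "linear_maps R M N = {f \<in> carrier M \<rightarrow>\<^sub>E carrier N.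
    (\<forall>x \<in> carrier M. \<forall>y \<in> carrier M. f (x \<oplus>\<^bsub>M\<^esub> y) = f x \<oplus>\<^bsub>N\<^esub> f y) \<and>
    (\<forall>r \<in> carrier R. \<forall>x \<in> carrier M. f (r \<odot>\<^bsub>M\<^esub> x) = r \<odot>\<^bsub>N\<^esub> f x)}"

definition submodule_generated ::
    "('r, 'p) ring_scheme \<Rightarrow> ('r, 'm, 'q) module_scheme \<Rightarrow> 'm set \<Rightarrow> 'm set"
  where "submodule_generated R M S = \<Inter> {N. submodule N R M \<and> S \<subseteq> N}"

definition quotient_module :: "('r, 'm, 'q) module_scheme \<Rightarrow> 'm set \<Rightarrow> ('r, 'm set) module"
  where "quotient_module M N =
    \<lparr>carrier = a_rcosets\<^bsub>M\<^esub> N, mult = undefined, one = undefined, zero = N, add = set_add M,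
     smult = (\<lambda>r C. \<Union>x\<in>C. N +>\<^bsub>M\<^esub> (r \<odot>\<^bsub>M\<^esub> x))\<rparr>"

definition free_module :: "('r, 'p) ring_scheme \<Rightarrow> 'x set \<Rightarrow> ('r, 'x \<Rightarrow> 'r) module"
  where "free_module R X =
    \<lparr>carrier = {p. (\<forall>x \<in> X. p x \<in> carrier R) \<and> (\<forall>x. x \<notin> X \<longrightarrow> p x = \<zero>\<^bsub>R\<^esub>) \<and>
                   finite {x. p x \<noteq> \<zero>\<^bsub>R\<^esub>}},
     mult = undefined, one = undefined,
     zero = (\<lambda>x. \<zero>\<^bsub>R\<^esub>), add = (\<lambda>p q x. p x \<oplus>\<^bsub>R\<^esub> q x),
     smult = (\<lambda>r p x. r \<otimes>\<^bsub>R\<^esub> p x)\<rparr>"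

definition free_gen :: "('r, 'p) ring_scheme \<Rightarrow> 'x \<Rightarrow> 'x \<Rightarrow> 'r"
  where "free_gen R x = (\<lambda>y. if y = x then \<one>\<^bsub>R\<^esub> else \<zero>\<^bsub>R\<^esub>)"

definition presented_module ::
    "('r, 'p) ring_scheme \<Rightarrow> 'x set \<Rightarrow> ('x \<Rightarrow> 'r) set \<Rightarrow> ('r, ('x \<Rightarrow> 'r) set) module"
  where "presented_module R X E =
    quotient_module (free_module R X) (submodule_generated R (free_module R X) E)"

definition presented_gen ::
    "('r, 'p) ring_scheme \<Rightarrow> 'x set \<Rightarrow> ('x \<Rightarrow> 'r) set \<Rightarrow> 'x \<Rightarrow> ('x \<Rightarrow> 'r) set"
  where "presented_gen R X E x =
    submodule_generated R (free_module R X) E +>\<^bsub>free_module R X\<^esub> free_gen R x"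

text \<open>
  \<open>lift R U F\<close> is the \<open>R\<close>-linear map from a presented module to \<open>U\<close> sending the generator \<open>x\<close>
  to \<open>F x\<close>: it is evaluated on an arbitrary representative in the free module, the choice being
  immaterial when \<open>F\<close> respects the relations.
\<close>

definition lift ::
    "('r, 'p) ring_scheme \<Rightarrow> ('r, 'u, 'q) module_scheme \<Rightarrow> ('x \<Rightarrow> 'u) \<Rightarrow> ('x \<Rightarrow> 'r) set \<Rightarrow> 'u"
  where "lift R U F C =
    (let p = (SOME p. p \<in> C) in \<Oplus>\<^bsub>U\<^esub> x \<in> {x. p x \<noteq> \<zero>\<^bsub>R\<^esub>}. p x \<odot>\<^bsub>U\<^esub> F x)"


section \<open>Tensor products\<close>

definition bilinear_relations ::
    "('k, 'p) ring_scheme \<Rightarrow> ('k, 'm, 'q) module_scheme \<Rightarrow> ('k, 'n, 's) module_scheme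
      \<Rightarrow> ('m \<times> 'n \<Rightarrow> 'k) set"
  where "bilinear_relations K M N =
    (let F = free_module K (carrier M \<times> carrier N); e = (\<lambda>x y. free_gen K (x, y)) in
      {e (x \<oplus>\<^bsub>M\<^esub> x') y \<ominus>\<^bsub>F\<^esub> (e x y \<oplus>\<^bsub>F\<^esub> e x' y) | x x' y.
        x \<in> carrier M \<and> x' \<in> carrier M \<and> y \<in> carrier N} \<union>
      {e x (y \<oplus>\<^bsub>N\<^esub> y') \<ominus>\<^bsub>F\<^esub> (e x y \<oplus>\<^bsub>F\<^esub> e x y') | x y y'.
        x \<in> carrier M \<and> y \<in> carrier N \<and> y' \<in> carrier N} \<union>
      {e (c \<odot>\<^bsub>M\<^esub> x) y \<ominus>\<^bsub>F\<^esub> c \<odot>\<^bsub>F\<^esub> e x y | c x y.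
        c \<in> carrier K \<and> x \<in> carrier M \<and> y \<in> carrier N} \<union>
      {e x (c \<odot>\<^bsub>N\<^esub> y) \<ominus>\<^bsub>F\<^esub> c \<odot>\<^bsub>F\<^esub> e x y | c x y.
        c \<in> carrier K \<and> x \<in> carrier M \<and> y \<in> carrier N})"

definition tensor ::
    "('k, 'p) ring_scheme \<Rightarrow> ('k, 'm, 'q) module_scheme \<Rightarrow> ('k, 'n, 's) module_scheme
      \<Rightarrow> ('k, ('m \<times> 'n \<Rightarrow> 'k) set) module"
  where "tensor K M N =
    presented_module K (carrier M \<times> carrier N) (bilinear_relations K M N)"

definition pure_tensor ::
    "('k, 'p) ring_scheme \<Rightarrow> ('k, 'm, 'q) module_scheme \<Rightarrow> ('k, 'n, 's) module_scheme
      \<Rightarrow> 'm \<Rightarrow> 'n \<Rightarrow> ('m \<times> 'n \<Rightarrow> 'k) set"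
  where "pure_tensor K M N x y =
    presented_gen K (carrier M \<times> carrier N) (bilinear_relations K M N) (x, y)"

text \<open>Restriction of scalars from a \<open>K\<close>-algebra \<open>B\<close> to \<open>K\<close>.\<close>

definition restrict_scalars ::
    "('k, 'b, 'p) module_scheme \<Rightarrow> ('b, 'm, 'q) module_scheme \<Rightarrow> ('k, 'm) module"
  where "restrict_scalars B M =
    \<lparr>carrier = carrier M, mult = mult M, one = one M, zero = zero M, add = add M,
     smult = (\<lambda>c x. (c \<odot>\<^bsub>B\<^esub> \<one>\<^bsub>B\<^esub>) \<odot>\<^bsub>M\<^esub> x)\<rparr>"

text \<open>
  The tensor product over \<open>B\<close> of a right \<open>B\<close>-module \<open>M\<close>, given as a \<open>K\<close>-module together with the
  right action \<open>act\<close>, and a left \<open>B\<close>-module \<open>N\<close>.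
\<close>

definition tensor_over_relations ::
    "('k, 'p) ring_scheme \<Rightarrow> ('k, 'b, 'q) module_scheme \<Rightarrow> ('k, 'm, 's) module_scheme
      \<Rightarrow> ('m \<Rightarrow> 'b \<Rightarrow> 'm) \<Rightarrow> ('b, 'n, 't) module_scheme \<Rightarrow> ('m \<times> 'n \<Rightarrow> 'k) set"
  where "tensor_over_relations K B M act N =
    bilinear_relations K M (restrict_scalars B N) \<union>
    (let F = free_module K (carrier M \<times> carrier N) in
      {free_gen K (act x b, y) \<ominus>\<^bsub>F\<^esub> free_gen K (x, b \<odot>\<^bsub>N\<^esub> y) | x b y.
        x \<in> carrier M \<and> b \<in> carrier B \<and> y \<in> carrier N})"

definition tensor_over ::
    "('k, 'p) ring_scheme \<Rightarrow> ('k, 'b, 'q) module_scheme \<Rightarrow> ('k, 'm, 's) module_scheme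
      \<Rightarrow> ('m \<Rightarrow> 'b \<Rightarrow> 'm) \<Rightarrow> ('b, 'n, 't) module_scheme \<Rightarrow> ('k, ('m \<times> 'n \<Rightarrow> 'k) set) module"
  where "tensor_over K B M act N =
    presented_module K (carrier M \<times> carrier N) (tensor_over_relations K B M act N)"

definition pure_over ::
    "('k, 'p) ring_scheme \<Rightarrow> ('k, 'b, 'q) module_scheme \<Rightarrow> ('k, 'm, 's) module_scheme
      \<Rightarrow> ('m \<Rightarrow> 'b \<Rightarrow> 'm) \<Rightarrow> ('b, 'n, 't) module_scheme \<Rightarrow> 'm \<Rightarrow> 'n \<Rightarrow> ('m \<times> 'n \<Rightarrow> 'k) set"
  where "pure_over K B M act N x y =
    presented_gen K (carrier M \<times> carrier N) (tensor_over_relations K B M act N) (x, y)"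

text \<open>
  Relations on lists of vectors expressing linearity in every slot. On all lists over \<open>V\<close> they
  present the tensor algebra, on the lists of length \<open>n\<close> the \<open>n\<close>-th tensor power.
\<close>

definition multilinear_relations ::
    "('k, 'p) ring_scheme \<Rightarrow> ('k, 'v, 'q) module_scheme \<Rightarrow> 'v list set \<Rightarrow> ('v list \<Rightarrow> 'k) set"
  where "multilinear_relations K V L =
    (let F = free_module K L; e = free_gen K in
      {e (xs @ (v \<oplus>\<^bsub>V\<^esub> v') # ys) \<ominus>\<^bsub>F\<^esub> (e (xs @ v # ys) \<oplus>\<^bsub>F\<^esub> e (xs @ v' # ys)) | xs ys v v'.
        xs @ v # ys \<in> L \<and> xs @ v' # ys \<in> L} \<union>
      {e (xs @ (c \<odot>\<^bsub>V\<^esub> v) # ys) \<ominus>\<^bsub>F\<^esub> c \<odot>\<^bsub>F\<^esub> e (xs @ v # ys) | xs ys c v.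
        c \<in> carrier K \<and> xs @ v # ys \<in> L})"

definition lists_of_length :: "('k, 'v, 'q) module_scheme \<Rightarrow> nat \<Rightarrow> 'v list set"
  where "lists_of_length V n = {xs \<in> lists (carrier V). length xs = n}"

definition tensor_power ::
    "('k, 'p) ring_scheme \<Rightarrow> ('k, 'v, 'q) module_scheme \<Rightarrow> nat \<Rightarrow> ('k, ('v list \<Rightarrow> 'k) set) module"
  where "tensor_power K V n =
    presented_module K (lists_of_length V n) (multilinear_relations K V (lists_of_length V n))"

definition pure_power ::
    "('k, 'p) ring_scheme \<Rightarrow> ('k, 'v, 'q) module_scheme \<Rightarrow> 'v list \<Rightarrow> ('v list \<Rightarrow> 'k) set"
  where "pure_power K V xs =
    (let L = lists_of_length V (length xs)
     in presented_gen K L (multilinear_relations K V L) xs)"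


section \<open>Algebras\<close>

definition opposite_algebra :: "('k, 'b, 'q) module_scheme \<Rightarrow> ('k, 'b, 'q) module_scheme"
  where "opposite_algebra B = B\<lparr>mult := (\<lambda>x y. y \<otimes>\<^bsub>B\<^esub> x)\<rparr>"

definition algebra_tensor ::
    "('k, 'p) ring_scheme \<Rightarrow> ('k, 'a, 'q) module_scheme \<Rightarrow> ('k, 'b, 's) module_scheme
      \<Rightarrow> ('k, ('a \<times> 'b \<Rightarrow> 'k) set) module"
  where "algebra_tensor K A B = (tensor K A B)
    \<lparr>mult := (\<lambda>C D. lift K (tensor K A B) (\<lambda>(a, b). lift K (tensor K A B)
        (\<lambda>(a', b'). pure_tensor K A B (a \<otimes>\<^bsub>A\<^esub> a') (b \<otimes>\<^bsub>B\<^esub> b')) D) C),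
     one := pure_tensor K A B \<one>\<^bsub>A\<^esub> \<one>\<^bsub>B\<^esub>\<rparr>"

definition enveloping ::
    "('k, 'p) ring_scheme \<Rightarrow> ('k, 'b, 'q) module_scheme \<Rightarrow> ('k, ('b \<times> 'b \<Rightarrow> 'k) set) module"
  where "enveloping K B = algebra_tensor K B (opposite_algebra B)"

definition env_pure ::
    "('k, 'p) ring_scheme \<Rightarrow> ('k, 'b, 'q) module_scheme \<Rightarrow> 'b \<Rightarrow> 'b \<Rightarrow> ('b \<times> 'b \<Rightarrow> 'k) set"
  where "env_pure K B = pure_tensor K B (opposite_algebra B)"

text \<open>\<open>B\<close> as a bimodule over itself, that is, as a left module over its enveloping algebra.\<close>

definition regular_bimodule ::
    "('k, 'p) ring_scheme \<Rightarrow> ('k, 'b, 'q) module_scheme \<Rightarrow> (('b \<times> 'b \<Rightarrow> 'k) set, 'b) module"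
  where "regular_bimodule K B =
    \<lparr>carrier = carrier B, mult = mult B, one = one B, zero = zero B, add = add B,
     smult = (\<lambda>C x. lift K B (\<lambda>(a, b). a \<otimes>\<^bsub>B\<^esub> x \<otimes>\<^bsub>B\<^esub> b) C)\<rparr>"

definition regular_module :: "('k, 'b, 'q) module_scheme \<Rightarrow> ('b, 'b) module"
  where "regular_module B =
    \<lparr>carrier = carrier B, mult = mult B, one = one B, zero = zero B, add = add B,
     smult = mult B\<rparr>"

definition commutator_span :: "('k, 'p) ring_scheme \<Rightarrow> ('k, 'b, 'q) module_scheme \<Rightarrow> 'b set"
  where "commutator_span K B = submodule_generated K B
    {x \<otimes>\<^bsub>B\<^esub> y \<ominus>\<^bsub>B\<^esub> y \<otimes>\<^bsub>B\<^esub> x | x y. x \<in> carrier B \<and> y \<in> carrier B}"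

definition trace_space ::
    "('k, 'p) ring_scheme \<Rightarrow> ('k, 'b, 'q) module_scheme \<Rightarrow> ('k, 'b set) module"
  where "trace_space K B = quotient_module B (commutator_span K B)"

definition trace_class :: "('k, 'p) ring_scheme \<Rightarrow> ('k, 'b, 'q) module_scheme \<Rightarrow> 'b \<Rightarrow> 'b set"
  where "trace_class K B b = commutator_span K B +>\<^bsub>B\<^esub> b"

definition derivations :: "('k, 'p) ring_scheme \<Rightarrow> ('k, 'b, 'q) module_scheme \<Rightarrow> ('b \<Rightarrow> 'b) set"
  where "derivations K B = {f \<in> linear_maps K B B. \<forall>x \<in> carrier B. \<forall>y \<in> carrier B.
    f (x \<otimes>\<^bsub>B\<^esub> y) = f x \<otimes>\<^bsub>B\<^esub> y \<oplus>\<^bsub>B\<^esub> x \<otimes>\<^bsub>B\<^esub> f y}"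

text \<open>The isomorphism from \<open>|B\<^sup>e|\<close> to the tensor square of \<open>|B|\<close>.\<close>

definition env_trace_split ::
    "('k, 'p) ring_scheme \<Rightarrow> ('k, 'b, 'q) module_scheme \<Rightarrow> ('b \<times> 'b \<Rightarrow> 'k) set set
      \<Rightarrow> ('b set list \<Rightarrow> 'k) set"
  where "env_trace_split K B C =
    lift K (tensor_power K (trace_space K B) 2)
      (\<lambda>(a, b). pure_power K (trace_space K B) [trace_class K B a, trace_class K B b])
      (SOME x. x \<in> C)"


section \<open>Noncommutative differential forms and connections\<close>

definition omega_relations ::
    "('k, 'p) ring_scheme \<Rightarrow> ('k, 'b, 'q) module_scheme \<Rightarrow> ('b \<Rightarrow> ('b \<times> 'b \<Rightarrow> 'k) set) set"
  where "omega_relations K B =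
    (let E = enveloping K B; F = free_module E (carrier B); e = free_gen E in
      {e (x \<oplus>\<^bsub>B\<^esub> y) \<ominus>\<^bsub>F\<^esub> (e x \<oplus>\<^bsub>F\<^esub> e y) | x y. x \<in> carrier B \<and> y \<in> carrier B} \<union>
      {e (c \<odot>\<^bsub>B\<^esub> x) \<ominus>\<^bsub>F\<^esub> (c \<odot>\<^bsub>E\<^esub> \<one>\<^bsub>E\<^esub>) \<odot>\<^bsub>F\<^esub> e x | c x. c \<in> carrier K \<and> x \<in> carrier B} \<union>
      {e (x \<otimes>\<^bsub>B\<^esub> y) \<ominus>\<^bsub>F\<^esub>
        (env_pure K B \<one>\<^bsub>B\<^esub> y \<odot>\<^bsub>F\<^esub> e x \<oplus>\<^bsub>F\<^esub> env_pure K B x \<one>\<^bsub>B\<^esub> \<odot>\<^bsub>F\<^esub> e y) | x y.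
        x \<in> carrier B \<and> y \<in> carrier B})"

definition omega ::
    "('k, 'p) ring_scheme \<Rightarrow> ('k, 'b, 'q) module_scheme
      \<Rightarrow> (('b \<times> 'b \<Rightarrow> 'k) set, ('b \<Rightarrow> ('b \<times> 'b \<Rightarrow> 'k) set) set) module"
  where "omega K B = presented_module (enveloping K B) (carrier B) (omega_relations K B)"

definition differential ::
    "('k, 'p) ring_scheme \<Rightarrow> ('k, 'b, 'q) module_scheme \<Rightarrow> 'b \<Rightarrow> ('b \<Rightarrow> ('b \<times> 'b \<Rightarrow> 'k) set) set"
  where "differential K B b =
    presented_gen (enveloping K B) (carrier B) (omega_relations K B) b"

definition left_mult ::
    "('k, 'p) ring_scheme \<Rightarrow> ('k, 'b, 'q) module_scheme \<Rightarrow> 'b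
      \<Rightarrow> ('b \<Rightarrow> ('b \<times> 'b \<Rightarrow> 'k) set) set \<Rightarrow> ('b \<Rightarrow> ('b \<times> 'b \<Rightarrow> 'k) set) set"
  where "left_mult K B b \<omega> = env_pure K B b \<one>\<^bsub>B\<^esub> \<odot>\<^bsub>omega K B\<^esub> \<omega>"

definition right_mult ::
    "('k, 'p) ring_scheme \<Rightarrow> ('k, 'b, 'q) module_scheme
      \<Rightarrow> ('b \<Rightarrow> ('b \<times> 'b \<Rightarrow> 'k) set) set \<Rightarrow> 'b \<Rightarrow> ('b \<Rightarrow> ('b \<times> 'b \<Rightarrow> 'k) set) set"
  where "right_mult K B \<omega> b = env_pure K B \<one>\<^bsub>B\<^esub> b \<odot>\<^bsub>omega K B\<^esub> \<omega>"

definition omega_K ::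
    "('k, 'p) ring_scheme \<Rightarrow> ('k, 'b, 'q) module_scheme
      \<Rightarrow> ('k, ('b \<Rightarrow> ('b \<times> 'b \<Rightarrow> 'k) set) set) module"
  where "omega_K K B = restrict_scalars (enveloping K B) (omega K B)"

definition contraction ::
    "('k, 'p) ring_scheme \<Rightarrow> ('k, 'b, 'q) module_scheme \<Rightarrow> ('b \<Rightarrow> 'b)
      \<Rightarrow> ('b \<Rightarrow> ('b \<times> 'b \<Rightarrow> 'k) set) set \<Rightarrow> 'b"
  where "contraction K B f = lift (enveloping K B) (regular_bimodule K B) f"

definition lie_derivative ::
    "('k, 'p) ring_scheme \<Rightarrow> ('k, 'b, 'q) module_scheme \<Rightarrow> ('b \<Rightarrow> 'b)
      \<Rightarrow> ('b \<Rightarrow> ('b \<times> 'b \<Rightarrow> 'k) set) set \<Rightarrow> ('b \<Rightarrow> ('b \<times> 'b \<Rightarrow> 'k) set) set"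
  where "lie_derivative K B f =
    (THE L. L \<in> linear_maps K (omega_K K B) (omega_K K B) \<and>
      (\<forall>b \<in> carrier B. \<forall>b' \<in> carrier B.
        L (left_mult K B b (differential K B b')) =
          left_mult K B (f b) (differential K B b') \<oplus>\<^bsub>omega K B\<^esub>
          left_mult K B b (differential K B (f b'))))"

definition forms_tensor ::
    "('k, 'p) ring_scheme \<Rightarrow> ('k, 'b, 'q) module_scheme \<Rightarrow> ('b, 'm, 's) module_scheme
      \<Rightarrow> ('k, (('b \<Rightarrow> ('b \<times> 'b \<Rightarrow> 'k) set) set \<times> 'm \<Rightarrow> 'k) set) module"
  where "forms_tensor K B M = tensor_over K B (omega_K K B) (right_mult K B) M"

definition forms_pure ::
    "('k, 'p) ring_scheme \<Rightarrow> ('k, 'b, 'q) module_scheme \<Rightarrow> ('b, 'm, 's) module_scheme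
      \<Rightarrow> ('b \<Rightarrow> ('b \<times> 'b \<Rightarrow> 'k) set) set \<Rightarrow> 'm
      \<Rightarrow> (('b \<Rightarrow> ('b \<times> 'b \<Rightarrow> 'k) set) set \<times> 'm \<Rightarrow> 'k) set"
  where "forms_pure K B M = pure_over K B (omega_K K B) (right_mult K B) M"

definition forms_left_mult ::
    "('k, 'p) ring_scheme \<Rightarrow> ('k, 'b, 'q) module_scheme \<Rightarrow> ('b, 'm, 's) module_scheme \<Rightarrow> 'b
      \<Rightarrow> (('b \<Rightarrow> ('b \<times> 'b \<Rightarrow> 'k) set) set \<times> 'm \<Rightarrow> 'k) set
      \<Rightarrow> (('b \<Rightarrow> ('b \<times> 'b \<Rightarrow> 'k) set) set \<times> 'm \<Rightarrow> 'k) set"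
  where "forms_left_mult K B M b =
    lift K (forms_tensor K B M) (\<lambda>(\<omega>, m). forms_pure K B M (left_mult K B b \<omega>) m)"

definition connections ::
    "('k, 'p) ring_scheme \<Rightarrow> ('k, 'b, 'q) module_scheme \<Rightarrow> ('b, 'm, 's) module_scheme
      \<Rightarrow> ('m \<Rightarrow> (('b \<Rightarrow> ('b \<times> 'b \<Rightarrow> 'k) set) set \<times> 'm \<Rightarrow> 'k) set) set"
  where "connections K B M =
    {D \<in> linear_maps K (restrict_scalars B M) (forms_tensor K B M).
      \<forall>b \<in> carrier B. \<forall>m \<in> carrier M. D (b \<odot>\<^bsub>M\<^esub> m) =
        forms_pure K B M (differential K B b) m \<oplus>\<^bsub>forms_tensor K B M\<^esub>
        forms_left_mult K B M b (D m)}"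

text \<open>
  \<open>(i\<^sub>g \<otimes> id) \<circ> D - r\<close>, where \<open>B \<otimes>\<^sub>B M\<close> is identified with \<open>M\<close>; here \<open>g\<close> is a derivation of \<open>B\<close>
  and \<open>r\<close> a \<open>K\<close>-linear endomorphism of \<open>M\<close>.
\<close>

definition connection_defect ::
    "('k, 'p) ring_scheme \<Rightarrow> ('k, 'b, 'q) module_scheme \<Rightarrow> ('b, 'm, 's) module_scheme
      \<Rightarrow> ('m \<Rightarrow> (('b \<Rightarrow> ('b \<times> 'b \<Rightarrow> 'k) set) set \<times> 'm \<Rightarrow> 'k) set)
      \<Rightarrow> ('b \<Rightarrow> 'b) \<Rightarrow> ('m \<Rightarrow> 'm) \<Rightarrow> 'm \<Rightarrow> 'm"
  where "connection_defect K B M D g r = (\<lambda>m \<in> carrier M.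
    lift K (restrict_scalars B M) (\<lambda>(\<omega>, m'). contraction K B g \<omega> \<odot>\<^bsub>M\<^esub> m') (D m) \<ominus>\<^bsub>M\<^esub> r m)"


section \<open>The trace of an endomorphism\<close>

definition dual_module ::
    "('k, 'b, 'q) module_scheme \<Rightarrow> ('b, 'm, 's) module_scheme \<Rightarrow> ('k, 'm \<Rightarrow> 'b) module"
  where "dual_module B M =
    \<lparr>carrier = linear_maps B M (regular_module B), mult = undefined, one = undefined,
     zero = (\<lambda>x \<in> carrier M. \<zero>\<^bsub>B\<^esub>),
     add = (\<lambda>\<mu> \<nu>. \<lambda>x \<in> carrier M. \<mu> x \<oplus>\<^bsub>B\<^esub> \<nu> x),
     smult = (\<lambda>c \<mu>. \<lambda>x \<in> carrier M. c \<odot>\<^bsub>B\<^esub> \<mu> x)\<rparr>"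

definition dual_right_mult ::
    "('k, 'b, 'q) module_scheme \<Rightarrow> ('b, 'm, 's) module_scheme \<Rightarrow> ('m \<Rightarrow> 'b) \<Rightarrow> 'b \<Rightarrow> 'm \<Rightarrow> 'b"
  where "dual_right_mult B M \<mu> b = (\<lambda>x \<in> carrier M. \<mu> x \<otimes>\<^bsub>B\<^esub> b)"

definition dual_tensor ::
    "('k, 'p) ring_scheme \<Rightarrow> ('k, 'b, 'q) module_scheme \<Rightarrow> ('b, 'm, 's) module_scheme
      \<Rightarrow> ('k, (('m \<Rightarrow> 'b) \<times> 'm \<Rightarrow> 'k) set) module"
  where "dual_tensor K B M = tensor_over K B (dual_module B M) (dual_right_mult B M) M"

text \<open>The canonical map from \<open>M\<^sup>* \<otimes>\<^sub>B M\<close> to \<open>End\<^sub>B(M)\<close>, bijective for finitely generated projective \<open>M\<close>.\<close>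

definition dual_tensor_End ::
    "('k, 'p) ring_scheme \<Rightarrow> ('k, 'b, 'q) module_scheme \<Rightarrow> ('b, 'm, 's) module_scheme
      \<Rightarrow> (('m \<Rightarrow> 'b) \<times> 'm \<Rightarrow> 'k) set \<Rightarrow> 'm \<Rightarrow> 'm"
  where "dual_tensor_End K B M C = (\<lambda>x \<in> carrier M.
    lift K (restrict_scalars B M) (\<lambda>(\<mu>, m). \<mu> x \<odot>\<^bsub>M\<^esub> m) C)"

definition module_trace ::
    "('k, 'p) ring_scheme \<Rightarrow> ('k, 'b, 'q) module_scheme \<Rightarrow> ('b, 'm, 's) module_scheme
      \<Rightarrow> ('m \<Rightarrow> 'm) \<Rightarrow> 'b set"
  where "module_trace K B M \<phi> =
    lift K (trace_space K B) (\<lambda>(\<mu>, m). trace_class K B (\<mu> m))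
      (THE C. C \<in> carrier (dual_tensor K B M) \<and> dual_tensor_End K B M C = \<phi>)"


section \<open>The tensor algebra and the maps \<open>\<delta>\<^sub>k\<close>\<close>

definition tensor_alg_module ::
    "('k, 'p) ring_scheme \<Rightarrow> ('k, 'w, 'q) module_scheme \<Rightarrow> ('k, ('w list \<Rightarrow> 'k) set) module"
  where "tensor_alg_module K W =
    presented_module K (lists (carrier W)) (multilinear_relations K W (lists (carrier W)))"

text \<open>The product of the letters of a list.\<close>

definition tensor_word ::
    "('k, 'p) ring_scheme \<Rightarrow> ('k, 'w, 'q) module_scheme \<Rightarrow> 'w list \<Rightarrow> ('w list \<Rightarrow> 'k) set"
  where "tensor_word K W ws =
    presented_gen K (lists (carrier W)) (multilinear_relations K W (lists (carrier W))) ws"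

definition tensor_alg ::
    "('k, 'p) ring_scheme \<Rightarrow> ('k, 'w, 'q) module_scheme \<Rightarrow> ('k, ('w list \<Rightarrow> 'k) set) module"
  where "tensor_alg K W = (tensor_alg_module K W)
    \<lparr>mult := (\<lambda>C D. lift K (tensor_alg_module K W) (\<lambda>u. lift K (tensor_alg_module K W)
        (\<lambda>w. tensor_word K W (u @ w)) D) C),
     one := tensor_word K W []\<rparr>"

text \<open>The derivation \<open>f \<otimes> id + id \<otimes> f\<close> of the enveloping algebra.\<close>

definition env_derivation ::
    "('k, 'p) ring_scheme \<Rightarrow> ('k, 'b, 'q) module_scheme \<Rightarrow> ('b \<Rightarrow> 'b)
      \<Rightarrow> ('b \<times> 'b \<Rightarrow> 'k) set \<Rightarrow> ('b \<times> 'b \<Rightarrow> 'k) set"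
  where "env_derivation K B f = (\<lambda>C \<in> carrier (enveloping K B).
    lift K (enveloping K B)
      (\<lambda>(a, b). env_pure K B (f a) b \<oplus>\<^bsub>enveloping K B\<^esub> env_pure K B a (f b)) C)"

definition canonical_connection ::
    "('k, 'p) ring_scheme \<Rightarrow> ('k, 'w, 'q) module_scheme \<Rightarrow> _"
  where "canonical_connection K W =
    (let A = tensor_alg K W; E = enveloping K A in
      THE D. D \<in> connections K E (omega K A) \<and>
        (\<forall>w \<in> carrier W. D (differential K A (tensor_word K W [w])) =
          \<zero>\<^bsub>forms_tensor K E (omega K A)\<^esub>))"

definition div_cocycle ::
    "('k, 'p) ring_scheme \<Rightarrow> ('k, 'w, 'q) module_scheme \<Rightarrow> _ \<Rightarrow> _ \<Rightarrow> _"
  where "div_cocycle K W D f =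
    (let A = tensor_alg K W in
      connection_defect K (enveloping K A) (omega K A) D (env_derivation K A f)
        (lie_derivative K A f))"

text \<open>The \<open>k\<close> derivations are given as a list, the value lies in \<open>|A\<^sup>e|\<close>.\<close>

definition Div ::
    "('k, 'p) ring_scheme \<Rightarrow> ('k, 'w, 'q) module_scheme \<Rightarrow> _ \<Rightarrow> _ list \<Rightarrow> _"
  where "Div K W D fs =
    (let A = tensor_alg K W; M = omega K A in
      module_trace K (enveloping K A) M
        (foldr (compose (carrier M)) (map (div_cocycle K W D) fs) (\<lambda>m \<in> carrier M. m)))"

definition pairing_ext ::
    "('k, 'p) ring_scheme \<Rightarrow> ('k, 'w, 'q) module_scheme \<Rightarrow> ('w \<Rightarrow> 'w \<Rightarrow> 'k)
      \<Rightarrow> ('w list \<Rightarrow> 'k) set \<Rightarrow> ('w list \<Rightarrow> 'k) set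
      \<Rightarrow> (('w list \<Rightarrow> 'k) set \<times> ('w list \<Rightarrow> 'k) set \<Rightarrow> 'k) set"
  where "pairing_ext K W \<beta> a b =
    (let A = tensor_alg K W; T = tensor K A A in
      lift K T (\<lambda>u. lift K T (\<lambda>w.
        \<Oplus>\<^bsub>T\<^esub> i \<in> {..<length u}. \<Oplus>\<^bsub>T\<^esub> j \<in> {..<length w}. \<beta> (u ! i) (w ! j) \<odot>\<^bsub>T\<^esub>
          pure_tensor K A A (tensor_word K W (take j w @ drop (Suc i) u))
                            (tensor_word K W (take i u @ drop (Suc j) w))) b) a)"

definition Ham ::
    "('k, 'p) ring_scheme \<Rightarrow> ('k, 'w, 'q) module_scheme \<Rightarrow> ('w \<Rightarrow> 'w \<Rightarrow> 'k)
      \<Rightarrow> ('w list \<Rightarrow> 'k) set set \<Rightarrow> ('w list \<Rightarrow> 'k) set \<Rightarrow> ('w list \<Rightarrow> 'k) set"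
  where "Ham K W \<beta> a =
    (let A = tensor_alg K W in
      (\<lambda>b \<in> carrier A. lift K A (\<lambda>(x, y). x \<otimes>\<^bsub>A\<^esub> y) (pairing_ext K W \<beta> (SOME a'. a' \<in> a) b)))"

abbreviation cyclic_words ::
    "('k, 'p) ring_scheme \<Rightarrow> ('k, 'w, 'q) module_scheme \<Rightarrow> ('k, ('w list \<Rightarrow> 'k) set set) module"
  where "cyclic_words K W \<equiv> trace_space K (tensor_alg K W)"

definition cyclic_word ::
    "('k, 'p) ring_scheme \<Rightarrow> ('k, 'w, 'q) module_scheme \<Rightarrow> 'w list \<Rightarrow> ('w list \<Rightarrow> 'k) set set"
  where "cyclic_word K W ws = trace_class K (tensor_alg K W) (tensor_word K W ws)"

definition delta ::
    "('k, 'p) ring_scheme \<Rightarrow> ('k, 'w, 'q) module_scheme \<Rightarrow> ('w \<Rightarrow> 'w \<Rightarrow> 'k) \<Rightarrow> _ \<Rightarrow> nat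
      \<Rightarrow> (('w list \<Rightarrow> 'k) set set list \<Rightarrow> 'k) set \<Rightarrow> (('w list \<Rightarrow> 'k) set set list \<Rightarrow> 'k) set"
  where "delta K W \<beta> D k = (\<lambda>x \<in> carrier (tensor_power K (cyclic_words K W) k).
    lift K (tensor_power K (cyclic_words K W) 2)
      (\<lambda>as. env_trace_split K (tensor_alg K W) (Div K W D (map (Ham K W \<beta>) as))) x)"


section \<open>Ribbon graphs and their operations\<close>

text \<open>
  Vertices, edges and boundary components are orbits of half-edges; a labelling of orbits is given
  as a function on half-edges. The set \<open>sources\<close> contains the smaller half-edge of every edge.
\<close>

record 'h ribbon_graph =
  half_edges :: "'h set"
  tau0 :: "'h \<Rightarrow> 'h"
  tau1 :: "'h \<Rightarrow> 'h"
  sources :: "'h set"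
  vertex_label :: "'h \<Rightarrow> nat"
  edge_label :: "'h \<Rightarrow> nat"
  boundary_label :: "'h \<Rightarrow> nat"

definition num_vertices :: "'h ribbon_graph \<Rightarrow> nat"
  where "num_vertices G = card (vertex_label G ` half_edges G)"

definition num_boundaries :: "'h ribbon_graph \<Rightarrow> nat"
  where "num_boundaries G = card (boundary_label G ` half_edges G)"

text \<open>As \<open>tau1\<close> is an involution, this is \<open>tau1\<^sup>-\<^sup>1 \<circ> tau0\<close>.\<close>

definition boundary_step :: "'h ribbon_graph \<Rightarrow> 'h \<Rightarrow> 'h"
  where "boundary_step G h = tau1 G (tau0 G h)"

definition labels_orbits :: "'h set \<Rightarrow> ('h \<Rightarrow> 'h) \<Rightarrow> ('h \<Rightarrow> nat) \<Rightarrow> bool"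
  where "labels_orbits H \<sigma> l \<longleftrightarrow> l ` H = {1..card (l ` H)} \<and>
    (\<forall>h \<in> H. \<forall>h' \<in> H. l h = l h' \<longleftrightarrow> (\<exists>j. h' = (\<sigma> ^^ j) h))"

definition directed_labelled_ribbon_graph :: "'h ribbon_graph \<Rightarrow> bool"
  where "directed_labelled_ribbon_graph G \<longleftrightarrow>
    finite (half_edges G) \<and> half_edges G \<noteq> {} \<and>
    bij_betw (tau0 G) (half_edges G) (half_edges G) \<and>
    (\<forall>h \<in> half_edges G. tau1 G h \<in> half_edges G \<and> tau1 G h \<noteq> h \<and> tau1 G (tau1 G h) = h) \<and>
    sources G \<subseteq> half_edges G \<and>
    (\<forall>h \<in> half_edges G. h \<in> sources G \<longleftrightarrow> tau1 G h \<notin> sources G) \<and>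
    labels_orbits (half_edges G) (tau0 G) (vertex_label G) \<and>
    labels_orbits (half_edges G) (tau1 G) (edge_label G) \<and>
    labels_orbits (half_edges G) (boundary_step G) (boundary_label G)"

definition cyclically_ordered :: "nat \<Rightarrow> nat \<Rightarrow> nat \<Rightarrow> bool"
  where "cyclically_ordered x y z \<longleftrightarrow> x < y \<and> y < z \<or> y < z \<and> z < x \<or> z < x \<and> x < y"

text \<open>
  The word at the vertex labelled \<open>i\<close> is entry \<open>i - 1\<close> of the list \<open>ws\<close>, and positions in words
  are counted from \<open>0\<close>. The maps \<open>q\<^sub>i\<close> are combined into one function on half-edges.
\<close>

definition vertex_word :: "'h ribbon_graph \<Rightarrow> 'w list list \<Rightarrow> 'h \<Rightarrow> 'w list"
  where "vertex_word G ws h = ws ! (vertex_label G h - 1)"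

definition placements :: "'h ribbon_graph \<Rightarrow> 'w list list \<Rightarrow> ('h \<Rightarrow> nat) set"
  where "placements G ws =
    {q \<in> (\<Pi>\<^sub>E h \<in> half_edges G. {..<length (vertex_word G ws h)}).
      (\<forall>h \<in> half_edges G. inj_on q {h' \<in> half_edges G. vertex_label G h' = vertex_label G h}) \<and>
      (\<forall>h \<in> half_edges G. \<forall>a b. 0 < a \<and> a < b \<and>
        b < card {h' \<in> half_edges G. vertex_label G h' = vertex_label G h} \<longrightarrow>
        cyclically_ordered (q h) (q ((tau0 G ^^ a) h)) (q ((tau0 G ^^ b) h)))}"

definition placement_weight ::
    "('k, 'p) ring_scheme \<Rightarrow> ('w \<Rightarrow> 'w \<Rightarrow> 'k) \<Rightarrow> 'h ribbon_graph \<Rightarrow> 'w list list \<Rightarrow> ('h \<Rightarrow> nat) \<Rightarrow> 'k"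
  where "placement_weight K \<beta> G ws q =
    (\<Otimes>\<^bsub>K\<^esub> h \<in> sources G.
      \<beta> (vertex_word G ws h ! q h) (vertex_word G ws (tau1 G h) ! q (tau1 G h)))"

text \<open>
  The letters strictly between \<open>h\<close> and \<open>tau0 h\<close> in the cyclic order; at a univalent vertex these
  are all letters except the one on \<open>h\<close>, starting after \<open>h\<close>.
\<close>

definition letters_after :: "'h ribbon_graph \<Rightarrow> 'w list list \<Rightarrow> ('h \<Rightarrow> nat) \<Rightarrow> 'h \<Rightarrow> 'w list"
  where "letters_after G ws q h =
    (let w = vertex_word G ws h; r = length w in
      map (\<lambda>j. w ! ((q h + 1 + j) mod r)) [0..<(q (tau0 G h) + r - q h - 1) mod r])"

definition boundary_word :: "'h ribbon_graph \<Rightarrow> 'w list list \<Rightarrow> ('h \<Rightarrow> nat) \<Rightarrow> nat \<Rightarrow> 'w list"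
  where "boundary_word G ws q l =
    (let h = (SOME h. h \<in> half_edges G \<and> boundary_label G h = l) in
      concat (map (\<lambda>j. letters_after G ws q ((boundary_step G ^^ j) h))
        [0..<card {h \<in> half_edges G. boundary_label G h = l}]))"

definition operation_value ::
    "('k, 'p) ring_scheme \<Rightarrow> ('k, 'w, 'q) module_scheme \<Rightarrow> ('w \<Rightarrow> 'w \<Rightarrow> 'k) \<Rightarrow> 'h ribbon_graph
      \<Rightarrow> 'w list list \<Rightarrow> (('w list \<Rightarrow> 'k) set set list \<Rightarrow> 'k) set"
  where "operation_value K W \<beta> G ws =
    (\<Oplus>\<^bsub>tensor_power K (cyclic_words K W) (num_boundaries G)\<^esub> q \<in> placements G ws.
      placement_weight K \<beta> G ws q
        \<odot>\<^bsub>tensor_power K (cyclic_words K W) (num_boundaries G)\<^esub>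
      pure_power K (cyclic_words K W)
        (map (\<lambda>l. cyclic_word K W (boundary_word G ws q l)) [1..<Suc (num_boundaries G)]))"

definition graph_operation ::
    "('k, 'p) ring_scheme \<Rightarrow> ('k, 'w, 'q) module_scheme \<Rightarrow> ('w \<Rightarrow> 'w \<Rightarrow> 'k) \<Rightarrow> 'h ribbon_graph
      \<Rightarrow> (('w list \<Rightarrow> 'k) set set list \<Rightarrow> 'k) set \<Rightarrow> (('w list \<Rightarrow> 'k) set set list \<Rightarrow> 'k) set"
  where "graph_operation K W \<beta> G =
    (THE \<Phi>. \<Phi> \<in> linear_maps K (tensor_power K (cyclic_words K W) (num_vertices G))
                             (tensor_power K (cyclic_words K W) (num_boundaries G)) \<and>
      (\<forall>ws. length ws = num_vertices G \<and> set ws \<subseteq> lists (carrier W) \<longrightarrow>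
        \<Phi> (pure_power K (cyclic_words K W) (map (cyclic_word K W) ws)) =
          operation_value K W \<beta> G ws))"


section \<open>The cycle graphs\<close>

text \<open>\<open>Out i\<close> and \<open>Inc i\<close> are the outgoing and incoming half-edges at the vertex \<open>i\<close>.\<close>

datatype cycle_half_edge = Out nat | Inc nat

definition cycle_next :: "nat \<Rightarrow> nat \<Rightarrow> nat"
  where "cycle_next k i = (if i = k then 1 else i + 1)"

definition cycle_prev :: "nat \<Rightarrow> nat \<Rightarrow> nat"
  where "cycle_prev k i = (if i = 1 then k else i - 1)"

definition cycle_graph :: "nat \<Rightarrow> cycle_half_edge ribbon_graph"
  where "cycle_graph k =
    \<lparr>half_edges = Out ` {1..k} \<union> Inc ` {1..k},
     tau0 = (\<lambda>h. case h of Out i \<Rightarrow> Inc i | Inc i \<Rightarrow> Out i),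
     tau1 = (\<lambda>h. case h of Out i \<Rightarrow> Inc (cycle_next k i) | Inc i \<Rightarrow> Out (cycle_prev k i)),
     sources = Out ` {1..k},
     vertex_label = (\<lambda>h. case h of Out i \<Rightarrow> i | Inc i \<Rightarrow> i),
     edge_label = (\<lambda>h. case h of Out i \<Rightarrow> i | Inc i \<Rightarrow> cycle_prev k i),
     boundary_label = (\<lambda>h. case h of Out i \<Rightarrow> 1 | Inc i \<Rightarrow> 2)\<rparr>"

lemma boundary_step_Out: "boundary_step (cycle_graph k) (Out i) = Out (cycle_prev k i)"
  and boundary_step_Inc: "boundary_step (cycle_graph k) (Inc i) = Inc (cycle_next k i)"
  by (simp_all add: boundary_step_def cycle_graph_def)

lemma boundary_step_Out_funpow:
  "j < i \<Longrightarrow> (boundary_step (cycle_graph k) ^^ j) (Out i) = Out (i - j)"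
  by (induction j) (auto simp: boundary_step_Out cycle_prev_def)

lemma boundary_step_Inc_funpow:
  "i + j \<le> k \<Longrightarrow> (boundary_step (cycle_graph k) ^^ j) (Inc i) = Inc (i + j)"
  by (induction j) (auto simp: boundary_step_Inc cycle_next_def)

lemma boundary_reach_Out:
  assumes "i \<in> {1..k}" "i' \<in> {1..k}"
  shows "\<exists>j. Out i' = (boundary_step (cycle_graph k) ^^ j) (Out i)"
proof (cases "i' \<le> i")
  case True
  then have "(boundary_step (cycle_graph k) ^^ (i - i')) (Out i) = Out i'"
    using assms by (subst boundary_step_Out_funpow) auto
  then show ?thesis by metis
next
  case False
  have "(boundary_step (cycle_graph k) ^^ ((k - i') + (Suc 0 + (i - 1)))) (Out i) = Out i'"
    unfolding funpow_add o_apply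
    using assms
    by (simp add: boundary_step_Out_funpow boundary_step_Out cycle_prev_def)
  then show ?thesis by metis
qed

lemma boundary_reach_Inc:
  assumes "i \<in> {1..k}" "i' \<in> {1..k}"
  shows "\<exists>j. Inc i' = (boundary_step (cycle_graph k) ^^ j) (Inc i)"
proof (cases "i \<le> i'")
  case True
  then have "(boundary_step (cycle_graph k) ^^ (i' - i)) (Inc i) = Inc i'"
    using assms by (subst boundary_step_Inc_funpow) auto
  then show ?thesis by metis
next
  case False
  have "(boundary_step (cycle_graph k) ^^ ((i' - 1) + (Suc 0 + (k - i)))) (Inc i) = Inc i'"
    unfolding funpow_add o_apply
    using assms
    by (simp add: boundary_step_Inc_funpow boundary_step_Inc cycle_next_def)
  then show ?thesis by metis
qed

lemma labels_orbits_involution: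
  assumes "l ` H = {1..card (l ` H)}"
    and "\<And>h. h \<in> H \<Longrightarrow> \<sigma> (\<sigma> h) = h"
    and "\<And>h h'. h \<in> H \<Longrightarrow> h' \<in> H \<Longrightarrow> l h = l h' \<longleftrightarrow> h' = h \<or> h' = \<sigma> h"
  shows "labels_orbits H \<sigma> l"
proof -
  have "(\<sigma> ^^ j) h = h \<or> (\<sigma> ^^ j) h = \<sigma> h" if "h \<in> H" for j h
    using assms(2) that by (induction j) auto
  moreover have "(\<sigma> ^^ 0) h = h" "(\<sigma> ^^ 1) h = \<sigma> h" for h by auto
  ultimately show ?thesis
    unfolding labels_orbits_def using assms by metis
qed

lemma directed_labelled_ribbon_graph_cycle_graph:
  assumes "k \<ge> 1"
  shows "directed_labelled_ribbon_graph (cycle_graph k)"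
    and "num_vertices (cycle_graph k) = k" and "num_boundaries (cycle_graph k) = 2"
proof -
  let ?G = "cycle_graph k"
  have H: "half_edges ?G = Out ` {1..k} \<union> Inc ` {1..k}"
    by (simp add: cycle_graph_def)
  have np: "i \<in> {1..k} \<Longrightarrow> cycle_prev k (cycle_next k i) = i"
      "i \<in> {1..k} \<Longrightarrow> cycle_next k (cycle_prev k i) = i"
      "i \<in> {1..k} \<Longrightarrow> cycle_prev k i \<in> {1..k}"
      "i \<in> {1..k} \<Longrightarrow> cycle_next k i \<in> {1..k}" for i
    by (auto simp: cycle_prev_def cycle_next_def)
  have prev_img: "cycle_prev k ` {1..k} = {1..k}"
    using np by (metis (no_types, lifting) image_eqI image_subsetI subsetI subset_antisym)
  have vimg: "vertex_label ?G ` half_edges ?G = {1..k}"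
    unfolding H image_Un image_image by (simp add: cycle_graph_def)
  have eimg: "edge_label ?G ` half_edges ?G = {1..k}"
    unfolding H image_Un image_image using prev_img by (simp add: cycle_graph_def)
  have bimg: "boundary_label ?G ` half_edges ?G = {1, 2}"
    unfolding H image_Un image_image using assms by (auto simp: cycle_graph_def)
  show nv: "num_vertices ?G = k" and nb: "num_boundaries ?G = 2"
    unfolding num_vertices_def num_boundaries_def vimg bimg by simp_all
  have t0: "tau0 ?G (tau0 ?G h) = h" and t0H: "h \<in> half_edges ?G \<Longrightarrow> tau0 ?G h \<in> half_edges ?G" for h
    by (auto simp: cycle_graph_def split: cycle_half_edge.splits)
  have t1: "tau1 ?G h \<in> half_edges ?G \<and> tau1 ?G h \<noteq> h \<and> tau1 ?G (tau1 ?G h) = h"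
    if "h \<in> half_edges ?G" for h
    using that np by (auto simp: cycle_graph_def)
  have "bij_betw (tau0 ?G) (half_edges ?G) (half_edges ?G)"
    by (rule bij_betw_byWitness[where f' = "tau0 ?G"]) (use t0 t0H in auto)
  moreover have "\<forall>h \<in> half_edges ?G. h \<in> sources ?G \<longleftrightarrow> tau1 ?G h \<notin> sources ?G"
    using np by (auto simp: cycle_graph_def)
  moreover have "labels_orbits (half_edges ?G) (tau0 ?G) (vertex_label ?G)"
    by (rule labels_orbits_involution)
      (auto simp: vimg t0, auto simp: cycle_graph_def)
  moreover have "labels_orbits (half_edges ?G) (tau1 ?G) (edge_label ?G)"
  proof (rule labels_orbits_involution)
    show "edge_label ?G ` half_edges ?G = {1..card (edge_label ?G ` half_edges ?G)}"
      by (simp add: eimg)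
    show "tau1 ?G (tau1 ?G h) = h" if "h \<in> half_edges ?G" for h
      using t1 that by blast
    show "edge_label ?G h = edge_label ?G h' \<longleftrightarrow> h' = h \<or> h' = tau1 ?G h"
      if "h \<in> half_edges ?G" "h' \<in> half_edges ?G" for h h'
      using that np unfolding cycle_graph_def
      by (auto; metis atLeastAtMost_iff One_nat_def)
  qed
  moreover have "labels_orbits (half_edges ?G) (boundary_step ?G) (boundary_label ?G)"
  proof -
    have bl: "boundary_label ?G (Out i) = 1" "boundary_label ?G (Inc i) = 2" for i
      by (simp_all add: cycle_graph_def)
    have "boundary_label ?G ((boundary_step ?G ^^ j) h) = boundary_label ?G h" for j h
    proof (induction j)
      case (Suc j)
      then show ?case
        by (cases "(boundary_step ?G ^^ j) h")
          (auto simp: boundary_step_Out boundary_step_Inc bl)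
    qed simp
    moreover have "\<exists>j. h' = (boundary_step ?G ^^ j) h"
      if "h \<in> half_edges ?G" "h' \<in> half_edges ?G" "boundary_label ?G h = boundary_label ?G h'"
      for h h'
    proof -
      from that consider (o) i i' where "h = Out i" "h' = Out i'" "i \<in> {1..k}" "i' \<in> {1..k}"
        | (t) i i' where "h = Inc i" "h' = Inc i'" "i \<in> {1..k}" "i' \<in> {1..k}"
        unfolding H by (auto simp: cycle_graph_def)
      then show ?thesis
        by cases (use boundary_reach_Out boundary_reach_Inc in blast)+
    qed
    ultimately show ?thesis
      unfolding labels_orbits_def bimg by auto
  qed
  moreover have "finite (half_edges ?G)" "half_edges ?G \<noteq> {}" "sources ?G \<subseteq> half_edges ?G"
    using assms by (auto simp: cycle_graph_def)
  ultimately show "directed_labelled_ribbon_graph ?G"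
    unfolding directed_labelled_ribbon_graph_def using t1 by blast
qed

end

theory Submission imports Defs begin

text \<open>Write \<open>A\<close> for the tensor algebra, \<open>E\<close> for its enveloping algebra and \<open>dx\<close> for the differential
  of a letter \<open>x\<close>. A basis \<open>I\<close> of \<open>W\<close> makes the forms on \<open>A\<close> an \<open>E\<close>-module with generators
  \<open>di\<close>, and the coordinate functions \<open>\<xi> i\<close> come from the partial derivatives of \<open>A\<close>, which
  exist because a derivation of a tensor algebra may be prescribed freely on letters. The argument
  is a computation in these coordinates.

  The connection and the Lie derivative are both determined by what they do to \<open>di\<close>. The canonical
  connection sends \<open>m\<close> to the sum of the \<open>d(\<xi> i m) \<otimes> di\<close>
  (\<open>canonical_connection_eq\<close>), and the Lie derivative along \<open>f\<close> sends it to the sum of the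
  \<open>\<phi>(\<xi> i m) di + \<xi> i m d(f i)\<close> (\<open>lie_derivative_eq\<close>). The first terms cancel in the
  cocycle, so that \<open>c(f) m = - (\<Sum>i. \<xi> i m d(f i))\<close> (\<open>div_cocycle_coordinates\<close>); in
  particular \<open>c(f)(dx) = - d(f x)\<close> on every letter. The trace of an endomorphism \<open>\<Phi>\<close> is the
  sum of the classes of \<open>\<xi> i (\<Phi> di)\<close> (\<open>module_trace_coordinates\<close>).

  Let now \<open>f\<close> be the Hamiltonian flow of a cyclic word \<open>u\<close>. Then \<open>f x\<close> is obtained by choosing a
  letter of \<open>u\<close>, pairing it with \<open>x\<close>, and cutting the cyclic word open at that letter; and \<open>d\<close>
  of the word so obtained chooses a second letter and leaves the segments on its two sides as
  coefficient in \<open>E\<close> (\<open>coc_word_letter\<close>). Composing the endomorphisms for \<open>u\<^sub>1, \<dots>,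
  u\<^sub>k\<close>, the letter differentiated in one word is the one that a letter of the preceding word
  is paired with (\<open>cocs_words_letter\<close>), and taking the trace pairs the last word with the first
  (\<open>dv_words\<close>). Two distinct letters have thus been chosen in each word, and consecutive words are
  paired around a circle. This is a placement of the half-edges of the cycle graph
  (\<open>bij_betw_placements\<close>). The product of the segments on one side is the word along the inner
  boundary, and the product of those on the other side, which is formed in the opposite algebra and
  so runs the other way round, is the word along the outer boundary (\<open>boundary_word_inner\<close>,
  \<open>boundary_word_outer\<close>). Each of the \<open>k\<close> factors contributes one sign, and these make up the
  sign in front of the divergence (\<open>weight_placement\<close>).

  Both sides of the theorem are linear, and tensors of cyclic words span the tensor power of the space
  of cyclic words, so the agreement on words suffices.

  The modules involved are all presented by generators and relations. Maps out of them are defined by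
  evaluating a linear extension on a chosen representative, and the first half of the development
  shows that these evaluations have the expected universal properties.\<close>

section \<open>Left modules and linear maps\<close>

text \<open>The scalars may be noncommutative, as they are for modules over an enveloping algebra; the axioms
  are those of the library locale for modules, over a ring instead of a commutative ring.\<close>

locale left_module = R?: ring R + M?: abelian_group M
  for R (structure) and M :: "('r, 'm, 'q) module_scheme" (structure) +
  assumes smult_closed [simp, intro]:
      "\<lbrakk> a \<in> carrier R; x \<in> carrier M \<rbrakk> \<Longrightarrow> a \<odot>\<^bsub>M\<^esub> x \<in> carrier M"
    and smult_l_distr:
      "\<lbrakk> a \<in> carrier R; b \<in> carrier R; x \<in> carrier M \<rbrakk> \<Longrightarrow>
      (a \<oplus> b) \<odot>\<^bsub>M\<^esub> x = a \<odot>\<^bsub>M\<^esub> x \<oplus>\<^bsub>M\<^esub> b \<odot>\<^bsub>M\<^esub> x"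
    and smult_r_distr:
      "\<lbrakk> a \<in> carrier R; x \<in> carrier M; y \<in> carrier M \<rbrakk> \<Longrightarrow>
      a \<odot>\<^bsub>M\<^esub> (x \<oplus>\<^bsub>M\<^esub> y) = a \<odot>\<^bsub>M\<^esub> x \<oplus>\<^bsub>M\<^esub> a \<odot>\<^bsub>M\<^esub> y"
    and smult_assoc1:
      "\<lbrakk> a \<in> carrier R; b \<in> carrier R; x \<in> carrier M \<rbrakk> \<Longrightarrow>
      (a \<otimes> b) \<odot>\<^bsub>M\<^esub> x = a \<odot>\<^bsub>M\<^esub> (b \<odot>\<^bsub>M\<^esub> x)"
    and smult_one [simp]:
      "x \<in> carrier M \<Longrightarrow> \<one> \<odot>\<^bsub>M\<^esub> x = x"

lemma left_moduleI:
  fixes R (structure) and M (structure)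
  assumes "ring R" "abelian_group M"
    and "\<And>a x. \<lbrakk> a \<in> carrier R; x \<in> carrier M \<rbrakk> \<Longrightarrow> a \<odot>\<^bsub>M\<^esub> x \<in> carrier M"
    and "\<And>a b x. \<lbrakk> a \<in> carrier R; b \<in> carrier R; x \<in> carrier M \<rbrakk> \<Longrightarrow>
      (a \<oplus> b) \<odot>\<^bsub>M\<^esub> x = a \<odot>\<^bsub>M\<^esub> x \<oplus>\<^bsub>M\<^esub> b \<odot>\<^bsub>M\<^esub> x"
    and "\<And>a x y. \<lbrakk> a \<in> carrier R; x \<in> carrier M; y \<in> carrier M \<rbrakk> \<Longrightarrow>
      a \<odot>\<^bsub>M\<^esub> (x \<oplus>\<^bsub>M\<^esub> y) = a \<odot>\<^bsub>M\<^esub> x \<oplus>\<^bsub>M\<^esub> a \<odot>\<^bsub>M\<^esub> y"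
    and "\<And>a b x. \<lbrakk> a \<in> carrier R; b \<in> carrier R; x \<in> carrier M \<rbrakk> \<Longrightarrow>
      (a \<otimes> b) \<odot>\<^bsub>M\<^esub> x = a \<odot>\<^bsub>M\<^esub> (b \<odot>\<^bsub>M\<^esub> x)"
    and "\<And>x. x \<in> carrier M \<Longrightarrow> \<one> \<odot>\<^bsub>M\<^esub> x = x"
  shows "left_module R M"
  using assms by (auto intro!: left_module.intro left_module_axioms.intro)

context left_module
begin

lemma smult_l_null [simp]: "x \<in> carrier M \<Longrightarrow> \<zero>\<^bsub>R\<^esub> \<odot>\<^bsub>M\<^esub> x = \<zero>\<^bsub>M\<^esub>"
proof -
  assume x: "x \<in> carrier M"
  have "\<zero>\<^bsub>R\<^esub> \<odot>\<^bsub>M\<^esub> x \<oplus>\<^bsub>M\<^esub> \<zero>\<^bsub>R\<^esub> \<odot>\<^bsub>M\<^esub> x = \<zero>\<^bsub>R\<^esub> \<odot>\<^bsub>M\<^esub> x \<oplus>\<^bsub>M\<^esub> \<zero>\<^bsub>M\<^esub>"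
    using x smult_l_distr[of "\<zero>\<^bsub>R\<^esub>" "\<zero>\<^bsub>R\<^esub>" x] by simp
  then show ?thesis using x by (metis M.add.l_cancel_one M.zero_closed R.zero_closed smult_closed)
qed

lemma smult_r_null [simp]: "a \<in> carrier R \<Longrightarrow> a \<odot>\<^bsub>M\<^esub> \<zero>\<^bsub>M\<^esub> = \<zero>\<^bsub>M\<^esub>"
proof -
  assume a: "a \<in> carrier R"
  have "a \<odot>\<^bsub>M\<^esub> \<zero>\<^bsub>M\<^esub> \<oplus>\<^bsub>M\<^esub> a \<odot>\<^bsub>M\<^esub> \<zero>\<^bsub>M\<^esub> = a \<odot>\<^bsub>M\<^esub> \<zero>\<^bsub>M\<^esub> \<oplus>\<^bsub>M\<^esub> \<zero>\<^bsub>M\<^esub>"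
    using a smult_r_distr[of a "\<zero>\<^bsub>M\<^esub>" "\<zero>\<^bsub>M\<^esub>"] by simp
  then show ?thesis using a by (metis M.add.l_cancel_one M.zero_closed smult_closed)
qed

lemma smult_l_minus_one: "x \<in> carrier M \<Longrightarrow> (\<ominus>\<^bsub>R\<^esub> \<one>\<^bsub>R\<^esub>) \<odot>\<^bsub>M\<^esub> x = \<ominus>\<^bsub>M\<^esub> x"
proof -
  assume x: "x \<in> carrier M"
  have "(\<ominus>\<^bsub>R\<^esub> \<one>\<^bsub>R\<^esub>) \<odot>\<^bsub>M\<^esub> x \<oplus>\<^bsub>M\<^esub> x = ((\<ominus>\<^bsub>R\<^esub> \<one>\<^bsub>R\<^esub>) \<oplus>\<^bsub>R\<^esub> \<one>\<^bsub>R\<^esub>) \<odot>\<^bsub>M\<^esub> x"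
    using x by (subst smult_l_distr) auto
  also have "\<dots> = \<zero>\<^bsub>M\<^esub>" using x by (simp add: R.l_neg)
  finally show ?thesis using x by (metis M.minus_equality R.a_inv_closed R.one_closed smult_closed)
qed

lemma finsum_smult:
  assumes "a \<in> carrier R" "f \<in> S \<rightarrow> carrier M"
  shows "a \<odot>\<^bsub>M\<^esub> (\<Oplus>\<^bsub>M\<^esub>i\<in>S. f i) = (\<Oplus>\<^bsub>M\<^esub>i\<in>S. a \<odot>\<^bsub>M\<^esub> f i)"
proof (cases "finite S")
  case True
  then show ?thesis using assms(2)
    by induction (use assms(1) in \<open>auto simp: smult_r_distr Pi_def\<close>)
qed (use assms in auto)

end

lemma (in module) left_module: "left_module R M"
  by unfold_locales (auto simp: smult_l_distr smult_r_distr smult_assoc1)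

lemma left_module_cong:
  assumes "left_module R M" "carrier N = carrier M" "add N = add M" "zero N = zero M" "smult N = smult M"
  shows "left_module R N"
proof -
  interpret left_module R M by fact
  have "abelian_group N"
    by (rule abelian_groupI) (use assms(2-4) M.add.l_inv_ex in \<open>auto simp: M.a_ac\<close>)
  then show ?thesis
    using assms(2-5) smult_l_distr smult_r_distr smult_assoc1
    by (intro left_moduleI R.ring_axioms) simp_all
qed

lemma finsum_record_cong:
  assumes "carrier N = carrier M" "add N = add M" "zero N = zero M"
  shows "finsum N = finsum M"
  using assms by (simp add: finsum_def[abs_def] finprod_def[abs_def] cong: if_cong)

definition is_linear ::
    "('r, 'p) ring_scheme \<Rightarrow> ('r, 'm, 'q) module_scheme \<Rightarrow> ('r, 'n, 's) module_scheme \<Rightarrow> ('m \<Rightarrow> 'n) \<Rightarrow> bool"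
  where "is_linear R M N f \<longleftrightarrow> f \<in> carrier M \<rightarrow> carrier N \<and>
    (\<forall>x \<in> carrier M. \<forall>y \<in> carrier M. f (x \<oplus>\<^bsub>M\<^esub> y) = f x \<oplus>\<^bsub>N\<^esub> f y) \<and>
    (\<forall>r \<in> carrier R. \<forall>x \<in> carrier M. f (r \<odot>\<^bsub>M\<^esub> x) = r \<odot>\<^bsub>N\<^esub> f x)"

lemma is_linearI:
  assumes "\<And>x. x \<in> carrier M \<Longrightarrow> f x \<in> carrier N"
    and "\<And>x y. x \<in> carrier M \<Longrightarrow> y \<in> carrier M \<Longrightarrow> f (x \<oplus>\<^bsub>M\<^esub> y) = f x \<oplus>\<^bsub>N\<^esub> f y"
    and "\<And>r x. r \<in> carrier R \<Longrightarrow> x \<in> carrier M \<Longrightarrow> f (r \<odot>\<^bsub>M\<^esub> x) = r \<odot>\<^bsub>N\<^esub> f x"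
  shows "is_linear R M N f"
  using assms unfolding is_linear_def by auto

lemma is_linearD:
  assumes "is_linear R M N f"
  shows "x \<in> carrier M \<Longrightarrow> f x \<in> carrier N"
    and "x \<in> carrier M \<Longrightarrow> y \<in> carrier M \<Longrightarrow> f (x \<oplus>\<^bsub>M\<^esub> y) = f x \<oplus>\<^bsub>N\<^esub> f y"
    and "r \<in> carrier R \<Longrightarrow> x \<in> carrier M \<Longrightarrow> f (r \<odot>\<^bsub>M\<^esub> x) = r \<odot>\<^bsub>N\<^esub> f x"
  using assms unfolding is_linear_def by auto

lemma linear_maps_iff: "f \<in> linear_maps R M N \<longleftrightarrow> is_linear R M N f \<and> f \<in> extensional (carrier M)"
  unfolding linear_maps_def is_linear_def PiE_def by auto

lemma is_linear_cong:
  "(\<And>x. x \<in> carrier M \<Longrightarrow> f x = g x) \<Longrightarrow> left_module R M \<Longrightarrow> is_linear R M N f \<longleftrightarrow> is_linear R M N g"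
proof -
  assume fg: "\<And>x. x \<in> carrier M \<Longrightarrow> f x = g x" and "left_module R M"
  interpret left_module R M by fact
  show ?thesis unfolding is_linear_def using fg by (auto simp: Pi_def)
qed

lemma is_linear_restrict:
  "left_module R M \<Longrightarrow> is_linear R M N f \<Longrightarrow> is_linear R M N (\<lambda>x \<in> carrier M. f x)"
  using is_linear_cong[of M f "\<lambda>x \<in> carrier M. f x" R N] by simp

lemma is_linear_id: "is_linear R M M (\<lambda>x. x)"
  by (auto intro: is_linearI)

lemma is_linear_compose:
  "is_linear R M N f \<Longrightarrow> is_linear R N P g \<Longrightarrow> is_linear R M P (\<lambda>x. g (f x))"
  unfolding is_linear_def by (auto simp: Pi_def)

locale linear_map = M: left_module R M + N: left_module R N for R M N + fixes f
  assumes lin: "is_linear R M N f"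
begin

lemmas [simp] = is_linearD[OF lin]

lemma map_zero [simp]: "f \<zero>\<^bsub>M\<^esub> = \<zero>\<^bsub>N\<^esub>"
proof -
  have "f \<zero>\<^bsub>M\<^esub> = f (\<zero>\<^bsub>R\<^esub> \<odot>\<^bsub>M\<^esub> \<zero>\<^bsub>M\<^esub>)" by simp
  also have "\<dots> = \<zero>\<^bsub>N\<^esub>" by (simp del: M.smult_r_null M.smult_l_null)
  finally show ?thesis .
qed

lemma map_minus [simp]: "x \<in> carrier M \<Longrightarrow> f (\<ominus>\<^bsub>M\<^esub> x) = \<ominus>\<^bsub>N\<^esub> f x"
  by (simp flip: M.smult_l_minus_one N.smult_l_minus_one)

lemma map_diff: "x \<in> carrier M \<Longrightarrow> y \<in> carrier M \<Longrightarrow> f (x \<ominus>\<^bsub>M\<^esub> y) = f x \<ominus>\<^bsub>N\<^esub> f y"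
  by (simp add: a_minus_def)

lemma map_diff_eq_zero:
  "x \<in> carrier M \<Longrightarrow> y \<in> carrier M \<Longrightarrow> f (x \<ominus>\<^bsub>M\<^esub> y) = \<zero>\<^bsub>N\<^esub> \<longleftrightarrow> f x = f y"
  by (simp add: map_diff) (metis N.add.inv_closed N.add.inv_solve_right' N.l_zero N.minus_eq is_linearD(1)[OF lin] N.zero_closed)

lemma map_finsum: "g \<in> S \<rightarrow> carrier M \<Longrightarrow> f (\<Oplus>\<^bsub>M\<^esub>i\<in>S. g i) = (\<Oplus>\<^bsub>N\<^esub>i\<in>S. f (g i))"
proof (induction S rule: infinite_finite_induct)
  case (insert x S)
  then show ?case by (simp add: Pi_def)
qed auto

end

lemma linear_mapI: "left_module R M \<Longrightarrow> left_module R N \<Longrightarrow> is_linear R M N f \<Longrightarrow> linear_map R M N f"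
  by (simp add: linear_map_def linear_map_axioms_def)

lemma is_linear_zero: "left_module R N \<Longrightarrow> is_linear R M N (\<lambda>x. \<zero>\<^bsub>N\<^esub>)"
proof -
  assume "left_module R N" then interpret left_module R N .
  show ?thesis by (rule is_linearI) auto
qed

lemma is_linear_add:
  assumes "left_module R N" "is_linear R M N f" "is_linear R M N g"
  shows "is_linear R M N (\<lambda>x. f x \<oplus>\<^bsub>N\<^esub> g x)"
proof -
  interpret N: left_module R N by fact
  show ?thesis
    by (rule is_linearI) (use assms(2,3)[THEN is_linearD(1)] assms(2,3)[THEN is_linearD(2)] 
      assms(2,3)[THEN is_linearD(3)] in \<open>auto simp: N.smult_r_distr N.a_ac\<close>)
qed

lemma is_linear_finsum:
  assumes "left_module R N" "\<And>i. i \<in> S \<Longrightarrow> is_linear R M N (f i)"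
  shows "is_linear R M N (\<lambda>x. \<Oplus>\<^bsub>N\<^esub>i\<in>S. f i x)"
proof -
  interpret N: left_module R N by fact
  show ?thesis
  proof (rule is_linearI)
    fix x y assume xy: "x \<in> carrier M" "y \<in> carrier M"
    show "(\<Oplus>\<^bsub>N\<^esub>i\<in>S. f i x) \<in> carrier N"
      using xy by (intro N.finsum_closed) (auto intro: is_linearD(1)[OF assms(2)])
    have "(\<Oplus>\<^bsub>N\<^esub>i\<in>S. f i (x \<oplus>\<^bsub>M\<^esub> y)) = (\<Oplus>\<^bsub>N\<^esub>i\<in>S. f i x \<oplus>\<^bsub>N\<^esub> f i y)"
      using xy by (intro N.finsum_cong') (auto simp: is_linearD[OF assms(2)])
    then show "(\<Oplus>\<^bsub>N\<^esub>i\<in>S. f i (x \<oplus>\<^bsub>M\<^esub> y)) = (\<Oplus>\<^bsub>N\<^esub>i\<in>S. f i x) \<oplus>\<^bsub>N\<^esub> (\<Oplus>\<^bsub>N\<^esub>i\<in>S. f i y)"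
      using xy by (subst N.finsum_addf[symmetric]) (auto simp: is_linearD[OF assms(2)])
  next
    fix r x assume rx: "r \<in> carrier R" "x \<in> carrier M"
    have "(\<Oplus>\<^bsub>N\<^esub>i\<in>S. f i (r \<odot>\<^bsub>M\<^esub> x)) = (\<Oplus>\<^bsub>N\<^esub>i\<in>S. r \<odot>\<^bsub>N\<^esub> f i x)"
      using rx by (intro N.finsum_cong') (auto simp: is_linearD[OF assms(2)])
    then show "(\<Oplus>\<^bsub>N\<^esub>i\<in>S. f i (r \<odot>\<^bsub>M\<^esub> x)) = r \<odot>\<^bsub>N\<^esub> (\<Oplus>\<^bsub>N\<^esub>i\<in>S. f i x)"
      using rx by (subst N.finsum_smult) (auto simp: is_linearD[OF assms(2)])
  qed
qed

lemma is_linear_smult: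
  assumes "cring R" "left_module R N" "is_linear R M N f" "c \<in> carrier R"
  shows "is_linear R M N (\<lambda>x. c \<odot>\<^bsub>N\<^esub> f x)"
proof -
  interpret R: cring R by fact
  interpret N: left_module R N by fact
  show ?thesis
  proof (rule is_linearI)
    fix r x assume "r \<in> carrier R" "x \<in> carrier M"
    then show "c \<odot>\<^bsub>N\<^esub> f (r \<odot>\<^bsub>M\<^esub> x) = r \<odot>\<^bsub>N\<^esub> (c \<odot>\<^bsub>N\<^esub> f x)"
      using assms(3,4) by (simp add: is_linearD R.m_comm flip: N.smult_assoc1)
  qed (use assms(3,4) in \<open>auto simp: is_linearD N.smult_r_distr\<close>)
qed

lemma (in abelian_monoid) finsum_swap:
  assumes "\<And>i j. i \<in> S \<Longrightarrow> j \<in> T \<Longrightarrow> f i j \<in> carrier G"  "finite S" "finite T"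
  shows "(\<Oplus>i\<in>S. \<Oplus>j\<in>T. f i j) = (\<Oplus>j\<in>T. \<Oplus>i\<in>S. f i j)"
  using assms(2,1)
proof induction
  case (insert a S)
  have "(\<Oplus>i\<in>insert a S. \<Oplus>j\<in>T. f i j) = (\<Oplus>j\<in>T. f a j) \<oplus> (\<Oplus>j\<in>T. \<Oplus>i\<in>S. f i j)"
    using insert by simp
  also have "\<dots> = (\<Oplus>j\<in>T. f a j \<oplus> (\<Oplus>i\<in>S. f i j))"
    using insert by (subst finsum_addf) auto
  also have "\<dots> = (\<Oplus>j\<in>T. \<Oplus>i\<in>insert a S. f i j)"
    using insert by (intro finsum_cong') auto
  finally show ?case .
qed (simp add: assms(3))

text \<open>The axioms of a module are equations, so they pass to the image under a surjection compatible with
  the operations. For cosets this replaces a verification on representatives.\<close>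

lemma left_module_image:
  assumes "left_module R M" "p ` carrier M = carrier Q" "p \<zero>\<^bsub>M\<^esub> = \<zero>\<^bsub>Q\<^esub>"
    and add: "\<And>x y. x \<in> carrier M \<Longrightarrow> y \<in> carrier M \<Longrightarrow> p (x \<oplus>\<^bsub>M\<^esub> y) = p x \<oplus>\<^bsub>Q\<^esub> p y"
    and smult: "\<And>r x. r \<in> carrier R \<Longrightarrow> x \<in> carrier M \<Longrightarrow> p (r \<odot>\<^bsub>M\<^esub> x) = r \<odot>\<^bsub>Q\<^esub> p x"
  shows "left_module R Q"
proof -
  interpret M: left_module R M by fact
  have c: "carrier Q = p ` carrier M" using assms by simp
  note a = add[symmetric] smult[symmetric] assms(3)[symmetric]
  show ?thesis
  proof (rule left_moduleI)
    show "abelian_group Q"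
    proof (rule abelian_groupI)
      fix x assume "x \<in> carrier Q"
      then obtain x' where x': "x' \<in> carrier M" "x = p x'" unfolding c by auto
      then show "\<exists>y\<in>carrier Q. y \<oplus>\<^bsub>Q\<^esub> x = \<zero>\<^bsub>Q\<^esub>"
        unfolding c by (intro bexI[of _ "p (\<ominus>\<^bsub>M\<^esub> x')"]) (auto simp: a M.l_neg)
    qed (auto simp: c a M.a_ac)
  qed (auto simp: c a M.smult_l_distr M.smult_r_distr M.smult_assoc1 M.ring_axioms)
qed

section \<open>Quotients and presentations\<close>

lemma quotient_module_simps:
  "carrier (quotient_module M N) = a_rcosets\<^bsub>M\<^esub> N" "zero (quotient_module M N) = N"
  "add (quotient_module M N) = set_add M"
  "smult (quotient_module M N) r C = (\<Union>x\<in>C. N +>\<^bsub>M\<^esub> (r \<odot>\<^bsub>M\<^esub> x))"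
  by (simp_all add: quotient_module_def)

locale module_quotient = left_module R M for R and M :: "('r, 'm, 'q) module_scheme" + fixes N
  assumes submod: "submodule N R M"
begin

abbreviation "Q \<equiv> quotient_module M N"
abbreviation "cls x \<equiv> N +>\<^bsub>M\<^esub> x"

sublocale N: submodule N R M by (rule submod)
sublocale AS: abelian_subgroup N M
  by (rule abelian_subgroupI3) (auto intro: N.subgroup_axioms additive_subgroupI M.abelian_group_axioms)

lemma cls_in: "x \<in> carrier M \<Longrightarrow> cls x \<in> carrier Q"
  by (auto simp: quotient_module_simps A_RCOSETS_def' a_r_coset_def')

lemma carrier_Q: "carrier Q = cls ` carrier M"
  by (auto simp: quotient_module_simps A_RCOSETS_def' a_r_coset_def')

lemma cls_rep_diff: "x \<in> carrier M \<Longrightarrow> y \<in> cls x \<Longrightarrow> \<exists>n \<in> N. y = n \<oplus>\<^bsub>M\<^esub> x"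
  by (auto simp: a_r_coset_def')

lemma cls_self: "x \<in> carrier M \<Longrightarrow> x \<in> cls x"
  by (rule AS.a_rcos_self)

lemma cls_some: "x \<in> carrier M \<Longrightarrow> (SOME y. y \<in> cls x) \<in> cls x"
  using cls_self by (rule someI)

lemma cls_zero: "cls \<zero>\<^bsub>M\<^esub> = zero Q"
  by (simp add: quotient_module_simps AS.a_rcos_const)

lemma cls_null: "x \<in> N \<Longrightarrow> cls x = zero Q"
  by (simp add: quotient_module_simps AS.a_rcos_const)

lemma cls_add: "x \<in> carrier M \<Longrightarrow> y \<in> carrier M \<Longrightarrow> cls (x \<oplus>\<^bsub>M\<^esub> y) = cls x \<oplus>\<^bsub>Q\<^esub> cls y"
  by (simp add: quotient_module_simps AS.a_rcos_sum)

lemma cls_smult: "r \<in> carrier R \<Longrightarrow> x \<in> carrier M \<Longrightarrow> cls (r \<odot>\<^bsub>M\<^esub> x) = r \<odot>\<^bsub>Q\<^esub> cls x"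
proof -
  assume r: "r \<in> carrier R" and x: "x \<in> carrier M"
  have 1: "cls (r \<odot>\<^bsub>M\<^esub> y) = cls (r \<odot>\<^bsub>M\<^esub> x)" if y: "y \<in> cls x" for y
  proof -
    obtain n where n: "n \<in> N" "y = n \<oplus>\<^bsub>M\<^esub> x" using cls_rep_diff[OF x y] by auto
    have nM: "n \<in> carrier M" using AS.a_Hcarr[OF n(1)] .
    have rn: "r \<odot>\<^bsub>M\<^esub> n \<in> N" using N.smult_closed[OF r n(1)] .
    have "cls (r \<odot>\<^bsub>M\<^esub> y) = cls (r \<odot>\<^bsub>M\<^esub> n) \<oplus>\<^bsub>Q\<^esub> cls (r \<odot>\<^bsub>M\<^esub> x)"
      unfolding n(2) smult_r_distr[OF r nM x] using r nM x by (intro cls_add) auto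
    also have "cls (r \<odot>\<^bsub>M\<^esub> n) = cls \<zero>\<^bsub>M\<^esub>"
      unfolding cls_null[OF rn] cls_zero ..
    also have "cls \<zero>\<^bsub>M\<^esub> \<oplus>\<^bsub>Q\<^esub> cls (r \<odot>\<^bsub>M\<^esub> x) = cls (\<zero>\<^bsub>M\<^esub> \<oplus>\<^bsub>M\<^esub> r \<odot>\<^bsub>M\<^esub> x)"
      using r x by (intro cls_add[symmetric]) auto
    finally show ?thesis using r x by simp
  qed
  have "r \<odot>\<^bsub>Q\<^esub> cls x = (\<Union>y\<in>cls x. cls (r \<odot>\<^bsub>M\<^esub> y))"
    by (simp add: quotient_module_simps)
  also have "\<dots> = (\<Union>y\<in>cls x. cls (r \<odot>\<^bsub>M\<^esub> x))"
    by (intro SUP_cong refl 1)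
  also have "\<dots> = cls (r \<odot>\<^bsub>M\<^esub> x)" using cls_self[OF x] by blast
  finally show ?thesis ..
qed

lemma left_module_Q: "left_module R Q"
  by (rule left_module_image[OF left_module_axioms carrier_Q[symmetric] cls_zero cls_add cls_smult])

lemma cls_linear: "is_linear R M Q cls"
  by (auto intro!: is_linearI simp: cls_in cls_add cls_smult)

lemma cls_eqI: "x \<in> carrier M \<Longrightarrow> y \<in> carrier M \<Longrightarrow> x \<ominus>\<^bsub>M\<^esub> y \<in> N \<Longrightarrow> cls x = cls y"
  using linear_map.map_diff_eq_zero[OF linear_mapI[OF left_module_axioms left_module_Q cls_linear]] cls_null
  by blast

text \<open>Two representatives of a class differ by an element of \<open>N\<close>, so a map that kills \<open>N\<close> takes the
  same value on any representative, in particular on the chosen one.\<close>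

lemma descend_rep:
  assumes "left_module R U" "is_linear R M U f" "\<And>n. n \<in> N \<Longrightarrow> f n = \<zero>\<^bsub>U\<^esub>" "x \<in> carrier M"
  shows "f (SOME y. y \<in> cls x) = f x"
proof -
  interpret U: left_module R U by fact
  obtain n where n: "n \<in> N" "(SOME y. y \<in> cls x) = n \<oplus>\<^bsub>M\<^esub> x"
    using cls_rep_diff[OF assms(4) cls_some[OF assms(4)]] by auto
  then show ?thesis using assms AS.a_Hcarr[OF n(1)] by (simp add: is_linearD[OF assms(2)])
qed

lemma descend_linear:
  assumes "left_module R U" "is_linear R M U f" "\<And>n. n \<in> N \<Longrightarrow> f n = \<zero>\<^bsub>U\<^esub>"
  shows "is_linear R Q U (\<lambda>C. f (SOME y. y \<in> C))"
proof (rule is_linearI; clarsimp simp: carrier_Q)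
  have rep: "f (SOME y. y \<in> cls x) = f x" if "x \<in> carrier M" for x
    by (rule descend_rep[OF assms(1,2) assms(3) that])
  fix x assume x: "x \<in> carrier M"
  show "f (SOME y. y \<in> cls x) \<in> carrier U"
    unfolding rep[OF x] using assms(2) x by (rule is_linearD)
  show "f (SOME z. z \<in> cls x \<oplus>\<^bsub>Q\<^esub> cls y) = f (SOME y. y \<in> cls x) \<oplus>\<^bsub>U\<^esub> f (SOME z. z \<in> cls y)"
    if y: "y \<in> carrier M" for y
    unfolding cls_add[OF x y, symmetric] rep[OF x] rep[OF y] rep[OF M.a_closed[OF x y]]
    using assms(2) x y by (rule is_linearD)
  show "f (SOME z. z \<in> r \<odot>\<^bsub>Q\<^esub> cls x) = r \<odot>\<^bsub>U\<^esub> f (SOME y. y \<in> cls x)" if r: "r \<in> carrier R" for r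
    unfolding cls_smult[OF r x, symmetric] rep[OF x] rep[OF smult_closed[OF r x]]
    using assms(2) r x by (rule is_linearD)
qed

end

lemma submodule_generated_submodule:
  assumes "left_module R M" "S \<subseteq> carrier M"
  shows "submodule (submodule_generated R M S) R M" and "S \<subseteq> submodule_generated R M S"
    and "submodule N R M \<Longrightarrow> S \<subseteq> N \<Longrightarrow> submodule_generated R M S \<subseteq> N"
proof -
  interpret M: left_module R M by fact
  have car: "submodule (carrier M) R M"
    by (intro submodule.intro M.add.group_incl_imp_subgroup submodule_axioms.intro)
      (auto intro: M.add.subgroup_self)
  let ?N = "submodule_generated R M S"
  have sub: "?N \<subseteq> carrier M" unfolding submodule_generated_def using car assms(2) by blast
  have mem: "x \<in> ?N \<longleftrightarrow> (\<forall>N. submodule N R M \<longrightarrow> S \<subseteq> N \<longrightarrow> x \<in> N)" for x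
    unfolding submodule_generated_def by blast
  have sg: "subgroup N (add_monoid M)" if "submodule N R M" for N
    using that by (rule submodule.axioms)
  have "subgroup ?N (add_monoid M)"
  proof
    show "?N \<subseteq> carrier (add_monoid M)" using sub by simp
    show "x \<otimes>\<^bsub>add_monoid M\<^esub> y \<in> ?N" if "x \<in> ?N" "y \<in> ?N" for x y
      using that unfolding mem by (meson sg subgroup.m_closed)
    show "\<one>\<^bsub>add_monoid M\<^esub> \<in> ?N" unfolding mem by (meson sg subgroup.one_closed)
    show "inv\<^bsub>add_monoid M\<^esub> x \<in> ?N" if "x \<in> ?N" for x
      using that unfolding mem by (meson sg subgroup.m_inv_closed)
  qed
  then show "submodule ?N R M"
    by (intro submodule.intro submodule_axioms.intro) (auto simp: mem submodule.smult_closed)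
  show "S \<subseteq> ?N" unfolding submodule_generated_def by blast
  show "?N \<subseteq> N" if "submodule N R M" "S \<subseteq> N" using that unfolding submodule_generated_def by blast
qed

lemma linear_kernel_submodule:
  assumes "left_module R M" "left_module R U" "is_linear R M U f"
  shows "submodule {x \<in> carrier M. f x = \<zero>\<^bsub>U\<^esub>} R M"
proof -
  interpret f: linear_map R M U f by (intro linear_mapI assms)
  show ?thesis
    by (intro submodule.intro submodule_axioms.intro f.M.add.subgroupI)
      auto
qed

text \<open>The kernel is a submodule, so it contains the submodule generated by any of its subsets.\<close>

lemma linear_zero_on_generated:
  assumes "left_module R M" "left_module R U" "is_linear R M U f" "S \<subseteq> carrier M"
    "\<And>x. x \<in> S \<Longrightarrow> f x = \<zero>\<^bsub>U\<^esub>" "x \<in> submodule_generated R M S"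
  shows "f x = \<zero>\<^bsub>U\<^esub>"
  using submodule_generated_submodule(3)[OF assms(1,4) linear_kernel_submodule[OF assms(1-3)]] assms(4-6)
  by blast

text \<open>Lifting a map on generators to a presented module evaluates this sum on a chosen representative of a
  class; stated on the free module, it can be compared across representatives.\<close>

definition free_ext ::
    "('r, 'p) ring_scheme \<Rightarrow> ('r, 'u, 'q) module_scheme \<Rightarrow> ('x \<Rightarrow> 'u) \<Rightarrow> ('x \<Rightarrow> 'r) \<Rightarrow> 'u"
  where "free_ext R U F p = (\<Oplus>\<^bsub>U\<^esub> x \<in> {x. p x \<noteq> \<zero>\<^bsub>R\<^esub>}. p x \<odot>\<^bsub>U\<^esub> F x)"

lemma lift_eq_free_ext: "lift R U F C = free_ext R U F (SOME p. p \<in> C)"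
  by (simp add: lift_def free_ext_def Let_def)

lemma free_module_simps:
  "carrier (free_module R X) = {p. (\<forall>x \<in> X. p x \<in> carrier R) \<and> (\<forall>x. x \<notin> X \<longrightarrow> p x = \<zero>\<^bsub>R\<^esub>) \<and>
     finite {x. p x \<noteq> \<zero>\<^bsub>R\<^esub>}}"
  "zero (free_module R X) = (\<lambda>x. \<zero>\<^bsub>R\<^esub>)"
  "add (free_module R X) p q = (\<lambda>x. p x \<oplus>\<^bsub>R\<^esub> q x)"
  "smult (free_module R X) r p = (\<lambda>x. r \<otimes>\<^bsub>R\<^esub> p x)"
  by (simp_all add: free_module_def)

lemma free_module_value:
  "ring R \<Longrightarrow> p \<in> carrier (free_module R X) \<Longrightarrow> p x \<in> carrier R"
  by (cases "x \<in> X") (auto simp: free_module_simps ring.ring_simprules(2))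

lemma left_module_free_module:
  fixes R :: "('r, 'p) ring_scheme" and X :: "'x set"
  assumes "ring R" shows "left_module R (free_module R X)"
proof -
  interpret R: ring R by fact
  have fin: "finite {x. p x \<oplus>\<^bsub>R\<^esub> q x \<noteq> \<zero>\<^bsub>R\<^esub>}"
    if "finite {x. p x \<noteq> \<zero>\<^bsub>R\<^esub>}" "finite {x. q x \<noteq> \<zero>\<^bsub>R\<^esub>}" for p q :: "'x \<Rightarrow> 'r"
    by (rule finite_subset[OF _ finite_UnI[OF that]]) auto
  have fin': "finite {x. r \<otimes>\<^bsub>R\<^esub> p x \<noteq> \<zero>\<^bsub>R\<^esub>}"
    if "finite {x. p x \<noteq> \<zero>\<^bsub>R\<^esub>}" "r \<in> carrier R" for p :: "'x \<Rightarrow> 'r" and r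
    by (rule finite_subset[OF _ that(1)]) (use that(2) in auto)
  note v = free_module_value[OF assms]
  show ?thesis
  proof (rule left_moduleI)
    show "abelian_group (free_module R X)"
    proof (rule abelian_groupI)
      fix p assume p: "p \<in> carrier (free_module R X)"
      have "{x. \<ominus>\<^bsub>R\<^esub> p x \<noteq> \<zero>\<^bsub>R\<^esub>} \<subseteq> {x. p x \<noteq> \<zero>\<^bsub>R\<^esub>}" by auto
      then have "(\<lambda>x. \<ominus>\<^bsub>R\<^esub> p x) \<in> carrier (free_module R X)"
        using p by (auto simp: free_module_simps intro: finite_subset)
      then show "\<exists>q\<in>carrier (free_module R X).
          q \<oplus>\<^bsub>free_module R X\<^esub> p = \<zero>\<^bsub>free_module R X\<^esub>"
        by (rule bexI[rotated]) (use v[OF p] in \<open>auto simp: free_module_simps R.l_neg\<close>)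
    next
      fix p q assume "p \<in> carrier (free_module R X)" "q \<in> carrier (free_module R X)"
      then show "p \<oplus>\<^bsub>free_module R X\<^esub> q \<in> carrier (free_module R X)"
        by (auto simp: free_module_simps fin)
    next
      fix p q l assume "p \<in> carrier (free_module R X)" "q \<in> carrier (free_module R X)"
        "l \<in> carrier (free_module R X)"
      note vs = this[THEN v]
      show "p \<oplus>\<^bsub>free_module R X\<^esub> q \<oplus>\<^bsub>free_module R X\<^esub> l
          = p \<oplus>\<^bsub>free_module R X\<^esub> (q \<oplus>\<^bsub>free_module R X\<^esub> l)"
        by (simp add: free_module_simps vs R.a_assoc)
    next
      fix p q assume "p \<in> carrier (free_module R X)" "q \<in> carrier (free_module R X)"
      note vs = this[THEN v]
      show "p \<oplus>\<^bsub>free_module R X\<^esub> q = q \<oplus>\<^bsub>free_module R X\<^esub> p"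
        by (simp add: free_module_simps vs R.a_comm)
    next
      fix p assume "p \<in> carrier (free_module R X)"
      note vs = this[THEN v]
      show "\<zero>\<^bsub>free_module R X\<^esub> \<oplus>\<^bsub>free_module R X\<^esub> p = p"
        by (simp add: free_module_simps vs)
    qed (simp add: free_module_simps)
  next
    fix r p assume "r \<in> carrier R" "p \<in> carrier (free_module R X)"
    then show "r \<odot>\<^bsub>free_module R X\<^esub> p \<in> carrier (free_module R X)"
      by (auto simp: free_module_simps fin')
  next
    fix r s p assume "r \<in> carrier R" "s \<in> carrier R" "p \<in> carrier (free_module R X)"
    note vs = this(1,2) this(3)[THEN v]
    show "(r \<oplus>\<^bsub>R\<^esub> s) \<odot>\<^bsub>free_module R X\<^esub> p
        = r \<odot>\<^bsub>free_module R X\<^esub> p \<oplus>\<^bsub>free_module R X\<^esub> s \<odot>\<^bsub>free_module R X\<^esub> p"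
      and "(r \<otimes>\<^bsub>R\<^esub> s) \<odot>\<^bsub>free_module R X\<^esub> p = r \<odot>\<^bsub>free_module R X\<^esub> (s \<odot>\<^bsub>free_module R X\<^esub> p)"
      by (simp_all add: free_module_simps vs R.l_distr R.m_assoc)
  next
    fix r p q assume "r \<in> carrier R" "p \<in> carrier (free_module R X)" "q \<in> carrier (free_module R X)"
    note vs = this(1) this(2,3)[THEN v]
    show "r \<odot>\<^bsub>free_module R X\<^esub> (p \<oplus>\<^bsub>free_module R X\<^esub> q)
        = r \<odot>\<^bsub>free_module R X\<^esub> p \<oplus>\<^bsub>free_module R X\<^esub> r \<odot>\<^bsub>free_module R X\<^esub> q"
      by (simp add: free_module_simps vs R.r_distr)
  next
    fix p assume "p \<in> carrier (free_module R X)"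
    note vs = this[THEN v]
    show "\<one>\<^bsub>R\<^esub> \<odot>\<^bsub>free_module R X\<^esub> p = p"
      by (simp add: free_module_simps vs)
  qed (rule assms)
qed

lemma free_gen_closed: "ring R \<Longrightarrow> x \<in> X \<Longrightarrow> free_gen R x \<in> carrier (free_module R X)"
proof -
  assume "ring R" "x \<in> X"
  then interpret R: ring R by simp
  have "{y. free_gen R x y \<noteq> \<zero>\<^bsub>R\<^esub>} \<subseteq> {x}" by (auto simp: free_gen_def)
  then show ?thesis using \<open>x \<in> X\<close>
    by (auto simp: free_module_simps intro: finite_subset) (auto simp: free_gen_def)
qed

context
  fixes R :: "('r, 'p) ring_scheme" and U :: "('r, 'u, 'q) module_scheme" and X :: "'x set"
  assumes U: "left_module R U"
begin

interpretation U: left_module R U by (rule U)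

lemma free_ext_superset:
  assumes "F \<in> X \<rightarrow> carrier U" "p \<in> carrier (free_module R X)" "{x. p x \<noteq> \<zero>\<^bsub>R\<^esub>} \<subseteq> S" "S \<subseteq> X" "finite S"
  shows "free_ext R U F p = (\<Oplus>\<^bsub>U\<^esub> x \<in> S. p x \<odot>\<^bsub>U\<^esub> F x)"
  unfolding free_ext_def
  by (rule U.add.finprod_mono_neutral_cong_left)
    (use assms in \<open>auto simp: free_module_simps Pi_iff subset_eq\<close>)

lemma free_ext_linear:
  assumes F: "F \<in> X \<rightarrow> carrier U"
  shows "is_linear R (free_module R X) U (free_ext R U F)"
proof (rule is_linearI)
  interpret FM: left_module R "free_module R X"
    by (rule left_module_free_module) (rule U.ring_axioms)
  have FX: "F x \<in> carrier U" if "x \<in> X" for x using that F by auto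
  have supp: "{x. p x \<noteq> \<zero>\<^bsub>R\<^esub>} \<subseteq> X \<and> finite {x. p x \<noteq> \<zero>\<^bsub>R\<^esub>}"
    if "p \<in> carrier (free_module R X)" for p
    using that by (auto simp: free_module_simps)
  note v = free_module_value[OF U.ring_axioms]
  fix p assume p: "p \<in> carrier (free_module R X)"
  show "free_ext R U F p \<in> carrier U"
    unfolding free_ext_def using supp[OF p] v[OF p] F by (auto intro!: U.finsum_closed)
  {
    fix q assume q: "q \<in> carrier (free_module R X)"
    let ?S = "{x. p x \<noteq> \<zero>\<^bsub>R\<^esub>} \<union> {x. q x \<noteq> \<zero>\<^bsub>R\<^esub>}"
    have S: "?S \<subseteq> X" "finite ?S" using supp[OF p] supp[OF q] by auto
    have pq: "p \<oplus>\<^bsub>free_module R X\<^esub> q \<in> carrier (free_module R X)" using p q by simp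
    have "free_ext R U F (p \<oplus>\<^bsub>free_module R X\<^esub> q)
        = (\<Oplus>\<^bsub>U\<^esub> x \<in> ?S. (p \<oplus>\<^bsub>free_module R X\<^esub> q) x \<odot>\<^bsub>U\<^esub> F x)"
      by (rule free_ext_superset[OF F pq _ S]) (auto simp: free_module_simps)
    also have "\<dots> = (\<Oplus>\<^bsub>U\<^esub> x \<in> ?S. p x \<odot>\<^bsub>U\<^esub> F x \<oplus>\<^bsub>U\<^esub> q x \<odot>\<^bsub>U\<^esub> F x)"
      using S FX by (intro U.finsum_cong')
        (auto simp: free_module_simps(3) U.smult_l_distr v[OF p] v[OF q] subset_eq)
    also have "\<dots> = (\<Oplus>\<^bsub>U\<^esub> x \<in> ?S. p x \<odot>\<^bsub>U\<^esub> F x) \<oplus>\<^bsub>U\<^esub> (\<Oplus>\<^bsub>U\<^esub> x \<in> ?S. q x \<odot>\<^bsub>U\<^esub> F x)"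
      using S FX by (intro U.finsum_addf) (auto simp: v[OF p] v[OF q] subset_eq)
    also have "(\<Oplus>\<^bsub>U\<^esub> x \<in> ?S. p x \<odot>\<^bsub>U\<^esub> F x) = free_ext R U F p"
      by (rule free_ext_superset[OF F p _ S, symmetric]) auto
    also have "(\<Oplus>\<^bsub>U\<^esub> x \<in> ?S. q x \<odot>\<^bsub>U\<^esub> F x) = free_ext R U F q"
      by (rule free_ext_superset[OF F q _ S, symmetric]) auto
    finally show "free_ext R U F (p \<oplus>\<^bsub>free_module R X\<^esub> q) = free_ext R U F p \<oplus>\<^bsub>U\<^esub> free_ext R U F q" .
  }
  fix r assume r: "r \<in> carrier R"
  let ?S = "{x. p x \<noteq> \<zero>\<^bsub>R\<^esub>}"
  have S: "?S \<subseteq> X" "finite ?S" using supp[OF p] by auto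
  have rp: "r \<odot>\<^bsub>free_module R X\<^esub> p \<in> carrier (free_module R X)" using p r by simp
  have "free_ext R U F (r \<odot>\<^bsub>free_module R X\<^esub> p) = (\<Oplus>\<^bsub>U\<^esub> x \<in> ?S. (r \<odot>\<^bsub>free_module R X\<^esub> p) x \<odot>\<^bsub>U\<^esub> F x)"
    by (rule free_ext_superset[OF F rp _ S]) (use r in \<open>auto simp: free_module_simps\<close>)
  also have "\<dots> = (\<Oplus>\<^bsub>U\<^esub> x \<in> ?S. r \<odot>\<^bsub>U\<^esub> (p x \<odot>\<^bsub>U\<^esub> F x))"
    using S FX r by (intro U.finsum_cong')
      (auto simp: free_module_simps(4) U.smult_assoc1 v[OF p] subset_eq)
  also have "\<dots> = r \<odot>\<^bsub>U\<^esub> free_ext R U F p"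
    unfolding free_ext_def
    using S FX r by (intro U.finsum_smult[symmetric]) (auto simp: v[OF p] subset_eq)
  finally show "free_ext R U F (r \<odot>\<^bsub>free_module R X\<^esub> p) = r \<odot>\<^bsub>U\<^esub> free_ext R U F p" .
qed

lemma free_ext_gen:
  assumes "F \<in> X \<rightarrow> carrier U" "x \<in> X" shows "free_ext R U F (free_gen R x) = F x"
proof -
  have "free_ext R U F (free_gen R x) = (\<Oplus>\<^bsub>U\<^esub> y \<in> {x}. free_gen R x y \<odot>\<^bsub>U\<^esub> F y)"
    by (rule free_ext_superset[OF assms(1)])
      (use assms in \<open>auto simp: free_gen_closed[OF U.ring_axioms]\<close>, auto simp: free_gen_def split: if_splits)
  also have "\<dots> = F x"
    using assms by (simp add: free_gen_def Pi_iff)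
  finally show ?thesis .
qed

lemma free_ext_add:
  assumes "F \<in> X \<rightarrow> carrier U" "G \<in> X \<rightarrow> carrier U" "p \<in> carrier (free_module R X)"
  shows "free_ext R U (\<lambda>x. F x \<oplus>\<^bsub>U\<^esub> G x) p = free_ext R U F p \<oplus>\<^bsub>U\<^esub> free_ext R U G p"
proof -
  have "(\<Oplus>\<^bsub>U\<^esub>x\<in>{x. p x \<noteq> \<zero>\<^bsub>R\<^esub>}. p x \<odot>\<^bsub>U\<^esub> (F x \<oplus>\<^bsub>U\<^esub> G x))
     = (\<Oplus>\<^bsub>U\<^esub>x\<in>{x. p x \<noteq> \<zero>\<^bsub>R\<^esub>}. p x \<odot>\<^bsub>U\<^esub> F x \<oplus>\<^bsub>U\<^esub> p x \<odot>\<^bsub>U\<^esub> G x)"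
    using assms by (intro U.finsum_cong') (auto simp: free_module_simps Pi_iff intro!: U.smult_r_distr, blast+)
  also have "\<dots> = free_ext R U F p \<oplus>\<^bsub>U\<^esub> free_ext R U G p"
    unfolding free_ext_def using assms
    by (intro U.finsum_addf) (auto simp: free_module_simps Pi_iff, blast+)
  finally show ?thesis unfolding free_ext_def .
qed

end

lemma free_ext_smult:
  assumes "left_module R U" "cring R" "F \<in> X \<rightarrow> carrier U" "p \<in> carrier (free_module R X)" "c \<in> carrier R"
  shows "free_ext R U (\<lambda>x. c \<odot>\<^bsub>U\<^esub> F x) p = c \<odot>\<^bsub>U\<^esub> free_ext R U F p"
proof -
  interpret U: left_module R U by fact
  interpret R: cring R by fact
  have 1: "p x \<in> carrier R \<and> F x \<in> carrier U" if "p x \<noteq> \<zero>\<^bsub>R\<^esub>" for x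
    using that assms by (auto simp: free_module_simps Pi_iff)
  then have "(\<Oplus>\<^bsub>U\<^esub>x\<in>{x. p x \<noteq> \<zero>\<^bsub>R\<^esub>}. p x \<odot>\<^bsub>U\<^esub> (c \<odot>\<^bsub>U\<^esub> F x))
     = (\<Oplus>\<^bsub>U\<^esub>x\<in>{x. p x \<noteq> \<zero>\<^bsub>R\<^esub>}. c \<odot>\<^bsub>U\<^esub> (p x \<odot>\<^bsub>U\<^esub> F x))"
    using assms(5) by (intro U.finsum_cong') (auto simp: R.m_comm simp flip: U.smult_assoc1)
  then show ?thesis unfolding free_ext_def using 1 assms(5) by (subst U.finsum_smult) auto
qed

text \<open>Induction on the size of the support: removing one point of the support subtracts a multiple of a
  generator.\<close>

lemma free_module_induct [consumes 2, case_names zero step]: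
  assumes "ring R" "p \<in> carrier (free_module R X)"
    and zero: "P \<zero>\<^bsub>free_module R X\<^esub>"
    and step: "\<And>p r x. p \<in> carrier (free_module R X) \<Longrightarrow> P p \<Longrightarrow> r \<in> carrier R \<Longrightarrow> x \<in> X
      \<Longrightarrow> P (r \<odot>\<^bsub>free_module R X\<^esub> free_gen R x \<oplus>\<^bsub>free_module R X\<^esub> p)"
  shows "P p"
proof -
  interpret R: ring R by fact
  have "\<forall>p \<in> carrier (free_module R X). {x. p x \<noteq> \<zero>\<^bsub>R\<^esub>} = S \<longrightarrow> P p" if "finite S" for S
    using that
  proof induction
    case empty
    have "p = \<zero>\<^bsub>free_module R X\<^esub>" if "{x. p x \<noteq> \<zero>\<^bsub>R\<^esub>} = {}" for p :: "'c \<Rightarrow> 'a"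
      using that by (auto simp: free_module_simps)
    then show ?case using zero by blast
  next
    case (insert a S)
    show ?case
    proof (intro ballI impI)
      fix p assume p: "p \<in> carrier (free_module R X)" and S: "{x. p x \<noteq> \<zero>\<^bsub>R\<^esub>} = insert a S"
      have a: "a \<in> X" "p a \<in> carrier R" using p S by (auto simp: free_module_simps)
      have S': "{x. (p(a := \<zero>\<^bsub>R\<^esub>)) x \<noteq> \<zero>\<^bsub>R\<^esub>} = S" using S insert(2) by auto
      moreover have p': "p(a := \<zero>\<^bsub>R\<^esub>) \<in> carrier (free_module R X)"
        using p insert(1) S' by (auto simp: free_module_simps)
      moreover have "p a \<odot>\<^bsub>free_module R X\<^esub> free_gen R a \<oplus>\<^bsub>free_module R X\<^esub> p(a := \<zero>\<^bsub>R\<^esub>) = p"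
        using a free_module_value[OF assms(1) p] by (auto simp: free_module_simps free_gen_def)
      ultimately show "P p" using step[OF p' _ a(2,1)] insert(3) by simp
    qed
  qed
  then show ?thesis using assms(2) by (auto simp: free_module_simps)
qed

text \<open>The condition under which a map on generators extends to the module that they present.\<close>

definition respects_relations ::
    "('r, 'p) ring_scheme \<Rightarrow> 'x set \<Rightarrow> ('x \<Rightarrow> 'r) set \<Rightarrow> ('r, 'u, 'q) module_scheme \<Rightarrow> ('x \<Rightarrow> 'u) \<Rightarrow> bool"
  where "respects_relations R X E U F \<longleftrightarrow> F \<in> X \<rightarrow> carrier U \<and> (\<forall>e \<in> E. free_ext R U F e = \<zero>\<^bsub>U\<^esub>)"

locale presentation = R: ring R for R :: "('r, 'p) ring_scheme" (structure) +
  fixes X :: "'x set" and E :: "('x \<Rightarrow> 'r) set"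
  assumes relations: "E \<subseteq> carrier (free_module R X)"
begin

abbreviation "FM \<equiv> free_module R X"
abbreviation "PM \<equiv> presented_module R X E"
abbreviation "gen \<equiv> presented_gen R X E"

sublocale FM: left_module R FM by (rule left_module_free_module) (rule R.ring_axioms)

sublocale q: module_quotient R FM "submodule_generated R FM E"
  by (intro module_quotient.intro module_quotient_axioms.intro FM.left_module_axioms
      submodule_generated_submodule(1) relations)

lemma left_module_PM: "left_module R PM"
  using q.left_module_Q by (simp add: presented_module_def)

sublocale PM: left_module R PM by (rule left_module_PM)

lemma gen_closed: "x \<in> X \<Longrightarrow> gen x \<in> carrier PM"
  by (simp add: presented_module_def presented_gen_def q.cls_in free_gen_closed R.ring_axioms)

lemma PM_induct [consumes 1, case_names gen add smult zero]:
  assumes "C \<in> carrier PM"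
    and gen: "\<And>x. x \<in> X \<Longrightarrow> P (gen x)"
    and add: "\<And>C D. C \<in> carrier PM \<Longrightarrow> D \<in> carrier PM \<Longrightarrow> P C \<Longrightarrow> P D \<Longrightarrow> P (C \<oplus>\<^bsub>PM\<^esub> D)"
    and smult: "\<And>r C. r \<in> carrier R \<Longrightarrow> C \<in> carrier PM \<Longrightarrow> P C \<Longrightarrow> P (r \<odot>\<^bsub>PM\<^esub> C)"
    and zero: "P \<zero>\<^bsub>PM\<^esub>"
  shows "P C"
proof -
  obtain p where p: "p \<in> carrier FM" "C = q.cls p"
    using assms(1) by (auto simp: presented_module_def q.carrier_Q)
  have "P (q.cls p)" using R.ring_axioms p(1)
  proof (induction rule: free_module_induct)
    case zero
    then show ?case using assms(5) by (simp add: q.cls_zero presented_module_def)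
  next
    case (step p r x)
    have g: "free_gen R x \<in> carrier FM" "gen x = q.cls (free_gen R x)"
      using step by (auto simp: free_gen_closed R.ring_axioms presented_gen_def)
    have c: "q.cls p \<in> carrier PM" using step(1) by (simp add: presented_module_def q.cls_in)
    have "q.cls (r \<odot>\<^bsub>FM\<^esub> free_gen R x \<oplus>\<^bsub>FM\<^esub> p) = r \<odot>\<^bsub>PM\<^esub> gen x \<oplus>\<^bsub>PM\<^esub> q.cls p"
      using step g(1) unfolding g(2) presented_module_def by (simp add: q.cls_add q.cls_smult)
    then show ?case
      using step c gen gen_closed by (auto intro!: add smult)
  qed
  then show ?thesis using p by simp
qed

lemma lift_rep:
  assumes "left_module R U" "respects_relations R X E U F" "p \<in> carrier FM"
  shows "lift R U F (q.cls p) = free_ext R U F p"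
proof -
  have F: "F \<in> X \<rightarrow> carrier U" using assms(2) by (simp add: respects_relations_def)
  show ?thesis unfolding lift_eq_free_ext
    by (rule q.descend_rep[OF assms(1) free_ext_linear[OF assms(1) F] _ assms(3)])
      (rule linear_zero_on_generated[OF FM.left_module_axioms assms(1) free_ext_linear[OF assms(1) F] relations],
        use assms(2) in \<open>auto simp: respects_relations_def\<close>)
qed

lemma lift_linear:
  assumes "left_module R U" "respects_relations R X E U F"
  shows "is_linear R PM U (lift R U F)"
proof -
  have F: "F \<in> X \<rightarrow> carrier U" using assms(2) by (simp add: respects_relations_def)
  show ?thesis unfolding lift_eq_free_ext[abs_def] presented_module_def
    by (rule q.descend_linear[OF assms(1) free_ext_linear[OF assms(1) F]])
      (rule linear_zero_on_generated[OF FM.left_module_axioms assms(1) free_ext_linear[OF assms(1) F] relations],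
        use assms(2) in \<open>auto simp: respects_relations_def\<close>)
qed

lemma lift_gen:
  assumes "left_module R U" "respects_relations R X E U F" "x \<in> X"
  shows "lift R U F (gen x) = F x"
proof -
  have F: "F \<in> X \<rightarrow> carrier U" using assms(2) by (simp add: respects_relations_def)
  show ?thesis
    using lift_rep[OF assms(1,2) free_gen_closed[OF R.ring_axioms assms(3)]]
    unfolding free_ext_gen[OF assms(1) F assms(3)] by (simp add: presented_gen_def)
qed

lemma linear_eqI:
  assumes "left_module R U" "is_linear R PM U f" "is_linear R PM U g" "\<And>x. x \<in> X \<Longrightarrow> f (gen x) = g (gen x)"
    "C \<in> carrier PM"
  shows "f C = g C"
proof -
  interpret f: linear_map R PM U f by (intro linear_mapI assms left_module_PM)
  interpret g: linear_map R PM U g by (intro linear_mapI assms left_module_PM)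
  show ?thesis using assms(5)
    by (induction rule: PM_induct) (simp_all add: assms(4))
qed

text \<open>A linear map on the free module is the extension of its restriction to generators. Applied to the
  quotient map this shows that the generators of a presented module satisfy the relations; applied
  to other maps it evaluates an extension on an explicit relation.\<close>

lemma free_ext_of_linear:
  assumes "left_module R U" "is_linear R FM U f" "p \<in> carrier FM"
  shows "free_ext R U (\<lambda>x. f (free_gen R x)) p = f p"
proof -
  have F: "(\<lambda>x. f (free_gen R x)) \<in> X \<rightarrow> carrier U"
    by (auto intro: is_linearD(1)[OF assms(2)] free_gen_closed R.ring_axioms)
  interpret f: linear_map R FM U f by (intro linear_mapI assms FM.left_module_axioms)
  interpret e: linear_map R FM U "free_ext R U (\<lambda>x. f (free_gen R x))"
    by (intro linear_mapI assms FM.left_module_axioms free_ext_linear F)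
  show ?thesis using R.ring_axioms assms(3)
  proof (induction rule: free_module_induct)
    case (step p r x)
    then show ?case using free_ext_gen[OF assms(1) F]
      by (simp add: free_gen_closed R.ring_axioms)
  qed auto
qed

lemma respects_gen: "respects_relations R X E PM gen"
  unfolding respects_relations_def
proof (intro conjI ballI)
  fix e assume e: "e \<in> E"
  have gen: "gen = (\<lambda>x. q.cls (free_gen R x))" by (simp add: fun_eq_iff presented_gen_def)
  have "free_ext R PM gen e = q.cls e"
    unfolding gen using free_ext_of_linear[OF left_module_PM, of q.cls e] q.cls_linear e relations
    by (auto simp: presented_module_def subset_eq)
  also have "\<dots> = \<zero>\<^bsub>PM\<^esub>"
    using e submodule_generated_submodule(2)[OF FM.left_module_axioms relations]
    by (subst q.cls_null) (auto simp: presented_module_def)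
  finally show "free_ext R PM gen e = \<zero>\<^bsub>PM\<^esub>" .
qed (auto intro: gen_closed)

end

context
  fixes R :: "('r, 'p) ring_scheme" and U :: "('r, 'u, 'q) module_scheme" and X :: "'x set"
  assumes U: "left_module R U"
begin

interpretation U: left_module R U by (rule U)

lemma free_ext_cong:
  assumes "p \<in> carrier (free_module R X)" "\<And>x. x \<in> X \<Longrightarrow> F x = G x" "G \<in> X \<rightarrow> carrier U"
  shows "free_ext R U F p = free_ext R U G p"
proof -
  have X: "x \<in> X" "p x \<in> carrier R" if "p x \<noteq> \<zero>\<^bsub>R\<^esub>" for x
    using assms(1) that by (auto simp: free_module_simps)
  show ?thesis unfolding free_ext_def
    by (intro U.finsum_cong') (use X assms(2) funcset_mem[OF assms(3)] in auto)
qed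

lemma respects_relations_cong:
  assumes "E \<subseteq> carrier (free_module R X)" "\<And>x. x \<in> X \<Longrightarrow> F x = G x" "respects_relations R X E U G"
  shows "respects_relations R X E U F"
proof -
  have G: "G \<in> X \<rightarrow> carrier U" using assms(3) by (simp add: respects_relations_def)
  have "free_ext R U F e = free_ext R U G e" if "e \<in> E" for e
    by (rule free_ext_cong[OF _ assms(2) G]) (use assms(1) that in auto)
  moreover have "F \<in> X \<rightarrow> carrier U" using funcset_mem[OF G] by (simp add: assms(2) Pi_iff)
  ultimately show ?thesis using assms(3) by (simp add: respects_relations_def)
qed

lemma respects_relations_zero: "respects_relations R X E U (\<lambda>x. \<zero>\<^bsub>U\<^esub>)" if "E \<subseteq> carrier (free_module R X)"
proof -
  have "free_ext R U (\<lambda>x. \<zero>\<^bsub>U\<^esub>) p = \<zero>\<^bsub>U\<^esub>" if p: "p \<in> carrier (free_module R X)" for p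
  proof -
    have "(\<Oplus>\<^bsub>U\<^esub>x\<in>{x. p x \<noteq> \<zero>\<^bsub>R\<^esub>}. p x \<odot>\<^bsub>U\<^esub> \<zero>\<^bsub>U\<^esub>) = (\<Oplus>\<^bsub>U\<^esub>x\<in>{x. p x \<noteq> \<zero>\<^bsub>R\<^esub>}. \<zero>\<^bsub>U\<^esub>)"
      by (intro U.finsum_cong') (use free_module_value[OF U.ring_axioms p] in auto)
    then show ?thesis by (simp add: free_ext_def)
  qed
  then show ?thesis using that by (auto simp: respects_relations_def)
qed

lemma respects_relations_add:
  assumes "E \<subseteq> carrier (free_module R X)" "respects_relations R X E U F" "respects_relations R X E U G"
  shows "respects_relations R X E U (\<lambda>x. F x \<oplus>\<^bsub>U\<^esub> G x)"
proof -
  have *: "F \<in> X \<rightarrow> carrier U" "G \<in> X \<rightarrow> carrier U" using assms by (simp_all add: respects_relations_def)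
  have "free_ext R U (\<lambda>x. F x \<oplus>\<^bsub>U\<^esub> G x) e = \<zero>\<^bsub>U\<^esub>" if "e \<in> E" for e
    using free_ext_add[OF U * subsetD[OF assms(1) that]] assms(2,3) that
    by (simp add: respects_relations_def)
  moreover have "(\<lambda>x. F x \<oplus>\<^bsub>U\<^esub> G x) \<in> X \<rightarrow> carrier U" using *[THEN funcset_mem] by auto
  ultimately show ?thesis by (simp add: respects_relations_def)
qed

lemma respects_relations_smult:
  assumes "cring R" "E \<subseteq> carrier (free_module R X)" "respects_relations R X E U F" "c \<in> carrier R"
  shows "respects_relations R X E U (\<lambda>x. c \<odot>\<^bsub>U\<^esub> F x)"
proof -
  have *: "F \<in> X \<rightarrow> carrier U" using assms by (simp add: respects_relations_def)
  have "free_ext R U (\<lambda>x. c \<odot>\<^bsub>U\<^esub> F x) e = \<zero>\<^bsub>U\<^esub>" if "e \<in> E" for e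
    using free_ext_smult[OF U assms(1) * subsetD[OF assms(2) that] assms(4)] assms(3,4) that
    by (simp add: respects_relations_def)
  moreover have "(\<lambda>x. c \<odot>\<^bsub>U\<^esub> F x) \<in> X \<rightarrow> carrier U" using *[THEN funcset_mem] assms(4) by auto
  ultimately show ?thesis by (simp add: respects_relations_def)
qed

end

definition is_bilinear ::
    "('k, 'p) ring_scheme \<Rightarrow> ('k, 'm, 'q) module_scheme \<Rightarrow> ('k, 'n, 's) module_scheme
      \<Rightarrow> ('k, 'u, 't) module_scheme \<Rightarrow> ('m \<Rightarrow> 'n \<Rightarrow> 'u) \<Rightarrow> bool"
  where "is_bilinear K M N U F \<longleftrightarrow>
    (\<forall>x \<in> carrier M. is_linear K N U (F x)) \<and> (\<forall>y \<in> carrier N. is_linear K M U (\<lambda>x. F x y))"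

lemma is_bilinearD:
  assumes "is_bilinear K M N U F"
  shows "x \<in> carrier M \<Longrightarrow> is_linear K N U (F x)" "y \<in> carrier N \<Longrightarrow> is_linear K M U (\<lambda>x. F x y)"
    "x \<in> carrier M \<Longrightarrow> y \<in> carrier N \<Longrightarrow> F x y \<in> carrier U"
    "x \<in> carrier M \<Longrightarrow> y \<in> carrier N \<Longrightarrow> y' \<in> carrier N \<Longrightarrow> F x (y \<oplus>\<^bsub>N\<^esub> y') = F x y \<oplus>\<^bsub>U\<^esub> F x y'"
    "x \<in> carrier M \<Longrightarrow> x' \<in> carrier M \<Longrightarrow> y \<in> carrier N \<Longrightarrow> F (x \<oplus>\<^bsub>M\<^esub> x') y = F x y \<oplus>\<^bsub>U\<^esub> F x' y"
    "x \<in> carrier M \<Longrightarrow> y \<in> carrier N \<Longrightarrow> c \<in> carrier K \<Longrightarrow> F x (c \<odot>\<^bsub>N\<^esub> y) = c \<odot>\<^bsub>U\<^esub> F x y"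
    "x \<in> carrier M \<Longrightarrow> y \<in> carrier N \<Longrightarrow> c \<in> carrier K \<Longrightarrow> F (c \<odot>\<^bsub>M\<^esub> x) y = c \<odot>\<^bsub>U\<^esub> F x y"
  using assms unfolding is_bilinear_def is_linear_def by auto

lemma is_bilinear_compose:
  "is_bilinear K M N U F \<Longrightarrow> is_linear K U V g \<Longrightarrow> is_bilinear K M N V (\<lambda>x y. g (F x y))"
  unfolding is_bilinear_def by (auto intro: is_linear_compose)

text \<open>Products and pairings of presented modules are defined by lifting twice, once in each argument. The
  result is linear in the outer argument by construction, and linearity in the inner one passes from
  generators to all elements because it is preserved by linear combinations.\<close>

context
  fixes K :: "('k, 'p) ring_scheme" and U :: "('k, 'u, 'q) module_scheme"
    and X :: "'x set" and E and Y :: "'y set" and E' and F :: "'x \<Rightarrow> 'y \<Rightarrow> 'u"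
  assumes K: "cring K" and U: "left_module K U" and PX: "presentation K X E" and PY: "presentation K Y E'"
    and FY: "\<And>x. x \<in> X \<Longrightarrow> respects_relations K Y E' U (F x)"
    and FX: "\<And>y. y \<in> Y \<Longrightarrow> respects_relations K X E U (\<lambda>x. F x y)"
begin

interpretation K: cring K by (rule K)
interpretation U: left_module K U by (rule U)
interpretation PX: presentation K X E by (rule PX)
interpretation PY: presentation K Y E' by (rule PY)

lemma respects_relations_lift:
  "D \<in> carrier PY.PM \<Longrightarrow> respects_relations K X E U (\<lambda>x. lift K U (F x) D)"
proof (induction rule: PY.PM_induct)
  case (gen y)
  then show ?case
    using FY FX by (intro respects_relations_cong[OF U PX.relations PY.lift_gen[OF U]]) auto
next
  case (add C D)
  show ?case
    by (rule respects_relations_cong[OF U PX.relations is_linearD(2)[OF PY.lift_linear[OF U FY]]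
          respects_relations_add[OF U PX.relations add(3,4)]]) (use add in auto)
next
  case (smult r C)
  show ?case
    by (rule respects_relations_cong[OF U PX.relations is_linearD(3)[OF PY.lift_linear[OF U FY]]
          respects_relations_smult[OF U K PX.relations smult(3,1)]]) (use smult in auto)
next
  case zero
  show ?case
    by (rule respects_relations_cong[OF U PX.relations 
          linear_map.map_zero[OF linear_mapI[OF PY.left_module_PM U PY.lift_linear[OF U FY]]]
          respects_relations_zero[OF U PX.relations]])
qed

lemma lift2_bilinear:
  "is_bilinear K PX.PM PY.PM U (\<lambda>C D. lift K U (\<lambda>x. lift K U (F x) D) C)"
  unfolding is_bilinear_def
proof (intro conjI ballI)
  fix D assume "D \<in> carrier PY.PM"
  then show "is_linear K PX.PM U (\<lambda>C. lift K U (\<lambda>x. lift K U (F x) D) C)"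
    by (intro PX.lift_linear U respects_relations_lift)
next
  note lin = PX.lift_linear[OF U respects_relations_lift]
  fix C assume C: "C \<in> carrier PX.PM"
  then show "is_linear K PY.PM U (\<lambda>D. lift K U (\<lambda>x. lift K U (F x) D) C)"
  proof (induction rule: PX.PM_induct)
    case (gen x)
    show ?case
      by (rule is_linear_cong[THEN iffD1, OF _ PY.left_module_PM PY.lift_linear[OF U FY[OF gen]]])
        (simp add: PX.lift_gen[OF U respects_relations_lift gen])
  next
    case (add C D)
    show ?case
      by (rule is_linear_cong[THEN iffD1, OF _ PY.left_module_PM is_linear_add[OF U add(3,4)]])
        (rule is_linearD(2)[OF lin, symmetric], use add in auto)
  next
    case (smult r C)
    show ?case
      by (rule is_linear_cong[THEN iffD1, OF _ PY.left_module_PM is_linear_smult[OF K U smult(3,1)]])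
        (rule is_linearD(3)[OF lin, symmetric], use smult in auto)
  next
    case zero
    show ?case
      by (rule is_linear_cong[THEN iffD1, OF _ PY.left_module_PM is_linear_zero[OF U]])
        (rule linear_map.map_zero[OF linear_mapI[OF PX.left_module_PM U lin], symmetric])
  qed
qed

lemma lift2_gen:
  "x \<in> X \<Longrightarrow> y \<in> Y \<Longrightarrow> lift K U (\<lambda>x. lift K U (F x) (PY.gen y)) (PX.gen x) = F x y"
  using PX.lift_gen[OF U respects_relations_lift[OF PY.gen_closed]] PY.lift_gen[OF U FY] by simp

end

section \<open>Tensor products\<close>

text \<open>Relations are differences of elements of a free module; a linear map kills such a difference exactly
  when it satisfies the corresponding identity.\<close>

lemma (in linear_map) relation_add:
  "a \<in> carrier M \<Longrightarrow> b \<in> carrier M \<Longrightarrow> c \<in> carrier M \<Longrightarrow>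
    f (a \<ominus>\<^bsub>M\<^esub> (b \<oplus>\<^bsub>M\<^esub> c)) = \<zero>\<^bsub>N\<^esub> \<longleftrightarrow> f a = f b \<oplus>\<^bsub>N\<^esub> f c"
  by (simp add: map_diff_eq_zero)

lemma (in linear_map) relation_smult:
  "a \<in> carrier M \<Longrightarrow> b \<in> carrier M \<Longrightarrow> c \<in> carrier R \<Longrightarrow>
    f (a \<ominus>\<^bsub>M\<^esub> c \<odot>\<^bsub>M\<^esub> b) = \<zero>\<^bsub>N\<^esub> \<longleftrightarrow> f a = c \<odot>\<^bsub>N\<^esub> f b"
  by (simp add: map_diff_eq_zero)

context
  fixes K :: "('k, 'p) ring_scheme" and M :: "('k, 'm, 'q) module_scheme" and N :: "('k, 'n, 's) module_scheme"
  assumes M: "left_module K M" and N: "left_module K N"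
begin

interpretation M: left_module K M by (rule M)
interpretation N: left_module K N by (rule N)
interpretation FM: left_module K "free_module K (carrier M \<times> carrier N)"
  by (rule left_module_free_module) (rule M.ring_axioms)

lemma bilinear_relations_closed:
  "bilinear_relations K M N \<subseteq> carrier (free_module K (carrier M \<times> carrier N))"
  unfolding bilinear_relations_def Let_def
  by (auto intro!: FM.minus_closed FM.a_closed FM.smult_closed free_gen_closed M.ring_axioms)

lemma
  assumes U: "left_module K U" and F: "F \<in> carrier M \<times> carrier N \<rightarrow> carrier U"
  shows bilinear_kills_relations: "is_bilinear K M N U (\<lambda>x y. F (x, y)) \<Longrightarrow> e \<in> bilinear_relations K M N
      \<Longrightarrow> free_ext K U F e = \<zero>\<^bsub>U\<^esub>"
    and kills_relations_bilinear: "(\<And>e. e \<in> bilinear_relations K M N \<Longrightarrow> free_ext K U F e = \<zero>\<^bsub>U\<^esub>)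
      \<Longrightarrow> is_bilinear K M N U (\<lambda>x y. F (x, y))"
proof -
  interpret e: linear_map K "free_module K (carrier M \<times> carrier N)" U "free_ext K U F"
    by (intro linear_mapI FM.left_module_axioms U free_ext_linear F)
  have g: "free_gen K (x, y) \<in> carrier (free_module K (carrier M \<times> carrier N))"
    "free_ext K U F (free_gen K (x, y)) = F (x, y)" if "x \<in> carrier M" "y \<in> carrier N" for x y
    using that by (auto intro: free_gen_closed[OF M.ring_axioms] free_ext_gen[OF U F])
  {
    assume bil: "is_bilinear K M N U (\<lambda>x y. F (x, y))" and "e \<in> bilinear_relations K M N"
    from this(2) show "free_ext K U F e = \<zero>\<^bsub>U\<^esub>"
      unfolding bilinear_relations_def Let_def Un_iff mem_Collect_eq
      by (elim disjE exE conjE) (simp_all add: g e.relation_add e.relation_smult is_bilinearD[OF bil])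
  }
  assume kills: "\<And>e. e \<in> bilinear_relations K M N \<Longrightarrow> free_ext K U F e = \<zero>\<^bsub>U\<^esub>"
  let ?e = "\<lambda>x y. free_gen K (x, y)" and ?FM = "free_module K (carrier M \<times> carrier N)"
  have 1: "F (x \<oplus>\<^bsub>M\<^esub> x', y) = F (x, y) \<oplus>\<^bsub>U\<^esub> F (x', y)"
    if "x \<in> carrier M" "x' \<in> carrier M" "y \<in> carrier N" for x x' y
  proof -
    have "?e (x \<oplus>\<^bsub>M\<^esub> x') y \<ominus>\<^bsub>?FM\<^esub> (?e x y \<oplus>\<^bsub>?FM\<^esub> ?e x' y) \<in> bilinear_relations K M N"
      unfolding bilinear_relations_def Let_def by (rule UnI1, rule UnI1, rule UnI1) (unfold mem_Collect_eq, intro exI conjI, rule refl, (rule that)+)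
    from kills[OF this] show ?thesis using that by (simp add: g e.relation_add)
  qed
  have 2: "F (x, y \<oplus>\<^bsub>N\<^esub> y') = F (x, y) \<oplus>\<^bsub>U\<^esub> F (x, y')"
    if "x \<in> carrier M" "y \<in> carrier N" "y' \<in> carrier N" for x y y'
  proof -
    have "?e x (y \<oplus>\<^bsub>N\<^esub> y') \<ominus>\<^bsub>?FM\<^esub> (?e x y \<oplus>\<^bsub>?FM\<^esub> ?e x y') \<in> bilinear_relations K M N"
      unfolding bilinear_relations_def Let_def by (rule UnI1, rule UnI1, rule UnI2) (unfold mem_Collect_eq, intro exI conjI, rule refl, (rule that)+)
    from kills[OF this] show ?thesis using that by (simp add: g e.relation_add)
  qed
  have 3: "F (c \<odot>\<^bsub>M\<^esub> x, y) = c \<odot>\<^bsub>U\<^esub> F (x, y)" "F (x, c \<odot>\<^bsub>N\<^esub> y) = c \<odot>\<^bsub>U\<^esub> F (x, y)"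
    if "c \<in> carrier K" "x \<in> carrier M" "y \<in> carrier N" for c x y
  proof -
    have "?e (c \<odot>\<^bsub>M\<^esub> x) y \<ominus>\<^bsub>?FM\<^esub> c \<odot>\<^bsub>?FM\<^esub> ?e x y \<in> bilinear_relations K M N"
      unfolding bilinear_relations_def Let_def by (rule UnI1, rule UnI2) (unfold mem_Collect_eq, intro exI conjI, rule refl, (rule that)+)
    from kills[OF this] show "F (c \<odot>\<^bsub>M\<^esub> x, y) = c \<odot>\<^bsub>U\<^esub> F (x, y)"
      using that by (simp add: g e.relation_smult)
    have "?e x (c \<odot>\<^bsub>N\<^esub> y) \<ominus>\<^bsub>?FM\<^esub> c \<odot>\<^bsub>?FM\<^esub> ?e x y \<in> bilinear_relations K M N"
      unfolding bilinear_relations_def Let_def by (rule UnI2) (unfold mem_Collect_eq, intro exI conjI, rule refl, (rule that)+)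
    from kills[OF this] show "F (x, c \<odot>\<^bsub>N\<^esub> y) = c \<odot>\<^bsub>U\<^esub> F (x, y)"
      using that by (simp add: g e.relation_smult)
  qed
  show "is_bilinear K M N U (\<lambda>x y. F (x, y))"
    unfolding is_bilinear_def using funcset_mem[OF F] by (simp add: is_linear_def Pi_iff 1 2 3)
qed

end

text \<open>The tensor product over \<open>K\<close> and the balanced one over an algebra differ by the balancing relations
  only, so the bilinear relations are contained in both sets of relations.\<close>

locale tensor_presentation = M: left_module K M + N: left_module K N
  for K and M :: "('k, 'm, 'q) module_scheme" and N :: "('k, 'n, 's) module_scheme" +
  fixes E
  assumes E_closed: "E \<subseteq> carrier (free_module K (carrier M \<times> carrier N))"
    and E_bilinear: "bilinear_relations K M N \<subseteq> E"
begin

sublocale presentation K "carrier M \<times> carrier N" E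
  by (intro presentation.intro presentation_axioms.intro M.ring_axioms E_closed)

lemma gen_bilinear: "is_bilinear K M N PM (\<lambda>x y. gen (x, y))"
  by (rule kills_relations_bilinear[OF M.left_module_axioms N.left_module_axioms left_module_PM])
    (use respects_gen E_bilinear in \<open>auto simp: respects_relations_def\<close>)

end

lemma left_module_tensor: "left_module K M \<Longrightarrow> left_module K N \<Longrightarrow> left_module K (tensor K M N)"
  and tensor_presentation: "left_module K M \<Longrightarrow> left_module K N \<Longrightarrow> tensor_presentation K M N (bilinear_relations K M N)"
proof -
  assume M: "left_module K M" and N: "left_module K N"
  then show t: "tensor_presentation K M N (bilinear_relations K M N)"
    by (intro tensor_presentation.intro tensor_presentation_axioms.intro bilinear_relations_closed) auto
  interpret tensor_presentation K M N "bilinear_relations K M N" by (rule t)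
  show "left_module K (tensor K M N)" unfolding tensor_def by (rule left_module_PM)
qed

lemma respects_bilinear_relations:
  assumes "left_module K M" "left_module K N" "left_module K U" "is_bilinear K M N U (\<lambda>x y. F (x, y))"
  shows "respects_relations K (carrier M \<times> carrier N) (bilinear_relations K M N) U F"
proof -
  have F: "F \<in> carrier M \<times> carrier N \<rightarrow> carrier U" using is_bilinearD(3)[OF assms(4)] by auto
  then show ?thesis
    using bilinear_kills_relations[OF assms(1-3) F assms(4)] by (simp add: respects_relations_def)
qed

context
  fixes K :: "('k, 'p) ring_scheme" and M :: "('k, 'm, 'q) module_scheme" and N :: "('k, 'n, 's) module_scheme"
  assumes M: "left_module K M" and N: "left_module K N"
begin

interpretation T: tensor_presentation K M N "bilinear_relations K M N"
  by (rule tensor_presentation[OF M N])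

lemma pure_tensor_bilinear: "is_bilinear K M N (tensor K M N) (pure_tensor K M N)"
  using T.gen_bilinear unfolding tensor_def pure_tensor_def[abs_def] .

lemma tensor_linear_eqI:
  assumes "left_module K U" "is_linear K (tensor K M N) U f" "is_linear K (tensor K M N) U g"
    "\<And>x y. x \<in> carrier M \<Longrightarrow> y \<in> carrier N \<Longrightarrow> f (pure_tensor K M N x y) = g (pure_tensor K M N x y)"
    "C \<in> carrier (tensor K M N)"
  shows "f C = g C"
  by (rule T.linear_eqI[OF assms(1)]) (use assms(2-5) in \<open>auto simp: tensor_def pure_tensor_def\<close>)

lemma
  assumes "left_module K U" "is_bilinear K M N U (\<lambda>x y. F (x, y))"
  shows tensor_lift_linear: "is_linear K (tensor K M N) U (lift K U F)"
    and tensor_lift_pure: "x \<in> carrier M \<Longrightarrow> y \<in> carrier N \<Longrightarrow> lift K U F (pure_tensor K M N x y) = F (x, y)"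
  using T.lift_linear[OF assms(1) respects_bilinear_relations[OF M N assms]]
    T.lift_gen[OF assms(1) respects_bilinear_relations[OF M N assms], of "(x, y)"]
  by (auto simp: tensor_def pure_tensor_def)

end

text \<open>The instances are the forms with values in a module and the tensor product of a dual module with the
  module itself; \<open>act\<close> is the right action of \<open>B\<close> on the left factor.\<close>

locale balanced_tensor = M: left_module K M + N': left_module K "restrict_scalars B N"
  for K and M :: "('k, 'm, 'q) module_scheme" and B :: "('k, 'b, 'q2) module_scheme"
    and N :: "('b, 'n, 's) module_scheme" +
  fixes act
  assumes act_closed: "x \<in> carrier M \<Longrightarrow> b \<in> carrier B \<Longrightarrow> act x b \<in> carrier M"
    and N_closed: "y \<in> carrier N \<Longrightarrow> b \<in> carrier B \<Longrightarrow> b \<odot>\<^bsub>N\<^esub> y \<in> carrier N"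
begin

abbreviation "T \<equiv> tensor_over K B M act N"
abbreviation "pure \<equiv> pure_over K B M act N"

lemma carrier_restrict: "carrier (restrict_scalars B N) = carrier N"
  by (simp add: restrict_scalars_def)

sublocale FN: left_module K "free_module K (carrier M \<times> carrier N)"
  by (rule left_module_free_module) (rule M.ring_axioms)

sublocale T: tensor_presentation K M "restrict_scalars B N" "tensor_over_relations K B M act N"
proof (intro tensor_presentation.intro tensor_presentation_axioms.intro M.left_module_axioms N'.left_module_axioms)
  show "bilinear_relations K M (restrict_scalars B N) \<subseteq> tensor_over_relations K B M act N"
    by (simp add: tensor_over_relations_def)
  show "tensor_over_relations K B M act N \<subseteq> carrier (free_module K (carrier M \<times> carrier (restrict_scalars B N)))"
    using bilinear_relations_closed[OF M.left_module_axioms N'.left_module_axioms]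
    unfolding tensor_over_relations_def Let_def carrier_restrict
    by (auto intro!: FN.minus_closed free_gen_closed M.ring_axioms simp: act_closed N_closed)
qed

lemma T_eq: "T = T.PM" "pure x y = T.gen (x, y)"
  by (simp_all add: tensor_over_def pure_over_def carrier_restrict)

lemma left_module_T: "left_module K T"
  unfolding T_eq by (rule T.left_module_PM)

lemma pure_bilinear: "is_bilinear K M (restrict_scalars B N) T pure"
  using T.gen_bilinear unfolding T_eq(1) unfolding T_eq(2)[abs_def] .

lemma T_linear_eqI:
  assumes "left_module K U" "is_linear K T U f" "is_linear K T U g"
    "\<And>x y. x \<in> carrier M \<Longrightarrow> y \<in> carrier N \<Longrightarrow> f (pure x y) = g (pure x y)" "C \<in> carrier T"
  shows "f C = g C"
  by (rule T.linear_eqI[OF assms(1-3)[unfolded T_eq(1)] _ assms(5)[unfolded T_eq(1)]])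
    (use assms(4) in \<open>auto simp: T_eq(2) carrier_restrict\<close>)

lemma
  assumes U: "left_module K U" and F: "F \<in> carrier M \<times> carrier N \<rightarrow> carrier U"
    and x: "x \<in> carrier M" and y: "y \<in> carrier N" and b: "b \<in> carrier B"
  shows balanced_iff: "free_ext K U F (free_gen K (act x b, y) \<ominus>\<^bsub>free_module K (carrier M \<times> carrier N)\<^esub>
      free_gen K (x, b \<odot>\<^bsub>N\<^esub> y)) = \<zero>\<^bsub>U\<^esub> \<longleftrightarrow> F (act x b, y) = F (x, b \<odot>\<^bsub>N\<^esub> y)"
proof -
  interpret e: linear_map K "free_module K (carrier M \<times> carrier N)" U "free_ext K U F"
    by (intro linear_mapI FN.left_module_axioms U free_ext_linear F)
  show ?thesis
    using x y b by (subst e.map_diff_eq_zero)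
      (auto simp: free_ext_gen[OF U F] act_closed N_closed intro!: free_gen_closed M.ring_axioms)
qed

lemma pure_balanced:
  assumes "x \<in> carrier M" "y \<in> carrier N" "b \<in> carrier B"
  shows "pure (act x b) y = pure x (b \<odot>\<^bsub>N\<^esub> y)"
proof -
  let ?r = "free_gen K (act x b, y) \<ominus>\<^bsub>free_module K (carrier M \<times> carrier N)\<^esub> free_gen K (x, b \<odot>\<^bsub>N\<^esub> y)"
  have "?r \<in> tensor_over_relations K B M act N"
    unfolding tensor_over_relations_def Let_def by (rule UnI2) (unfold mem_Collect_eq, intro exI conjI, rule refl, (rule assms)+)
  then have 0: "free_ext K T.PM T.gen ?r = \<zero>\<^bsub>T.PM\<^esub>"
    using T.respects_gen unfolding respects_relations_def by (elim conjE) (erule (1) bspec)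
  have F: "T.gen \<in> carrier M \<times> carrier N \<rightarrow> carrier T.PM"
    using T.respects_gen unfolding respects_relations_def carrier_restrict by (elim conjE)
  show ?thesis
    unfolding T_eq using balanced_iff[OF T.left_module_PM F assms(1,2,3)] 0 by (rule iffD1)
qed

lemma
  assumes U: "left_module K U" and bil: "is_bilinear K M (restrict_scalars B N) U (\<lambda>x y. F (x, y))"
    and bal: "\<And>x y b. x \<in> carrier M \<Longrightarrow> y \<in> carrier N \<Longrightarrow> b \<in> carrier B \<Longrightarrow> F (act x b, y) = F (x, b \<odot>\<^bsub>N\<^esub> y)"
  shows T_lift_linear: "is_linear K T U (lift K U F)"
    and T_lift_pure: "x \<in> carrier M \<Longrightarrow> y \<in> carrier N \<Longrightarrow> lift K U F (pure x y) = F (x, y)"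
proof -
  have "F (x, y) \<in> carrier U" if "x \<in> carrier M" "y \<in> carrier N" for x y
    by (rule is_bilinearD(3)[OF bil that(1)]) (simp add: carrier_restrict that)
  then have F: "F \<in> carrier M \<times> carrier N \<rightarrow> carrier U" by (simp add: Pi_iff)
  have kills: "free_ext K U F e = \<zero>\<^bsub>U\<^esub>" if e: "e \<in> tensor_over_relations K B M act N" for e
    using e unfolding tensor_over_relations_def Let_def Un_iff mem_Collect_eq
  proof (elim disjE exE conjE)
    assume "e \<in> bilinear_relations K M (restrict_scalars B N)"
    then show ?thesis
      by (rule bilinear_kills_relations[OF M.left_module_axioms N'.left_module_axioms U
            F[folded carrier_restrict] bil])
  next
    fix x b y assume e: "e = free_gen K (act x b, y) \<ominus>\<^bsub>free_module K (carrier M \<times> carrier N)\<^esub> free_gen K (x, b \<odot>\<^bsub>N\<^esub> y)"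
      and xby: "x \<in> carrier M" "b \<in> carrier B" "y \<in> carrier N"
    show ?thesis
      unfolding e by (rule balanced_iff[OF U F xby(1,3,2), THEN iffD2, OF bal[OF xby(1,3,2)]])
  qed
  have r: "respects_relations K (carrier M \<times> carrier (restrict_scalars B N)) (tensor_over_relations K B M act N) U F"
    unfolding respects_relations_def carrier_restrict by (intro conjI ballI F kills)
  show "is_linear K T U (lift K U F)" unfolding T_eq by (rule T.lift_linear[OF U r])
  show "lift K U F (pure x y) = F (x, y)" if "x \<in> carrier M" "y \<in> carrier N"
    unfolding T_eq by (rule T.lift_gen[OF U r]) (simp add: that carrier_restrict)
qed

end

section \<open>Multilinear maps\<close>

text \<open>The property of a set of tuples under which linearity in each entry makes sense: an entry may be
  replaced by any other vector. Words of arbitrary length and words of a fixed length both have it,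
  which covers the tensor algebra and the tensor powers at once.\<close>

definition slot_closed :: "('k, 'v, 'q) module_scheme \<Rightarrow> 'v list set \<Rightarrow> bool"
  where "slot_closed V L \<longleftrightarrow>
    (\<forall>xs v ys. xs @ v # ys \<in> L \<longrightarrow> v \<in> carrier V \<and> (\<forall>v' \<in> carrier V. xs @ v' # ys \<in> L))"

lemma slot_closed_lists: "slot_closed V (lists (carrier V))"
  by (auto simp: slot_closed_def)

lemma slot_closed_lists_of_length: "slot_closed V (lists_of_length V n)"
  by (auto simp: slot_closed_def lists_of_length_def)

definition multilinear ::
    "('k, 'p) ring_scheme \<Rightarrow> ('k, 'v, 'q) module_scheme \<Rightarrow> 'v list set
      \<Rightarrow> ('k, 'u, 't) module_scheme \<Rightarrow> ('v list \<Rightarrow> 'u) \<Rightarrow> bool"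
  where "multilinear K V L U F \<longleftrightarrow> F \<in> L \<rightarrow> carrier U \<and>
    (\<forall>xs v ys. xs @ v # ys \<in> L \<longrightarrow> is_linear K V U (\<lambda>v. F (xs @ v # ys)))"

lemma multilinearD:
  assumes "multilinear K V L U F"
  shows "xs \<in> L \<Longrightarrow> F xs \<in> carrier U"
    and "xs @ v # ys \<in> L \<Longrightarrow> is_linear K V U (\<lambda>v. F (xs @ v # ys))"
  using assms unfolding multilinear_def by auto

locale multilinear_presentation = V: left_module K V
  for K and V :: "('k, 'v, 'q) module_scheme" and L +
  assumes slots: "slot_closed V L"
begin

abbreviation "E \<equiv> multilinear_relations K V L"

lemma slotD:
  assumes "xs @ v # ys \<in> L"
  shows "v \<in> carrier V" and "v' \<in> carrier V \<Longrightarrow> xs @ v' # ys \<in> L"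
proof -
  have *: "v \<in> carrier V \<and> (\<forall>v' \<in> carrier V. xs @ v' # ys \<in> L)"
    using slots[unfolded slot_closed_def, THEN spec, THEN spec, THEN spec, THEN mp, OF assms] .
  show "v \<in> carrier V" using * by (rule conjunct1)
  show "xs @ v' # ys \<in> L" if "v' \<in> carrier V" using * that by simp
qed

interpretation FL: left_module K "free_module K L"
  by (rule left_module_free_module) (rule V.ring_axioms)

lemma relations_closed: "E \<subseteq> carrier (free_module K L)"
proof
  fix e assume e: "e \<in> E"
  note g = free_gen_closed[OF V.ring_axioms]
  show "e \<in> carrier (free_module K L)"
    using e unfolding multilinear_relations_def Let_def Un_iff mem_Collect_eq
  proof (elim disjE exE conjE)
    fix xs ys v v'
    assume e: "e = free_gen K (xs @ (v \<oplus>\<^bsub>V\<^esub> v') # ys) \<ominus>\<^bsub>free_module K L\<^esub>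
        (free_gen K (xs @ v # ys) \<oplus>\<^bsub>free_module K L\<^esub> free_gen K (xs @ v' # ys))"
      and L: "xs @ v # ys \<in> L" "xs @ v' # ys \<in> L"
    note vs = L(1)[THEN slotD(1)] L(2)[THEN slotD(1)]
    show ?thesis
      unfolding e
      by (rule FL.minus_closed[OF g[OF slotD(2)[OF L(1) V.M.a_closed[OF vs]]] FL.M.a_closed[OF g[OF L(1)] g[OF L(2)]]])
  next
    fix xs ys c v
    assume e: "e = free_gen K (xs @ (c \<odot>\<^bsub>V\<^esub> v) # ys) \<ominus>\<^bsub>free_module K L\<^esub>
        c \<odot>\<^bsub>free_module K L\<^esub> free_gen K (xs @ v # ys)"
      and L: "c \<in> carrier K" "xs @ v # ys \<in> L"
    show ?thesis
      unfolding e
      by (rule FL.minus_closed[OF g[OF slotD(2)[OF L(2) V.smult_closed[OF L(1) slotD(1)[OF L(2)]]]]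
            FL.smult_closed[OF L(1) g[OF L(2)]]])
  qed
qed

sublocale presentation K L E
  by (intro presentation.intro presentation_axioms.intro V.ring_axioms relations_closed)

lemma respects_multilinear_relations:
  assumes U: "left_module K U" and F: "multilinear K V L U F"
  shows "respects_relations K L E U F"
proof -
  have FL': "F \<in> L \<rightarrow> carrier U" using F by (simp add: multilinear_def)
  interpret e: linear_map K "free_module K L" U "free_ext K U F"
    by (intro linear_mapI FL.left_module_axioms U free_ext_linear FL')
  have g: "free_gen K xs \<in> carrier (free_module K L)" "free_ext K U F (free_gen K xs) = F xs"
    if "xs \<in> L" for xs
    by (rule free_gen_closed[OF V.ring_axioms that], rule free_ext_gen[OF U FL' that])
  note lin = is_linearD[OF multilinearD(2)[OF F]]
  have kills: "free_ext K U F e = \<zero>\<^bsub>U\<^esub>" if e: "e \<in> E" for e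
    using e unfolding multilinear_relations_def Let_def Un_iff mem_Collect_eq
  proof (elim disjE exE conjE)
    fix xs ys v v'
    assume e: "e = free_gen K (xs @ (v \<oplus>\<^bsub>V\<^esub> v') # ys) \<ominus>\<^bsub>free_module K L\<^esub>
        (free_gen K (xs @ v # ys) \<oplus>\<^bsub>free_module K L\<^esub> free_gen K (xs @ v' # ys))"
      and L: "xs @ v # ys \<in> L" "xs @ v' # ys \<in> L"
    note vs = L(1)[THEN slotD(1)] L(2)[THEN slotD(1)]
    have "xs @ (v \<oplus>\<^bsub>V\<^esub> v') # ys \<in> L" by (rule slotD(2)[OF L(1) V.M.a_closed[OF vs]])
    then show ?thesis
      unfolding e using L lin(2)[OF L(1) vs] by (simp add: g e.relation_add)
  next
    fix xs ys c v
    assume e: "e = free_gen K (xs @ (c \<odot>\<^bsub>V\<^esub> v) # ys) \<ominus>\<^bsub>free_module K L\<^esub>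
        c \<odot>\<^bsub>free_module K L\<^esub> free_gen K (xs @ v # ys)"
      and L: "c \<in> carrier K" "xs @ v # ys \<in> L"
    note vs = L(2)[THEN slotD(1)]
    have "xs @ (c \<odot>\<^bsub>V\<^esub> v) # ys \<in> L" by (rule slotD(2)[OF L(2) V.smult_closed[OF L(1) vs]])
    then show ?thesis
      unfolding e using L lin(3)[OF L(2,1) vs] by (simp add: g e.relation_smult)
  qed
  show ?thesis unfolding respects_relations_def by (intro conjI ballI FL' kills)
qed

lemma gen_multilinear: "multilinear K V L PM gen"
  unfolding multilinear_def
proof (intro conjI allI impI funcsetI gen_closed)
  interpret e: linear_map K "free_module K L" PM "free_ext K PM gen"
    by (intro linear_mapI FL.left_module_axioms left_module_PM free_ext_linear)
      (auto intro: gen_closed)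
  have FL': "gen \<in> L \<rightarrow> carrier PM" by (auto intro: gen_closed)
  have g: "free_gen K xs \<in> carrier (free_module K L)" "free_ext K PM gen (free_gen K xs) = gen xs"
    if "xs \<in> L" for xs
    by (rule free_gen_closed[OF V.ring_axioms that], rule free_ext_gen[OF left_module_PM FL' that])
  have kills: "free_ext K PM gen e = \<zero>\<^bsub>PM\<^esub>" if "e \<in> E" for e
    using respects_gen that by (simp add: respects_relations_def)
  fix xs v ys assume L: "xs @ v # ys \<in> L"
  show "is_linear K V PM (\<lambda>v. gen (xs @ v # ys))"
  proof (rule is_linearI)
    fix v assume "v \<in> carrier V"
    then show "gen (xs @ v # ys) \<in> carrier PM" by (intro gen_closed slotD(2)[OF L])
  next
    fix v v' assume v: "v \<in> carrier V" and v': "v' \<in> carrier V"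
    note Ls = slotD(2)[OF L v] slotD(2)[OF L v'] slotD(2)[OF L V.M.a_closed[OF v v']]
    have "free_gen K (xs @ (v \<oplus>\<^bsub>V\<^esub> v') # ys) \<ominus>\<^bsub>free_module K L\<^esub>
        (free_gen K (xs @ v # ys) \<oplus>\<^bsub>free_module K L\<^esub> free_gen K (xs @ v' # ys)) \<in> E"
      unfolding multilinear_relations_def Let_def
      by (rule UnI1) (unfold mem_Collect_eq, intro exI conjI, rule refl, (rule Ls)+)
    from kills[OF this] show "gen (xs @ (v \<oplus>\<^bsub>V\<^esub> v') # ys) = gen (xs @ v # ys) \<oplus>\<^bsub>PM\<^esub> gen (xs @ v' # ys)"
      using Ls by (simp add: g e.relation_add)
  next
    fix c v assume c: "c \<in> carrier K" and v: "v \<in> carrier V"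
    note Ls = slotD(2)[OF L v] slotD(2)[OF L V.smult_closed[OF c v]]
    have "free_gen K (xs @ (c \<odot>\<^bsub>V\<^esub> v) # ys) \<ominus>\<^bsub>free_module K L\<^esub>
        c \<odot>\<^bsub>free_module K L\<^esub> free_gen K (xs @ v # ys) \<in> E"
      unfolding multilinear_relations_def Let_def
      by (rule UnI2) (unfold mem_Collect_eq, intro exI conjI, rule refl, rule c, rule Ls)
    from kills[OF this] show "gen (xs @ (c \<odot>\<^bsub>V\<^esub> v) # ys) = c \<odot>\<^bsub>PM\<^esub> gen (xs @ v # ys)"
      using Ls c by (simp add: g e.relation_smult)
  qed
qed

end

section \<open>Algebras\<close>

locale kalgebra = K: cring K + B: ring B + B: left_module K B
  for K :: "('k, 'p) ring_scheme" and B :: "('k, 'b, 'q) module_scheme" +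
  assumes smult_mult_left: "c \<in> carrier K \<Longrightarrow> x \<in> carrier B \<Longrightarrow> y \<in> carrier B \<Longrightarrow>
      (c \<odot>\<^bsub>B\<^esub> x) \<otimes>\<^bsub>B\<^esub> y = c \<odot>\<^bsub>B\<^esub> (x \<otimes>\<^bsub>B\<^esub> y)"
    and smult_mult_right: "c \<in> carrier K \<Longrightarrow> x \<in> carrier B \<Longrightarrow> y \<in> carrier B \<Longrightarrow>
      x \<otimes>\<^bsub>B\<^esub> (c \<odot>\<^bsub>B\<^esub> y) = c \<odot>\<^bsub>B\<^esub> (x \<otimes>\<^bsub>B\<^esub> y)"

lemma (in kalgebra) mult_bilinear: "is_bilinear K B B B (mult B)"
  unfolding is_bilinear_def
  by (auto intro!: is_linearI simp: B.l_distr B.r_distr smult_mult_left smult_mult_right)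

text \<open>Associativity and the unit laws are identities between maps that are linear in each argument, so
  they need to be checked only on a set \<open>G\<close> whose elements determine linear maps; the arguments
  are freed from \<open>G\<close> one after the other.\<close>

lemma kalgebraI:
  assumes "cring K" "left_module K B" and bil: "is_bilinear K B B B (mult B)" and one: "\<one>\<^bsub>B\<^esub> \<in> carrier B"
    and eq: "\<And>f g x. is_linear K B B f \<Longrightarrow> is_linear K B B g \<Longrightarrow> (\<And>x. x \<in> G \<Longrightarrow> f x = g x) \<Longrightarrow> x \<in> carrier B \<Longrightarrow> f x = g x"
    and G: "G \<subseteq> carrier B"
    and assoc: "\<And>x y z. x \<in> G \<Longrightarrow> y \<in> G \<Longrightarrow> z \<in> G \<Longrightarrow> x \<otimes>\<^bsub>B\<^esub> y \<otimes>\<^bsub>B\<^esub> z = x \<otimes>\<^bsub>B\<^esub> (y \<otimes>\<^bsub>B\<^esub> z)"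
    and l_one: "\<And>x. x \<in> G \<Longrightarrow> \<one>\<^bsub>B\<^esub> \<otimes>\<^bsub>B\<^esub> x = x" and r_one: "\<And>x. x \<in> G \<Longrightarrow> x \<otimes>\<^bsub>B\<^esub> \<one>\<^bsub>B\<^esub> = x"
  shows "kalgebra K B"
proof -
  interpret K: cring K by fact
  interpret B: left_module K B by fact
  note m = is_bilinearD[OF bil]
  have GB: "x \<in> carrier B" if "x \<in> G" for x using G that by auto
  have a1: "x \<otimes>\<^bsub>B\<^esub> y \<otimes>\<^bsub>B\<^esub> z = x \<otimes>\<^bsub>B\<^esub> (y \<otimes>\<^bsub>B\<^esub> z)" if "x \<in> carrier B" "y \<in> G" "z \<in> G" for x y z
    by (rule eq[of "\<lambda>x. x \<otimes>\<^bsub>B\<^esub> y \<otimes>\<^bsub>B\<^esub> z" "\<lambda>x. x \<otimes>\<^bsub>B\<^esub> (y \<otimes>\<^bsub>B\<^esub> z)", OF _ _ _ that(1)])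
      (use that GB assoc in \<open>auto intro!: m(2,3) is_linear_compose[OF m(2) m(2)]\<close>)
  have a2: "x \<otimes>\<^bsub>B\<^esub> y \<otimes>\<^bsub>B\<^esub> z = x \<otimes>\<^bsub>B\<^esub> (y \<otimes>\<^bsub>B\<^esub> z)" if "x \<in> carrier B" "y \<in> carrier B" "z \<in> G" for x y z
    by (rule eq[of "\<lambda>y. x \<otimes>\<^bsub>B\<^esub> y \<otimes>\<^bsub>B\<^esub> z" "\<lambda>y. x \<otimes>\<^bsub>B\<^esub> (y \<otimes>\<^bsub>B\<^esub> z)", OF _ _ _ that(2)])
      (use that GB a1 in \<open>auto intro!: is_linear_compose[OF m(1) m(2)] is_linear_compose[OF m(2) m(1)]\<close>)
  have a3: "x \<otimes>\<^bsub>B\<^esub> y \<otimes>\<^bsub>B\<^esub> z = x \<otimes>\<^bsub>B\<^esub> (y \<otimes>\<^bsub>B\<^esub> z)" if "x \<in> carrier B" "y \<in> carrier B" "z \<in> carrier B" for x y z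
    by (rule eq[of "\<lambda>z. x \<otimes>\<^bsub>B\<^esub> y \<otimes>\<^bsub>B\<^esub> z" "\<lambda>z. x \<otimes>\<^bsub>B\<^esub> (y \<otimes>\<^bsub>B\<^esub> z)", OF _ _ _ that(3)])
      (use that GB a2 in \<open>auto intro!: m(1,3) is_linear_compose[OF m(1) m(1)]\<close>)
  have o1: "\<one>\<^bsub>B\<^esub> \<otimes>\<^bsub>B\<^esub> x = x" if "x \<in> carrier B" for x
    by (rule eq[of "\<lambda>x. \<one>\<^bsub>B\<^esub> \<otimes>\<^bsub>B\<^esub> x" "\<lambda>x. x", OF _ _ _ that]) (use l_one in \<open>auto intro!: m(1) one is_linear_id\<close>)
  have o2: "x \<otimes>\<^bsub>B\<^esub> \<one>\<^bsub>B\<^esub> = x" if "x \<in> carrier B" for x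
    by (rule eq[of "\<lambda>x. x \<otimes>\<^bsub>B\<^esub> \<one>\<^bsub>B\<^esub>" "\<lambda>x. x", OF _ _ _ that]) (use r_one in \<open>auto intro!: m(2) one is_linear_id\<close>)
  have "ring B"
    by (rule ringI) (auto intro!: monoidI B.abelian_group_axioms simp: m(3) m(4) m(5) one a3 o1 o2)
  then show ?thesis
    by (intro kalgebra.intro kalgebra_axioms.intro K.cring_axioms B.left_module_axioms) (auto simp: m(6,7))
qed

lemma opposite_algebra_simps:
  "carrier (opposite_algebra B) = carrier B" "add (opposite_algebra B) = add B"
  "zero (opposite_algebra B) = zero B" "one (opposite_algebra B) = one B"
  "smult (opposite_algebra B) = smult B" "x \<otimes>\<^bsub>opposite_algebra B\<^esub> y = y \<otimes>\<^bsub>B\<^esub> x"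
  by (simp_all add: opposite_algebra_def)

lemma (in kalgebra) opposite_kalgebra: "kalgebra K (opposite_algebra B)"
proof (rule kalgebraI[where G = "carrier B"])
  show "is_bilinear K (opposite_algebra B) (opposite_algebra B) (opposite_algebra B) (mult (opposite_algebra B))"
    using mult_bilinear by (simp add: is_bilinear_def is_linear_def opposite_algebra_simps)
  show "left_module K (opposite_algebra B)"
    by (rule left_module_cong[OF B.left_module_axioms]) (simp_all add: opposite_algebra_simps)
qed (simp_all add: opposite_algebra_simps K.cring_axioms B.m_assoc)

section \<open>Tensor products of algebras\<close>

lemma algebra_tensor_simps:
  "carrier (algebra_tensor K A B) = carrier (tensor K A B)" "add (algebra_tensor K A B) = add (tensor K A B)"
  "zero (algebra_tensor K A B) = zero (tensor K A B)" "smult (algebra_tensor K A B) = smult (tensor K A B)"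
  "one (algebra_tensor K A B) = pure_tensor K A B \<one>\<^bsub>A\<^esub> \<one>\<^bsub>B\<^esub>"
  "mult (algebra_tensor K A B) = (\<lambda>C D. lift K (tensor K A B) (\<lambda>x. lift K (tensor K A B)
        (\<lambda>y. pure_tensor K A B (fst x \<otimes>\<^bsub>A\<^esub> fst y) (snd x \<otimes>\<^bsub>B\<^esub> snd y)) D) C)"
  by (simp_all add: algebra_tensor_def case_prod_beta')

lemma is_linear_record_cong:
  assumes "carrier M' = carrier M" "add M' = add M" "smult M' = smult M"
    "carrier N' = carrier N" "add N' = add N" "smult N' = smult N"
  shows "is_linear K M' N' f \<longleftrightarrow> is_linear K M N f"
  using assms by (simp add: is_linear_def)

text \<open>The product of pure tensors is bilinear in each of the two pairs, hence lifts in both arguments;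
  pure tensors determine linear maps, and on them the algebra axioms are those of the factors.\<close>

lemma algebra_tensor_kalgebra:
  assumes "kalgebra K A" "kalgebra K B"
  shows "kalgebra K (algebra_tensor K A B)"
    and "a \<in> carrier A \<Longrightarrow> b \<in> carrier B \<Longrightarrow> a' \<in> carrier A \<Longrightarrow> b' \<in> carrier B \<Longrightarrow>
      pure_tensor K A B a b \<otimes>\<^bsub>algebra_tensor K A B\<^esub> pure_tensor K A B a' b' = pure_tensor K A B (a \<otimes>\<^bsub>A\<^esub> a') (b \<otimes>\<^bsub>B\<^esub> b')"
proof -
  interpret A: kalgebra K A by fact
  interpret B: kalgebra K B by fact
  note lA = A.B.left_module_axioms and lB = B.B.left_module_axioms
  let ?T = "tensor K A B" and ?S = "algebra_tensor K A B" and ?p = "pure_tensor K A B"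
  interpret T: tensor_presentation K A B "bilinear_relations K A B" by (rule tensor_presentation[OF lA lB])
  have lT: "left_module K ?T" by (rule left_module_tensor[OF lA lB])
  note p = is_bilinearD[OF pure_tensor_bilinear[OF lA lB]]
  have 1: "is_bilinear K A B ?T (\<lambda>a' b'. ?p (a \<otimes>\<^bsub>A\<^esub> a') (b \<otimes>\<^bsub>B\<^esub> b'))" if "a \<in> carrier A" "b \<in> carrier B" for a b
    unfolding is_bilinear_def using that
    by (auto intro!: is_linear_compose[OF is_bilinearD(1)[OF B.mult_bilinear] p(1)]
        is_linear_compose[OF is_bilinearD(1)[OF A.mult_bilinear] p(2)])
  have 2: "is_bilinear K A B ?T (\<lambda>a b. ?p (a \<otimes>\<^bsub>A\<^esub> a') (b \<otimes>\<^bsub>B\<^esub> b'))" if "a' \<in> carrier A" "b' \<in> carrier B" for a' b'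
    unfolding is_bilinear_def using that
    by (auto intro!: is_linear_compose[OF is_bilinearD(2)[OF B.mult_bilinear] p(1)]
        is_linear_compose[OF is_bilinearD(2)[OF A.mult_bilinear] p(2)])
  let ?F = "\<lambda>x y. ?p (fst x \<otimes>\<^bsub>A\<^esub> fst y) (snd x \<otimes>\<^bsub>B\<^esub> snd y)"
  have F1: "respects_relations K (carrier A \<times> carrier B) (bilinear_relations K A B) ?T (?F x)"
    if "x \<in> carrier A \<times> carrier B" for x
    by (rule respects_bilinear_relations[OF lA lB lT]) (use that 1 in auto)
  have F2: "respects_relations K (carrier A \<times> carrier B) (bilinear_relations K A B) ?T (\<lambda>x. ?F x y)"
    if "y \<in> carrier A \<times> carrier B" for y
    by (rule respects_bilinear_relations[OF lA lB lT]) (use that 2 in auto)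
  note l2 = A.K.cring_axioms lT T.presentation_axioms T.presentation_axioms F1 F2
  have bil: "is_bilinear K ?T ?T ?T (mult ?S)"
    using lift2_bilinear[OF l2] unfolding algebra_tensor_simps(6) unfolding tensor_def .
  show mult: "?p a b \<otimes>\<^bsub>?S\<^esub> ?p a' b' = ?p (a \<otimes>\<^bsub>A\<^esub> a') (b \<otimes>\<^bsub>B\<^esub> b')"
    if "a \<in> carrier A" "b \<in> carrier B" "a' \<in> carrier A" "b' \<in> carrier B" for a b a' b'
    using lift2_gen[OF l2, of "(a, b)" "(a', b')"] that
    unfolding algebra_tensor_simps(6) by (simp add: pure_tensor_def)
  have bil': "is_bilinear K ?S ?S ?S (mult ?S)"
    using bil by (simp add: is_bilinear_def is_linear_def algebra_tensor_simps)
  show "kalgebra K ?S"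
  proof (rule kalgebraI[OF A.K.cring_axioms _ bil', where G = "{?p a b | a b. a \<in> carrier A \<and> b \<in> carrier B}"])
    show "left_module K ?S"
      by (rule left_module_cong[OF lT]) (simp_all add: algebra_tensor_simps)
    show "{?p a b | a b. a \<in> carrier A \<and> b \<in> carrier B} \<subseteq> carrier ?S"
      using p(3) by (auto simp: algebra_tensor_simps)
    show "\<one>\<^bsub>?S\<^esub> \<in> carrier ?S" by (simp add: algebra_tensor_simps p(3))
    show "f x = g x" if f: "is_linear K ?S ?S f" and g: "is_linear K ?S ?S g" 
      and fg: "\<And>x. x \<in> {?p a b | a b. a \<in> carrier A \<and> b \<in> carrier B} \<Longrightarrow> f x = g x" and x: "x \<in> carrier ?S" for f g x
    proof -
      have c: "is_linear K ?S ?S h \<longleftrightarrow> is_linear K ?T ?T h" for h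
        by (rule is_linear_record_cong) (simp_all add: algebra_tensor_simps)
      show ?thesis
        by (rule tensor_linear_eqI[OF lA lB lT f[unfolded c] g[unfolded c] fg])
          (use x in \<open>auto simp: algebra_tensor_simps\<close>)
    qed
  next
    fix x y z assume "x \<in> {?p a b | a b. a \<in> carrier A \<and> b \<in> carrier B}"
      "y \<in> {?p a b | a b. a \<in> carrier A \<and> b \<in> carrier B}" "z \<in> {?p a b | a b. a \<in> carrier A \<and> b \<in> carrier B}"
    then show "x \<otimes>\<^bsub>?S\<^esub> y \<otimes>\<^bsub>?S\<^esub> z = x \<otimes>\<^bsub>?S\<^esub> (y \<otimes>\<^bsub>?S\<^esub> z)"
      by (auto simp: mult A.B.m_assoc B.B.m_assoc)
  next
    fix x assume "x \<in> {?p a b | a b. a \<in> carrier A \<and> b \<in> carrier B}"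
    then show "\<one>\<^bsub>?S\<^esub> \<otimes>\<^bsub>?S\<^esub> x = x" "x \<otimes>\<^bsub>?S\<^esub> \<one>\<^bsub>?S\<^esub> = x"
      by (auto simp: mult algebra_tensor_simps(5))
  qed
qed

section \<open>Enveloping algebras and bimodules\<close>

lemma opp_linear: "is_linear K (opposite_algebra B) U f \<longleftrightarrow> is_linear K B U f"
  by (rule is_linear_record_cong) (simp_all add: opposite_algebra_simps)

lemma opp_bilinear: "is_bilinear K M (opposite_algebra B) U F \<longleftrightarrow> is_bilinear K M B U F"
  by (simp add: is_bilinear_def opp_linear opposite_algebra_simps)

context kalgebra
begin

abbreviation "E \<equiv> enveloping K B"
abbreviation "ep \<equiv> env_pure K B"

lemma E_kalgebra: "kalgebra K E"
  unfolding enveloping_def by (rule algebra_tensor_kalgebra(1)[OF kalgebra_axioms opposite_kalgebra])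

interpretation E: kalgebra K E by (rule E_kalgebra)

lemma left_module_opp: "left_module K (opposite_algebra B)"
  using opposite_kalgebra by (rule kalgebra.axioms)

lemma E_linear_source: "is_linear K E U f \<longleftrightarrow> is_linear K (tensor K B (opposite_algebra B)) U f"
  by (rule is_linear_record_cong) (simp_all add: algebra_tensor_simps enveloping_def)

lemma E_linear_target: "is_linear K U E f \<longleftrightarrow> is_linear K U (tensor K B (opposite_algebra B)) f"
  by (rule is_linear_record_cong) (simp_all add: algebra_tensor_simps enveloping_def)

lemma ep_bilinear: "is_bilinear K B B E ep"
  using pure_tensor_bilinear[OF B.left_module_axioms left_module_opp]
  unfolding env_pure_def[symmetric] opp_bilinear by (simp add: is_bilinear_def E_linear_target)

lemmas ep_simps = is_bilinearD(3-)[OF ep_bilinear]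

lemma ep_mult: "a \<in> carrier B \<Longrightarrow> b \<in> carrier B \<Longrightarrow> a' \<in> carrier B \<Longrightarrow> b' \<in> carrier B \<Longrightarrow>
    ep a b \<otimes>\<^bsub>E\<^esub> ep a' b' = ep (a \<otimes>\<^bsub>B\<^esub> a') (b' \<otimes>\<^bsub>B\<^esub> b)"
  using algebra_tensor_kalgebra(2)[OF kalgebra_axioms opposite_kalgebra, of a b a' b']
  by (simp add: enveloping_def env_pure_def opposite_algebra_simps)

lemma ep_one: "\<one>\<^bsub>E\<^esub> = ep \<one>\<^bsub>B\<^esub> \<one>\<^bsub>B\<^esub>"
  by (simp add: enveloping_def env_pure_def opposite_algebra_simps algebra_tensor_simps)

lemma E_linear_eqI:
  assumes "left_module K U" "is_linear K E U f" "is_linear K E U g"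
    "\<And>x y. x \<in> carrier B \<Longrightarrow> y \<in> carrier B \<Longrightarrow> f (ep x y) = g (ep x y)" "C \<in> carrier E"
  shows "f C = g C"
  by (rule tensor_linear_eqI[OF B.left_module_axioms left_module_opp assms(1-3)[unfolded E_linear_source]])
    (use assms(4,5) in \<open>auto simp: env_pure_def opposite_algebra_simps algebra_tensor_simps enveloping_def\<close>)

lemma E_lift_linear: 
  assumes "left_module K U" "is_bilinear K B B U (\<lambda>x y. F (x, y))"
  shows "is_linear K E U (lift K U F)"
  unfolding E_linear_source
  by (rule tensor_lift_linear[OF B.left_module_axioms left_module_opp assms(1)]) (simp add: opp_bilinear assms(2))

lemma E_lift_pure: 
  assumes "left_module K U" "is_bilinear K B B U (\<lambda>x y. F (x, y))" "x \<in> carrier B" "y \<in> carrier B"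
  shows "lift K U F (ep x y) = F (x, y)"
  unfolding env_pure_def
  by (rule tensor_lift_pure[OF B.left_module_axioms left_module_opp assms(1)])
    (simp_all add: opp_bilinear opposite_algebra_simps assms(2-))

lemma regular_bimodule_simps:
  "carrier (regular_bimodule K B) = carrier B" "add (regular_bimodule K B) = add B"
  "zero (regular_bimodule K B) = zero B"
  "C \<odot>\<^bsub>regular_bimodule K B\<^esub> x = lift K B (\<lambda>(a, b). a \<otimes>\<^bsub>B\<^esub> x \<otimes>\<^bsub>B\<^esub> b) C"
  by (simp_all add: regular_bimodule_def)

lemma bimodule_action_linear: "x \<in> carrier B \<Longrightarrow> is_linear K E B (\<lambda>C. C \<odot>\<^bsub>regular_bimodule K B\<^esub> x)"
  and bimodule_action_pure: "x \<in> carrier B \<Longrightarrow> a \<in> carrier B \<Longrightarrow> b \<in> carrier B \<Longrightarrow>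
      ep a b \<odot>\<^bsub>regular_bimodule K B\<^esub> x = a \<otimes>\<^bsub>B\<^esub> x \<otimes>\<^bsub>B\<^esub> b"
proof -
  assume x: "x \<in> carrier B"
  have bil: "is_bilinear K B B B (\<lambda>a b. case (a, b) of (a, b) \<Rightarrow> a \<otimes>\<^bsub>B\<^esub> x \<otimes>\<^bsub>B\<^esub> b)"
    using x unfolding is_bilinear_def
    by (auto intro!: is_linearI simp: B.l_distr B.r_distr smult_mult_left smult_mult_right)
  show "is_linear K E B (\<lambda>C. C \<odot>\<^bsub>regular_bimodule K B\<^esub> x)"
    unfolding regular_bimodule_simps by (rule E_lift_linear[OF B.left_module_axioms bil])
  show "ep a b \<odot>\<^bsub>regular_bimodule K B\<^esub> x = a \<otimes>\<^bsub>B\<^esub> x \<otimes>\<^bsub>B\<^esub> b" if "a \<in> carrier B" "b \<in> carrier B"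
    unfolding regular_bimodule_simps
    using E_lift_pure[OF B.left_module_axioms bil that] by simp
qed

lemma bimodule_action_linear_right:
  assumes "C \<in> carrier E" shows "is_linear K B B (\<lambda>x. C \<odot>\<^bsub>regular_bimodule K B\<^esub> x)"
proof (rule is_linearI)
  note a = is_linearD[OF bimodule_action_linear]
  fix x assume x: "x \<in> carrier B"
  show "C \<odot>\<^bsub>regular_bimodule K B\<^esub> x \<in> carrier B" using a(1)[OF x assms] .
  {
    fix y assume y: "y \<in> carrier B"
    note xy = B.a_closed[OF x y]
    show "C \<odot>\<^bsub>regular_bimodule K B\<^esub> (x \<oplus>\<^bsub>B\<^esub> y) =
      C \<odot>\<^bsub>regular_bimodule K B\<^esub> x \<oplus>\<^bsub>B\<^esub> C \<odot>\<^bsub>regular_bimodule K B\<^esub> y"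
      by (rule E_linear_eqI[OF B.left_module_axioms bimodule_action_linear[OF xy]
            is_linear_add[OF B.left_module_axioms bimodule_action_linear[OF x] bimodule_action_linear[OF y]] _ assms])
        (use x y in \<open>simp add: bimodule_action_pure B.l_distr B.r_distr\<close>)
  }
  fix r assume r: "r \<in> carrier K"
  note rx = B.smult_closed[OF r x]
  show "C \<odot>\<^bsub>regular_bimodule K B\<^esub> (r \<odot>\<^bsub>B\<^esub> x) = r \<odot>\<^bsub>B\<^esub> (C \<odot>\<^bsub>regular_bimodule K B\<^esub> x)"
    by (rule E_linear_eqI[OF B.left_module_axioms bimodule_action_linear[OF rx]
          is_linear_smult[OF K.cring_axioms B.left_module_axioms bimodule_action_linear[OF x] r] _ assms])
      (use x r in \<open>simp add: bimodule_action_pure smult_mult_left smult_mult_right\<close>)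
qed

lemma left_module_regular_bimodule: "left_module E (regular_bimodule K B)"
proof (rule left_moduleI)
  note a = is_linearD[OF bimodule_action_linear]
  show "abelian_group (regular_bimodule K B)"
    by (rule abelian_groupI) (use B.add.l_inv_ex in \<open>auto simp: regular_bimodule_simps(1-3) B.a_ac\<close>)
  fix C x assume C: "C \<in> carrier E" and "x \<in> carrier (regular_bimodule K B)"
  then have x: "x \<in> carrier B" by (simp add: regular_bimodule_simps)
  show "C \<odot>\<^bsub>regular_bimodule K B\<^esub> x \<in> carrier (regular_bimodule K B)"
    using a(1)[OF x C] by (simp add: regular_bimodule_simps(1))
  {
    fix D assume D: "D \<in> carrier E"
    show "(C \<oplus>\<^bsub>E\<^esub> D) \<odot>\<^bsub>regular_bimodule K B\<^esub> x
      = C \<odot>\<^bsub>regular_bimodule K B\<^esub> x \<oplus>\<^bsub>regular_bimodule K B\<^esub> D \<odot>\<^bsub>regular_bimodule K B\<^esub> x"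
      using a(2)[OF x C D] by (simp add: regular_bimodule_simps(2))
    have 1: "(C \<otimes>\<^bsub>E\<^esub> ep a b) \<odot>\<^bsub>regular_bimodule K B\<^esub> x
       = C \<odot>\<^bsub>regular_bimodule K B\<^esub> (ep a b \<odot>\<^bsub>regular_bimodule K B\<^esub> x)"
      if ab: "a \<in> carrier B" "b \<in> carrier B" for a b
    proof -
      have "a \<otimes>\<^bsub>B\<^esub> x \<otimes>\<^bsub>B\<^esub> b \<in> carrier B" using ab x by simp
      from bimodule_action_linear[OF this] have l: 
        "is_linear K E B (\<lambda>C. C \<odot>\<^bsub>regular_bimodule K B\<^esub> (ep a b \<odot>\<^bsub>regular_bimodule K B\<^esub> x))"
        by (simp only: bimodule_action_pure[OF x ab])
      show ?thesis
        by (rule E_linear_eqI[OF B.left_module_axioms is_linear_compose[OF is_bilinearD(2)[OF E.mult_bilinear ep_simps(1)[OF ab]]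
                bimodule_action_linear[OF x]] l _ C])
          (use ab x in \<open>simp add: ep_mult bimodule_action_pure B.m_assoc\<close>)
    qed
    show "C \<otimes>\<^bsub>E\<^esub> D \<odot>\<^bsub>regular_bimodule K B\<^esub> x
        = C \<odot>\<^bsub>regular_bimodule K B\<^esub> (D \<odot>\<^bsub>regular_bimodule K B\<^esub> x)"
      by (rule E_linear_eqI[OF B.left_module_axioms is_linear_compose[OF is_bilinearD(1)[OF E.mult_bilinear C] bimodule_action_linear[OF x]]
          is_linear_compose[OF bimodule_action_linear[OF x] bimodule_action_linear_right[OF C]] 1 D])
  }
  fix y assume "y \<in> carrier (regular_bimodule K B)"
  then show "C \<odot>\<^bsub>regular_bimodule K B\<^esub> (x \<oplus>\<^bsub>regular_bimodule K B\<^esub> y)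
      = C \<odot>\<^bsub>regular_bimodule K B\<^esub> x \<oplus>\<^bsub>regular_bimodule K B\<^esub> C \<odot>\<^bsub>regular_bimodule K B\<^esub> y"
    using is_linearD(2)[OF bimodule_action_linear_right[OF C] x, of y] by (simp add: regular_bimodule_simps(1,2))
next
  fix x assume "x \<in> carrier (regular_bimodule K B)"
  then show "\<one>\<^bsub>E\<^esub> \<odot>\<^bsub>regular_bimodule K B\<^esub> x = x"
    by (simp add: ep_one bimodule_action_pure regular_bimodule_simps(1))
qed (rule E.B.ring_axioms)

end

lemma restrict_scalars_simps:
  "carrier (restrict_scalars B M) = carrier M" "add (restrict_scalars B M) = add M"
  "zero (restrict_scalars B M) = zero M" "c \<odot>\<^bsub>restrict_scalars B M\<^esub> x = (c \<odot>\<^bsub>B\<^esub> \<one>\<^bsub>B\<^esub>) \<odot>\<^bsub>M\<^esub> x"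
  "finsum (restrict_scalars B M) = finsum M"
      apply (simp_all add: restrict_scalars_def)
  by (rule finsum_record_cong) simp_all

lemma (in kalgebra) left_module_restrict_scalars:
  assumes "left_module B M" shows "left_module K (restrict_scalars B M)"
proof -
  interpret M: left_module B M by fact
  show ?thesis
  proof (rule left_moduleI)
    show "abelian_group (restrict_scalars B M)"
      by (rule abelian_groupI; unfold restrict_scalars_simps(1-3))
        (simp_all add: M.M.a_ac M.M.add.l_inv_ex)
  next
    fix a b x assume a: "a \<in> carrier K" "b \<in> carrier K" and "x \<in> carrier (restrict_scalars B M)"
    then have x: "x \<in> carrier M" by (simp add: restrict_scalars_simps(1))
    have "(a \<otimes>\<^bsub>K\<^esub> b) \<odot>\<^bsub>B\<^esub> \<one>\<^bsub>B\<^esub> = (a \<odot>\<^bsub>B\<^esub> \<one>\<^bsub>B\<^esub>) \<otimes>\<^bsub>B\<^esub> (b \<odot>\<^bsub>B\<^esub> \<one>\<^bsub>B\<^esub>)"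
      using a by (simp add: smult_mult_left B.smult_assoc1)
    then show "a \<otimes>\<^bsub>K\<^esub> b \<odot>\<^bsub>restrict_scalars B M\<^esub> x = a \<odot>\<^bsub>restrict_scalars B M\<^esub> (b \<odot>\<^bsub>restrict_scalars B M\<^esub> x)"
      using a x by (simp add: restrict_scalars_simps(4) M.smult_assoc1)
  qed (simp_all add: restrict_scalars_simps(1-4) K.ring_axioms M.smult_l_distr M.smult_r_distr B.smult_l_distr)
qed

lemma (in kalgebra) restrict_scalars_linear:
  "is_linear B M N f \<Longrightarrow> is_linear K (restrict_scalars B M) (restrict_scalars B N) f"
  unfolding is_linear_def by (simp add: restrict_scalars_simps(1,2,4))

lemma (in kalgebra) smult_one_smult:
  assumes "left_module B M" "c \<in> carrier K" "b \<in> carrier B" "x \<in> carrier M"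
  shows "(c \<odot>\<^bsub>B\<^esub> b) \<odot>\<^bsub>M\<^esub> x = c \<odot>\<^bsub>restrict_scalars B M\<^esub> (b \<odot>\<^bsub>M\<^esub> x)"
    and "(c \<odot>\<^bsub>B\<^esub> b) \<odot>\<^bsub>M\<^esub> x = b \<odot>\<^bsub>M\<^esub> (c \<odot>\<^bsub>restrict_scalars B M\<^esub> x)"
proof -
  interpret M: left_module B M by fact
  have "c \<odot>\<^bsub>B\<^esub> b = (c \<odot>\<^bsub>B\<^esub> \<one>\<^bsub>B\<^esub>) \<otimes>\<^bsub>B\<^esub> b" using assms by (simp add: smult_mult_left)
  then show "(c \<odot>\<^bsub>B\<^esub> b) \<odot>\<^bsub>M\<^esub> x = c \<odot>\<^bsub>restrict_scalars B M\<^esub> (b \<odot>\<^bsub>M\<^esub> x)"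
    using assms by (simp add: restrict_scalars_simps M.smult_assoc1)
  have "c \<odot>\<^bsub>B\<^esub> b = b \<otimes>\<^bsub>B\<^esub> (c \<odot>\<^bsub>B\<^esub> \<one>\<^bsub>B\<^esub>)" using assms by (simp add: smult_mult_right)
  then show "(c \<odot>\<^bsub>B\<^esub> b) \<odot>\<^bsub>M\<^esub> x = b \<odot>\<^bsub>M\<^esub> (c \<odot>\<^bsub>restrict_scalars B M\<^esub> x)"
    using assms by (simp add: restrict_scalars_simps M.smult_assoc1)
qed

lemma (in kalgebra) module_action_bilinear:
  assumes "left_module B M"
  shows "is_bilinear K B (restrict_scalars B M) (restrict_scalars B M) (smult M)"
proof -
  interpret M: left_module B M by fact
  show ?thesis unfolding is_bilinear_def
  proof (intro conjI ballI is_linearI)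
    fix b c x assume "b \<in> carrier B" "c \<in> carrier K" "x \<in> carrier (restrict_scalars B M)"
    then show "b \<odot>\<^bsub>M\<^esub> (c \<odot>\<^bsub>restrict_scalars B M\<^esub> x) = c \<odot>\<^bsub>restrict_scalars B M\<^esub> (b \<odot>\<^bsub>M\<^esub> x)"
      using smult_one_smult[OF assms, of c b x] by (simp add: restrict_scalars_simps(1))
  next
    fix b c x assume "b \<in> carrier B" "c \<in> carrier K" "x \<in> carrier (restrict_scalars B M)"
    then show "(c \<odot>\<^bsub>B\<^esub> b) \<odot>\<^bsub>M\<^esub> x = c \<odot>\<^bsub>restrict_scalars B M\<^esub> (b \<odot>\<^bsub>M\<^esub> x)"
      using smult_one_smult[OF assms, of c b x] by (simp add: restrict_scalars_simps(1))
  qed (simp_all add: restrict_scalars_simps(1,2) M.smult_l_distr M.smult_r_distr)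
qed

section \<open>Traces\<close>

context kalgebra
begin

lemma commutators_closed: "{x \<otimes>\<^bsub>B\<^esub> y \<ominus>\<^bsub>B\<^esub> y \<otimes>\<^bsub>B\<^esub> x | x y. x \<in> carrier B \<and> y \<in> carrier B} \<subseteq> carrier B"
  by auto

sublocale tr: module_quotient K B "commutator_span K B"
  unfolding commutator_span_def
  by (intro module_quotient.intro module_quotient_axioms.intro B.left_module_axioms
      submodule_generated_submodule(1) commutators_closed)

abbreviation "TR \<equiv> trace_space K B"
abbreviation "tc \<equiv> trace_class K B"

lemma tc_eq: "tc b = tr.cls b" "TR = tr.Q"
  by (simp_all add: trace_class_def trace_space_def)

lemma left_module_TR: "left_module K TR"
  unfolding tc_eq by (rule tr.left_module_Q)

lemma tc_linear: "is_linear K B TR tc"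
  using tr.cls_linear unfolding tc_eq(1)[abs_def] tc_eq(2) .

lemma carrier_TR: "carrier TR = tc ` carrier B"
  by (simp add: tc_eq tr.carrier_Q)

lemma tc_commute: "x \<in> carrier B \<Longrightarrow> y \<in> carrier B \<Longrightarrow> tc (x \<otimes>\<^bsub>B\<^esub> y) = tc (y \<otimes>\<^bsub>B\<^esub> x)"
proof -
  assume x: "x \<in> carrier B" and y: "y \<in> carrier B"
  have "x \<otimes>\<^bsub>B\<^esub> y \<ominus>\<^bsub>B\<^esub> y \<otimes>\<^bsub>B\<^esub> x \<in> commutator_span K B"
    unfolding commutator_span_def
    by (rule subsetD[OF submodule_generated_submodule(2)[OF B.left_module_axioms commutators_closed]])
      (unfold mem_Collect_eq, intro exI conjI, rule refl, (rule x y)+)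
  then show ?thesis unfolding tc_eq by (intro tr.cls_eqI) (simp_all add: x y)
qed

text \<open>Such a map kills the commutators, hence the submodule that they span.\<close>

lemma
  assumes U: "left_module K U" and f: "is_linear K B U f"
    and sym: "\<And>x y. x \<in> carrier B \<Longrightarrow> y \<in> carrier B \<Longrightarrow> f (x \<otimes>\<^bsub>B\<^esub> y) = f (y \<otimes>\<^bsub>B\<^esub> x)"
  shows trace_descend_linear: "is_linear K TR U (\<lambda>C. f (SOME b. b \<in> C))"
    and trace_descend: "b \<in> carrier B \<Longrightarrow> f (SOME b'. b' \<in> tc b) = f b"
proof -
  interpret f: linear_map K B U f by (intro linear_mapI B.left_module_axioms U f)
  have 0: "f n = \<zero>\<^bsub>U\<^esub>" if n: "n \<in> commutator_span K B" for n
  proof (rule linear_zero_on_generated[OF B.left_module_axioms U f commutators_closed _ n[unfolded commutator_span_def]])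
    fix c assume "c \<in> {x \<otimes>\<^bsub>B\<^esub> y \<ominus>\<^bsub>B\<^esub> y \<otimes>\<^bsub>B\<^esub> x | x y. x \<in> carrier B \<and> y \<in> carrier B}"
    then obtain x y where c: "c = x \<otimes>\<^bsub>B\<^esub> y \<ominus>\<^bsub>B\<^esub> y \<otimes>\<^bsub>B\<^esub> x" "x \<in> carrier B" "y \<in> carrier B"
      unfolding mem_Collect_eq by (elim exE conjE)
    then show "f c = \<zero>\<^bsub>U\<^esub>" unfolding c(1) by (subst f.map_diff_eq_zero) (simp_all add: sym)
  qed
  show "is_linear K TR U (\<lambda>C. f (SOME b. b \<in> C))"
    unfolding tc_eq by (rule tr.descend_linear[OF U f 0])
  show "b \<in> carrier B \<Longrightarrow> f (SOME b'. b' \<in> tc b) = f b"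
    unfolding tc_eq by (rule tr.descend_rep[OF U f 0])
qed

end

section \<open>Noncommutative differential forms\<close>

context kalgebra
begin

interpretation E: kalgebra K E by (rule E_kalgebra)

text \<open>A derivation into a bimodule, with both actions expressed through the enveloping algebra.\<close>

definition bimodule_derivation :: "(('b \<times> 'b \<Rightarrow> 'k) set, 'u, 't) module_scheme \<Rightarrow> ('b \<Rightarrow> 'u) \<Rightarrow> bool"
  where "bimodule_derivation U F \<longleftrightarrow> is_linear K B (restrict_scalars E U) F \<and>
    (\<forall>x \<in> carrier B. \<forall>y \<in> carrier B.
      F (x \<otimes>\<^bsub>B\<^esub> y) = ep \<one>\<^bsub>B\<^esub> y \<odot>\<^bsub>U\<^esub> F x \<oplus>\<^bsub>U\<^esub> ep x \<one>\<^bsub>B\<^esub> \<odot>\<^bsub>U\<^esub> F y)"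

lemma bimodule_derivationD:
  assumes "bimodule_derivation U F"
  shows "is_linear K B (restrict_scalars E U) F" "x \<in> carrier B \<Longrightarrow> F x \<in> carrier U"
    "x \<in> carrier B \<Longrightarrow> y \<in> carrier B \<Longrightarrow> F (x \<oplus>\<^bsub>B\<^esub> y) = F x \<oplus>\<^bsub>U\<^esub> F y"
    "c \<in> carrier K \<Longrightarrow> x \<in> carrier B \<Longrightarrow> F (c \<odot>\<^bsub>B\<^esub> x) = (c \<odot>\<^bsub>E\<^esub> \<one>\<^bsub>E\<^esub>) \<odot>\<^bsub>U\<^esub> F x"
    "x \<in> carrier B \<Longrightarrow> y \<in> carrier B \<Longrightarrow>
      F (x \<otimes>\<^bsub>B\<^esub> y) = ep \<one>\<^bsub>B\<^esub> y \<odot>\<^bsub>U\<^esub> F x \<oplus>\<^bsub>U\<^esub> ep x \<one>\<^bsub>B\<^esub> \<odot>\<^bsub>U\<^esub> F y"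
proof -
  show l: "is_linear K B (restrict_scalars E U) F" using assms by (simp add: bimodule_derivation_def)
  show "x \<in> carrier B \<Longrightarrow> F x \<in> carrier U"
    "x \<in> carrier B \<Longrightarrow> y \<in> carrier B \<Longrightarrow> F (x \<oplus>\<^bsub>B\<^esub> y) = F x \<oplus>\<^bsub>U\<^esub> F y"
    "c \<in> carrier K \<Longrightarrow> x \<in> carrier B \<Longrightarrow> F (c \<odot>\<^bsub>B\<^esub> x) = (c \<odot>\<^bsub>E\<^esub> \<one>\<^bsub>E\<^esub>) \<odot>\<^bsub>U\<^esub> F x"
    using is_linearD[OF l] by (simp_all add: restrict_scalars_simps(1,2,4))
  show "x \<in> carrier B \<Longrightarrow> y \<in> carrier B \<Longrightarrow>
      F (x \<otimes>\<^bsub>B\<^esub> y) = ep \<one>\<^bsub>B\<^esub> y \<odot>\<^bsub>U\<^esub> F x \<oplus>\<^bsub>U\<^esub> ep x \<one>\<^bsub>B\<^esub> \<odot>\<^bsub>U\<^esub> F y"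
    using assms by (simp add: bimodule_derivation_def)
qed

interpretation FB: left_module E "free_module E (carrier B)"
  by (rule left_module_free_module) (rule E.B.ring_axioms)

abbreviation "FB \<equiv> free_module E (carrier B)"

lemma omega_relations_cases:
  assumes "e \<in> omega_relations K B"
  obtains (add) x y where "x \<in> carrier B" "y \<in> carrier B"
      "e = free_gen E (x \<oplus>\<^bsub>B\<^esub> y) \<ominus>\<^bsub>FB\<^esub> (free_gen E x \<oplus>\<^bsub>FB\<^esub> free_gen E y)"
    | (smult) c x where "c \<in> carrier K" "x \<in> carrier B"
      "e = free_gen E (c \<odot>\<^bsub>B\<^esub> x) \<ominus>\<^bsub>FB\<^esub> (c \<odot>\<^bsub>E\<^esub> \<one>\<^bsub>E\<^esub>) \<odot>\<^bsub>FB\<^esub> free_gen E x"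
    | (mult) x y where "x \<in> carrier B" "y \<in> carrier B"
      "e = free_gen E (x \<otimes>\<^bsub>B\<^esub> y) \<ominus>\<^bsub>FB\<^esub>
        (ep \<one>\<^bsub>B\<^esub> y \<odot>\<^bsub>FB\<^esub> free_gen E x \<oplus>\<^bsub>FB\<^esub> ep x \<one>\<^bsub>B\<^esub> \<odot>\<^bsub>FB\<^esub> free_gen E y)"
  using assms unfolding omega_relations_def Let_def Un_iff mem_Collect_eq
  by (elim disjE exE conjE) (rule that; assumption)+

lemma fgB: "x \<in> carrier B \<Longrightarrow> free_gen E x \<in> carrier FB"
  by (rule free_gen_closed[OF E.B.ring_axioms])

lemma omega_relations_closed: "omega_relations K B \<subseteq> carrier FB"
proof
  fix e assume "e \<in> omega_relations K B"
  then show "e \<in> carrier FB"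
    by (cases rule: omega_relations_cases) (simp_all add: fgB ep_simps)
qed

interpretation O: presentation E "carrier B" "omega_relations K B"
  by (intro presentation.intro presentation_axioms.intro E.B.ring_axioms omega_relations_closed)

abbreviation "Om \<equiv> omega K B"
abbreviation "d \<equiv> differential K B"

lemma omega_eq: "Om = O.PM" "d b = O.gen b"
  by (simp_all add: omega_def differential_def)

lemma left_module_omega: "left_module E Om"
  unfolding omega_eq by (rule O.left_module_PM)

interpretation Om: left_module E Om by (rule left_module_omega)

lemma respects_omega_relations:
  assumes U: "left_module E U" and F: "bimodule_derivation U F"
  shows "respects_relations E (carrier B) (omega_relations K B) U F"
proof -
  note D = bimodule_derivationD[OF F]
  have FU: "F \<in> carrier B \<rightarrow> carrier U" by (rule funcsetI) (rule D(2))
  interpret e: linear_map E FB U "free_ext E U F"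
    by (intro linear_mapI FB.left_module_axioms U free_ext_linear FU)
  have g: "free_ext E U F (free_gen E x) = F x" if "x \<in> carrier B" for x
    by (rule free_ext_gen[OF U FU that])
  have kills: "free_ext E U F e = \<zero>\<^bsub>U\<^esub>" if "e \<in> omega_relations K B" for e
    using that
  proof (cases rule: omega_relations_cases)
    case (add x y)
    then show ?thesis by (simp only:) (subst e.relation_add; simp add: fgB g D)
  next
    case (smult c x)
    then show ?thesis by (simp only:) (subst e.relation_smult; simp add: fgB g D)
  next
    case (mult x y)
    then show ?thesis by (simp only:) (subst e.relation_add; simp add: fgB g D ep_simps)
  qed
  show ?thesis unfolding respects_relations_def by (intro conjI ballI FU kills)
qed

lemma d_derivation: "bimodule_derivation Om d"
proof -
  have FU: "O.gen \<in> carrier B \<rightarrow> carrier O.PM" by (rule funcsetI) (rule O.gen_closed)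
  interpret e: linear_map E FB O.PM "free_ext E O.PM O.gen"
    by (intro linear_mapI FB.left_module_axioms O.left_module_PM free_ext_linear FU)
  have g: "free_ext E O.PM O.gen (free_gen E x) = O.gen x" if "x \<in> carrier B" for x
    by (rule free_ext_gen[OF O.left_module_PM FU that])
  have kills: "free_ext E O.PM O.gen e = \<zero>\<^bsub>O.PM\<^esub>" if "e \<in> omega_relations K B" for e
    using O.respects_gen that by (simp add: respects_relations_def)
  have 1: "O.gen (x \<oplus>\<^bsub>B\<^esub> y) = O.gen x \<oplus>\<^bsub>O.PM\<^esub> O.gen y" if x: "x \<in> carrier B" and y: "y \<in> carrier B" for x y
  proof -
    have "free_gen E (x \<oplus>\<^bsub>B\<^esub> y) \<ominus>\<^bsub>FB\<^esub> (free_gen E x \<oplus>\<^bsub>FB\<^esub> free_gen E y) \<in> omega_relations K B"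
      unfolding omega_relations_def Let_def
      by (rule UnI1, rule UnI1) (unfold mem_Collect_eq, intro exI conjI, rule refl, (rule x y)+)
    from kills[OF this] show ?thesis
      using x y by (subst (asm) e.relation_add; simp add: fgB g)
  qed
  have 2: "O.gen (c \<odot>\<^bsub>B\<^esub> x) = (c \<odot>\<^bsub>E\<^esub> \<one>\<^bsub>E\<^esub>) \<odot>\<^bsub>O.PM\<^esub> O.gen x" if c: "c \<in> carrier K" and x: "x \<in> carrier B" for c x
  proof -
    have "free_gen E (c \<odot>\<^bsub>B\<^esub> x) \<ominus>\<^bsub>FB\<^esub> (c \<odot>\<^bsub>E\<^esub> \<one>\<^bsub>E\<^esub>) \<odot>\<^bsub>FB\<^esub> free_gen E x \<in> omega_relations K B"
      unfolding omega_relations_def Let_def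
      by (rule UnI1, rule UnI2) (unfold mem_Collect_eq, intro exI conjI, rule refl, (rule c x)+)
    from kills[OF this] show ?thesis
      using x c by (subst (asm) e.relation_smult; simp add: fgB g)
  qed
  have 3: "O.gen (x \<otimes>\<^bsub>B\<^esub> y) = ep \<one>\<^bsub>B\<^esub> y \<odot>\<^bsub>O.PM\<^esub> O.gen x \<oplus>\<^bsub>O.PM\<^esub> ep x \<one>\<^bsub>B\<^esub> \<odot>\<^bsub>O.PM\<^esub> O.gen y"
    if x: "x \<in> carrier B" and y: "y \<in> carrier B" for x y
  proof -
    have "free_gen E (x \<otimes>\<^bsub>B\<^esub> y) \<ominus>\<^bsub>FB\<^esub>
        (ep \<one>\<^bsub>B\<^esub> y \<odot>\<^bsub>FB\<^esub> free_gen E x \<oplus>\<^bsub>FB\<^esub> ep x \<one>\<^bsub>B\<^esub> \<odot>\<^bsub>FB\<^esub> free_gen E y) \<in> omega_relations K B"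
      unfolding omega_relations_def Let_def
      by (rule UnI2) (unfold mem_Collect_eq, intro exI conjI, rule refl, (rule x y)+)
    from kills[OF this] show ?thesis
      using x y by (subst (asm) e.relation_add; simp add: fgB g ep_simps)
  qed
  have "is_linear K B (restrict_scalars E O.PM) O.gen"
    by (rule is_linearI; unfold restrict_scalars_simps(1,2,4); (rule O.gen_closed 1 2; assumption))
  with 3 show ?thesis
    unfolding bimodule_derivation_def omega_eq(1) omega_eq(2)[abs_def] by simp
qed

lemmas d_simps = bimodule_derivationD(2-)[OF d_derivation]

lemma omega_lift_linear:
  "left_module E U \<Longrightarrow> bimodule_derivation U F \<Longrightarrow> is_linear E Om U (lift E U F)"
  unfolding omega_eq by (rule O.lift_linear) (assumption, rule respects_omega_relations)

lemma omega_lift_d: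
  "left_module E U \<Longrightarrow> bimodule_derivation U F \<Longrightarrow> b \<in> carrier B \<Longrightarrow> lift E U F (d b) = F b"
  unfolding omega_eq by (rule O.lift_gen[OF _ respects_omega_relations])

lemma omega_linear_eqI:
  assumes "left_module E U" "is_linear E Om U f" "is_linear E Om U g"
    "\<And>b. b \<in> carrier B \<Longrightarrow> f (d b) = g (d b)" "\<omega> \<in> carrier Om"
  shows "f \<omega> = g \<omega>"
  by (rule O.linear_eqI[OF assms(1-3)[unfolded omega_eq(1)] assms(4)[unfolded omega_eq(2)]
        assms(5)[unfolded omega_eq(1)]])

text \<open>Together with the lift of a derivation this identifies the derivations into a bimodule with the
  bimodule maps out of the forms.\<close>

lemma derivation_of_linear:
  assumes "is_linear E Om U f" shows "bimodule_derivation U (\<lambda>b. f (d b))"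
proof -
  note f = is_linearD[OF assms]
  show ?thesis
    unfolding bimodule_derivation_def
    by (intro conjI is_linearI ballI; simp add: restrict_scalars_simps(1,2,4) d_simps f ep_simps)
qed

text \<open>A form is a sum of terms \<open>a (dc) b\<close>, and the Leibniz rule rewrites these as \<open>a d(c b) - (a c)
  db\<close>. Hence forms \<open>a db\<close> determine maps that are linear over \<open>K\<close> only, such as the Lie
  derivative.\<close>

lemma omega_K_linear_eqI:
  assumes U: "left_module K U" and f: "is_linear K (omega_K K B) U f" and g: "is_linear K (omega_K K B) U g"
    and eq: "\<And>a b. a \<in> carrier B \<Longrightarrow> b \<in> carrier B \<Longrightarrow> f (left_mult K B a (d b)) = g (left_mult K B a (d b))"
    and \<omega>: "\<omega> \<in> carrier Om"
  shows "f \<omega> = g \<omega>"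
proof -
  have lK: "left_module K (omega_K K B)"
    unfolding omega_K_def by (rule E.left_module_restrict_scalars[OF left_module_omega])
  interpret f: linear_map K "omega_K K B" U f by (intro linear_mapI lK U f)
  interpret g: linear_map K "omega_K K B" U g by (intro linear_mapI lK U g)
  note rs = restrict_scalars_simps(1,2)[where B = E and M = Om, folded omega_K_def]
  have fadd: "f (x \<oplus>\<^bsub>Om\<^esub> y) = f x \<oplus>\<^bsub>U\<^esub> f y" "g (x \<oplus>\<^bsub>Om\<^esub> y) = g x \<oplus>\<^bsub>U\<^esub> g y"
    if "x \<in> carrier Om" "y \<in> carrier Om" for x y
    using is_linearD(2)[OF f] is_linearD(2)[OF g] that by (simp_all add: rs)
  have lm: "left_mult K B a \<eta> = ep a \<one>\<^bsub>B\<^esub> \<odot>\<^bsub>Om\<^esub> \<eta>" for a \<eta> by (simp add: left_mult_def)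
  have cl: "ep a b \<odot>\<^bsub>Om\<^esub> d c \<in> carrier Om" if "a \<in> carrier B" "b \<in> carrier B" "c \<in> carrier B" for a b c
    using that by (simp add: ep_simps d_simps)
  have 1: "f (ep a b \<odot>\<^bsub>Om\<^esub> d c) = g (ep a b \<odot>\<^bsub>Om\<^esub> d c)"
    if abc: "a \<in> carrier B" "b \<in> carrier B" "c \<in> carrier B" for a b c
  proof -
    have "ep a \<one>\<^bsub>B\<^esub> \<odot>\<^bsub>Om\<^esub> d (c \<otimes>\<^bsub>B\<^esub> b)
        = ep a b \<odot>\<^bsub>Om\<^esub> d c \<oplus>\<^bsub>Om\<^esub> ep (a \<otimes>\<^bsub>B\<^esub> c) \<one>\<^bsub>B\<^esub> \<odot>\<^bsub>Om\<^esub> d b"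
      using abc by (simp add: d_simps(4) Om.smult_r_distr ep_simps d_simps(1) ep_mult flip: Om.smult_assoc1)
    then have "f (ep a b \<odot>\<^bsub>Om\<^esub> d c) \<oplus>\<^bsub>U\<^esub> f (ep (a \<otimes>\<^bsub>B\<^esub> c) \<one>\<^bsub>B\<^esub> \<odot>\<^bsub>Om\<^esub> d b)
        = g (ep a b \<odot>\<^bsub>Om\<^esub> d c) \<oplus>\<^bsub>U\<^esub> g (ep (a \<otimes>\<^bsub>B\<^esub> c) \<one>\<^bsub>B\<^esub> \<odot>\<^bsub>Om\<^esub> d b)"
      using abc eq[of a "c \<otimes>\<^bsub>B\<^esub> b"] by (simp add: lm fadd[symmetric] cl)
    moreover have "f (ep (a \<otimes>\<^bsub>B\<^esub> c) \<one>\<^bsub>B\<^esub> \<odot>\<^bsub>Om\<^esub> d b) = g (ep (a \<otimes>\<^bsub>B\<^esub> c) \<one>\<^bsub>B\<^esub> \<odot>\<^bsub>Om\<^esub> d b)"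
      using abc eq[of "a \<otimes>\<^bsub>B\<^esub> c" b] by (simp add: lm)
    moreover have "f (ep a b \<odot>\<^bsub>Om\<^esub> d c) \<in> carrier U" "g (ep a b \<odot>\<^bsub>Om\<^esub> d c) \<in> carrier U"
      "g (ep (a \<otimes>\<^bsub>B\<^esub> c) \<one>\<^bsub>B\<^esub> \<odot>\<^bsub>Om\<^esub> d b) \<in> carrier U"
      using abc cl by (simp_all add: rs is_linearD(1)[OF f] is_linearD(1)[OF g])
    ultimately show ?thesis using f.N.add.right_cancel by simp
  qed
  have 2: "f (C \<odot>\<^bsub>Om\<^esub> \<omega>) = g (C \<odot>\<^bsub>Om\<^esub> \<omega>)" if "\<omega> = d c" and c: "c \<in> carrier B" and C: "C \<in> carrier E" for C c \<omega>
  proof -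
    have l: "is_linear K E (omega_K K B) (\<lambda>C. C \<odot>\<^bsub>Om\<^esub> d c)"
      using is_bilinearD(2)[OF E.module_action_bilinear[OF left_module_omega]] c
      by (simp add: omega_K_def restrict_scalars_simps(1) d_simps)
    show ?thesis unfolding that(1)
      by (rule E_linear_eqI[OF U is_linear_compose[OF l f] is_linear_compose[OF l g] _ C]) (rule 1[OF _ _ c])
  qed
  have "\<forall>C \<in> carrier E. f (C \<odot>\<^bsub>Om\<^esub> \<omega>) = g (C \<odot>\<^bsub>Om\<^esub> \<omega>)"
    using \<omega>[unfolded omega_eq(1)]
  proof (induction rule: O.PM_induct)
    case (gen c) then show ?case using 2[OF refl gen] unfolding omega_eq(2) by blast
  next
    case (add x y)
    then show ?case unfolding omega_eq(1)[symmetric] by (simp add: Om.smult_r_distr fadd)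
  next
    case (smult r x)
    then show ?case unfolding omega_eq(1)[symmetric] by (simp flip: Om.smult_assoc1)
  next
    case zero
    show ?case unfolding omega_eq(1)[symmetric] using f.map_zero g.map_zero
      by (simp add: restrict_scalars_simps(3)[where B = E and M = Om, folded omega_K_def])
  qed
  then show ?thesis using \<omega> E.B.one_closed Om.smult_one by metis
qed

section \<open>Derivations\<close>

lemma derivationsD:
  assumes "f \<in> derivations K B"
  shows "is_linear K B B f" "x \<in> carrier B \<Longrightarrow> f x \<in> carrier B"
    "x \<in> carrier B \<Longrightarrow> y \<in> carrier B \<Longrightarrow> f (x \<oplus>\<^bsub>B\<^esub> y) = f x \<oplus>\<^bsub>B\<^esub> f y"
    "c \<in> carrier K \<Longrightarrow> x \<in> carrier B \<Longrightarrow> f (c \<odot>\<^bsub>B\<^esub> x) = c \<odot>\<^bsub>B\<^esub> f x"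
    "x \<in> carrier B \<Longrightarrow> y \<in> carrier B \<Longrightarrow> f (x \<otimes>\<^bsub>B\<^esub> y) = f x \<otimes>\<^bsub>B\<^esub> y \<oplus>\<^bsub>B\<^esub> x \<otimes>\<^bsub>B\<^esub> f y"
proof -
  show l: "is_linear K B B f" using assms by (simp add: derivations_def linear_maps_iff)
  show "x \<in> carrier B \<Longrightarrow> f x \<in> carrier B"
    "x \<in> carrier B \<Longrightarrow> y \<in> carrier B \<Longrightarrow> f (x \<oplus>\<^bsub>B\<^esub> y) = f x \<oplus>\<^bsub>B\<^esub> f y"
    "c \<in> carrier K \<Longrightarrow> x \<in> carrier B \<Longrightarrow> f (c \<odot>\<^bsub>B\<^esub> x) = c \<odot>\<^bsub>B\<^esub> f x"
    using is_linearD[OF l] by simp_all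
  show "x \<in> carrier B \<Longrightarrow> y \<in> carrier B \<Longrightarrow> f (x \<otimes>\<^bsub>B\<^esub> y) = f x \<otimes>\<^bsub>B\<^esub> y \<oplus>\<^bsub>B\<^esub> x \<otimes>\<^bsub>B\<^esub> f y"
    using assms by (simp add: derivations_def)
qed

lemma derivationsI:
  assumes "is_linear K B B f" "f \<in> extensional (carrier B)"
    "\<And>x y. x \<in> carrier B \<Longrightarrow> y \<in> carrier B \<Longrightarrow> f (x \<otimes>\<^bsub>B\<^esub> y) = f x \<otimes>\<^bsub>B\<^esub> y \<oplus>\<^bsub>B\<^esub> x \<otimes>\<^bsub>B\<^esub> f y"
  shows "f \<in> derivations K B"
  using assms by (simp add: derivations_def linear_maps_iff)

lemma derivation_one: "f \<in> derivations K B \<Longrightarrow> f \<one>\<^bsub>B\<^esub> = \<zero>\<^bsub>B\<^esub>"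
proof -
  assume f: "f \<in> derivations K B"
  have "f \<one>\<^bsub>B\<^esub> \<oplus>\<^bsub>B\<^esub> f \<one>\<^bsub>B\<^esub> = f \<one>\<^bsub>B\<^esub>"
    using derivationsD(5)[OF f, of "\<one>\<^bsub>B\<^esub>" "\<one>\<^bsub>B\<^esub>"] derivationsD(2)[OF f] by simp
  then show ?thesis using derivationsD(2)[OF f, of "\<one>\<^bsub>B\<^esub>"] by simp
qed

lemma derivation_scalar: "f \<in> derivations K B \<Longrightarrow> c \<in> carrier K \<Longrightarrow> f (c \<odot>\<^bsub>B\<^esub> \<one>\<^bsub>B\<^esub>) = \<zero>\<^bsub>B\<^esub>"
  by (simp add: derivationsD(4) derivation_one)

lemma d_scalar:
  assumes c: "c \<in> carrier K" shows "d (c \<odot>\<^bsub>B\<^esub> \<one>\<^bsub>B\<^esub>) = \<zero>\<^bsub>Om\<^esub>"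
proof -
  have "d \<one>\<^bsub>B\<^esub> \<oplus>\<^bsub>Om\<^esub> d \<one>\<^bsub>B\<^esub> = d \<one>\<^bsub>B\<^esub>"
    using d_simps(4)[of "\<one>\<^bsub>B\<^esub>" "\<one>\<^bsub>B\<^esub>"] by (simp add: ep_one[symmetric] d_simps(1))
  then have "d \<one>\<^bsub>B\<^esub> = \<zero>\<^bsub>Om\<^esub>" using d_simps(1)[of "\<one>\<^bsub>B\<^esub>"] by simp
  then show ?thesis using c by (simp add: d_simps(3))
qed

lemma derivation_bimodule: "f \<in> derivations K B \<Longrightarrow> bimodule_derivation (regular_bimodule K B) f"
proof -
  assume f: "f \<in> derivations K B"
  have 1: "(c \<odot>\<^bsub>E\<^esub> \<one>\<^bsub>E\<^esub>) \<odot>\<^bsub>regular_bimodule K B\<^esub> x = c \<odot>\<^bsub>B\<^esub> x" if c: "c \<in> carrier K" and x: "x \<in> carrier B" for c x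
    using is_linearD(3)[OF bimodule_action_linear[OF x] c E.B.one_closed]
    by (simp add: ep_one bimodule_action_pure x)
  show ?thesis
    unfolding bimodule_derivation_def
  proof (intro conjI is_linearI ballI; unfold restrict_scalars_simps(1,2,4) regular_bimodule_simps(1,2))
    fix x y assume "x \<in> carrier B" "y \<in> carrier B"
    then show "f (x \<otimes>\<^bsub>B\<^esub> y) = ep \<one>\<^bsub>B\<^esub> y \<odot>\<^bsub>regular_bimodule K B\<^esub> f x \<oplus>\<^bsub>B\<^esub>
        ep x \<one>\<^bsub>B\<^esub> \<odot>\<^bsub>regular_bimodule K B\<^esub> f y"
      by (simp add: derivationsD[OF f] bimodule_action_pure)
  qed (simp_all add: derivationsD[OF f] 1)
qed

lemma contraction_linear: "f \<in> derivations K B \<Longrightarrow> is_linear E Om (regular_bimodule K B) (contraction K B f)"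
  unfolding contraction_def by (rule omega_lift_linear[OF left_module_regular_bimodule derivation_bimodule])

lemma contraction_d: "f \<in> derivations K B \<Longrightarrow> b \<in> carrier B \<Longrightarrow> contraction K B f (d b) = f b"
  unfolding contraction_def by (rule omega_lift_d[OF left_module_regular_bimodule derivation_bimodule])

lemma
  assumes f: "f \<in> derivations K B"
  shows env_derivation_derivation: "env_derivation K B f \<in> derivations K E"
    and env_derivation_pure: "a \<in> carrier B \<Longrightarrow> b \<in> carrier B \<Longrightarrow>
      env_derivation K B f (ep a b) = ep (f a) b \<oplus>\<^bsub>E\<^esub> ep a (f b)"
proof -
  note D = derivationsD[OF f]
  let ?\<phi> = "env_derivation K B f"
  have bil: "is_bilinear K B B E (\<lambda>x y. case (x, y) of (a, b) \<Rightarrow> ep (f a) b \<oplus>\<^bsub>E\<^esub> ep a (f b))"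
    unfolding is_bilinear_def prod.case
    by (intro conjI ballI is_linear_add E.B.left_module_axioms is_bilinearD(1,2)[OF ep_bilinear]
        is_linear_compose[OF D(1) is_bilinearD(1)[OF ep_bilinear]]
        is_linear_compose[OF D(1) is_bilinearD(2)[OF ep_bilinear]] D(2))
  have pure: "?\<phi> (ep a b) = ep (f a) b \<oplus>\<^bsub>E\<^esub> ep a (f b)" if "a \<in> carrier B" "b \<in> carrier B" for a b
    using E_lift_pure[OF E.B.left_module_axioms bil that] ep_simps(1)[OF that]
    by (simp add: env_derivation_def)
  then show "a \<in> carrier B \<Longrightarrow> b \<in> carrier B \<Longrightarrow> ?\<phi> (ep a b) = ep (f a) b \<oplus>\<^bsub>E\<^esub> ep a (f b)" .
  have lin: "is_linear K E E ?\<phi>"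
    unfolding env_derivation_def
    by (rule is_linear_restrict[OF E.B.left_module_axioms E_lift_linear[OF E.B.left_module_axioms bil]])
  note m = is_bilinearD[OF E.mult_bilinear]
  have Dlin1: "is_linear K E E (\<lambda>y. ?\<phi> x \<otimes>\<^bsub>E\<^esub> y \<oplus>\<^bsub>E\<^esub> x \<otimes>\<^bsub>E\<^esub> ?\<phi> y)" if x: "x \<in> carrier E" for x
    by (rule is_linear_add[OF E.B.left_module_axioms m(1)[OF is_linearD(1)[OF lin x]] is_linear_compose[OF lin m(1)[OF x]]])
  have Dlin2: "is_linear K E E (\<lambda>x. ?\<phi> x \<otimes>\<^bsub>E\<^esub> y \<oplus>\<^bsub>E\<^esub> x \<otimes>\<^bsub>E\<^esub> ?\<phi> y)" if y: "y \<in> carrier E" for y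
    by (rule is_linear_add[OF E.B.left_module_axioms is_linear_compose[OF lin m(2)[OF y]] m(2)[OF is_linearD(1)[OF lin y]]])
  have 1: "?\<phi> (ep a b \<otimes>\<^bsub>E\<^esub> ep a' b') = ?\<phi> (ep a b) \<otimes>\<^bsub>E\<^esub> ep a' b' \<oplus>\<^bsub>E\<^esub> ep a b \<otimes>\<^bsub>E\<^esub> ?\<phi> (ep a' b')"
    if "a \<in> carrier B" "b \<in> carrier B" "a' \<in> carrier B" "b' \<in> carrier B" for a b a' b'
    using that
    by (simp add: ep_mult pure D ep_simps E.B.l_distr E.B.r_distr E.B.a_ac)
  have 2: "?\<phi> (x \<otimes>\<^bsub>E\<^esub> ep a b) = ?\<phi> x \<otimes>\<^bsub>E\<^esub> ep a b \<oplus>\<^bsub>E\<^esub> x \<otimes>\<^bsub>E\<^esub> ?\<phi> (ep a b)"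
    if "x \<in> carrier E" "a \<in> carrier B" "b \<in> carrier B" for x a b
    by (rule E_linear_eqI[OF E.B.left_module_axioms is_linear_compose[OF m(2)[OF ep_simps(1)] lin] Dlin2[OF ep_simps(1)] 1 that(1)])
      (rule that | assumption)+
  have 3: "?\<phi> (x \<otimes>\<^bsub>E\<^esub> y) = ?\<phi> x \<otimes>\<^bsub>E\<^esub> y \<oplus>\<^bsub>E\<^esub> x \<otimes>\<^bsub>E\<^esub> ?\<phi> y"
    if x: "x \<in> carrier E" and y: "y \<in> carrier E" for x y
    by (rule E_linear_eqI[OF E.B.left_module_axioms is_linear_compose[OF m(1)[OF x] lin] Dlin1[OF x] 2[OF x] y])
  show "?\<phi> \<in> derivations K E"
    by (rule kalgebra.derivationsI[OF E_kalgebra lin _ 3]) (simp_all only: env_derivation_def restrict_extensional)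
qed

section \<open>Forms with values in a module\<close>

lemma left_mult_eq: "left_mult K B b \<omega> = ep b \<one>\<^bsub>B\<^esub> \<odot>\<^bsub>Om\<^esub> \<omega>" "right_mult K B \<omega> b = ep \<one>\<^bsub>B\<^esub> b \<odot>\<^bsub>Om\<^esub> \<omega>"
  by (simp_all add: left_mult_def right_mult_def)

lemma omega_K_simps: "carrier (omega_K K B) = carrier Om" "add (omega_K K B) = add Om" "zero (omega_K K B) = zero Om"
  by (simp_all add: omega_K_def restrict_scalars_simps)

lemma left_module_omega_K: "left_module K (omega_K K B)"
  unfolding omega_K_def by (rule E.left_module_restrict_scalars[OF left_module_omega])

lemma omega_action_linear:
  "C \<in> carrier E \<Longrightarrow> is_linear K (omega_K K B) (omega_K K B) (\<lambda>\<omega>. C \<odot>\<^bsub>Om\<^esub> \<omega>)"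
  using is_bilinearD(1)[OF E.module_action_bilinear[OF left_module_omega]] by (simp add: omega_K_def)

lemma d_linear: "is_linear K B (omega_K K B) d"
  unfolding omega_K_def by (rule bimodule_derivationD(1)[OF d_derivation])

lemma contraction_K_linear:
  assumes f: "f \<in> derivations K B" shows "is_linear K (omega_K K B) B (contraction K B f)"
proof (rule is_linearI; unfold omega_K_simps)
  note c = is_linearD[OF contraction_linear[OF f], unfolded regular_bimodule_simps(1,2)]
  fix \<omega> assume \<omega>: "\<omega> \<in> carrier Om"
  show "contraction K B f \<omega> \<in> carrier B" by (rule c(1)[OF \<omega>])
  show "contraction K B f (\<omega> \<oplus>\<^bsub>Om\<^esub> \<eta>) = contraction K B f \<omega> \<oplus>\<^bsub>B\<^esub> contraction K B f \<eta>"
    if "\<eta> \<in> carrier Om" for \<eta> by (rule c(2)[OF \<omega> that])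
  fix r assume r: "r \<in> carrier K"
  have "contraction K B f (r \<odot>\<^bsub>omega_K K B\<^esub> \<omega>) = (r \<odot>\<^bsub>E\<^esub> \<one>\<^bsub>E\<^esub>) \<odot>\<^bsub>regular_bimodule K B\<^esub> contraction K B f \<omega>"
    unfolding omega_K_def restrict_scalars_simps(4) using r \<omega> by (intro c(3)) simp_all
  also have "\<dots> = r \<odot>\<^bsub>B\<^esub> contraction K B f \<omega>"
    using is_linearD(3)[OF bimodule_action_linear[OF c(1)[OF \<omega>]] r E.B.one_closed]
    by (simp add: ep_one bimodule_action_pure c(1) \<omega>)
  finally show "contraction K B f (r \<odot>\<^bsub>omega_K K B\<^esub> \<omega>) = r \<odot>\<^bsub>B\<^esub> contraction K B f \<omega>" .
qed

lemma balanced_tensor_forms: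
  assumes "left_module B M" shows "balanced_tensor K (omega_K K B) B M (right_mult K B)"
proof -
  interpret M: left_module B M by fact
  show ?thesis
    by (intro balanced_tensor.intro balanced_tensor_axioms.intro left_module_omega_K
        left_module_restrict_scalars assms) (simp_all add: omega_K_simps left_mult_eq ep_simps)
qed

context
  fixes M :: "('b, 'm, 's) module_scheme"
  assumes M: "left_module B M"
begin

interpretation M: left_module B M by (rule M)
interpretation T: balanced_tensor K "omega_K K B" B M "right_mult K B" by (rule balanced_tensor_forms[OF M])

abbreviation "FT \<equiv> forms_tensor K B M"
abbreviation "fp \<equiv> forms_pure K B M"

lemma FT_eq: "FT = T.T" "fp = T.pure"
  by (simp_all add: forms_tensor_def forms_pure_def)

lemma left_module_FT: "left_module K FT"
  unfolding FT_eq by (rule T.left_module_T)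

lemma fp_bilinear: "is_bilinear K (omega_K K B) (restrict_scalars B M) FT fp"
  unfolding FT_eq by (rule T.pure_bilinear)

lemma fp_balanced: "\<omega> \<in> carrier Om \<Longrightarrow> m \<in> carrier M \<Longrightarrow> b \<in> carrier B \<Longrightarrow>
    fp (right_mult K B \<omega> b) m = fp \<omega> (b \<odot>\<^bsub>M\<^esub> m)"
  unfolding FT_eq by (rule T.pure_balanced) (simp_all add: omega_K_simps)

lemma
  assumes b: "b \<in> carrier B"
  shows forms_left_mult_linear: "is_linear K FT FT (forms_left_mult K B M b)"
    and forms_left_mult_pure: "\<omega> \<in> carrier Om \<Longrightarrow> m \<in> carrier M \<Longrightarrow>
      forms_left_mult K B M b (fp \<omega> m) = fp (left_mult K B b \<omega>) m"
proof -
  have l: "is_linear K (omega_K K B) (omega_K K B) (left_mult K B b)"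
    unfolding left_mult_eq(1)[abs_def] by (rule omega_action_linear) (simp add: ep_simps b)
  have bil: "is_bilinear K (omega_K K B) (restrict_scalars B M) T.T
      (\<lambda>\<omega> m. case (\<omega>, m) of (\<omega>, m) \<Rightarrow> fp (left_mult K B b \<omega>) m)"
    unfolding is_bilinear_def prod.case FT_eq(1)[symmetric]
    by (intro conjI ballI is_linear_compose[OF l is_bilinearD(2)[OF fp_bilinear]]
        is_bilinearD(1)[OF fp_bilinear] is_linearD(1)[OF l])
  have bal: "(case (right_mult K B \<omega> b', m) of (\<omega>, m) \<Rightarrow> fp (left_mult K B b \<omega>) m)
      = (case (\<omega>, b' \<odot>\<^bsub>M\<^esub> m) of (\<omega>, m) \<Rightarrow> fp (left_mult K B b \<omega>) m)"
    if "\<omega> \<in> carrier (omega_K K B)" "m \<in> carrier M" "b' \<in> carrier B" for \<omega> m b'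
  proof -
    have \<omega>: "\<omega> \<in> carrier Om" using that(1) by (simp add: omega_K_simps)
    have "left_mult K B b (right_mult K B \<omega> b') = right_mult K B (left_mult K B b \<omega>) b'"
      using \<omega> that b by (simp add: left_mult_eq ep_simps ep_mult flip: Om.smult_assoc1)
    moreover have "left_mult K B b \<omega> \<in> carrier Om" using \<omega> b by (simp add: left_mult_eq ep_simps)
    ultimately show ?thesis using that by (simp add: fp_balanced)
  qed
  show "is_linear K FT FT (forms_left_mult K B M b)"
    unfolding forms_left_mult_def FT_eq(1) by (rule T.T_lift_linear[OF T.left_module_T bil bal])
  show "forms_left_mult K B M b (fp \<omega> m) = fp (left_mult K B b \<omega>) m" if "\<omega> \<in> carrier Om" "m \<in> carrier M"
    using T.T_lift_pure[OF T.left_module_T bil bal, of \<omega> m] that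
    unfolding forms_left_mult_def FT_eq by (simp add: omega_K_simps)
qed

text \<open>This is \<open>i\<^sub>f \<otimes> id\<close> followed by the action \<open>B \<otimes>\<^sub>B M \<rightarrow> M\<close>.
  It respects the balancing relations because the contraction is a map of right modules.\<close>

lemma
  assumes f: "f \<in> derivations K B"
  shows contraction_tensor_linear: "is_linear K FT (restrict_scalars B M)
      (lift K (restrict_scalars B M) (\<lambda>(\<omega>, m'). contraction K B f \<omega> \<odot>\<^bsub>M\<^esub> m'))"
    and contraction_tensor_pure: "\<omega> \<in> carrier Om \<Longrightarrow> m \<in> carrier M \<Longrightarrow>
      lift K (restrict_scalars B M) (\<lambda>(\<omega>, m'). contraction K B f \<omega> \<odot>\<^bsub>M\<^esub> m') (fp \<omega> m) = contraction K B f \<omega> \<odot>\<^bsub>M\<^esub> m"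
proof -
  note l = contraction_K_linear[OF f]
  note act = module_action_bilinear[OF M]
  have bil: "is_bilinear K (omega_K K B) (restrict_scalars B M) (restrict_scalars B M)
      (\<lambda>\<omega> m. case (\<omega>, m) of (\<omega>, m') \<Rightarrow> contraction K B f \<omega> \<odot>\<^bsub>M\<^esub> m')"
    unfolding is_bilinear_def prod.case
    by (intro conjI ballI is_linear_compose[OF l is_bilinearD(2)[OF act]] is_bilinearD(1)[OF act] is_linearD(1)[OF l])
  have bal: "(case (right_mult K B \<omega> b', m) of (\<omega>, m') \<Rightarrow> contraction K B f \<omega> \<odot>\<^bsub>M\<^esub> m')
      = (case (\<omega>, b' \<odot>\<^bsub>M\<^esub> m) of (\<omega>, m') \<Rightarrow> contraction K B f \<omega> \<odot>\<^bsub>M\<^esub> m')"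
    if "\<omega> \<in> carrier (omega_K K B)" "m \<in> carrier M" "b' \<in> carrier B" for \<omega> m b'
  proof -
    have \<omega>: "\<omega> \<in> carrier Om" using that(1) by (simp add: omega_K_simps)
    have c: "contraction K B f \<omega> \<in> carrier B" using is_linearD(1)[OF l that(1)] .
    have "contraction K B f (right_mult K B \<omega> b') = contraction K B f \<omega> \<otimes>\<^bsub>B\<^esub> b'"
      unfolding left_mult_eq
      using is_linearD(3)[OF contraction_linear[OF f] _ \<omega>, of "ep \<one>\<^bsub>B\<^esub> b'"] that c
      by (simp add: ep_simps bimodule_action_pure)
    then show ?thesis using c that by (simp add: M.smult_assoc1)
  qed
  note lM = left_module_restrict_scalars[OF M]
  show "is_linear K FT (restrict_scalars B M)
      (lift K (restrict_scalars B M) (\<lambda>(\<omega>, m'). contraction K B f \<omega> \<odot>\<^bsub>M\<^esub> m'))"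
    unfolding FT_eq(1) by (rule T.T_lift_linear[OF lM bil bal])
  show "lift K (restrict_scalars B M) (\<lambda>(\<omega>, m'). contraction K B f \<omega> \<odot>\<^bsub>M\<^esub> m') (fp \<omega> m) = contraction K B f \<omega> \<odot>\<^bsub>M\<^esub> m"
    if "\<omega> \<in> carrier Om" "m \<in> carrier M"
    using T.T_lift_pure[OF lM bil bal, of \<omega> m] that unfolding FT_eq by (simp add: omega_K_simps)
qed

end

end

section \<open>Modules with coordinates\<close>

lemma regular_module_simps:
  "carrier (regular_module B) = carrier B" "add (regular_module B) = add B"
  "zero (regular_module B) = zero B" "smult (regular_module B) = mult B"
  by (simp_all add: regular_module_def)

lemma dual_module_simps:
  "carrier (dual_module B M) = linear_maps B M (regular_module B)"
  "zero (dual_module B M) = (\<lambda>x \<in> carrier M. \<zero>\<^bsub>B\<^esub>)"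
  "\<mu> \<oplus>\<^bsub>dual_module B M\<^esub> \<nu> = (\<lambda>x \<in> carrier M. \<mu> x \<oplus>\<^bsub>B\<^esub> \<nu> x)"
  "c \<odot>\<^bsub>dual_module B M\<^esub> \<mu> = (\<lambda>x \<in> carrier M. c \<odot>\<^bsub>B\<^esub> \<mu> x)"
  by (simp_all add: dual_module_def)

text \<open>A dual basis in the sense of finitely generated projective modules: what is required of the
  generators \<open>g\<close> and the functionals \<open>\<xi>\<close> is the expansion of every element, from which the
  connection and the trace are computed.\<close>

locale coordinates = kalgebra K B + M: left_module B M
  for K :: "('k, 'p) ring_scheme" and B :: "('k, 'b, 'q) module_scheme"
    and M :: "('b, 'm, 's) module_scheme" +
  fixes I :: "'i set" and g :: "'i \<Rightarrow> 'm" and \<xi> :: "'i \<Rightarrow> 'm \<Rightarrow> 'b"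
  assumes finite_I: "finite I" and g_closed: "i \<in> I \<Longrightarrow> g i \<in> carrier M"
    and \<xi>_linear: "i \<in> I \<Longrightarrow> is_linear B M (regular_module B) (\<xi> i)"
    and expand: "m \<in> carrier M \<Longrightarrow> (\<Oplus>\<^bsub>M\<^esub>i\<in>I. \<xi> i m \<odot>\<^bsub>M\<^esub> g i) = m"
begin

interpretation E: kalgebra K E by (rule E_kalgebra)
interpretation Om: left_module E Om by (rule left_module_omega)

lemma left_module_regular: "left_module B (regular_module B)"
proof (rule left_moduleI)
  show "abelian_group (regular_module B)"
    by (rule abelian_groupI; unfold regular_module_simps) (simp_all add: B.a_ac B.add.l_inv_ex)
qed (simp_all add: regular_module_simps B.l_distr B.r_distr B.m_assoc B.ring_axioms)

lemma \<xi>_simps: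
  assumes "i \<in> I"
  shows "m \<in> carrier M \<Longrightarrow> \<xi> i m \<in> carrier B"
    "m \<in> carrier M \<Longrightarrow> n \<in> carrier M \<Longrightarrow> \<xi> i (m \<oplus>\<^bsub>M\<^esub> n) = \<xi> i m \<oplus>\<^bsub>B\<^esub> \<xi> i n"
    "b \<in> carrier B \<Longrightarrow> m \<in> carrier M \<Longrightarrow> \<xi> i (b \<odot>\<^bsub>M\<^esub> m) = b \<otimes>\<^bsub>B\<^esub> \<xi> i m"
  using is_linearD[OF \<xi>_linear[OF assms]] by (simp_all add: regular_module_simps)

abbreviation "MK \<equiv> restrict_scalars B M"

lemma lMK: "left_module K MK" by (rule left_module_restrict_scalars[OF M.left_module_axioms])

lemma \<xi>_K_linear: "i \<in> I \<Longrightarrow> is_linear K MK B (\<xi> i)"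
  by (rule is_linearI) (simp_all add: restrict_scalars_simps(1,2,4) \<xi>_simps smult_mult_left)

lemma linear_expand:
  assumes "left_module B N" "is_linear B M N \<phi>" "m \<in> carrier M"
  shows "\<phi> m = (\<Oplus>\<^bsub>N\<^esub>i\<in>I. \<xi> i m \<odot>\<^bsub>N\<^esub> \<phi> (g i))"
proof -
  interpret p: linear_map B M N \<phi> by (intro linear_mapI M.left_module_axioms assms)
  have "\<phi> m = \<phi> (\<Oplus>\<^bsub>M\<^esub>i\<in>I. \<xi> i m \<odot>\<^bsub>M\<^esub> g i)" by (simp add: expand assms(3))
  also have "\<dots> = (\<Oplus>\<^bsub>N\<^esub>i\<in>I. \<phi> (\<xi> i m \<odot>\<^bsub>M\<^esub> g i))"
    by (rule p.map_finsum) (simp add: \<xi>_simps g_closed assms(3))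
  also have "\<dots> = (\<Oplus>\<^bsub>N\<^esub>i\<in>I. \<xi> i m \<odot>\<^bsub>N\<^esub> \<phi> (g i))"
    by (rule p.N.finsum_cong') (simp_all add: \<xi>_simps g_closed assms(3))
  finally show ?thesis .
qed

subsection \<open>The flat connection\<close>

abbreviation "F \<equiv> forms_tensor K B M"
abbreviation "pr \<equiv> forms_pure K B M"

lemma lF: "left_module K F" by (rule left_module_FT[OF M.left_module_axioms])

interpretation F: left_module K F by (rule lF)

lemmas pr_bilinear = fp_bilinear[OF M.left_module_axioms]
lemmas pr_balanced = fp_balanced[OF M.left_module_axioms]
lemmas flm_linear = forms_left_mult_linear[OF M.left_module_axioms]
lemmas flm_pure = forms_left_mult_pure[OF M.left_module_axioms]

lemmas pr_simps = is_bilinearD(3-5)[OF pr_bilinear, unfolded omega_K_simps restrict_scalars_simps(1,2)]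

definition flat_connection :: "'m \<Rightarrow> (('b \<Rightarrow> ('b \<times> 'b \<Rightarrow> 'k) set) set \<times> 'm \<Rightarrow> 'k) set"
  where "flat_connection = (\<lambda>m \<in> carrier M. \<Oplus>\<^bsub>F\<^esub>i\<in>I. pr (d (\<xi> i m)) (g i))"

lemma flat_connection_linear: "is_linear K MK F (\<lambda>m. \<Oplus>\<^bsub>F\<^esub>i\<in>I. pr (d (\<xi> i m)) (g i))"
proof (rule is_linear_finsum[OF lF])
  fix i assume i: "i \<in> I"
  have gi: "g i \<in> carrier MK" by (simp add: restrict_scalars_simps(1) g_closed i)
  show "is_linear K MK F (\<lambda>m. pr (d (\<xi> i m)) (g i))"
    by (rule is_linear_compose[OF is_linear_compose[OF \<xi>_K_linear[OF i] d_linear] is_bilinearD(2)[OF pr_bilinear gi]])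
qed

text \<open>The Leibniz rule for \<open>d\<close> splits \<open>d(b \<xi> i m)\<close> into \<open>(db) \<xi> i m + b d(\<xi> i m)\<close>; in
  the first term the coordinate moves across the tensor sign, and the sum over \<open>i\<close> restores \<open>m\<close>.\<close>

lemma flat_connection_mem: "flat_connection \<in> connections K B M"
  unfolding connections_def mem_Collect_eq
proof (intro conjI ballI)
  have "is_linear K MK F flat_connection"
    unfolding flat_connection_def
    using is_linear_restrict[OF lMK flat_connection_linear] by (simp only: restrict_scalars_simps(1))
  then show "flat_connection \<in> linear_maps K MK F"
    unfolding linear_maps_iff flat_connection_def restrict_scalars_simps(1) by (simp only: restrict_extensional simp_thms)
  fix b m assume b: "b \<in> carrier B" and m: "m \<in> carrier M"
  interpret L: linear_map K F F "forms_left_mult K B M b" by (intro linear_mapI lF flm_linear b)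
  have db: "d b \<in> carrier Om" by (rule d_simps(1)[OF b])
  have 1: "pr (d (\<xi> i (b \<odot>\<^bsub>M\<^esub> m))) (g i) = pr (d b) (\<xi> i m \<odot>\<^bsub>M\<^esub> g i) \<oplus>\<^bsub>F\<^esub> forms_left_mult K B M b (pr (d (\<xi> i m)) (g i))"
    if i: "i \<in> I" for i
  proof -
    have x: "\<xi> i m \<in> carrier B" and dx: "d (\<xi> i m) \<in> carrier Om" using i m by (simp_all add: \<xi>_simps d_simps(1))
    have "d (\<xi> i (b \<odot>\<^bsub>M\<^esub> m)) = right_mult K B (d b) (\<xi> i m) \<oplus>\<^bsub>Om\<^esub> left_mult K B b (d (\<xi> i m))"
      using b m i x by (simp add: \<xi>_simps(3) d_simps(4) left_mult_eq)
    moreover have "right_mult K B (d b) (\<xi> i m) \<in> carrier Om" "left_mult K B b (d (\<xi> i m)) \<in> carrier Om"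
      using db dx x b by (simp_all add: left_mult_eq ep_simps)
    ultimately show ?thesis
      using i db dx x by (simp add: pr_simps(3) g_closed pr_balanced flm_pure[OF b])
  qed
  have c1: "pr (d b) (\<xi> i m \<odot>\<^bsub>M\<^esub> g i) \<in> carrier F" "pr (d (\<xi> i m)) (g i) \<in> carrier F" if "i \<in> I" for i
    using that m db by (simp_all add: pr_simps(1) \<xi>_simps g_closed d_simps(1))
  have "flat_connection (b \<odot>\<^bsub>M\<^esub> m) = (\<Oplus>\<^bsub>F\<^esub>i\<in>I. pr (d (\<xi> i (b \<odot>\<^bsub>M\<^esub> m))) (g i))"
    using b m by (simp add: flat_connection_def)
  also have "\<dots> = (\<Oplus>\<^bsub>F\<^esub>i\<in>I. pr (d b) (\<xi> i m \<odot>\<^bsub>M\<^esub> g i) \<oplus>\<^bsub>F\<^esub> forms_left_mult K B M b (pr (d (\<xi> i m)) (g i)))"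
    by (rule F.finsum_cong') (simp_all add: 1 c1)
  also have "\<dots> = (\<Oplus>\<^bsub>F\<^esub>i\<in>I. pr (d b) (\<xi> i m \<odot>\<^bsub>M\<^esub> g i)) \<oplus>\<^bsub>F\<^esub> (\<Oplus>\<^bsub>F\<^esub>i\<in>I. forms_left_mult K B M b (pr (d (\<xi> i m)) (g i)))"
    by (rule F.finsum_addf) (simp_all add: c1)
  also have "(\<Oplus>\<^bsub>F\<^esub>i\<in>I. forms_left_mult K B M b (pr (d (\<xi> i m)) (g i))) = forms_left_mult K B M b (flat_connection m)"
    using m by (simp add: flat_connection_def) (rule L.map_finsum[symmetric], simp add: c1)
  also have "(\<Oplus>\<^bsub>F\<^esub>i\<in>I. pr (d b) (\<xi> i m \<odot>\<^bsub>M\<^esub> g i)) = pr (d b) m"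
  proof -
    interpret p: linear_map K MK F "pr (d b)"
      by (intro linear_mapI lMK lF is_bilinearD(1)[OF pr_bilinear]) (simp add: omega_K_simps db)
    show ?thesis
      using p.map_finsum[of "\<lambda>i. \<xi> i m \<odot>\<^bsub>M\<^esub> g i" I] m
      by (simp add: restrict_scalars_simps(1,5) \<xi>_simps g_closed expand)
  qed
  finally show "flat_connection (b \<odot>\<^bsub>M\<^esub> m) = pr (d b) m \<oplus>\<^bsub>F\<^esub> forms_left_mult K B M b (flat_connection m)" .
qed

text \<open>Differentials of scalars vanish.\<close>

lemma flat_connection_zero:
  assumes "m \<in> carrier M" "\<And>i. i \<in> I \<Longrightarrow> \<exists>c \<in> carrier K. \<xi> i m = c \<odot>\<^bsub>B\<^esub> \<one>\<^bsub>B\<^esub>"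
  shows "flat_connection m = \<zero>\<^bsub>F\<^esub>"
proof -
  have "pr (d (\<xi> i m)) (g i) = \<zero>\<^bsub>F\<^esub>" if i: "i \<in> I" for i
  proof -
    interpret p: linear_map K "omega_K K B" F "\<lambda>\<omega>. pr \<omega> (g i)"
      by (intro linear_mapI left_module_omega_K lF is_bilinearD(2)[OF pr_bilinear])
        (simp add: restrict_scalars_simps(1) g_closed i)
    obtain c where "c \<in> carrier K" "\<xi> i m = c \<odot>\<^bsub>B\<^esub> \<one>\<^bsub>B\<^esub>" using assms(2)[OF i] by (elim bexE)
    then have "d (\<xi> i m) = \<zero>\<^bsub>omega_K K B\<^esub>" by (simp add: d_scalar omega_K_simps)
    then show ?thesis using p.map_zero by simp
  qed
  then have "(\<Oplus>\<^bsub>F\<^esub>i\<in>I. pr (d (\<xi> i m)) (g i)) = (\<Oplus>\<^bsub>F\<^esub>i\<in>I. \<zero>\<^bsub>F\<^esub>)"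
    by (intro F.finsum_cong') simp_all
  then show ?thesis using assms(1) by (simp add: flat_connection_def)
qed

text \<open>The Leibniz rule determines a connection from its values on generators.\<close>

lemma flat_connection_unique:
  assumes D: "D \<in> connections K B M" and 0: "\<And>i. i \<in> I \<Longrightarrow> D (g i) = \<zero>\<^bsub>F\<^esub>"
  shows "D = flat_connection"
proof (rule extensionalityI[where A = "carrier M"])
  have D1: "is_linear K MK F D" "D \<in> extensional (carrier M)"
    using D by (simp_all add: connections_def linear_maps_iff restrict_scalars_simps(1))
  show "D \<in> extensional (carrier M)" by (rule D1)
  show "flat_connection \<in> extensional (carrier M)" unfolding flat_connection_def by (rule restrict_extensional)
  interpret D: linear_map K MK F D by (intro linear_mapI lMK lF D1)
  fix m assume m: "m \<in> carrier M"
  have 1: "D (\<xi> i m \<odot>\<^bsub>M\<^esub> g i) = pr (d (\<xi> i m)) (g i)" if i: "i \<in> I" for i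
  proof -
    have x: "\<xi> i m \<in> carrier B" using i m by (simp add: \<xi>_simps)
    interpret L: linear_map K F F "forms_left_mult K B M (\<xi> i m)" by (intro linear_mapI lF flm_linear x)
    have "D (\<xi> i m \<odot>\<^bsub>M\<^esub> g i) = pr (d (\<xi> i m)) (g i) \<oplus>\<^bsub>F\<^esub> forms_left_mult K B M (\<xi> i m) (D (g i))"
      using D x g_closed[OF i] by (simp add: connections_def)
    then show ?thesis using x i by (simp add: 0 pr_simps(1) d_simps(1) g_closed)
  qed
  have "D m = D (\<Oplus>\<^bsub>MK\<^esub>i\<in>I. \<xi> i m \<odot>\<^bsub>M\<^esub> g i)" using m by (simp add: restrict_scalars_simps(5) expand)
  also have "\<dots> = (\<Oplus>\<^bsub>F\<^esub>i\<in>I. D (\<xi> i m \<odot>\<^bsub>M\<^esub> g i))"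
    by (rule D.map_finsum) (simp add: restrict_scalars_simps(1) \<xi>_simps g_closed m)
  also have "\<dots> = (\<Oplus>\<^bsub>F\<^esub>i\<in>I. pr (d (\<xi> i m)) (g i))"
    by (rule F.finsum_cong') (simp_all add: 1 pr_simps(1) d_simps(1) g_closed \<xi>_simps m)
  finally show "D m = flat_connection m" using m by (simp add: flat_connection_def)
qed

lemma flat_connection_defect:
  assumes f: "f \<in> derivations K B" and m: "m \<in> carrier M"
  shows "connection_defect K B M flat_connection f r m = (\<Oplus>\<^bsub>M\<^esub>i\<in>I. f (\<xi> i m) \<odot>\<^bsub>M\<^esub> g i) \<ominus>\<^bsub>M\<^esub> r m"
proof -
  let ?c = "lift K MK (\<lambda>(\<omega>, m'). contraction K B f \<omega> \<odot>\<^bsub>M\<^esub> m')"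
  interpret c: linear_map K F MK ?c
    by (intro linear_mapI lF lMK contraction_tensor_linear[OF M.left_module_axioms f])
  have "?c (flat_connection m) = (\<Oplus>\<^bsub>MK\<^esub>i\<in>I. ?c (pr (d (\<xi> i m)) (g i)))"
    using m by (simp add: flat_connection_def)
      (rule c.map_finsum, simp add: pr_simps(1) d_simps(1) g_closed \<xi>_simps m)
  also have "\<dots> = (\<Oplus>\<^bsub>MK\<^esub>i\<in>I. f (\<xi> i m) \<odot>\<^bsub>M\<^esub> g i)"
    by (rule c.N.finsum_cong')
      (simp_all add: restrict_scalars_simps(1) contraction_tensor_pure[OF M.left_module_axioms f]
        contraction_d[OF f] d_simps(1) g_closed \<xi>_simps m derivationsD(2)[OF f])
  finally show ?thesis using m by (simp add: connection_defect_def restrict_scalars_simps(5))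
qed

subsection \<open>The trace\<close>

lemma dual_carrier: "\<mu> \<in> carrier (dual_module B M) \<longleftrightarrow> is_linear B M (regular_module B) \<mu> \<and> \<mu> \<in> extensional (carrier M)"
  by (simp add: dual_module_simps linear_maps_iff)

lemma dualI:
  assumes "\<And>x. x \<in> carrier M \<Longrightarrow> f x \<in> carrier B"
    "\<And>x y. x \<in> carrier M \<Longrightarrow> y \<in> carrier M \<Longrightarrow> f (x \<oplus>\<^bsub>M\<^esub> y) = f x \<oplus>\<^bsub>B\<^esub> f y"
    "\<And>b x. b \<in> carrier B \<Longrightarrow> x \<in> carrier M \<Longrightarrow> f (b \<odot>\<^bsub>M\<^esub> x) = b \<otimes>\<^bsub>B\<^esub> f x"
  shows "(\<lambda>x \<in> carrier M. f x) \<in> carrier (dual_module B M)"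
proof -
  have "is_linear B M (regular_module B) f"
    by (rule is_linearI; unfold regular_module_simps; rule assms)
  from is_linear_restrict[OF M.left_module_axioms this] show ?thesis
    unfolding dual_carrier by (intro conjI restrict_extensional)
qed

lemma dualD:
  assumes "\<mu> \<in> carrier (dual_module B M)"
  shows "x \<in> carrier M \<Longrightarrow> \<mu> x \<in> carrier B"
    "x \<in> carrier M \<Longrightarrow> y \<in> carrier M \<Longrightarrow> \<mu> (x \<oplus>\<^bsub>M\<^esub> y) = \<mu> x \<oplus>\<^bsub>B\<^esub> \<mu> y"
    "b \<in> carrier B \<Longrightarrow> x \<in> carrier M \<Longrightarrow> \<mu> (b \<odot>\<^bsub>M\<^esub> x) = b \<otimes>\<^bsub>B\<^esub> \<mu> x"
    "\<mu> \<in> extensional (carrier M)"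
  using assms is_linearD[of B M "regular_module B" \<mu>] unfolding dual_carrier regular_module_simps by simp_all

lemma dual_eqI:
  assumes "\<mu> \<in> carrier (dual_module B M)" "\<nu> \<in> carrier (dual_module B M)" "\<And>x. x \<in> carrier M \<Longrightarrow> \<mu> x = \<nu> x"
  shows "\<mu> = \<nu>"
  by (rule extensionalityI[OF dualD(4)[OF assms(1)] dualD(4)[OF assms(2)] assms(3)])

lemma left_module_dual: "left_module K (dual_module B M)"
proof -
  let ?D = "dual_module B M"
  have add: "\<mu> \<oplus>\<^bsub>?D\<^esub> \<nu> \<in> carrier ?D" if "\<mu> \<in> carrier ?D" "\<nu> \<in> carrier ?D" for \<mu> \<nu>
    unfolding dual_module_simps(3)
    by (rule dualI) (simp_all add: dualD[OF that(1)] dualD[OF that(2)] B.a_ac B.r_distr)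
  have zero: "\<zero>\<^bsub>?D\<^esub> \<in> carrier ?D"
    unfolding dual_module_simps(2) by (rule dualI) simp_all
  have smult: "c \<odot>\<^bsub>?D\<^esub> \<mu> \<in> carrier ?D" if "c \<in> carrier K" "\<mu> \<in> carrier ?D" for \<mu> c
    unfolding dual_module_simps(4)
    by (rule dualI) (simp_all add: dualD[OF that(2)] that(1) B.smult_r_distr smult_mult_right)
  have neg: "(\<lambda>x \<in> carrier M. \<ominus>\<^bsub>B\<^esub> \<mu> x) \<in> carrier ?D" if "\<mu> \<in> carrier ?D" for \<mu>
    by (rule dualI) (simp_all add: dualD[OF that] B.minus_add B.r_minus)
  show ?thesis
  proof (rule left_moduleI)
    show "abelian_group ?D"
    proof (rule abelian_groupI)
      fix \<mu> assume m: "\<mu> \<in> carrier ?D"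
      have "(\<lambda>x \<in> carrier M. \<ominus>\<^bsub>B\<^esub> \<mu> x) \<oplus>\<^bsub>?D\<^esub> \<mu> = \<zero>\<^bsub>?D\<^esub>"
        by (rule dual_eqI[OF add[OF neg[OF m] m] zero]) (simp add: dual_module_simps(2,3) dualD[OF m] B.l_neg)
      then show "\<exists>\<nu>\<in>carrier ?D. \<nu> \<oplus>\<^bsub>?D\<^esub> \<mu> = \<zero>\<^bsub>?D\<^esub>" using neg[OF m] by (rule bexI)
      show "\<zero>\<^bsub>?D\<^esub> \<oplus>\<^bsub>?D\<^esub> \<mu> = \<mu>"
        by (rule dual_eqI[OF add[OF zero m] m]) (simp add: dual_module_simps(2,3) dualD[OF m])
      fix \<nu> assume n: "\<nu> \<in> carrier ?D"
      show "\<mu> \<oplus>\<^bsub>?D\<^esub> \<nu> = \<nu> \<oplus>\<^bsub>?D\<^esub> \<mu>"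
        by (rule dual_eqI[OF add[OF m n] add[OF n m]]) (simp add: dual_module_simps(2,3) dualD(1)[OF m] dualD(1)[OF n] B.a_comm)
      fix l assume l: "l \<in> carrier ?D"
      show "\<mu> \<oplus>\<^bsub>?D\<^esub> \<nu> \<oplus>\<^bsub>?D\<^esub> l = \<mu> \<oplus>\<^bsub>?D\<^esub> (\<nu> \<oplus>\<^bsub>?D\<^esub> l)"
        by (rule dual_eqI[OF add[OF add[OF m n] l] add[OF m add[OF n l]]])
          (simp add: dual_module_simps(2,3) dualD(1)[OF m] dualD(1)[OF n] dualD(1)[OF l] B.a_assoc)
    qed (simp_all add: add zero)
  next
    fix a b \<mu> assume a: "a \<in> carrier K" and b: "b \<in> carrier K" and m: "\<mu> \<in> carrier ?D"
    show "(a \<oplus>\<^bsub>K\<^esub> b) \<odot>\<^bsub>?D\<^esub> \<mu> = a \<odot>\<^bsub>?D\<^esub> \<mu> \<oplus>\<^bsub>?D\<^esub> b \<odot>\<^bsub>?D\<^esub> \<mu>"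
      by (rule dual_eqI[OF smult[OF K.a_closed[OF a b] m] add[OF smult[OF a m] smult[OF b m]]])
        (simp add: dual_module_simps(3,4) dualD(1)[OF m] a b B.smult_l_distr)
    show "(a \<otimes>\<^bsub>K\<^esub> b) \<odot>\<^bsub>?D\<^esub> \<mu> = a \<odot>\<^bsub>?D\<^esub> (b \<odot>\<^bsub>?D\<^esub> \<mu>)"
      by (rule dual_eqI[OF smult[OF K.m_closed[OF a b] m] smult[OF a smult[OF b m]]])
        (simp add: dual_module_simps(3,4) dualD(1)[OF m] a b B.smult_assoc1)
  next
    fix a \<mu> \<nu> assume a: "a \<in> carrier K" and m: "\<mu> \<in> carrier ?D" and n: "\<nu> \<in> carrier ?D"
    show "a \<odot>\<^bsub>?D\<^esub> (\<mu> \<oplus>\<^bsub>?D\<^esub> \<nu>) = a \<odot>\<^bsub>?D\<^esub> \<mu> \<oplus>\<^bsub>?D\<^esub> a \<odot>\<^bsub>?D\<^esub> \<nu>"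
      by (rule dual_eqI[OF smult[OF a add[OF m n]] add[OF smult[OF a m] smult[OF a n]]])
        (simp add: dual_module_simps(3,4) dualD(1)[OF m] dualD(1)[OF n] a B.smult_r_distr)
  next
    fix \<mu> assume m: "\<mu> \<in> carrier ?D"
    show "\<one>\<^bsub>K\<^esub> \<odot>\<^bsub>?D\<^esub> \<mu> = \<mu>"
      by (rule dual_eqI[OF smult[OF K.one_closed m] m]) (simp add: dual_module_simps(4) dualD(1)[OF m])
  qed (simp_all add: K.ring_axioms smult)
qed

lemma dual_eval_linear: "x \<in> carrier M \<Longrightarrow> is_linear K (dual_module B M) B (\<lambda>\<mu>. \<mu> x)"
  by (rule is_linearI) (simp_all add: dualD(1) dual_module_simps(3,4))

lemma dual_right_mult_closed:
  assumes m: "\<mu> \<in> carrier (dual_module B M)" and b: "b \<in> carrier B"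
  shows "dual_right_mult B M \<mu> b \<in> carrier (dual_module B M)"
  unfolding dual_right_mult_def by (rule dualI) (simp_all add: dualD[OF m] b B.l_distr B.m_assoc)

lemma balanced_tensor_dual: "balanced_tensor K (dual_module B M) B M (dual_right_mult B M)"
  by (intro balanced_tensor.intro balanced_tensor_axioms.intro left_module_dual lMK dual_right_mult_closed) simp_all

interpretation D: left_module K "dual_module B M" by (rule left_module_dual)
interpretation DT: balanced_tensor K "dual_module B M" B M "dual_right_mult B M" by (rule balanced_tensor_dual)

abbreviation "dp \<equiv> pure_over K B (dual_module B M) (dual_right_mult B M) M"

lemma dual_tensor_eq: "dual_tensor K B M = DT.T" by (simp add: dual_tensor_def)

interpretation T: left_module K "dual_tensor K B M"
  unfolding dual_tensor_eq by (rule DT.left_module_T)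

lemma dp_bilinear: "is_bilinear K (dual_module B M) MK (dual_tensor K B M) dp"
  unfolding dual_tensor_eq by (rule DT.pure_bilinear)

abbreviation "ev x \<equiv> lift K MK (\<lambda>(\<mu>, m). \<mu> x \<odot>\<^bsub>M\<^esub> m)"

lemma
  assumes x: "x \<in> carrier M"
  shows ev_linear: "is_linear K (dual_tensor K B M) MK (ev x)"
    and ev_pure: "\<mu> \<in> carrier (dual_module B M) \<Longrightarrow> m \<in> carrier M \<Longrightarrow> ev x (dp \<mu> m) = \<mu> x \<odot>\<^bsub>M\<^esub> m"
proof -
  note act = module_action_bilinear[OF M.left_module_axioms]
  have bil: "is_bilinear K (dual_module B M) MK MK (\<lambda>\<mu> m. case (\<mu>, m) of (\<mu>, m) \<Rightarrow> \<mu> x \<odot>\<^bsub>M\<^esub> m)"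
    unfolding is_bilinear_def prod.case
    by (intro conjI ballI is_linear_compose[OF dual_eval_linear[OF x] is_bilinearD(2)[OF act]]
        is_bilinearD(1)[OF act] is_linearD(1)[OF dual_eval_linear[OF x]])
  have bal: "(case (dual_right_mult B M \<mu> b, m) of (\<mu>, m) \<Rightarrow> \<mu> x \<odot>\<^bsub>M\<^esub> m) =
      (case (\<mu>, b \<odot>\<^bsub>M\<^esub> m) of (\<mu>, m) \<Rightarrow> \<mu> x \<odot>\<^bsub>M\<^esub> m)"
    if "\<mu> \<in> carrier (dual_module B M)" "m \<in> carrier M" "b \<in> carrier B" for \<mu> m b
    using x that by (simp add: dual_right_mult_def M.smult_assoc1 dualD(1))
  show "is_linear K (dual_tensor K B M) MK (ev x)"
    unfolding dual_tensor_eq by (rule DT.T_lift_linear[OF lMK bil bal])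
  show "ev x (dp \<mu> m) = \<mu> x \<odot>\<^bsub>M\<^esub> m" if "\<mu> \<in> carrier (dual_module B M)" "m \<in> carrier M"
    using DT.T_lift_pure[OF lMK bil bal that] by simp
qed

definition "\<xi>' i = (\<lambda>m \<in> carrier M. \<xi> i m)"

lemma \<xi>'_dual: "i \<in> I \<Longrightarrow> \<xi>' i \<in> carrier (dual_module B M)"
  unfolding \<xi>'_def by (rule dualI) (simp_all add: \<xi>_simps)

text \<open>The functional \<open>\<mu>\<close> equals the sum of the \<open>\<xi> i\<close> multiplied on the right by \<open>\<mu> (g
  i)\<close>, and balancing moves the factor \<open>\<mu> (g i)\<close> to the other side, where it forms the value
  at \<open>g i\<close> of the endomorphism belonging to \<open>\<mu> \<otimes> m\<close>. So a tensor is recovered from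
  its endomorphism, and the canonical map to endomorphisms is injective.\<close>

lemma dual_tensor_expand:
  assumes C: "C \<in> carrier (dual_tensor K B M)"
  shows "C = (\<Oplus>\<^bsub>dual_tensor K B M\<^esub>i\<in>I. dp (\<xi>' i) (ev (g i) C))"
proof -
  have lin: "is_linear K (dual_tensor K B M) (dual_tensor K B M) (\<lambda>C. \<Oplus>\<^bsub>dual_tensor K B M\<^esub>i\<in>I. dp (\<xi>' i) (ev (g i) C))"
    by (rule is_linear_finsum[OF T.left_module_axioms])
      (rule is_linear_compose[OF ev_linear[OF g_closed] is_bilinearD(1)[OF dp_bilinear \<xi>'_dual]])
  have pure: "dp \<mu> m = (\<Oplus>\<^bsub>dual_tensor K B M\<^esub>i\<in>I. dp (\<xi>' i) (ev (g i) (dp \<mu> m)))"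
    if \<mu>: "\<mu> \<in> carrier (dual_module B M)" and m: "m \<in> carrier M" for \<mu> m
  proof -
    interpret p: linear_map K "dual_module B M" "dual_tensor K B M" "\<lambda>\<mu>. dp \<mu> m"
      by (intro linear_mapI left_module_dual T.left_module_axioms is_bilinearD(2)[OF dp_bilinear])
        (simp add: restrict_scalars_simps(1) m)
    have rc: "dual_right_mult B M (\<xi>' i) (\<mu> (g i)) \<in> carrier (dual_module B M)" if "i \<in> I" for i
      using that by (intro dual_right_mult_closed \<xi>'_dual dualD(1)[OF \<mu>] g_closed)
    have "\<mu> = (\<Oplus>\<^bsub>dual_module B M\<^esub>i\<in>I. dual_right_mult B M (\<xi>' i) (\<mu> (g i)))"
    proof (rule dual_eqI[OF \<mu>])
      show "(\<Oplus>\<^bsub>dual_module B M\<^esub>i\<in>I. dual_right_mult B M (\<xi>' i) (\<mu> (g i))) \<in> carrier (dual_module B M)"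
        using rc by (intro D.finsum_closed) simp
      fix x assume x: "x \<in> carrier M"
      interpret e: linear_map K "dual_module B M" B "\<lambda>\<mu>. \<mu> x"
        by (intro linear_mapI left_module_dual B.left_module_axioms dual_eval_linear x)
      have "(\<Oplus>\<^bsub>dual_module B M\<^esub>i\<in>I. dual_right_mult B M (\<xi>' i) (\<mu> (g i))) x
          = (\<Oplus>\<^bsub>B\<^esub>i\<in>I. dual_right_mult B M (\<xi>' i) (\<mu> (g i)) x)"
        by (rule e.map_finsum) (simp add: rc)
      also have "\<dots> = (\<Oplus>\<^bsub>B\<^esub>i\<in>I. \<xi> i x \<otimes>\<^bsub>B\<^esub> \<mu> (g i))"
        by (rule B.finsum_cong') (simp_all add: dual_right_mult_def \<xi>'_def x \<xi>_simps dualD(1)[OF \<mu>] g_closed)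
      also have "\<dots> = \<mu> x"
        using linear_expand[OF left_module_regular _ x, of \<mu>] \<mu>
        by (simp add: dual_carrier regular_module_simps finsum_record_cong[of "regular_module B" B])
      finally show "\<mu> x = (\<Oplus>\<^bsub>dual_module B M\<^esub>i\<in>I. dual_right_mult B M (\<xi>' i) (\<mu> (g i))) x" ..
    qed
    then have "dp \<mu> m = dp (\<Oplus>\<^bsub>dual_module B M\<^esub>i\<in>I. dual_right_mult B M (\<xi>' i) (\<mu> (g i))) m"
      by (rule arg_cong)
    also have "\<dots> = (\<Oplus>\<^bsub>dual_tensor K B M\<^esub>i\<in>I. dp (dual_right_mult B M (\<xi>' i) (\<mu> (g i))) m)"
      by (rule p.map_finsum) (simp add: rc)
    also have "\<dots> = (\<Oplus>\<^bsub>dual_tensor K B M\<^esub>i\<in>I. dp (\<xi>' i) (ev (g i) (dp \<mu> m)))"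
    proof (rule T.finsum_cong'[OF refl])
      fix i assume i: "i \<in> I"
      show "dp (dual_right_mult B M (\<xi>' i) (\<mu> (g i))) m = dp (\<xi>' i) (ev (g i) (dp \<mu> m))"
        unfolding ev_pure[OF g_closed[OF i] \<mu> m]
        by (rule DT.pure_balanced[OF \<xi>'_dual[OF i] m dualD(1)[OF \<mu> g_closed[OF i]]])
    next
      show "(\<lambda>i. dp (\<xi>' i) (ev (g i) (dp \<mu> m))) \<in> I \<rightarrow> carrier (dual_tensor K B M)"
      proof
        fix i assume i: "i \<in> I"
        show "dp (\<xi>' i) (ev (g i) (dp \<mu> m)) \<in> carrier (dual_tensor K B M)"
          unfolding ev_pure[OF g_closed[OF i] \<mu> m]
          by (rule is_bilinearD(3)[OF dp_bilinear \<xi>'_dual[OF i]])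
            (simp add: restrict_scalars_simps(1) dualD(1)[OF \<mu>] g_closed[OF i] m)
      qed
    qed
    finally show ?thesis .
  qed
  show ?thesis
    by (rule DT.T_linear_eqI[where f = "\<lambda>C. C", OF DT.left_module_T is_linear_id lin[unfolded dual_tensor_eq]
          pure[unfolded dual_tensor_eq] C[unfolded dual_tensor_eq], folded dual_tensor_eq])
qed

text \<open>The tensor that represents \<open>\<phi>\<close> is the sum of the \<open>\<xi> i \<otimes> \<phi> (g i)\<close>.
  Evaluating a functional is balanced only up to commutators, which is why the trace takes its
  values in the trace space.\<close>

theorem module_trace_coordinates:
  assumes \<phi>: "is_linear B M M \<phi>" "\<phi> \<in> extensional (carrier M)"
  shows "module_trace K B M \<phi> = (\<Oplus>\<^bsub>TR\<^esub>i\<in>I. tc (\<xi> i (\<phi> (g i))))"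
proof -
  let ?T = "dual_tensor K B M"
  interpret TR: left_module K TR by (rule left_module_TR)
  note \<phi>g = is_linearD(1)[OF \<phi>(1) g_closed]
  define C where "C = (\<Oplus>\<^bsub>?T\<^esub>i\<in>I. dp (\<xi>' i) (\<phi> (g i)))"
  have dpc: "dp (\<xi>' i) (\<phi> (g i)) \<in> carrier ?T" if "i \<in> I" for i
    by (rule is_bilinearD(3)[OF dp_bilinear \<xi>'_dual[OF that]]) (simp add: restrict_scalars_simps(1) \<phi>g that)
  have Cc: "C \<in> carrier ?T" unfolding C_def using dpc by (intro T.finsum_closed) simp
  have EndC: "dual_tensor_End K B M C = \<phi>"
  proof (rule extensionalityI[where A = "carrier M"])
    show "dual_tensor_End K B M C \<in> extensional (carrier M)"
      unfolding dual_tensor_End_def by (rule restrict_extensional)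
    show "\<phi> \<in> extensional (carrier M)" by (rule \<phi>)
    fix x assume x: "x \<in> carrier M"
    interpret e: linear_map K ?T MK "ev x" by (intro linear_mapI T.left_module_axioms lMK ev_linear x)
    have "ev x C = (\<Oplus>\<^bsub>MK\<^esub>i\<in>I. ev x (dp (\<xi>' i) (\<phi> (g i))))"
      unfolding C_def by (rule e.map_finsum) (simp add: dpc)
    also have "\<dots> = (\<Oplus>\<^bsub>MK\<^esub>i\<in>I. \<xi> i x \<odot>\<^bsub>M\<^esub> \<phi> (g i))"
      by (rule DT.N'.finsum_cong')
        (simp_all add: restrict_scalars_simps(1) ev_pure[OF x] \<xi>'_dual \<phi>g \<xi>_simps x, simp add: \<xi>'_def x)
    also have "\<dots> = \<phi> x"
      unfolding restrict_scalars_simps(5) by (rule linear_expand[OF M.left_module_axioms \<phi>(1) x, symmetric])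
    finally show "dual_tensor_End K B M C x = \<phi> x" by (simp add: dual_tensor_End_def x)
  qed
  have "(THE C. C \<in> carrier ?T \<and> dual_tensor_End K B M C = \<phi>) = C"
  proof (rule the_equality)
    fix C' assume C': "C' \<in> carrier ?T \<and> dual_tensor_End K B M C' = \<phi>"
    have "ev (g i) C' = \<phi> (g i)" if "i \<in> I" for i
      using C' g_closed[OF that] by (auto simp: dual_tensor_End_def)
    then have "(\<Oplus>\<^bsub>?T\<^esub>i\<in>I. dp (\<xi>' i) (ev (g i) C')) = C"
      unfolding C_def using dpc by (intro T.finsum_cong') simp_all
    then show "C' = C" using dual_tensor_expand[of C'] C' by simp
  qed (intro conjI Cc EndC)
  then have tr: "module_trace K B M \<phi> = lift K TR (\<lambda>(\<mu>, m). tc (\<mu> m)) C"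
    by (simp add: module_trace_def)
  have ml: "is_linear K MK B \<mu>" if m: "\<mu> \<in> carrier (dual_module B M)" for \<mu>
    by (rule is_linearI) (simp_all add: restrict_scalars_simps(1,2,4) dualD[OF m] smult_mult_left)
  have bil: "is_bilinear K (dual_module B M) MK TR (\<lambda>\<mu> m. case (\<mu>, m) of (\<mu>, m) \<Rightarrow> tc (\<mu> m))"
    unfolding is_bilinear_def prod.case restrict_scalars_simps(1)
    by (intro conjI ballI is_linear_compose[OF ml tc_linear] is_linear_compose[OF dual_eval_linear tc_linear])
  have bal: "(case (dual_right_mult B M \<mu> b, m) of (\<mu>, m) \<Rightarrow> tc (\<mu> m)) = (case (\<mu>, b \<odot>\<^bsub>M\<^esub> m) of (\<mu>, m) \<Rightarrow> tc (\<mu> m))"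
    if "\<mu> \<in> carrier (dual_module B M)" "m \<in> carrier M" "b \<in> carrier B" for \<mu> m b
    using that tc_commute[of "\<mu> m" b] by (simp add: dual_right_mult_def dualD[OF that(1)])
  interpret t: linear_map K ?T TR "lift K TR (\<lambda>(\<mu>, m). tc (\<mu> m))"
    unfolding dual_tensor_eq
    by (intro linear_mapI DT.left_module_T left_module_TR DT.T_lift_linear[OF left_module_TR bil bal])
  have "lift K TR (\<lambda>(\<mu>, m). tc (\<mu> m)) C = (\<Oplus>\<^bsub>TR\<^esub>i\<in>I. lift K TR (\<lambda>(\<mu>, m). tc (\<mu> m)) (dp (\<xi>' i) (\<phi> (g i))))"
    unfolding C_def by (rule t.map_finsum) (simp add: dpc)
  also have "\<dots> = (\<Oplus>\<^bsub>TR\<^esub>i\<in>I. tc (\<xi> i (\<phi> (g i))))"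
  proof (rule TR.finsum_cong'[OF refl])
    fix i assume i: "i \<in> I"
    show "lift K TR (\<lambda>(\<mu>, m). tc (\<mu> m)) (dp (\<xi>' i) (\<phi> (g i))) = tc (\<xi> i (\<phi> (g i)))"
      using DT.T_lift_pure[OF left_module_TR bil bal \<xi>'_dual[OF i] \<phi>g[OF i]] \<phi>g[OF i] by (simp add: \<xi>'_def)
  next
    show "(\<lambda>i. tc (\<xi> i (\<phi> (g i)))) \<in> I \<rightarrow> carrier TR"
      by (intro funcsetI is_linearD(1)[OF tc_linear] \<xi>_simps(1) \<phi>g)
  qed
  finally show ?thesis using tr by simp
qed

end

section \<open>The tensor algebra\<close>

context abelian_monoid
begin

lemma finsum_lessThan_add:
  fixes m n :: nat
  assumes "\<And>i. i < m + n \<Longrightarrow> f i \<in> carrier G"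
  shows "(\<Oplus>i\<in>{..<m + n}. f i) = (\<Oplus>i\<in>{..<m}. f i) \<oplus> (\<Oplus>i\<in>{..<n}. f (m + i))"
proof -
  have s: "{..<m + n} = {..<m} \<union> (+) m ` {..<n}"
    using image_add_atLeastLessThan[of m 0 n] ivl_disj_un_two(3)[of 0 m "m + n"]
    by (simp add: lessThan_atLeast0 add.commute)
  have "(\<Oplus>i\<in>{..<m + n}. f i) = (\<Oplus>i\<in>{..<m}. f i) \<oplus> (\<Oplus>i\<in>(+) m ` {..<n}. f i)"
    unfolding s using assms by (intro finsum_Un_disjoint) auto
  also have "(\<Oplus>i\<in>(+) m ` {..<n}. f i) = (\<Oplus>i\<in>{..<n}. f (m + i))"
    using assms by (intro finsum_reindex) auto
  finally show ?thesis .
qed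

end

lemma multilinear_finsum:
  assumes "left_module K U" "\<And>i. i \<in> S \<Longrightarrow> multilinear K V L U (F i)"
  shows "multilinear K V L U (\<lambda>u. \<Oplus>\<^bsub>U\<^esub>i\<in>S. F i u)"
proof -
  interpret U: left_module K U by fact
  have "(\<Oplus>\<^bsub>U\<^esub>i\<in>S. F i u) \<in> carrier U" if "u \<in> L" for u
    by (rule U.finsum_closed) (rule funcsetI, rule multilinearD(1)[OF assms(2) that])
  moreover have "is_linear K V U (\<lambda>v. \<Oplus>\<^bsub>U\<^esub>i\<in>S. F i (xs @ v # ys))" if "xs @ v # ys \<in> L" for xs v ys
    by (rule is_linear_finsum[OF assms(1) multilinearD(2)[OF assms(2) that]])
  ultimately show ?thesis by (simp add: multilinear_def)
qed

text \<open>When the letter at one position varies, each summand sees it either as the distinguished letter or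
  as a letter of the words before or after it, according to the order of the two positions.\<close>

lemma multilinear_sum_splits:
  assumes U: "left_module K U" and V: "left_module K V"
    and letter: "\<And>a b. a \<in> lists (carrier V) \<Longrightarrow> b \<in> lists (carrier V) \<Longrightarrow> is_linear K V U (\<lambda>x. \<Phi> a x b)"
    and before: "\<And>a a' x b. a \<in> lists (carrier V) \<Longrightarrow> a' \<in> lists (carrier V) \<Longrightarrow> x \<in> carrier V \<Longrightarrow>
      b \<in> lists (carrier V) \<Longrightarrow> is_linear K V U (\<lambda>v. \<Phi> (a @ v # a') x b)"
    and after: "\<And>a x b b'. a \<in> lists (carrier V) \<Longrightarrow> x \<in> carrier V \<Longrightarrow> b \<in> lists (carrier V) \<Longrightarrow>
      b' \<in> lists (carrier V) \<Longrightarrow> is_linear K V U (\<lambda>v. \<Phi> a x (b @ v # b'))"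
  shows "multilinear K V (lists (carrier V)) U
    (\<lambda>u. \<Oplus>\<^bsub>U\<^esub>p\<in>{..<length u}. \<Phi> (take p u) (u ! p) (drop (Suc p) u))"
proof -
  interpret U: left_module K U by fact
  have take_drop: "take n u \<in> lists (carrier V)" "drop n u \<in> lists (carrier V)" if "u \<in> lists (carrier V)" for n u
    using that by (auto dest: in_set_takeD in_set_dropD)
  have 1: "(\<Oplus>\<^bsub>U\<^esub>p\<in>{..<length u}. \<Phi> (take p u) (u ! p) (drop (Suc p) u)) \<in> carrier U" if u: "u \<in> lists (carrier V)" for u
  proof (rule U.finsum_closed, rule funcsetI)
    fix p assume "p \<in> {..<length u}"
    then have "u ! p \<in> carrier V" using u by auto
    then show "\<Phi> (take p u) (u ! p) (drop (Suc p) u) \<in> carrier U"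
      by (rule is_linearD(1)[OF letter[OF take_drop[OF u]]])
  qed
  have 2: "is_linear K V U (\<lambda>v. \<Oplus>\<^bsub>U\<^esub>p\<in>{..<length (xs @ v # ys)}. \<Phi> (take p (xs @ v # ys)) ((xs @ v # ys) ! p) (drop (Suc p) (xs @ v # ys)))"
    if "xs @ v # ys \<in> lists (carrier V)" for xs v ys
  proof -
    have xs: "xs \<in> lists (carrier V)" and ys: "ys \<in> lists (carrier V)" using that by auto
    have "is_linear K V U (\<lambda>v. \<Phi> (take p (xs @ v # ys)) ((xs @ v # ys) ! p) (drop (Suc p) (xs @ v # ys)))"
      if p: "p \<in> {..<Suc (length xs + length ys)}" for p
    proof -
      consider "p < length xs" | "p = length xs" | q where "p = length xs + Suc q" "q < length ys"
        using p by (metis add_Suc_right lessThan_iff less_imp_Suc_add linorder_neqE_nat nat_add_left_cancel_less Suc_less_eq)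
      then show ?thesis
      proof cases
        case 1
        then have "xs ! p \<in> carrier V" using xs by auto
        from after[OF take_drop(1)[OF xs] this take_drop(2)[OF xs] ys, of p "Suc p"]
        show ?thesis using 1 by (simp add: nth_append)
      next
        case 2
        then show ?thesis using letter[OF xs ys] by simp
      next
        case (3 q)
        then have "ys ! q \<in> carrier V" using ys by auto
        from before[OF xs take_drop(1)[OF ys] this take_drop(2)[OF ys], of q "Suc q"]
        show ?thesis using 3 by (simp add: nth_append)
      qed
    qed
    then show ?thesis unfolding length_append list.size(4) add_Suc_right
      by (intro is_linear_finsum[OF U]) simp
  qed
  show ?thesis unfolding multilinear_def by (intro conjI allI impI funcsetI 1 2)
qed

locale tensor_algebra = K: cring K + W: left_module K W
  for K :: "('k, 'p) ring_scheme" and W :: "('k, 'w, 'q) module_scheme"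
begin

abbreviation "A \<equiv> tensor_alg K W"
abbreviation "word \<equiv> tensor_word K W"
abbreviation "LW \<equiv> lists (carrier W)"

interpretation P: multilinear_presentation K W LW
  by (intro multilinear_presentation.intro multilinear_presentation_axioms.intro W.left_module_axioms slot_closed_lists)

lemma A_simps: "carrier A = carrier P.PM" "add A = add P.PM" "zero A = zero P.PM" "smult A = smult P.PM"
  "one A = word []" "word u = P.gen u"
  by (simp_all add: tensor_alg_def tensor_alg_module_def tensor_word_def)

lemma A_linear: "is_linear K A U f \<longleftrightarrow> is_linear K P.PM U f" "is_linear K U A f' \<longleftrightarrow> is_linear K U P.PM f'"
  by (rule is_linear_record_cong; simp add: A_simps)+

lemma A_linear_eqI:
  assumes "left_module K U" "is_linear K A U f" "is_linear K A U h"
    "\<And>u. u \<in> LW \<Longrightarrow> f (word u) = h (word u)" "a \<in> carrier A"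
  shows "f a = h a"
  by (rule P.linear_eqI[OF assms(1,2,3)[unfolded A_linear] assms(4)[unfolded A_simps(6)] assms(5)[unfolded A_simps(1)]])

lemma word_closed: "u \<in> LW \<Longrightarrow> word u \<in> carrier A"
  unfolding A_simps by (rule P.gen_closed)

lemma word_slot: "xs \<in> LW \<Longrightarrow> ys \<in> LW \<Longrightarrow> is_linear K W A (\<lambda>v. word (xs @ v # ys))"
  unfolding A_linear A_simps(6) by (rule multilinearD(2)[OF P.gen_multilinear, where v = "\<zero>\<^bsub>W\<^esub>"]) simp

lemma
  assumes "left_module K U" "multilinear K W LW U F"
  shows A_lift_linear: "is_linear K A U (lift K U F)" and A_lift_word: "u \<in> LW \<Longrightarrow> lift K U F (word u) = F u"
  unfolding A_linear A_simps
  by (rule P.lift_linear[OF assms(1) P.respects_multilinear_relations[OF assms]],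
      rule P.lift_gen[OF assms(1) P.respects_multilinear_relations[OF assms]])

lemma
  assumes "left_module K U" "\<And>u. u \<in> LW \<Longrightarrow> multilinear K W LW U (F u)"
    "\<And>w. w \<in> LW \<Longrightarrow> multilinear K W LW U (\<lambda>u. F u w)"
  shows A_lift2_bilinear: "is_bilinear K A A U (\<lambda>C D. lift K U (\<lambda>u. lift K U (F u) D) C)"
    and A_lift2_word: "u \<in> LW \<Longrightarrow> w \<in> LW \<Longrightarrow> lift K U (\<lambda>u. lift K U (F u) (word w)) (word u) = F u w"
proof -
  note r = K.cring_axioms assms(1) P.presentation_axioms P.presentation_axioms
    P.respects_multilinear_relations[OF assms(1) assms(2)] P.respects_multilinear_relations[OF assms(1) assms(3)]
  show "is_bilinear K A A U (\<lambda>C D. lift K U (\<lambda>u. lift K U (F u) D) C)"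
    using lift2_bilinear[OF r] by (simp add: is_bilinear_def A_linear A_simps(1))
  show "u \<in> LW \<Longrightarrow> w \<in> LW \<Longrightarrow> lift K U (\<lambda>u. lift K U (F u) (word w)) (word u) = F u w"
    unfolding A_simps(6) by (rule lift2_gen[OF r])
qed

lemma mult_A: "mult A = (\<lambda>C D. lift K P.PM (\<lambda>u. lift K P.PM (\<lambda>w. word (u @ w)) D) C)"
  by (simp add: tensor_alg_def tensor_alg_module_def)

text \<open>Words are closed under concatenation, which is associative and multilinear in both words.\<close>

lemma
  shows A_kalgebra: "kalgebra K A" and word_mult: "u \<in> LW \<Longrightarrow> w \<in> LW \<Longrightarrow> word u \<otimes>\<^bsub>A\<^esub> word w = word (u @ w)"
proof -
  have s: "is_linear K W P.PM (\<lambda>v. word (xs @ v # ys))" if "xs \<in> LW" "ys \<in> LW" for xs ys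
    using word_slot[OF that] unfolding A_linear .
  have c: "word u \<in> carrier P.PM" if "u \<in> LW" for u using word_closed[OF that] by (simp add: A_simps(1))
  have m1: "multilinear K W LW P.PM (\<lambda>w. word (u @ w))" if "u \<in> LW" for u
    unfolding multilinear_def
  proof (intro conjI allI impI funcsetI)
    show "word (u @ w) \<in> carrier P.PM" if "w \<in> LW" for w using c \<open>u \<in> LW\<close> that by simp
    show "is_linear K W P.PM (\<lambda>v. word (u @ xs @ v # ys))" if "xs @ v # ys \<in> LW" for xs v ys
      using s[of "u @ xs" ys] \<open>u \<in> LW\<close> that by simp
  qed
  have m2: "multilinear K W LW P.PM (\<lambda>u. word (u @ w))" if "w \<in> LW" for w
    unfolding multilinear_def
  proof (intro conjI allI impI funcsetI)
    show "word (u @ w) \<in> carrier P.PM" if "u \<in> LW" for u using c \<open>w \<in> LW\<close> that by simp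
    show "is_linear K W P.PM (\<lambda>v. word ((xs @ v # ys) @ w))" if "xs @ v # ys \<in> LW" for xs v ys
      using s[of xs "ys @ w"] \<open>w \<in> LW\<close> that by simp
  qed
  have bil: "is_bilinear K A A A (mult A)"
    using A_lift2_bilinear[OF P.left_module_PM m1 m2] unfolding mult_A[symmetric]
    by (simp add: is_bilinear_def A_linear(2))
  show wm: "word u \<otimes>\<^bsub>A\<^esub> word w = word (u @ w)" if "u \<in> LW" "w \<in> LW" for u w
    unfolding mult_A by (rule A_lift2_word[OF P.left_module_PM m1 m2]; (assumption | rule that))
  have lA: "left_module K A" by (rule left_module_cong[OF P.left_module_PM]) (simp_all add: A_simps)
  show "kalgebra K A"
  proof (rule kalgebraI[OF K.cring_axioms lA bil, where G = "word ` LW"])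
    show "f x = h x" if f: "is_linear K A A f" and h: "is_linear K A A h"
      and fh: "\<And>x. x \<in> word ` LW \<Longrightarrow> f x = h x" and x: "x \<in> carrier A" for f h x
      by (rule A_linear_eqI[OF lA f h _ x]) (rule fh, rule imageI)
    show "\<one>\<^bsub>A\<^esub> \<in> carrier A" by (simp add: A_simps(5) word_closed)
    show "word ` LW \<subseteq> carrier A" using word_closed by (rule image_subsetI)
  next
    fix x y z assume "x \<in> word ` LW" "y \<in> word ` LW" "z \<in> word ` LW"
    then obtain u v w where "x = word u" "y = word v" "z = word w" "u \<in> LW" "v \<in> LW" "w \<in> LW"
      by (elim imageE)
    then show "x \<otimes>\<^bsub>A\<^esub> y \<otimes>\<^bsub>A\<^esub> z = x \<otimes>\<^bsub>A\<^esub> (y \<otimes>\<^bsub>A\<^esub> z)" by (simp add: wm)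
  next
    fix x assume "x \<in> word ` LW"
    then obtain u where "x = word u" "u \<in> LW" by (elim imageE)
    then show "\<one>\<^bsub>A\<^esub> \<otimes>\<^bsub>A\<^esub> x = x" "x \<otimes>\<^bsub>A\<^esub> \<one>\<^bsub>A\<^esub> = x" by (simp_all add: wm A_simps(5))
  qed
qed

sublocale A: kalgebra K A by (rule A_kalgebra)

abbreviation "EA \<equiv> enveloping K A"
abbreviation "OA \<equiv> omega K A"
abbreviation "e \<equiv> env_pure K A"
abbreviation "dA \<equiv> differential K A"

sublocale E: kalgebra K EA by (rule A.E_kalgebra)
sublocale O: left_module EA OA by (rule A.left_module_omega)

lemma word_one: "\<one>\<^bsub>A\<^esub> = word []" by (rule A_simps(5))

lemma word_Cons: "x \<in> carrier W \<Longrightarrow> u \<in> LW \<Longrightarrow> word (x # u) = word [x] \<otimes>\<^bsub>A\<^esub> word u"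
  using word_mult[of "[x]" u] by simp

text \<open>A derivation is determined by its values on letters, and these are arbitrary because the tensor
  algebra is free: on a word, the letters are differentiated one after the other, with the words
  before and after acting from the two sides. This sum is multilinear in the word, so it defines a
  map on the tensor algebra.\<close>

lemma word_derivation_multilinear:
  assumes U: "left_module EA U" and D: "is_linear K W (restrict_scalars EA U) D"
  shows "multilinear K W LW (restrict_scalars EA U)
    (\<lambda>u. \<Oplus>\<^bsub>restrict_scalars EA U\<^esub>p\<in>{..<length u}. e (word (take p u)) (word (drop (Suc p) u)) \<odot>\<^bsub>U\<^esub> D (u ! p))"
proof -
  note act = E.module_action_bilinear[OF U]
  note Dc = is_linearD(1)[OF D]
  note ep = is_bilinearD[OF A.ep_bilinear]
  show ?thesis
  proof (rule multilinear_sum_splits[OF E.left_module_restrict_scalars[OF U] W.left_module_axioms])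
    fix a b assume "a \<in> LW" "b \<in> LW"
    then have "e (word a) (word b) \<in> carrier EA" by (simp add: ep(3) word_closed)
    from is_linear_compose[OF D is_bilinearD(1)[OF act this]]
    show "is_linear K W (restrict_scalars EA U) (\<lambda>x. e (word a) (word b) \<odot>\<^bsub>U\<^esub> D x)" .
  next
    fix a a' x b assume "a \<in> LW" "a' \<in> LW" "x \<in> carrier W" "b \<in> LW"
    then show "is_linear K W (restrict_scalars EA U) (\<lambda>v. e (word (a @ v # a')) (word b) \<odot>\<^bsub>U\<^esub> D x)"
      by (intro is_linear_compose[OF is_linear_compose[OF word_slot ep(2)] is_bilinearD(2)[OF act]] word_closed Dc)
  next
    fix a x b b' assume "a \<in> LW" "x \<in> carrier W" "b \<in> LW" "b' \<in> LW"
    then show "is_linear K W (restrict_scalars EA U) (\<lambda>v. e (word a) (word (b @ v # b')) \<odot>\<^bsub>U\<^esub> D x)"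
      by (intro is_linear_compose[OF is_linear_compose[OF word_slot ep(1)] is_bilinearD(2)[OF act]] word_closed Dc)
  qed
qed

lemma
  assumes U: "left_module EA U" and D: "is_linear K W (restrict_scalars EA U) D"
  defines "F \<equiv> lift K (restrict_scalars EA U) (\<lambda>u. \<Oplus>\<^bsub>restrict_scalars EA U\<^esub>p\<in>{..<length u}.
      e (word (take p u)) (word (drop (Suc p) u)) \<odot>\<^bsub>U\<^esub> D (u ! p))"
  shows letter_derivation_word: "u \<in> LW \<Longrightarrow> F (word u) =
      (\<Oplus>\<^bsub>U\<^esub>p\<in>{..<length u}. e (word (take p u)) (word (drop (Suc p) u)) \<odot>\<^bsub>U\<^esub> D (u ! p))"
    and letter_derivation_letter: "x \<in> carrier W \<Longrightarrow> F (word [x]) = D x"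
    and letter_derivation_derivation: "A.bimodule_derivation U F"
proof -
  interpret U: left_module EA U by (rule U)
  let ?UK = "restrict_scalars EA U"
  have lU: "left_module K ?UK" by (rule E.left_module_restrict_scalars[OF U])
  note m = word_derivation_multilinear[OF U D]
  note ep = A.ep_simps A.ep_mult
  have lin: "is_linear K A ?UK F" unfolding F_def by (rule A_lift_linear[OF lU m])
  show Fw: "F (word u) = (\<Oplus>\<^bsub>U\<^esub>p\<in>{..<length u}. e (word (take p u)) (word (drop (Suc p) u)) \<odot>\<^bsub>U\<^esub> D (u ! p))"
    if "u \<in> LW" for u
    unfolding F_def using A_lift_word[OF lU m that] by (simp only: restrict_scalars_simps(5))
  have Dc: "D x \<in> carrier U" if "x \<in> carrier W" for x
    using is_linearD(1)[OF D that] by (simp add: restrict_scalars_simps(1))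
  show "F (word [x]) = D x" if x: "x \<in> carrier W" for x
  proof -
    have "{..<length [x]} = {0}" by auto
    then show ?thesis
      using x Dc[OF x] by (simp add: Fw lessThan_Suc word_one[symmetric] A.ep_one[symmetric])
  qed
  have c: "e (word (take p u)) (word (drop (Suc p) u)) \<odot>\<^bsub>U\<^esub> D (u ! p) \<in> carrier U"
    if "u \<in> LW" "p < length u" for u p
  proof -
    have "take p u \<in> LW" "drop (Suc p) u \<in> LW" "u ! p \<in> carrier W"
      using that by (auto dest: in_set_takeD in_set_dropD)
    then show ?thesis by (simp add: ep word_closed Dc)
  qed
  have 1: "F (word u \<otimes>\<^bsub>A\<^esub> word w) = e \<one>\<^bsub>A\<^esub> (word w) \<odot>\<^bsub>U\<^esub> F (word u) \<oplus>\<^bsub>U\<^esub> e (word u) \<one>\<^bsub>A\<^esub> \<odot>\<^bsub>U\<^esub> F (word w)"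
    if u: "u \<in> LW" and w: "w \<in> LW" for u w
  proof -
    let ?t = "\<lambda>u p. e (word (take p u)) (word (drop (Suc p) u)) \<odot>\<^bsub>U\<^esub> D (u ! p)"
    have uw: "u @ w \<in> LW" using u w by simp
    have ew: "e \<one>\<^bsub>A\<^esub> (word w) \<in> carrier EA" and eu: "e (word u) \<one>\<^bsub>A\<^esub> \<in> carrier EA"
      using u w by (simp_all add: ep word_closed)
    have "F (word u \<otimes>\<^bsub>A\<^esub> word w) = (\<Oplus>\<^bsub>U\<^esub>p\<in>{..<length u + length w}. ?t (u @ w) p)"
      unfolding word_mult[OF u w] Fw[OF uw] by simp
    also have "\<dots> = (\<Oplus>\<^bsub>U\<^esub>p\<in>{..<length u}. ?t (u @ w) p) \<oplus>\<^bsub>U\<^esub> (\<Oplus>\<^bsub>U\<^esub>p\<in>{..<length w}. ?t (u @ w) (length u + p))"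
      using c[OF uw] by (intro U.M.finsum_lessThan_add) simp
    also have "(\<Oplus>\<^bsub>U\<^esub>p\<in>{..<length u}. ?t (u @ w) p) = (\<Oplus>\<^bsub>U\<^esub>p\<in>{..<length u}. e \<one>\<^bsub>A\<^esub> (word w) \<odot>\<^bsub>U\<^esub> ?t u p)"
    proof (rule U.M.finsum_cong'[OF refl])
      fix p assume p: "p \<in> {..<length u}"
      then have "take p u \<in> LW" "drop (Suc p) u \<in> LW" "u ! p \<in> carrier W"
        using u by (auto dest: in_set_takeD in_set_dropD)
      then show "?t (u @ w) p = e \<one>\<^bsub>A\<^esub> (word w) \<odot>\<^bsub>U\<^esub> ?t u p"
        using p w by (simp add: nth_append ep word_closed Dc word_mult flip: U.smult_assoc1)
    qed (use c[OF u] ew in auto)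
    also have "\<dots> = e \<one>\<^bsub>A\<^esub> (word w) \<odot>\<^bsub>U\<^esub> F (word u)"
      unfolding Fw[OF u] using c[OF u] ew by (intro U.finsum_smult[symmetric]) auto
    also have "(\<Oplus>\<^bsub>U\<^esub>p\<in>{..<length w}. ?t (u @ w) (length u + p)) = (\<Oplus>\<^bsub>U\<^esub>p\<in>{..<length w}. e (word u) \<one>\<^bsub>A\<^esub> \<odot>\<^bsub>U\<^esub> ?t w p)"
    proof (rule U.M.finsum_cong'[OF refl])
      fix p assume p: "p \<in> {..<length w}"
      then have "take p w \<in> LW" "drop (Suc p) w \<in> LW" "w ! p \<in> carrier W"
        using w by (auto dest: in_set_takeD in_set_dropD)
      then show "?t (u @ w) (length u + p) = e (word u) \<one>\<^bsub>A\<^esub> \<odot>\<^bsub>U\<^esub> ?t w p"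
        using p u by (simp add: nth_append ep word_closed Dc word_mult flip: U.smult_assoc1)
    qed (use c[OF w] eu in auto)
    also have "\<dots> = e (word u) \<one>\<^bsub>A\<^esub> \<odot>\<^bsub>U\<^esub> F (word w)"
      unfolding Fw[OF w] using c[OF w] eu by (intro U.finsum_smult[symmetric]) auto
    finally show ?thesis .
  qed
  note act = E.module_action_bilinear[OF U]
  note mb = is_bilinearD[OF A.mult_bilinear]
  note epb = is_bilinearD[OF A.ep_bilinear]
  have bil1: "is_bilinear K A A ?UK (\<lambda>x y. F (x \<otimes>\<^bsub>A\<^esub> y))"
    by (rule is_bilinear_compose[OF A.mult_bilinear lin])
  have Fc: "F x \<in> carrier ?UK" if "x \<in> carrier A" for x by (rule is_linearD(1)[OF lin that])
  have rsa: "add U = add ?UK" by (simp add: restrict_scalars_simps(2))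
  have bil2: "is_bilinear K A A ?UK (\<lambda>x y. e \<one>\<^bsub>A\<^esub> y \<odot>\<^bsub>U\<^esub> F x \<oplus>\<^bsub>U\<^esub> e x \<one>\<^bsub>A\<^esub> \<odot>\<^bsub>U\<^esub> F y)"
    unfolding is_bilinear_def rsa
  proof (intro conjI ballI is_linear_add[OF lU])
    fix x assume x: "x \<in> carrier A"
    show "is_linear K A ?UK (\<lambda>y. e \<one>\<^bsub>A\<^esub> y \<odot>\<^bsub>U\<^esub> F x)"
      by (rule is_linear_compose[OF epb(1)[OF A.B.one_closed] is_bilinearD(2)[OF act Fc[OF x]]])
    show "is_linear K A ?UK (\<lambda>y. e y \<one>\<^bsub>A\<^esub> \<odot>\<^bsub>U\<^esub> F x)"
      by (rule is_linear_compose[OF epb(2)[OF A.B.one_closed] is_bilinearD(2)[OF act Fc[OF x]]])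
    show "is_linear K A ?UK (\<lambda>y. e x \<one>\<^bsub>A\<^esub> \<odot>\<^bsub>U\<^esub> F y)"
      by (rule is_linear_compose[OF lin is_bilinearD(1)[OF act epb(3)[OF x A.B.one_closed]]])
    show "is_linear K A ?UK (\<lambda>y. e \<one>\<^bsub>A\<^esub> x \<odot>\<^bsub>U\<^esub> F y)"
      by (rule is_linear_compose[OF lin is_bilinearD(1)[OF act epb(3)[OF A.B.one_closed x]]])
  qed
  have 2: "F (x \<otimes>\<^bsub>A\<^esub> y) = e \<one>\<^bsub>A\<^esub> y \<odot>\<^bsub>U\<^esub> F x \<oplus>\<^bsub>U\<^esub> e x \<one>\<^bsub>A\<^esub> \<odot>\<^bsub>U\<^esub> F y"
    if x: "x \<in> carrier A" and y: "y \<in> carrier A" for x y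
  proof -
    have "F (word u \<otimes>\<^bsub>A\<^esub> y) = e \<one>\<^bsub>A\<^esub> y \<odot>\<^bsub>U\<^esub> F (word u) \<oplus>\<^bsub>U\<^esub> e (word u) \<one>\<^bsub>A\<^esub> \<odot>\<^bsub>U\<^esub> F y" if "u \<in> LW" for u
      by (rule A_linear_eqI[OF lU is_bilinearD(1)[OF bil1] is_bilinearD(1)[OF bil2] _ y])
        (simp_all add: word_closed that 1)
    then show ?thesis
      by (intro A_linear_eqI[OF lU is_bilinearD(2)[OF bil1 y] is_bilinearD(2)[OF bil2 y] _ x])
  qed
  show "A.bimodule_derivation U F"
    unfolding A.bimodule_derivation_def using lin 2 by simp
qed

lemma derivation_eqI:
  assumes U: "left_module EA U" and F: "A.bimodule_derivation U F" and H: "A.bimodule_derivation U H"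
    and eq: "\<And>x. x \<in> carrier W \<Longrightarrow> F (word [x]) = H (word [x])" and a: "a \<in> carrier A"
  shows "F a = H a"
proof -
  interpret U: left_module EA U by (rule U)
  have one: "D \<one>\<^bsub>A\<^esub> = \<zero>\<^bsub>U\<^esub>" if D: "A.bimodule_derivation U D" for D
  proof -
    note D = A.bimodule_derivationD[OF D]
    have "D \<one>\<^bsub>A\<^esub> \<oplus>\<^bsub>U\<^esub> D \<one>\<^bsub>A\<^esub> = D \<one>\<^bsub>A\<^esub>"
      using D(5)[OF A.B.one_closed A.B.one_closed] D(2)[OF A.B.one_closed] by (simp add: A.ep_one[symmetric])
    then show ?thesis using D(2)[OF A.B.one_closed] by simp
  qed
  have "F (word u) = H (word u)" if "u \<in> LW" for u
    using that
  proof (induction u)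
    case Nil
    then show ?case using one[OF F] one[OF H] by (simp add: word_one)
  next
    case (Cons x u)
    then have "word (x # u) = word [x] \<otimes>\<^bsub>A\<^esub> word u" by (intro word_Cons) auto
    with Cons show ?case
      by (simp add: A.bimodule_derivationD(5)[OF F] A.bimodule_derivationD(5)[OF H] word_closed eq)
  qed
  then show ?thesis
    by (intro A_linear_eqI[OF E.left_module_restrict_scalars[OF U] A.bimodule_derivationD(1)[OF F] A.bimodule_derivationD(1)[OF H] _ a])
qed

lemma letter_linear: "is_linear K W A (\<lambda>x. word [x])"
  using word_slot[of "[]" "[]"] by simp

text \<open>Both sides are derivations with the same values on letters.\<close>

lemma d_word:
  assumes u: "u \<in> LW"
  shows "dA (word u) = (\<Oplus>\<^bsub>OA\<^esub>p\<in>{..<length u}. e (word (take p u)) (word (drop (Suc p) u)) \<odot>\<^bsub>OA\<^esub> dA (word [u ! p]))"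
proof -
  have D: "is_linear K W (restrict_scalars EA OA) (\<lambda>x. dA (word [x]))"
    by (rule is_linear_compose[OF letter_linear A.bimodule_derivationD(1)[OF A.d_derivation]])
  show ?thesis
    using derivation_eqI[OF O.left_module_axioms A.d_derivation letter_derivation_derivation[OF O.left_module_axioms D]
        letter_derivation_letter[OF O.left_module_axioms D, symmetric] word_closed[OF u]]
      letter_derivation_word[OF O.left_module_axioms D u] by simp
qed

end

section \<open>The divergence cocycle of the tensor algebra\<close>

locale tensor_algebra_basis = tensor_algebra K W
  for K :: "('k, 'p) ring_scheme" and W :: "('k, 'w, 'q) module_scheme" +
  fixes I :: "'w set" and \<zeta> :: "'w \<Rightarrow> 'w \<Rightarrow> 'k"
  assumes finite_basis: "finite I" and basis_closed: "I \<subseteq> carrier W"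
    and \<zeta>_closed: "i \<in> I \<Longrightarrow> x \<in> carrier W \<Longrightarrow> \<zeta> i x \<in> carrier K"
    and \<zeta>_add: "i \<in> I \<Longrightarrow> x \<in> carrier W \<Longrightarrow> y \<in> carrier W \<Longrightarrow> \<zeta> i (x \<oplus>\<^bsub>W\<^esub> y) = \<zeta> i x \<oplus>\<^bsub>K\<^esub> \<zeta> i y"
    and \<zeta>_smult: "i \<in> I \<Longrightarrow> c \<in> carrier K \<Longrightarrow> x \<in> carrier W \<Longrightarrow> \<zeta> i (c \<odot>\<^bsub>W\<^esub> x) = c \<otimes>\<^bsub>K\<^esub> \<zeta> i x"
    and \<zeta>_expand: "x \<in> carrier W \<Longrightarrow> (\<Oplus>\<^bsub>W\<^esub>i\<in>I. \<zeta> i x \<odot>\<^bsub>W\<^esub> i) = x"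
begin

lemma letter_expand:
  assumes "left_module K N" "is_linear K W N h" "x \<in> carrier W"
  shows "h x = (\<Oplus>\<^bsub>N\<^esub>i\<in>I. \<zeta> i x \<odot>\<^bsub>N\<^esub> h i)"
proof -
  interpret h: linear_map K W N h by (intro linear_mapI W.left_module_axioms assms)
  have i: "i \<in> carrier W" if "i \<in> I" for i using basis_closed that by auto
  have "h x = h (\<Oplus>\<^bsub>W\<^esub>i\<in>I. \<zeta> i x \<odot>\<^bsub>W\<^esub> i)" by (simp add: \<zeta>_expand assms(3))
  also have "\<dots> = (\<Oplus>\<^bsub>N\<^esub>i\<in>I. h (\<zeta> i x \<odot>\<^bsub>W\<^esub> i))"
    by (rule h.map_finsum) (simp add: \<zeta>_closed i assms(3))
  also have "\<dots> = (\<Oplus>\<^bsub>N\<^esub>i\<in>I. \<zeta> i x \<odot>\<^bsub>N\<^esub> h i)"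
    by (rule h.N.finsum_cong') (simp_all add: \<zeta>_closed i assms(3))
  finally show ?thesis .
qed

abbreviation "RE \<equiv> regular_module EA"

lemma left_module_RE: "left_module EA RE"
proof (rule left_moduleI)
  show "abelian_group RE"
    by (rule abelian_groupI; unfold regular_module_simps) (simp_all add: E.B.a_ac E.B.add.l_inv_ex)
qed (simp_all add: regular_module_simps E.B.l_distr E.B.r_distr E.B.m_assoc E.B.ring_axioms)

lemma \<zeta>_linear: "i \<in> I \<Longrightarrow> is_linear K W (restrict_scalars EA RE) (\<lambda>x. \<zeta> i x \<odot>\<^bsub>EA\<^esub> \<one>\<^bsub>EA\<^esub>)"
  by (rule is_linearI)
    (simp_all add: restrict_scalars_simps(1,2,4) regular_module_simps \<zeta>_closed \<zeta>_add \<zeta>_smult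
      E.B.smult_l_distr E.smult_mult_left E.B.smult_assoc1)

text \<open>The double derivation with value \<open>\<zeta> i x (1 \<otimes> 1)\<close> on a letter \<open>x\<close>; on a word it
  sums the splittings of the word at each of its letters, weighted by the coordinate of that letter.\<close>

definition "partial i = lift K (restrict_scalars EA RE) (\<lambda>u. \<Oplus>\<^bsub>restrict_scalars EA RE\<^esub>p\<in>{..<length u}.
    e (word (take p u)) (word (drop (Suc p) u)) \<odot>\<^bsub>RE\<^esub> (\<zeta> i (u ! p) \<odot>\<^bsub>EA\<^esub> \<one>\<^bsub>EA\<^esub>))"

definition "\<xi> i = lift EA RE (partial i)"

lemma partial_derivation: "i \<in> I \<Longrightarrow> A.bimodule_derivation RE (partial i)"
  unfolding partial_def by (rule letter_derivation_derivation[OF left_module_RE \<zeta>_linear])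

lemma \<xi>_linear: "i \<in> I \<Longrightarrow> is_linear EA OA RE (\<xi> i)"
  unfolding \<xi>_def by (rule A.omega_lift_linear[OF left_module_RE partial_derivation])

lemma \<xi>_letter: "i \<in> I \<Longrightarrow> x \<in> carrier W \<Longrightarrow> \<xi> i (dA (word [x])) = \<zeta> i x \<odot>\<^bsub>EA\<^esub> \<one>\<^bsub>EA\<^esub>"
  unfolding \<xi>_def
  using A.omega_lift_d[OF left_module_RE partial_derivation, of i "word [x]"] word_closed[of "[x]"]
    letter_derivation_letter[OF left_module_RE \<zeta>_linear, of i x] by (simp add: partial_def)

abbreviation "dl x \<equiv> dA (word [x])"

lemma dl_closed: "x \<in> carrier W \<Longrightarrow> dl x \<in> carrier OA"
  by (rule A.d_simps(1)) (simp add: word_closed)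

lemma dl_linear: "is_linear K W (omega_K K A) (\<lambda>x. dl x)"
  by (rule is_linear_compose[OF letter_linear A.d_linear])

lemma omega_K_smult: "c \<odot>\<^bsub>omega_K K A\<^esub> m = (c \<odot>\<^bsub>EA\<^esub> \<one>\<^bsub>EA\<^esub>) \<odot>\<^bsub>OA\<^esub> m" "finsum (omega_K K A) = finsum OA"
  by (simp_all add: omega_K_def restrict_scalars_simps)

lemma scalar_closed: "c \<in> carrier K \<Longrightarrow> c \<odot>\<^bsub>EA\<^esub> \<one>\<^bsub>EA\<^esub> \<in> carrier EA" by simp

lemma basis_in: "i \<in> I \<Longrightarrow> i \<in> carrier W" using basis_closed by auto

lemma letters_expand_omega:
  assumes "is_linear K W (omega_K K A) h" "x \<in> carrier W"
  shows "(\<Oplus>\<^bsub>OA\<^esub>i\<in>I. \<xi> i (dl x) \<odot>\<^bsub>OA\<^esub> h i) = h x"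
proof -
  have hc: "h i \<in> carrier OA" if "i \<in> I" for i
    using is_linearD(1)[OF assms(1) basis_in[OF that]] by (simp add: A.omega_K_simps)
  have "h x = (\<Oplus>\<^bsub>OA\<^esub>i\<in>I. \<zeta> i x \<odot>\<^bsub>omega_K K A\<^esub> h i)"
    using letter_expand[OF A.left_module_omega_K assms] by (simp add: omega_K_smult(2))
  also have "\<dots> = (\<Oplus>\<^bsub>OA\<^esub>i\<in>I. \<xi> i (dl x) \<odot>\<^bsub>OA\<^esub> h i)"
    by (rule O.M.finsum_cong') (simp_all add: omega_K_smult(1) \<xi>_letter assms(2) hc \<zeta>_closed scalar_closed del: E.B.smult_closed)
  finally show ?thesis ..
qed

lemma \<xi>_closed: "i \<in> I \<Longrightarrow> m \<in> carrier OA \<Longrightarrow> \<xi> i m \<in> carrier EA"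
  using is_linearD(1)[OF \<xi>_linear] by (simp add: regular_module_simps)

lemma \<xi>_term_linear:
  assumes "i \<in> I" "n \<in> carrier OA" shows "is_linear EA OA OA (\<lambda>m. \<xi> i m \<odot>\<^bsub>OA\<^esub> n)"
proof (rule is_linearI)
  note x = is_linearD[OF \<xi>_linear[OF assms(1)], unfolded regular_module_simps]
  fix m assume m: "m \<in> carrier OA"
  show "\<xi> i m \<odot>\<^bsub>OA\<^esub> n \<in> carrier OA" by (rule O.smult_closed[OF x(1)[OF m] assms(2)])
  show "\<xi> i (m \<oplus>\<^bsub>OA\<^esub> m') \<odot>\<^bsub>OA\<^esub> n = \<xi> i m \<odot>\<^bsub>OA\<^esub> n \<oplus>\<^bsub>OA\<^esub> \<xi> i m' \<odot>\<^bsub>OA\<^esub> n" if m': "m' \<in> carrier OA" for m'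
    unfolding x(2)[OF m m'] by (rule O.smult_l_distr[OF x(1)[OF m] x(1)[OF m'] assms(2)])
  show "\<xi> i (b \<odot>\<^bsub>OA\<^esub> m) \<odot>\<^bsub>OA\<^esub> n = b \<odot>\<^bsub>OA\<^esub> (\<xi> i m \<odot>\<^bsub>OA\<^esub> n)" if b: "b \<in> carrier EA" for b
    unfolding x(3)[OF b m] by (rule O.smult_assoc1[OF b x(1)[OF m] assms(2)])
qed

lemma \<xi>_sum_linear:
  assumes "\<And>i. i \<in> I \<Longrightarrow> h i \<in> carrier OA"
  shows "is_linear EA OA OA (\<lambda>m. \<Oplus>\<^bsub>OA\<^esub>i\<in>I. \<xi> i m \<odot>\<^bsub>OA\<^esub> h i)"
  by (rule is_linear_finsum[OF O.left_module_axioms \<xi>_term_linear[OF _ assms]])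

text \<open>Forms are generated by differentials, and \<open>d\<close> of an element is determined by its letters; on the
  differential of a letter this is the expansion of the letter in the coordinates on \<open>W\<close>.\<close>

lemma omega_expand: "m \<in> carrier OA \<Longrightarrow> (\<Oplus>\<^bsub>OA\<^esub>i\<in>I. \<xi> i m \<odot>\<^bsub>OA\<^esub> dl i) = m"
proof -
  assume m: "m \<in> carrier OA"
  have l: "is_linear EA OA OA (\<lambda>m. \<Oplus>\<^bsub>OA\<^esub>i\<in>I. \<xi> i m \<odot>\<^bsub>OA\<^esub> dl i)"
    by (rule \<xi>_sum_linear) (rule dl_closed[OF basis_in])
  have eq: "(\<Oplus>\<^bsub>OA\<^esub>i\<in>I. \<xi> i (dA b) \<odot>\<^bsub>OA\<^esub> dl i) = dA b" if b: "b \<in> carrier A" for b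
    by (rule derivation_eqI[OF O.left_module_axioms A.derivation_of_linear[OF l] A.d_derivation _ b])
      (rule letters_expand_omega[OF dl_linear])
  show ?thesis
    by (rule A.omega_linear_eqI[where g = "\<lambda>m. m", OF O.left_module_axioms l is_linear_id eq m])
qed

sublocale C: coordinates K EA OA I "\<lambda>i. dl i" \<xi>
  by (intro coordinates.intro coordinates_axioms.intro E.kalgebra_axioms O.left_module_axioms finite_basis
      dl_closed basis_in \<xi>_linear omega_expand)

lemma flat_connection_letter: "x \<in> carrier W \<Longrightarrow> C.flat_connection (dl x) = \<zero>\<^bsub>forms_tensor K EA OA\<^esub>"
proof (rule C.flat_connection_zero)
  assume x: "x \<in> carrier W"
  show "dl x \<in> carrier OA" by (rule dl_closed[OF x])
  fix i assume i: "i \<in> I"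
  show "\<exists>c\<in>carrier K. \<xi> i (dl x) = c \<odot>\<^bsub>EA\<^esub> \<one>\<^bsub>EA\<^esub>" by (rule bexI[of _ "\<zeta> i x"]) (rule \<xi>_letter[OF i x], rule \<zeta>_closed[OF i x])
qed

text \<open>The coordinates of the differential of a letter are scalars, so the flat connection of the
  coordinates kills it; and a connection is determined by its values on the generators.\<close>

theorem canonical_connection_eq: "canonical_connection K W = C.flat_connection"
  unfolding canonical_connection_def Let_def
proof (rule the_equality)
  show "C.flat_connection \<in> connections K EA OA \<and> (\<forall>w\<in>carrier W. C.flat_connection (dl w) = \<zero>\<^bsub>forms_tensor K EA OA\<^esub>)"
    by (intro conjI ballI C.flat_connection_mem flat_connection_letter)
  fix D assume D: "D \<in> connections K EA OA \<and> (\<forall>w\<in>carrier W. D (dl w) = \<zero>\<^bsub>forms_tensor K EA OA\<^esub>)"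
  show "D = C.flat_connection"
    by (rule C.flat_connection_unique[OF conjunct1[OF D] bspec[OF conjunct2[OF D] basis_in]])
qed

text \<open>The Lie derivative is a derivation along the derivation \<open>\<phi>\<close> of the enveloping algebra and
  maps \<open>di\<close> to \<open>d(f i)\<close>. Expanding a form in the generators \<open>di\<close> therefore gives the following
  expression for it.\<close>

context
  fixes f assumes f: "f \<in> derivations K A"
begin

abbreviation (input) "\<phi> \<equiv> env_derivation K A f"

lemmas fD = A.derivationsD[OF f]
lemmas \<phi>D = E.derivationsD[OF A.env_derivation_derivation[OF f]]

definition "lie m = (\<Oplus>\<^bsub>OA\<^esub>i\<in>I. \<phi> (\<xi> i m) \<odot>\<^bsub>OA\<^esub> dl i) \<oplus>\<^bsub>OA\<^esub> (\<Oplus>\<^bsub>OA\<^esub>i\<in>I. \<xi> i m \<odot>\<^bsub>OA\<^esub> dA (f (word [i])))"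

lemma df_closed: "x \<in> carrier W \<Longrightarrow> dA (f (word [x])) \<in> carrier OA"
  by (intro A.d_simps(1) fD(2) word_closed) simp

lemma lie_linear: "is_linear K (omega_K K A) (omega_K K A) lie"
proof -
  note lO = A.left_module_omega_K
  have x: "is_linear K (omega_K K A) EA (\<xi> i)" if "i \<in> I" for i
    using C.\<xi>_K_linear[OF that] by (simp add: omega_K_def)
  note act = E.module_action_bilinear[OF O.left_module_axioms, folded omega_K_def]
  have 1: "is_linear K (omega_K K A) (omega_K K A) (\<lambda>m. \<Oplus>\<^bsub>omega_K K A\<^esub>i\<in>I. \<phi> (\<xi> i m) \<odot>\<^bsub>OA\<^esub> dl i)"
    by (rule is_linear_finsum[OF lO])
      (rule is_linear_compose[OF is_linear_compose[OF x \<phi>D(1)] is_bilinearD(2)[OF act]];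
        simp add: A.omega_K_simps dl_closed basis_in)
  have 2: "is_linear K (omega_K K A) (omega_K K A) (\<lambda>m. \<Oplus>\<^bsub>omega_K K A\<^esub>i\<in>I. \<xi> i m \<odot>\<^bsub>OA\<^esub> dA (f (word [i])))"
    by (rule is_linear_finsum[OF lO])
      (rule is_linear_compose[OF x is_bilinearD(2)[OF act]]; simp add: A.omega_K_simps df_closed basis_in)
  show ?thesis
    using is_linear_add[OF lO 1 2] unfolding lie_def[abs_def] omega_K_smult(2) A.omega_K_simps .
qed

lemma lie_smult:
  assumes b: "b \<in> carrier EA" and m: "m \<in> carrier OA"
  shows "lie (b \<odot>\<^bsub>OA\<^esub> m) = \<phi> b \<odot>\<^bsub>OA\<^esub> m \<oplus>\<^bsub>OA\<^esub> b \<odot>\<^bsub>OA\<^esub> lie m"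
proof -
  have x: "\<xi> i m \<in> carrier EA" if "i \<in> I" for i using that m by (rule \<xi>_closed)
  have px: "\<phi> (\<xi> i m) \<in> carrier EA" if "i \<in> I" for i using \<phi>D(2)[OF x[OF that]] .
  have pb: "\<phi> b \<in> carrier EA" by (rule \<phi>D(2)[OF b])
  have c1: "\<xi> i m \<odot>\<^bsub>OA\<^esub> dl i \<in> carrier OA" "\<phi> (\<xi> i m) \<odot>\<^bsub>OA\<^esub> dl i \<in> carrier OA"
    "\<xi> i m \<odot>\<^bsub>OA\<^esub> dA (f (word [i])) \<in> carrier OA" if "i \<in> I" for i
    using x[OF that] px[OF that] dl_closed[OF basis_in[OF that]] df_closed[OF basis_in[OF that]] by simp_all
  have "(\<Oplus>\<^bsub>OA\<^esub>i\<in>I. \<phi> (\<xi> i (b \<odot>\<^bsub>OA\<^esub> m)) \<odot>\<^bsub>OA\<^esub> dl i)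
      = (\<Oplus>\<^bsub>OA\<^esub>i\<in>I. \<phi> b \<odot>\<^bsub>OA\<^esub> (\<xi> i m \<odot>\<^bsub>OA\<^esub> dl i) \<oplus>\<^bsub>OA\<^esub> b \<odot>\<^bsub>OA\<^esub> (\<phi> (\<xi> i m) \<odot>\<^bsub>OA\<^esub> dl i))"
    using b m c1 pb by (intro O.M.finsum_cong')
      (simp_all add: C.\<xi>_simps(3) \<phi>D(5) x px O.smult_l_distr O.smult_assoc1 dl_closed basis_in)
  also have "\<dots> = (\<Oplus>\<^bsub>OA\<^esub>i\<in>I. \<phi> b \<odot>\<^bsub>OA\<^esub> (\<xi> i m \<odot>\<^bsub>OA\<^esub> dl i)) \<oplus>\<^bsub>OA\<^esub> (\<Oplus>\<^bsub>OA\<^esub>i\<in>I. b \<odot>\<^bsub>OA\<^esub> (\<phi> (\<xi> i m) \<odot>\<^bsub>OA\<^esub> dl i))"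
    using b c1 pb by (intro O.M.finsum_addf) simp_all
  also have "(\<Oplus>\<^bsub>OA\<^esub>i\<in>I. \<phi> b \<odot>\<^bsub>OA\<^esub> (\<xi> i m \<odot>\<^bsub>OA\<^esub> dl i)) = \<phi> b \<odot>\<^bsub>OA\<^esub> m"
    using c1 pb by (subst O.finsum_smult[symmetric]) (simp_all add: omega_expand m)
  also have "(\<Oplus>\<^bsub>OA\<^esub>i\<in>I. b \<odot>\<^bsub>OA\<^esub> (\<phi> (\<xi> i m) \<odot>\<^bsub>OA\<^esub> dl i)) = b \<odot>\<^bsub>OA\<^esub> (\<Oplus>\<^bsub>OA\<^esub>i\<in>I. \<phi> (\<xi> i m) \<odot>\<^bsub>OA\<^esub> dl i)"
    using c1 b by (subst O.finsum_smult) simp_all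
  finally have 1: "(\<Oplus>\<^bsub>OA\<^esub>i\<in>I. \<phi> (\<xi> i (b \<odot>\<^bsub>OA\<^esub> m)) \<odot>\<^bsub>OA\<^esub> dl i)
      = \<phi> b \<odot>\<^bsub>OA\<^esub> m \<oplus>\<^bsub>OA\<^esub> b \<odot>\<^bsub>OA\<^esub> (\<Oplus>\<^bsub>OA\<^esub>i\<in>I. \<phi> (\<xi> i m) \<odot>\<^bsub>OA\<^esub> dl i)" .
  have 2: "(\<Oplus>\<^bsub>OA\<^esub>i\<in>I. \<xi> i (b \<odot>\<^bsub>OA\<^esub> m) \<odot>\<^bsub>OA\<^esub> dA (f (word [i])))
      = b \<odot>\<^bsub>OA\<^esub> (\<Oplus>\<^bsub>OA\<^esub>i\<in>I. \<xi> i m \<odot>\<^bsub>OA\<^esub> dA (f (word [i])))"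
    by (rule is_linearD(3)[OF \<xi>_sum_linear b m]) (rule df_closed[OF basis_in])
  have s: "(\<Oplus>\<^bsub>OA\<^esub>i\<in>I. \<phi> (\<xi> i m) \<odot>\<^bsub>OA\<^esub> dl i) \<in> carrier OA" "(\<Oplus>\<^bsub>OA\<^esub>i\<in>I. \<xi> i m \<odot>\<^bsub>OA\<^esub> dA (f (word [i]))) \<in> carrier OA"
    using c1 by (simp_all add: O.M.finsum_closed)
  show ?thesis
    unfolding lie_def 1 2 using s b m pb by (simp add: O.smult_r_distr O.M.a_assoc)
qed

lemma lie_letter: "x \<in> carrier W \<Longrightarrow> lie (dl x) = dA (f (word [x]))"
proof -
  assume x: "x \<in> carrier W"
  have "\<phi> (\<xi> i (dl x)) \<odot>\<^bsub>OA\<^esub> dl i = \<zero>\<^bsub>OA\<^esub>" if "i \<in> I" for i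
    using that x by (simp add: \<xi>_letter E.derivation_scalar[OF A.env_derivation_derivation[OF f]] \<zeta>_closed dl_closed basis_in)
  then have 1: "(\<Oplus>\<^bsub>OA\<^esub>i\<in>I. \<phi> (\<xi> i (dl x)) \<odot>\<^bsub>OA\<^esub> dl i) = (\<Oplus>\<^bsub>OA\<^esub>i\<in>I. \<zero>\<^bsub>OA\<^esub>)"
    by (intro O.M.finsum_cong') simp_all
  have 2: "(\<Oplus>\<^bsub>OA\<^esub>i\<in>I. \<xi> i (dl x) \<odot>\<^bsub>OA\<^esub> dA (f (word [i]))) = dA (f (word [x]))"
    by (rule letters_expand_omega[OF is_linear_compose[OF is_linear_compose[OF letter_linear fD(1)] A.d_linear] x])
  show ?thesis unfolding lie_def 1 2 using df_closed[OF x] by simp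
qed

lemma env_derivation_sides:
  assumes a: "a \<in> carrier A"
  shows "\<phi> (e \<one>\<^bsub>A\<^esub> a) = e \<one>\<^bsub>A\<^esub> (f a)" "\<phi> (e a \<one>\<^bsub>A\<^esub>) = e (f a) \<one>\<^bsub>A\<^esub>"
proof -
  have z: "e \<zero>\<^bsub>A\<^esub> a = \<zero>\<^bsub>EA\<^esub>" "e a \<zero>\<^bsub>A\<^esub> = \<zero>\<^bsub>EA\<^esub>"
    using linear_map.map_zero[OF linear_mapI[OF A.B.left_module_axioms E.B.left_module_axioms is_bilinearD(2)[OF A.ep_bilinear a]]]
      linear_map.map_zero[OF linear_mapI[OF A.B.left_module_axioms E.B.left_module_axioms is_bilinearD(1)[OF A.ep_bilinear a]]]
    by simp_all
  show "\<phi> (e \<one>\<^bsub>A\<^esub> a) = e \<one>\<^bsub>A\<^esub> (f a)" "\<phi> (e a \<one>\<^bsub>A\<^esub>) = e (f a) \<one>\<^bsub>A\<^esub>"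
    using a fD(2)[OF a] by (simp_all add: A.env_derivation_pure[OF f] A.derivation_one[OF f] z A.ep_simps)
qed

text \<open>By induction on words: both sides satisfy the same Leibniz rule, because \<open>\<phi>\<close> restricts to
  \<open>f\<close> on either side of the enveloping algebra, and they agree on letters.\<close>

lemma lie_d: "b \<in> carrier A \<Longrightarrow> lie (dA b) = dA (f b)"
proof -
  assume b: "b \<in> carrier A"
  note ladd = is_linearD(2)[OF lie_linear, unfolded A.omega_K_simps]
  have one: "lie (dA \<one>\<^bsub>A\<^esub>) = dA (f \<one>\<^bsub>A\<^esub>)"
  proof -
    have "dA \<one>\<^bsub>A\<^esub> = \<zero>\<^bsub>omega_K K A\<^esub>" using A.d_scalar[OF K.one_closed] by (simp add: A.omega_K_simps)
    moreover have "dA \<zero>\<^bsub>A\<^esub> = \<zero>\<^bsub>omega_K K A\<^esub>"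
      by (rule linear_map.map_zero[OF linear_mapI[OF A.B.left_module_axioms A.left_module_omega_K A.d_linear]])
    moreover have "lie \<zero>\<^bsub>omega_K K A\<^esub> = \<zero>\<^bsub>omega_K K A\<^esub>"
      by (rule linear_map.map_zero[OF linear_mapI[OF A.left_module_omega_K A.left_module_omega_K lie_linear]])
    ultimately show ?thesis by (simp add: A.derivation_one[OF f])
  qed
  have mult: "lie (dA (a \<otimes>\<^bsub>A\<^esub> b)) = dA (f (a \<otimes>\<^bsub>A\<^esub> b))"
    if a: "a \<in> carrier A" and b: "b \<in> carrier A" and la: "lie (dA a) = dA (f a)" and lb: "lie (dA b) = dA (f b)" for a b
  proof -
    note cl = a b A.d_simps(1)[OF a] A.d_simps(1)[OF b] fD(2)[OF a] fD(2)[OF b]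
      A.d_simps(1)[OF fD(2)[OF a]] A.d_simps(1)[OF fD(2)[OF b]]
    show ?thesis
      using cl by (simp add: A.d_simps(4) A.d_simps(2) A.ep_simps ladd lie_smult env_derivation_sides la lb fD(5) O.M.a_ac)
  qed
  have "lie (dA (word u)) = dA (f (word u))" if "u \<in> LW" for u
    using that
  proof (induction u)
    case Nil then show ?case using one by (simp add: word_one)
  next
    case (Cons x u)
    then have "word (x # u) = word [x] \<otimes>\<^bsub>A\<^esub> word u" by (intro word_Cons) auto
    with Cons show ?case by (simp add: mult word_closed lie_letter)
  qed
  then show ?thesis
    by (intro A_linear_eqI[OF A.left_module_omega_K is_linear_compose[OF A.d_linear lie_linear]
          is_linear_compose[OF fD(1) A.d_linear] _ b])
qed

text \<open>The defining property follows from the twisted Leibniz rule and from the compatibility with \<open>d\<close>,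
  and determines the map because forms \<open>a db\<close> span.\<close>

lemma lie_derivative_eq: "lie_derivative K A f = (\<lambda>m \<in> carrier OA. lie m)"
  unfolding lie_derivative_def
proof (rule the_equality)
  let ?P = "\<lambda>L. \<forall>b\<in>carrier A. \<forall>b'\<in>carrier A. L (left_mult K A b (dA b')) =
      left_mult K A (f b) (dA b') \<oplus>\<^bsub>OA\<^esub> left_mult K A b (dA (f b'))"
  have r: "is_linear K (omega_K K A) (omega_K K A) (\<lambda>m \<in> carrier OA. lie m)"
    using is_linear_restrict[OF A.left_module_omega_K lie_linear] by (simp only: A.omega_K_simps)
  have p: "?P (\<lambda>m \<in> carrier OA. lie m)"
  proof (intro ballI)
    fix b b' assume b: "b \<in> carrier A" and b': "b' \<in> carrier A"
    then show "(\<lambda>m \<in> carrier OA. lie m) (left_mult K A b (dA b')) =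
      left_mult K A (f b) (dA b') \<oplus>\<^bsub>OA\<^esub> left_mult K A b (dA (f b'))"
      by (simp add: A.left_mult_eq A.ep_simps A.d_simps(1) lie_smult lie_d env_derivation_sides fD(2))
  qed
  show "(\<lambda>m \<in> carrier OA. lie m) \<in> linear_maps K (omega_K K A) (omega_K K A) \<and> ?P (\<lambda>m \<in> carrier OA. lie m)"
    unfolding linear_maps_iff A.omega_K_simps by (intro conjI r p restrict_extensional)
  fix L assume L: "L \<in> linear_maps K (omega_K K A) (omega_K K A) \<and> ?P L"
  then have l: "is_linear K (omega_K K A) (omega_K K A) L" and x: "L \<in> extensional (carrier OA)"
    by (simp_all add: linear_maps_iff A.omega_K_simps)
  show "L = (\<lambda>m \<in> carrier OA. lie m)"
  proof (rule extensionalityI[OF x restrict_extensional])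
    fix m assume m: "m \<in> carrier OA"
    show "L m = (\<lambda>m \<in> carrier OA. lie m) m"
      by (rule A.omega_K_linear_eqI[OF A.left_module_omega_K l r _ m]) (use L p in simp)
  qed
qed

text \<open>The contraction of the connection produces the first of the two sums in the Lie derivative, and only
  the second remains.\<close>

theorem div_cocycle_coordinates:
  assumes m: "m \<in> carrier OA"
  shows "div_cocycle K W (canonical_connection K W) f m = \<ominus>\<^bsub>OA\<^esub> (\<Oplus>\<^bsub>OA\<^esub>i\<in>I. \<xi> i m \<odot>\<^bsub>OA\<^esub> dA (f (word [i])))"
proof -
  let ?P = "\<Oplus>\<^bsub>OA\<^esub>i\<in>I. \<phi> (\<xi> i m) \<odot>\<^bsub>OA\<^esub> dl i" and ?Q = "\<Oplus>\<^bsub>OA\<^esub>i\<in>I. \<xi> i m \<odot>\<^bsub>OA\<^esub> dA (f (word [i]))"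
  have c: "?P \<in> carrier OA" "?Q \<in> carrier OA"
    using m by (auto intro!: O.M.finsum_closed O.smult_closed \<phi>D(2) \<xi>_closed dl_closed df_closed basis_in)
  have "div_cocycle K W (canonical_connection K W) f m = ?P \<ominus>\<^bsub>OA\<^esub> (?P \<oplus>\<^bsub>OA\<^esub> ?Q)"
    unfolding div_cocycle_def Let_def canonical_connection_eq
    using C.flat_connection_defect[OF A.env_derivation_derivation[OF f] m] m by (simp add: lie_derivative_eq lie_def)
  also have "\<dots> = \<ominus>\<^bsub>OA\<^esub> ?Q"
    using c by (simp add: a_minus_def O.M.minus_add O.M.r_neg1 O.M.r_neg2 O.M.a_assoc[symmetric] O.M.r_neg)
  finally show ?thesis .
qed

end

end

section \<open>The Hamiltonian flow\<close>

lemma (in kalgebra) regular_bimodule_linear: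
  "is_linear K V (restrict_scalars E (regular_bimodule K B)) f \<longleftrightarrow> is_linear K V B f"
proof -
  interpret E: kalgebra K E by (rule E_kalgebra)
  have 1: "(c \<odot>\<^bsub>E\<^esub> \<one>\<^bsub>E\<^esub>) \<odot>\<^bsub>regular_bimodule K B\<^esub> x = c \<odot>\<^bsub>B\<^esub> x" if c: "c \<in> carrier K" and x: "x \<in> carrier B" for c x
    using is_linearD(3)[OF bimodule_action_linear[OF x] c E.B.one_closed]
    by (simp add: ep_one bimodule_action_pure x)
  show ?thesis
    unfolding is_linear_def restrict_scalars_simps(1,2,4) regular_bimodule_simps(1,2)
    by (auto simp: 1 Pi_iff)
qed

text \<open>A cyclic word cut open at its letter number \<open>s\<close>, which is removed.\<close>

definition rot :: "'w list \<Rightarrow> nat \<Rightarrow> 'w list"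
  where "rot u s = drop (Suc s) u @ take s u"

locale tensor_algebra_pairing = tensor_algebra K W
  for K :: "('k, 'p) ring_scheme" and W :: "('k, 'w, 'q) module_scheme" +
  fixes \<beta> :: "'w \<Rightarrow> 'w \<Rightarrow> 'k"
  assumes \<beta>_closed: "u \<in> carrier W \<Longrightarrow> v \<in> carrier W \<Longrightarrow> \<beta> u v \<in> carrier K"
    and \<beta>_add_left: "u \<in> carrier W \<Longrightarrow> u' \<in> carrier W \<Longrightarrow> v \<in> carrier W \<Longrightarrow>
      \<beta> (u \<oplus>\<^bsub>W\<^esub> u') v = \<beta> u v \<oplus>\<^bsub>K\<^esub> \<beta> u' v"
    and \<beta>_smult_left: "c \<in> carrier K \<Longrightarrow> u \<in> carrier W \<Longrightarrow> v \<in> carrier W \<Longrightarrow>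
      \<beta> (c \<odot>\<^bsub>W\<^esub> u) v = c \<otimes>\<^bsub>K\<^esub> \<beta> u v"
    and \<beta>_add_right: "u \<in> carrier W \<Longrightarrow> v \<in> carrier W \<Longrightarrow> v' \<in> carrier W \<Longrightarrow>
      \<beta> u (v \<oplus>\<^bsub>W\<^esub> v') = \<beta> u v \<oplus>\<^bsub>K\<^esub> \<beta> u v'"
    and \<beta>_smult_right: "c \<in> carrier K \<Longrightarrow> u \<in> carrier W \<Longrightarrow> v \<in> carrier W \<Longrightarrow>
      \<beta> u (c \<odot>\<^bsub>W\<^esub> v) = c \<otimes>\<^bsub>K\<^esub> \<beta> u v"
begin

lemma \<beta>_linear:
  assumes N: "left_module K N" and n: "n \<in> carrier N" and u: "u \<in> carrier W"
  shows "is_linear K W N (\<lambda>x. \<beta> u x \<odot>\<^bsub>N\<^esub> n)" "is_linear K W N (\<lambda>x. \<beta> x u \<odot>\<^bsub>N\<^esub> n)"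
proof -
  interpret N: left_module K N by (rule N)
  show "is_linear K W N (\<lambda>x. \<beta> u x \<odot>\<^bsub>N\<^esub> n)" "is_linear K W N (\<lambda>x. \<beta> x u \<odot>\<^bsub>N\<^esub> n)"
    by (rule is_linearI; simp add: u n \<beta>_closed \<beta>_add_left \<beta>_add_right \<beta>_smult_left \<beta>_smult_right
        N.smult_l_distr N.smult_assoc1)+
qed

lemma LW_parts: "u \<in> LW \<Longrightarrow> take n u \<in> LW" "u \<in> LW \<Longrightarrow> drop n u \<in> LW" "u \<in> LW \<Longrightarrow> p < length u \<Longrightarrow> u ! p \<in> carrier W"
  by (auto dest: in_set_takeD in_set_dropD)

lemma rot_closed: "u \<in> LW \<Longrightarrow> rot u s \<in> LW"
  unfolding rot_def by (simp only: append_in_lists_conv LW_parts simp_thms)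

abbreviation "T \<equiv> tensor K A A"
abbreviation "pt \<equiv> pure_tensor K A A"

lemma left_module_T: "left_module K T" by (rule left_module_tensor[OF A.B.left_module_axioms A.B.left_module_axioms])

interpretation T: left_module K T by (rule left_module_T)

lemmas pt_bilinear = pure_tensor_bilinear[OF A.B.left_module_axioms A.B.left_module_axioms]

abbreviation pairing_term :: "'w list \<Rightarrow> 'w list \<Rightarrow> (('w list \<Rightarrow> 'k) set \<times> ('w list \<Rightarrow> 'k) set \<Rightarrow> 'k) set"
  where "pairing_term u w \<equiv> \<Oplus>\<^bsub>T\<^esub> i \<in> {..<length u}. \<Oplus>\<^bsub>T\<^esub> j \<in> {..<length w}. \<beta> (u ! i) (w ! j) \<odot>\<^bsub>T\<^esub>
          pt (word (take j w @ drop (Suc i) u)) (word (take i u @ drop (Suc j) w))"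

lemma pt_words: "a \<in> LW \<Longrightarrow> b \<in> LW \<Longrightarrow> pt (word a) (word b) \<in> carrier T"
  by (rule is_bilinearD(3)[OF pt_bilinear word_closed word_closed])

lemma pt_slot_left: "xs \<in> LW \<Longrightarrow> ys \<in> LW \<Longrightarrow> b \<in> LW \<Longrightarrow> c \<in> carrier K \<Longrightarrow> is_linear K W T (\<lambda>v. c \<odot>\<^bsub>T\<^esub> pt (word (xs @ v # ys)) (word b))"
  by (rule is_linear_smult[OF K.cring_axioms left_module_T is_linear_compose[OF word_slot is_bilinearD(2)[OF pt_bilinear word_closed]]])

lemma pt_slot_right: "xs \<in> LW \<Longrightarrow> ys \<in> LW \<Longrightarrow> b \<in> LW \<Longrightarrow> c \<in> carrier K \<Longrightarrow> is_linear K W T (\<lambda>v. c \<odot>\<^bsub>T\<^esub> pt (word b) (word (xs @ v # ys)))"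
  by (rule is_linear_smult[OF K.cring_axioms left_module_T is_linear_compose[OF word_slot is_bilinearD(1)[OF pt_bilinear word_closed]]])

lemma pairing_multilinear_right:
  assumes u: "u \<in> LW" shows "multilinear K W LW T (pairing_term u)"
proof (rule multilinear_finsum[OF left_module_T])
  fix i assume i: "i \<in> {..<length u}"
  have ui: "u ! i \<in> carrier W" "drop (Suc i) u \<in> LW" "take i u \<in> LW" using LW_parts[OF u] i by simp_all
  show "multilinear K W LW T (\<lambda>w. \<Oplus>\<^bsub>T\<^esub> j \<in> {..<length w}. \<beta> (u ! i) (w ! j) \<odot>\<^bsub>T\<^esub>
          pt (word (take j w @ drop (Suc i) u)) (word (take i u @ drop (Suc j) w)))"
  proof (rule multilinear_sum_splits[OF left_module_T W.left_module_axioms])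
    fix a b assume ab: "a \<in> LW" "b \<in> LW"
    show "is_linear K W T (\<lambda>x. \<beta> (u ! i) x \<odot>\<^bsub>T\<^esub> pt (word (a @ drop (Suc i) u)) (word (take i u @ b)))"
      by (rule \<beta>_linear(1)[OF left_module_T pt_words ui(1)]) (use ab ui in simp_all)
  next
    fix a a' x b assume ab: "a \<in> LW" "a' \<in> LW" "x \<in> carrier W" "b \<in> LW"
    show "is_linear K W T (\<lambda>v. \<beta> (u ! i) x \<odot>\<^bsub>T\<^esub> pt (word ((a @ v # a') @ drop (Suc i) u)) (word (take i u @ b)))"
      using pt_slot_left[of a "a' @ drop (Suc i) u" "take i u @ b" "\<beta> (u ! i) x"] ab ui by (simp add: \<beta>_closed)
  next
    fix a x b b' assume ab: "a \<in> LW" "x \<in> carrier W" "b \<in> LW" "b' \<in> LW"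
    show "is_linear K W T (\<lambda>v. \<beta> (u ! i) x \<odot>\<^bsub>T\<^esub> pt (word (a @ drop (Suc i) u)) (word (take i u @ (b @ v # b'))))"
      using pt_slot_right[of "take i u @ b" b' "a @ drop (Suc i) u" "\<beta> (u ! i) x"] ab ui by (simp add: \<beta>_closed)
  qed
qed

lemma pairing_multilinear_left:
  assumes w: "w \<in> LW" shows "multilinear K W LW T (\<lambda>u. pairing_term u w)"
proof (rule multilinear_sum_splits[OF left_module_T W.left_module_axioms,
      where \<Phi> = "\<lambda>a x b. \<Oplus>\<^bsub>T\<^esub> j \<in> {..<length w}. \<beta> x (w ! j) \<odot>\<^bsub>T\<^esub> pt (word (take j w @ b)) (word (a @ drop (Suc j) w))"];
    rule is_linear_finsum[OF left_module_T])
  fix a b j assume ab: "a \<in> LW" "b \<in> LW" and j: "j \<in> {..<length w}"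
  have wj: "w ! j \<in> carrier W" "drop (Suc j) w \<in> LW" "take j w \<in> LW" using LW_parts[OF w] j by simp_all
  show "is_linear K W T (\<lambda>x. \<beta> x (w ! j) \<odot>\<^bsub>T\<^esub> pt (word (take j w @ b)) (word (a @ drop (Suc j) w)))"
    by (rule \<beta>_linear(2)[OF left_module_T pt_words wj(1)]) (use ab wj in simp_all)
next
  fix a a' x b j assume ab: "a \<in> LW" "a' \<in> LW" "x \<in> carrier W" "b \<in> LW" and j: "j \<in> {..<length w}"
  have wj: "w ! j \<in> carrier W" "drop (Suc j) w \<in> LW" "take j w \<in> LW" using LW_parts[OF w] j by simp_all
  show "is_linear K W T (\<lambda>v. \<beta> x (w ! j) \<odot>\<^bsub>T\<^esub> pt (word (take j w @ b)) (word ((a @ v # a') @ drop (Suc j) w)))"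
    using pt_slot_right[of a "a' @ drop (Suc j) w" "take j w @ b" "\<beta> x (w ! j)"] ab wj by (simp add: \<beta>_closed)
next
  fix a x b b' j assume ab: "a \<in> LW" "x \<in> carrier W" "b \<in> LW" "b' \<in> LW" and j: "j \<in> {..<length w}"
  have wj: "w ! j \<in> carrier W" "drop (Suc j) w \<in> LW" "take j w \<in> LW" using LW_parts[OF w] j by simp_all
  show "is_linear K W T (\<lambda>v. \<beta> x (w ! j) \<odot>\<^bsub>T\<^esub> pt (word (take j w @ (b @ v # b'))) (word (a @ drop (Suc j) w)))"
    using pt_slot_left[of "take j w @ b" b' "a @ drop (Suc j) w" "\<beta> x (w ! j)"] ab wj by (simp add: \<beta>_closed)
qed

definition flow :: "('w list \<Rightarrow> 'k) set \<Rightarrow> ('w list \<Rightarrow> 'k) set \<Rightarrow> ('w list \<Rightarrow> 'k) set"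
  where "flow a b = lift K A (\<lambda>(x, y). x \<otimes>\<^bsub>A\<^esub> y) (pairing_ext K W \<beta> a b)"

lemma mult_tensor: "is_bilinear K A A A (\<lambda>x y. case (x, y) of (x, y) \<Rightarrow> x \<otimes>\<^bsub>A\<^esub> y)"
  using A.mult_bilinear by simp

lemmas mult_lift_linear = tensor_lift_linear[OF A.B.left_module_axioms A.B.left_module_axioms A.B.left_module_axioms mult_tensor]
lemmas mult_lift_pure = tensor_lift_pure[OF A.B.left_module_axioms A.B.left_module_axioms A.B.left_module_axioms mult_tensor]

lemma flow_bilinear: "is_bilinear K A A A flow"
proof -
  have 1: "is_bilinear K A A T (pairing_ext K W \<beta>)"
    using A_lift2_bilinear[OF left_module_T pairing_multilinear_right pairing_multilinear_left]
    by (simp only: pairing_ext_def[abs_def] Let_def)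
  show ?thesis using is_bilinear_compose[OF 1 mult_lift_linear] unfolding flow_def[abs_def] .
qed

text \<open>The flow of the word \<open>u\<close> evaluated on the letter \<open>x\<close>; on longer words the flow extends this as a
  derivation.\<close>

definition flow_letter :: "'w list \<Rightarrow> 'w \<Rightarrow> ('w list \<Rightarrow> 'k) set"
  where "flow_letter u x = (\<Oplus>\<^bsub>A\<^esub>i\<in>{..<length u}. \<beta> (u ! i) x \<odot>\<^bsub>A\<^esub> word (rot u i))"

lemma flow_letter_linear: "u \<in> LW \<Longrightarrow> is_linear K W A (flow_letter u)"
  unfolding flow_letter_def[abs_def]
  by (rule is_linear_finsum[OF A.B.left_module_axioms])
    (rule \<beta>_linear(1)[OF A.B.left_module_axioms word_closed[OF rot_closed]]; simp add: LW_parts)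

text \<open>Multiplying the two tensor factors of the pairing puts the cut-open word \<open>u\<close> in place of the
  letter of \<open>w\<close> that it was paired with.\<close>

lemma flow_word:
  assumes u: "u \<in> LW" and w: "w \<in> LW"
  shows "flow (word u) (word w) = (\<Oplus>\<^bsub>A\<^esub>j\<in>{..<length w}. e (word (take j w)) (word (drop (Suc j) w)) \<odot>\<^bsub>regular_bimodule K A\<^esub> flow_letter u (w ! j))"
proof -
  interpret m: linear_map K T A "lift K A (\<lambda>(x, y). x \<otimes>\<^bsub>A\<^esub> y)"
    by (intro linear_mapI left_module_T A.B.left_module_axioms mult_lift_linear)
  have wd: "take j w \<in> LW" "drop (Suc j) w \<in> LW" for j using LW_parts[OF w] by simp_all
  have ud: "take i u \<in> LW" "drop (Suc i) u \<in> LW" for i using LW_parts[OF u] by simp_all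
  have b: "\<beta> (u ! i) (w ! j) \<in> carrier K" if "i < length u" "j < length w" for i j
    using \<beta>_closed[OF LW_parts(3)[OF u that(1)] LW_parts(3)[OF w that(2)]] .
  let ?p = "\<lambda>i j. pt (word (take j w @ drop (Suc i) u)) (word (take i u @ drop (Suc j) w))"
  let ?w = "\<lambda>i j. word (take j w) \<otimes>\<^bsub>A\<^esub> word (rot u i) \<otimes>\<^bsub>A\<^esub> word (drop (Suc j) w)"
  have p: "?p i j \<in> carrier T" for i j by (rule pt_words) (simp_all add: wd ud del: in_lists_conv_set)
  have wc: "?w i j \<in> carrier A" for i j
    by (intro A.B.m_closed word_closed rot_closed u wd)
  have mp: "lift K A (\<lambda>(x, y). x \<otimes>\<^bsub>A\<^esub> y) (?p i j) = ?w i j" for i j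
    using wd[of j] ud[of i] by (simp add: mult_lift_pure word_closed word_mult rot_def del: in_lists_conv_set)
  have "flow (word u) (word w) = lift K A (\<lambda>(x, y). x \<otimes>\<^bsub>A\<^esub> y) (pairing_term u w)"
    unfolding flow_def pairing_ext_def Let_def
    by (subst A_lift2_word[OF left_module_T pairing_multilinear_right pairing_multilinear_left]; (assumption | rule u w refl))
  also have "\<dots> = (\<Oplus>\<^bsub>A\<^esub>i\<in>{..<length u}. \<Oplus>\<^bsub>A\<^esub>j\<in>{..<length w}. \<beta> (u ! i) (w ! j) \<odot>\<^bsub>A\<^esub> ?w i j)"
  proof -
    have L: "lift K A (\<lambda>(x, y). x \<otimes>\<^bsub>A\<^esub> y) (\<Oplus>\<^bsub>T\<^esub> j \<in> {..<length w}. \<beta> (u ! i) (w ! j) \<odot>\<^bsub>T\<^esub> ?p i j)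
        = (\<Oplus>\<^bsub>A\<^esub>j\<in>{..<length w}. \<beta> (u ! i) (w ! j) \<odot>\<^bsub>A\<^esub> ?w i j)" if i: "i \<in> {..<length u}" for i
    proof -
      have "lift K A (\<lambda>(x, y). x \<otimes>\<^bsub>A\<^esub> y) (\<Oplus>\<^bsub>T\<^esub> j \<in> {..<length w}. \<beta> (u ! i) (w ! j) \<odot>\<^bsub>T\<^esub> ?p i j)
          = (\<Oplus>\<^bsub>A\<^esub>j\<in>{..<length w}. lift K A (\<lambda>(x, y). x \<otimes>\<^bsub>A\<^esub> y) (\<beta> (u ! i) (w ! j) \<odot>\<^bsub>T\<^esub> ?p i j))"
        using i by (intro m.map_finsum funcsetI T.smult_closed p) (simp add: b)
      also have "\<dots> = (\<Oplus>\<^bsub>A\<^esub>j\<in>{..<length w}. \<beta> (u ! i) (w ! j) \<odot>\<^bsub>A\<^esub> ?w i j)"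
        using i by (intro A.B.finsum_cong' funcsetI A.B.smult_closed wc refl) (simp_all add: b p mp)
      finally show ?thesis .
    qed
    have cT: "(\<Oplus>\<^bsub>T\<^esub> j \<in> {..<length w}. \<beta> (u ! i) (w ! j) \<odot>\<^bsub>T\<^esub> ?p i j) \<in> carrier T" if i: "i \<in> {..<length u}" for i
      using i by (intro T.finsum_closed funcsetI T.smult_closed p) (simp add: b)
    have cA: "(\<Oplus>\<^bsub>A\<^esub> j \<in> {..<length w}. \<beta> (u ! i) (w ! j) \<odot>\<^bsub>A\<^esub> ?w i j) \<in> carrier A" if i: "i \<in> {..<length u}" for i
      using i by (intro A.B.finsum_closed funcsetI A.B.smult_closed wc) (simp add: b)
    have s1: "lift K A (\<lambda>(x, y). x \<otimes>\<^bsub>A\<^esub> y) (pairing_term u w)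
        = (\<Oplus>\<^bsub>A\<^esub>i\<in>{..<length u}. lift K A (\<lambda>(x, y). x \<otimes>\<^bsub>A\<^esub> y) (\<Oplus>\<^bsub>T\<^esub> j \<in> {..<length w}. \<beta> (u ! i) (w ! j) \<odot>\<^bsub>T\<^esub> ?p i j))"
      by (rule m.map_finsum) (rule funcsetI, rule cT)
    have s2: "(\<Oplus>\<^bsub>A\<^esub>i\<in>{..<length u}. lift K A (\<lambda>(x, y). x \<otimes>\<^bsub>A\<^esub> y) (\<Oplus>\<^bsub>T\<^esub> j \<in> {..<length w}. \<beta> (u ! i) (w ! j) \<odot>\<^bsub>T\<^esub> ?p i j))
        = (\<Oplus>\<^bsub>A\<^esub>i\<in>{..<length u}. \<Oplus>\<^bsub>A\<^esub>j\<in>{..<length w}. \<beta> (u ! i) (w ! j) \<odot>\<^bsub>A\<^esub> ?w i j)"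
      by (rule A.B.finsum_cong'[OF refl funcsetI[OF cA] L])
    show ?thesis by (rule trans[OF s1 s2])
  qed
  also have "\<dots> = (\<Oplus>\<^bsub>A\<^esub>j\<in>{..<length w}. \<Oplus>\<^bsub>A\<^esub>i\<in>{..<length u}. \<beta> (u ! i) (w ! j) \<odot>\<^bsub>A\<^esub> ?w i j)"
    by (rule A.B.finsum_swap) (simp_all add: b wc del: A.B.m_closed)
  also have "\<dots> = (\<Oplus>\<^bsub>A\<^esub>j\<in>{..<length w}. e (word (take j w)) (word (drop (Suc j) w)) \<odot>\<^bsub>regular_bimodule K A\<^esub> flow_letter u (w ! j))"
  proof (rule A.B.finsum_cong'[OF refl])
    fix j assume j: "j \<in> {..<length w}"
    then have wj: "w ! j \<in> carrier W" using LW_parts(3)[OF w] by simp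
    let ?c = "e (word (take j w)) (word (drop (Suc j) w))"
    have cE: "?c \<in> carrier EA" by (rule A.ep_simps(1)[OF word_closed[OF wd(1)] word_closed[OF wd(2)]])
    interpret c: linear_map K A A "\<lambda>x. ?c \<odot>\<^bsub>regular_bimodule K A\<^esub> x"
      by (intro linear_mapI A.B.left_module_axioms A.bimodule_action_linear_right cE)
    have rc: "word (rot u i) \<in> carrier A" for i by (rule word_closed[OF rot_closed[OF u]])
    have act: "?c \<odot>\<^bsub>regular_bimodule K A\<^esub> word (rot u i) = ?w i j" for i
      by (rule A.bimodule_action_pure[OF rc word_closed[OF wd(1)] word_closed[OF wd(2)]])
    have "?c \<odot>\<^bsub>regular_bimodule K A\<^esub> flow_letter u (w ! j)
        = (\<Oplus>\<^bsub>A\<^esub>i\<in>{..<length u}. ?c \<odot>\<^bsub>regular_bimodule K A\<^esub> (\<beta> (u ! i) (w ! j) \<odot>\<^bsub>A\<^esub> word (rot u i)))"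
      unfolding flow_letter_def using j by (intro c.map_finsum funcsetI A.B.smult_closed rc) (simp add: b)
    also have "\<dots> = (\<Oplus>\<^bsub>A\<^esub>i\<in>{..<length u}. \<beta> (u ! i) (w ! j) \<odot>\<^bsub>A\<^esub> ?w i j)"
      using j by (intro A.B.finsum_cong' funcsetI A.B.smult_closed wc refl) (simp_all add: b rc act)
    finally show "(\<Oplus>\<^bsub>A\<^esub>i\<in>{..<length u}. \<beta> (u ! i) (w ! j) \<odot>\<^bsub>A\<^esub> ?w i j) = ?c \<odot>\<^bsub>regular_bimodule K A\<^esub> flow_letter u (w ! j)" ..
  next
    show "(\<lambda>j. e (word (take j w)) (word (drop (Suc j) w)) \<odot>\<^bsub>regular_bimodule K A\<^esub> flow_letter u (w ! j)) \<in> {..<length w} \<rightarrow> carrier A"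
      by (intro funcsetI is_linearD(1)[OF A.bimodule_action_linear_right] is_linearD(1)[OF flow_letter_linear[OF u]]
          A.ep_simps(1) word_closed wd LW_parts(3)[OF w]) simp
  qed
  finally show ?thesis .
qed

lemma flow_word_eq_letter_derivation:
  assumes u: "u \<in> LW" and b: "b \<in> carrier A"
  shows "flow (word u) b = lift K (restrict_scalars EA (regular_bimodule K A)) (\<lambda>w. \<Oplus>\<^bsub>restrict_scalars EA (regular_bimodule K A)\<^esub>j\<in>{..<length w}.
     e (word (take j w)) (word (drop (Suc j) w)) \<odot>\<^bsub>regular_bimodule K A\<^esub> flow_letter u (w ! j)) b"
    (is "_ = ?F b")
proof -
  have D: "is_linear K W (restrict_scalars EA (regular_bimodule K A)) (flow_letter u)"
    unfolding A.regular_bimodule_linear by (rule flow_letter_linear[OF u])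
  note R = A.left_module_regular_bimodule
  have l: "is_linear K A A ?F"
    using A.bimodule_derivationD(1)[OF letter_derivation_derivation[OF R D]]
    unfolding A.regular_bimodule_linear .
  have fs: "finsum (regular_bimodule K A) = finsum A" by (rule finsum_record_cong) (simp_all add: A.regular_bimodule_simps)
  show ?thesis
    by (rule A_linear_eqI[OF A.B.left_module_axioms is_bilinearD(1)[OF flow_bilinear word_closed[OF u]] l _ b])
      (simp only: flow_word[OF u] letter_derivation_word[OF R D] fs)
qed

lemma flow_word_letter: "u \<in> LW \<Longrightarrow> x \<in> carrier W \<Longrightarrow> flow (word u) (word [x]) = flow_letter u x"
proof -
  assume u: "u \<in> LW" and x: "x \<in> carrier W"
  have D: "is_linear K W (restrict_scalars EA (regular_bimodule K A)) (flow_letter u)"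
    unfolding A.regular_bimodule_linear by (rule flow_letter_linear[OF u])
  have "word [x] \<in> carrier A" using x by (simp add: word_closed)
  from flow_word_eq_letter_derivation[OF u this] letter_derivation_letter[OF A.left_module_regular_bimodule D x]
  show ?thesis by simp
qed

text \<open>On words the flow is the derivation determined by its values on letters, and the Leibniz rule is
  linear in the element that generates the flow.\<close>

lemma flow_mult:
  assumes a: "a \<in> carrier A" and x: "x \<in> carrier A" and y: "y \<in> carrier A"
  shows "flow a (x \<otimes>\<^bsub>A\<^esub> y) = flow a x \<otimes>\<^bsub>A\<^esub> y \<oplus>\<^bsub>A\<^esub> x \<otimes>\<^bsub>A\<^esub> flow a y"
proof -
  note fl = is_bilinearD(2)[OF flow_bilinear]
  note m = is_bilinearD[OF A.mult_bilinear]
  have xy: "x \<otimes>\<^bsub>A\<^esub> y \<in> carrier A" using x y by simp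
  have r: "is_linear K A A (\<lambda>a. flow a x \<otimes>\<^bsub>A\<^esub> y \<oplus>\<^bsub>A\<^esub> x \<otimes>\<^bsub>A\<^esub> flow a y)"
    by (rule is_linear_add[OF A.B.left_module_axioms is_linear_compose[OF fl[OF x] m(2)[OF y]] is_linear_compose[OF fl[OF y] m(1)[OF x]]])
  have w: "flow (word u) (x \<otimes>\<^bsub>A\<^esub> y) = flow (word u) x \<otimes>\<^bsub>A\<^esub> y \<oplus>\<^bsub>A\<^esub> x \<otimes>\<^bsub>A\<^esub> flow (word u) y" if u: "u \<in> LW" for u
  proof -
    have D: "is_linear K W (restrict_scalars EA (regular_bimodule K A)) (flow_letter u)"
      unfolding A.regular_bimodule_linear by (rule flow_letter_linear[OF u])
    note eq = flow_word_eq_letter_derivation[OF u, symmetric]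
    have c: "flow (word u) x \<in> carrier A" "flow (word u) y \<in> carrier A"
      by (rule is_bilinearD(3)[OF flow_bilinear word_closed[OF u]]; rule x y)+
    show ?thesis
      using A.bimodule_derivationD(5)[OF letter_derivation_derivation[OF A.left_module_regular_bimodule D] x y]
      unfolding eq[OF x] eq[OF y] eq[OF xy] using x y c
      by (simp add: A.bimodule_action_pure A.regular_bimodule_simps(2))
  qed
  show ?thesis by (rule A_linear_eqI[OF A.B.left_module_axioms fl[OF xy] r w a])
qed

lemma flow_derivation: "a \<in> carrier A \<Longrightarrow> (\<lambda>b \<in> carrier A. flow a b) \<in> derivations K A"
proof -
  assume a: "a \<in> carrier A"
  have l: "is_linear K A A (\<lambda>b \<in> carrier A. flow a b)"
    by (rule is_linear_restrict[OF A.B.left_module_axioms is_bilinearD(1)[OF flow_bilinear a]])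
  show ?thesis
    by (rule A.derivationsI[OF l restrict_extensional]) (simp add: flow_mult a)
qed

text \<open>Cutting open \<open>u @ w\<close> or \<open>w @ u\<close> at the same letter gives the same word.\<close>

lemma flow_letter_append:
  assumes u: "u \<in> LW" and w: "w \<in> LW" and x: "x \<in> carrier W"
  shows "flow_letter (u @ w) x = flow_letter (w @ u) x"
proof -
  let ?L = "\<lambda>u w. \<Oplus>\<^bsub>A\<^esub>i\<in>{..<length u}. \<beta> (u ! i) x \<odot>\<^bsub>A\<^esub> word (drop (Suc i) u @ w @ take i u)"
  have split: "flow_letter (u @ w) x = ?L u w \<oplus>\<^bsub>A\<^esub> ?L w u" and cl: "?L u w \<in> carrier A"
    if u: "u \<in> LW" and w: "w \<in> LW" for u w
  proof -
    have uw: "u @ w \<in> LW" using u w by simp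
    have c: "\<beta> ((u @ w) ! i) x \<odot>\<^bsub>A\<^esub> word (rot (u @ w) i) \<in> carrier A" if "i < length u + length w" for i
      using that by (intro A.B.smult_closed \<beta>_closed LW_parts(3)[OF uw] word_closed rot_closed uw x) simp
    have 1: "\<beta> (u ! i) x \<odot>\<^bsub>A\<^esub> word (drop (Suc i) u @ w @ take i u) = \<beta> ((u @ w) ! i) x \<odot>\<^bsub>A\<^esub> word (rot (u @ w) i)"
      if "i < length u" for i using that by (simp add: rot_def nth_append)
    have 2: "\<beta> (w ! i) x \<odot>\<^bsub>A\<^esub> word (drop (Suc i) w @ u @ take i w) = \<beta> ((u @ w) ! (length u + i)) x \<odot>\<^bsub>A\<^esub> word (rot (u @ w) (length u + i))"
      if "i < length w" for i using that by (simp add: rot_def nth_append)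
    have s1: "(\<Oplus>\<^bsub>A\<^esub>i\<in>{..<length u}. \<beta> ((u @ w) ! i) x \<odot>\<^bsub>A\<^esub> word (rot (u @ w) i)) = ?L u w"
      using 1 c by (intro A.B.finsum_cong') auto
    have c': "\<beta> (w ! i) x \<odot>\<^bsub>A\<^esub> word (drop (Suc i) w @ u @ take i w) \<in> carrier A" if "i < length w" for i
      unfolding 2[OF that] using that by (intro c) simp
    have s2: "(\<Oplus>\<^bsub>A\<^esub>i\<in>{..<length w}. \<beta> ((u @ w) ! (length u + i)) x \<odot>\<^bsub>A\<^esub> word (rot (u @ w) (length u + i))) = ?L w u"
      by (intro A.B.finsum_cong' refl funcsetI) (simp_all only: lessThan_iff 2[symmetric] c')
    show "flow_letter (u @ w) x = ?L u w \<oplus>\<^bsub>A\<^esub> ?L w u"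
      unfolding flow_letter_def length_append s1[symmetric] s2[symmetric] by (rule A.B.finsum_lessThan_add) (rule c)
    show "?L u w \<in> carrier A" using 1 c by (intro A.B.finsum_closed) auto
  qed
  show ?thesis unfolding split[OF u w] split[OF w u] by (rule A.B.a_comm[OF cl[OF u w] cl[OF w u]])
qed

text \<open>Two derivations that agree on letters are equal, so it suffices to compare the flows of two words in
  opposite orders on letters.\<close>

lemma flow_cyclic:
  assumes a: "a \<in> carrier A" and a': "a' \<in> carrier A" and b: "b \<in> carrier A"
  shows "flow (a \<otimes>\<^bsub>A\<^esub> a') b = flow (a' \<otimes>\<^bsub>A\<^esub> a) b"
proof -
  note fl = is_bilinearD(2)[OF flow_bilinear b]
  note m = is_bilinearD[OF A.mult_bilinear]
  have w: "flow (word u \<otimes>\<^bsub>A\<^esub> word w) b = flow (word w \<otimes>\<^bsub>A\<^esub> word u) b" if u: "u \<in> LW" and w: "w \<in> LW" for u w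
  proof -
    have c: "u @ w \<in> LW" "w @ u \<in> LW" using u w by simp_all
    have der: "A.bimodule_derivation (regular_bimodule K A) (\<lambda>b \<in> carrier A. flow (word v) b)" if "v \<in> LW" for v
      by (rule A.derivation_bimodule[OF flow_derivation[OF word_closed[OF that]]])
    have "(\<lambda>b \<in> carrier A. flow (word (u @ w)) b) b = (\<lambda>b \<in> carrier A. flow (word (w @ u)) b) b"
    proof (rule derivation_eqI[OF A.left_module_regular_bimodule der[OF c(1)] der[OF c(2)] _ b])
      fix x assume x: "x \<in> carrier W"
      then have "word [x] \<in> carrier A" by (simp add: word_closed)
      then show "(\<lambda>b \<in> carrier A. flow (word (u @ w)) b) (word [x]) = (\<lambda>b \<in> carrier A. flow (word (w @ u)) b) (word [x])"
        by (simp only: restrict_apply' flow_word_letter[OF c(1) x] flow_word_letter[OF c(2) x] flow_letter_append[OF u w x])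
    qed
    then show ?thesis using b by (simp only: restrict_apply' word_mult[OF u w] word_mult[OF w u])
  qed
  have "flow (word u \<otimes>\<^bsub>A\<^esub> a') b = flow (a' \<otimes>\<^bsub>A\<^esub> word u) b" if u: "u \<in> LW" for u
    by (rule A_linear_eqI[OF A.B.left_module_axioms is_linear_compose[OF m(1)[OF word_closed[OF u]] fl]
          is_linear_compose[OF m(2)[OF word_closed[OF u]] fl] w[OF u] a'])
  then show ?thesis
    by (rule A_linear_eqI[OF A.B.left_module_axioms is_linear_compose[OF m(2)[OF a'] fl] is_linear_compose[OF m(1)[OF a'] fl] _ a])
qed

abbreviation "CW \<equiv> cyclic_words K W"
abbreviation "ham \<equiv> Ham K W \<beta>"

lemma Ham_eq: "ham C = (\<lambda>b \<in> carrier A. flow (SOME a. a \<in> C) b)"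
  unfolding Ham_def Let_def flow_def ..

lemma Ham_class: "a \<in> carrier A \<Longrightarrow> ham (trace_class K A a) = (\<lambda>b \<in> carrier A. flow a b)"
  unfolding Ham_eq
  by (rule restrict_ext) (rule A.trace_descend[OF A.B.left_module_axioms is_bilinearD(2)[OF flow_bilinear] flow_cyclic])

lemma Ham_linear:
  assumes b: "b \<in> carrier A" shows "is_linear K CW A (\<lambda>C. ham C b)"
proof -
  have "is_linear K CW A (\<lambda>C. flow (SOME a. a \<in> C) b)"
    by (rule A.trace_descend_linear[OF A.B.left_module_axioms is_bilinearD(2)[OF flow_bilinear b] flow_cyclic[OF _ _ b]])
  then show ?thesis using b by (simp add: Ham_eq)
qed

lemma Ham_derivation: "C \<in> carrier CW \<Longrightarrow> ham C \<in> derivations K A"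
  unfolding A.carrier_TR by (elim imageE) (simp only: Ham_class flow_derivation)

lemma Ham_cyclic_word:
  assumes u: "u \<in> LW" and x: "x \<in> carrier W"
  shows "ham (cyclic_word K W u) (word [x]) = flow_letter u x"
proof -
  have "word [x] \<in> carrier A" using x by (simp add: word_closed)
  then show ?thesis
    unfolding cyclic_word_def Ham_class[OF word_closed[OF u]] by (simp only: restrict_apply' flow_word_letter[OF u x])
qed

end

section \<open>Coordinates on a finite-dimensional space\<close>

lemma submodule_closed:
  assumes "left_module R M" "submodule N R M"
  shows "x \<in> N \<Longrightarrow> x \<in> carrier M" "x \<in> N \<Longrightarrow> y \<in> N \<Longrightarrow> x \<oplus>\<^bsub>M\<^esub> y \<in> N" "\<zero>\<^bsub>M\<^esub> \<in> N"
    "x \<in> N \<Longrightarrow> \<ominus>\<^bsub>M\<^esub> x \<in> N" "r \<in> carrier R \<Longrightarrow> x \<in> N \<Longrightarrow> r \<odot>\<^bsub>M\<^esub> x \<in> N"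
proof -
  interpret M: left_module R M by fact
  have s: "subgroup N (add_monoid M)" using assms(2) by (rule submodule.axioms)
  show "x \<in> N \<Longrightarrow> x \<in> carrier M" using subgroup.mem_carrier[OF s] by simp
  show "x \<in> N \<Longrightarrow> y \<in> N \<Longrightarrow> x \<oplus>\<^bsub>M\<^esub> y \<in> N" using subgroup.m_closed[OF s] by simp
  show "\<zero>\<^bsub>M\<^esub> \<in> N" using subgroup.one_closed[OF s] by simp
  show "x \<in> N \<Longrightarrow> \<ominus>\<^bsub>M\<^esub> x \<in> N" using subgroup.m_inv_closed[OF s] by (simp add: a_inv_def)
  show "r \<in> carrier R \<Longrightarrow> x \<in> N \<Longrightarrow> r \<odot>\<^bsub>M\<^esub> x \<in> N" by (rule submodule.smult_closed[OF assms(2)])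
qed

lemma submodule_finsum_closed:
  assumes M: "left_module R M" and N: "submodule N R M" and f: "\<And>i. i \<in> S \<Longrightarrow> f i \<in> N"
  shows "(\<Oplus>\<^bsub>M\<^esub>i\<in>S. f i) \<in> N"
  using f
proof (induction S rule: infinite_finite_induct)
  case (insert x S)
  interpret M: left_module R M by fact
  have "f \<in> S \<rightarrow> carrier M" "f x \<in> carrier M" using insert submodule_closed(1)[OF M N] by auto
  then have "(\<Oplus>\<^bsub>M\<^esub>i\<in>insert x S. f i) = f x \<oplus>\<^bsub>M\<^esub> (\<Oplus>\<^bsub>M\<^esub>i\<in>S. f i)" using insert by simp
  also have "\<dots> \<in> N" using insert by (intro submodule_closed(2)[OF M N]) simp_all
  finally show ?case .
next
  case (infinite S)
  interpret M: left_module R M by fact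
  show ?case using infinite submodule_closed(3)[OF M N] by simp
next
  case empty
  interpret M: left_module R M by fact
  show ?case using submodule_closed(3)[OF M N] by simp
qed

text \<open>A generating set of minimal size is a basis: in a nontrivial linear relation some coefficient is
  nonzero, hence invertible in a field, and the corresponding generator could be removed. The
  coordinates of a vector are then the coefficients of its unique expression.\<close>

lemma dual_basis_exists:
  fixes K :: "('k, 'p) ring_scheme" and W :: "('k, 'w, 'q) module_scheme"
  assumes "field K" and W: "left_module K W"
    and S: "finite S" "S \<subseteq> carrier W" "submodule_generated K W S = carrier W"
  obtains I \<zeta> where "tensor_algebra_basis K W I \<zeta>"
proof -
  interpret K: field K by fact
  interpret W: left_module K W by (rule W)
  let ?P = "\<lambda>I. finite I \<and> I \<subseteq> carrier W \<and> submodule_generated K W I = carrier W"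
  obtain I where I: "?P I" and min: "\<And>J. ?P J \<Longrightarrow> card I \<le> card J"
    using ex_has_least_nat[of ?P S card] S by auto
  let ?F = "free_module K I" and ?ext = "free_ext K W (\<lambda>x. x)"
  interpret F: left_module K ?F by (rule left_module_free_module[OF K.ring_axioms])
  have idI: "(\<lambda>x. x) \<in> I \<rightarrow> carrier W" using I by auto
  have lin: "is_linear K ?F W ?ext" by (rule free_ext_linear[OF W idI])
  interpret ext: linear_map K ?F W ?ext by (intro linear_mapI F.left_module_axioms W lin)
  have IW: "x \<in> carrier W" if "x \<in> I" for x using I that by auto
  have pK: "p x \<in> carrier K" if "p \<in> carrier ?F" for p x by (rule free_module_value[OF K.ring_axioms that])
  have sum: "?ext p = (\<Oplus>\<^bsub>W\<^esub>x\<in>I. p x \<odot>\<^bsub>W\<^esub> x)" if "p \<in> carrier ?F" for p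
    by (rule free_ext_superset[OF W idI that _ subset_refl]) (use that I in \<open>auto simp: free_module_simps\<close>)
  have sub: "submodule (?ext ` carrier ?F) K W"
  proof (intro submodule.intro submodule_axioms.intro W.M.add.subgroupI)
    show "?ext ` carrier ?F \<noteq> {}" using F.M.zero_closed by blast
    fix a assume "a \<in> ?ext ` carrier ?F"
    then obtain p where p: "p \<in> carrier ?F" "a = ?ext p" by auto
    show "\<ominus>\<^bsub>W\<^esub> a \<in> ?ext ` carrier ?F" unfolding p(2) by (rule image_eqI[of _ _ "\<ominus>\<^bsub>?F\<^esub> p"]) (use p in simp_all)
    show "r \<odot>\<^bsub>W\<^esub> a \<in> ?ext ` carrier ?F" if "r \<in> carrier K" for r
      unfolding p(2) by (rule image_eqI[of _ _ "r \<odot>\<^bsub>?F\<^esub> p"]) (use p that in simp_all)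
    fix b assume "b \<in> ?ext ` carrier ?F"
    then obtain q where q: "q \<in> carrier ?F" "b = ?ext q" by auto
    show "a \<oplus>\<^bsub>W\<^esub> b \<in> ?ext ` carrier ?F"
      unfolding p(2) q(2) by (rule image_eqI[of _ _ "p \<oplus>\<^bsub>?F\<^esub> q"]) (use p q in simp_all)
  qed auto
  have "I \<subseteq> ?ext ` carrier ?F"
  proof
    fix x assume x: "x \<in> I"
    show "x \<in> ?ext ` carrier ?F"
      by (rule image_eqI[of _ _ "free_gen K x"]) (simp_all add: free_ext_gen[OF W idI x] free_gen_closed[OF K.ring_axioms x])
  qed
  then have surj: "carrier W \<subseteq> ?ext ` carrier ?F"
    using submodule_generated_submodule(3)[OF W _ sub, of I] I by simp
  \<comment> \<open>Minimality makes the generators independent.\<close>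
  have ker: "p = \<zero>\<^bsub>?F\<^esub>" if p: "p \<in> carrier ?F" and 0: "?ext p = \<zero>\<^bsub>W\<^esub>" for p
  proof (rule ccontr)
    assume "p \<noteq> \<zero>\<^bsub>?F\<^esub>"
    then obtain s where s: "p s \<noteq> \<zero>\<^bsub>K\<^esub>" by (auto simp: free_module_simps)
    then have sI: "s \<in> I" using p by (auto simp: free_module_simps)
    let ?N = "submodule_generated K W (I - {s})"
    have sW: "I - {s} \<subseteq> carrier W" using I by auto
    note gen = submodule_generated_submodule[OF W sW]
    note cl = submodule_closed[OF W gen(1)]
    have N: "(\<Oplus>\<^bsub>W\<^esub>x\<in>I - {s}. p x \<odot>\<^bsub>W\<^esub> x) \<in> ?N"
      by (rule submodule_finsum_closed[OF W gen(1)]) (use gen(2) pK[OF p] in \<open>auto intro!: cl(5)\<close>)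
    have "\<zero>\<^bsub>W\<^esub> = (\<Oplus>\<^bsub>W\<^esub>x\<in>insert s (I - {s}). p x \<odot>\<^bsub>W\<^esub> x)"
      using sum[OF p] 0 sI by (simp add: insert_absorb)
    also have "\<dots> = p s \<odot>\<^bsub>W\<^esub> s \<oplus>\<^bsub>W\<^esub> (\<Oplus>\<^bsub>W\<^esub>x\<in>I - {s}. p x \<odot>\<^bsub>W\<^esub> x)"
      using I sI pK[OF p] by (intro W.M.finsum_insert) auto
    finally have "p s \<odot>\<^bsub>W\<^esub> s = \<ominus>\<^bsub>W\<^esub> (\<Oplus>\<^bsub>W\<^esub>x\<in>I - {s}. p x \<odot>\<^bsub>W\<^esub> x)"
      using cl(1)[OF N] IW[OF sI] pK[OF p] by (metis W.M.minus_equality W.smult_closed)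
    then have ps: "p s \<odot>\<^bsub>W\<^esub> s \<in> ?N" using cl(4)[OF N] by simp
    have u: "p s \<in> Units K" using s pK[OF p] by (simp add: K.field_Units)
    have "s = (inv\<^bsub>K\<^esub> (p s) \<otimes>\<^bsub>K\<^esub> p s) \<odot>\<^bsub>W\<^esub> s" using u IW[OF sI] by simp
    also have "\<dots> = inv\<^bsub>K\<^esub> (p s) \<odot>\<^bsub>W\<^esub> (p s \<odot>\<^bsub>W\<^esub> s)"
      using u IW[OF sI] pK[OF p] by (intro W.smult_assoc1) simp_all
    also have "\<dots> \<in> ?N" by (rule cl(5)[OF K.Units_inv_closed[OF u] ps])
    finally have "s \<in> ?N" .
    then have "I \<subseteq> ?N" using gen(2) by auto
    then have "submodule_generated K W I \<subseteq> ?N" using I by (intro submodule_generated_submodule(3)[OF W _ gen(1)]) auto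
    then have "?P (I - {s})" using I cl(1) sW by auto
    from min[OF this] show False using sI I card_Diff1_less[of I s] by auto
  qed
  have inj: "p = q" if "p \<in> carrier ?F" "q \<in> carrier ?F" "?ext p = ?ext q" for p q
  proof -
    have "p \<ominus>\<^bsub>?F\<^esub> q = \<zero>\<^bsub>?F\<^esub>" using that by (intro ker) (simp_all add: ext.map_diff_eq_zero)
    then show ?thesis using linear_map.map_diff_eq_zero[OF linear_mapI[OF F.left_module_axioms F.left_module_axioms is_linear_id] that(1,2)]
      by simp
  qed
  define c where "c x = (SOME p. p \<in> carrier ?F \<and> ?ext p = x)" for x
  have c: "c x \<in> carrier ?F" "?ext (c x) = x" if "x \<in> carrier W" for x
  proof -
    have "\<exists>p. p \<in> carrier ?F \<and> ?ext p = x" using surj that by auto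
    from someI_ex[OF this] show "c x \<in> carrier ?F" "?ext (c x) = x" by (simp_all add: c_def)
  qed
  have "tensor_algebra_basis K W I (\<lambda>i x. c x i)"
  proof (intro tensor_algebra_basis.intro tensor_algebra.intro tensor_algebra_basis_axioms.intro K.cring_axioms W)
    fix i x y assume i: "i \<in> I" and x: "x \<in> carrier W"
    show "c x i \<in> carrier K" by (rule pK[OF c(1)[OF x]])
    show "c (x \<oplus>\<^bsub>W\<^esub> y) i = c x i \<oplus>\<^bsub>K\<^esub> c y i" if y: "y \<in> carrier W"
    proof -
      have "c (x \<oplus>\<^bsub>W\<^esub> y) = c x \<oplus>\<^bsub>?F\<^esub> c y" using x y by (intro inj) (simp_all add: c)
      then show ?thesis by (simp add: free_module_simps)
    qed
    show "c (r \<odot>\<^bsub>W\<^esub> x) i = r \<otimes>\<^bsub>K\<^esub> c x i" if r: "r \<in> carrier K" for r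
    proof -
      have "c (r \<odot>\<^bsub>W\<^esub> x) = r \<odot>\<^bsub>?F\<^esub> c x" using x r by (intro inj) (simp_all add: c)
      then show ?thesis by (simp add: free_module_simps)
    qed
  next
    fix x assume x: "x \<in> carrier W"
    show "(\<Oplus>\<^bsub>W\<^esub>i\<in>I. c x i \<odot>\<^bsub>W\<^esub> i) = x" using sum[OF c(1)[OF x]] c(2)[OF x] by simp
  qed (use I in auto)
  then show ?thesis by (rule that)
qed

section \<open>The divergence of Hamiltonian flows\<close>

lemma is_linear_minus:
  assumes N: "left_module R N" and f: "is_linear R M N f"
  shows "is_linear R M N (\<lambda>x. \<ominus>\<^bsub>N\<^esub> f x)"
proof -
  interpret N: left_module R N by (rule N)
  note f = is_linearD[OF f]
  have "r \<odot>\<^bsub>N\<^esub> (\<ominus>\<^bsub>N\<^esub> x) = \<ominus>\<^bsub>N\<^esub> (r \<odot>\<^bsub>N\<^esub> x)" if "r \<in> carrier R" "x \<in> carrier N" for r x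
  proof -
    have "r \<odot>\<^bsub>N\<^esub> (\<ominus>\<^bsub>N\<^esub> x) \<oplus>\<^bsub>N\<^esub> r \<odot>\<^bsub>N\<^esub> x = \<zero>\<^bsub>N\<^esub>"
      using that by (simp flip: N.smult_r_distr add: N.M.l_neg)
    then show ?thesis using that by (metis N.M.minus_equality N.smult_closed N.M.a_inv_closed)
  qed
  then show ?thesis by (intro is_linearI) (simp_all add: f N.M.minus_add)
qed

lemma (in abelian_monoid) finsum_product:
  assumes "finite S" "finite T" "\<And>s t. s \<in> S \<Longrightarrow> t \<in> T \<Longrightarrow> f (s, t) \<in> carrier G"
  shows "(\<Oplus>x\<in>S \<times> T. f x) = (\<Oplus>s\<in>S. \<Oplus>t\<in>T. f (s, t))"
  using assms(1,3)
proof induction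
  case (insert a S)
  have s: "insert a S \<times> T = Pair a ` T \<union> S \<times> T" by auto
  have "(\<Oplus>x\<in>insert a S \<times> T. f x) = (\<Oplus>x\<in>Pair a ` T. f x) \<oplus> (\<Oplus>x\<in>S \<times> T. f x)"
    unfolding s using insert assms(2) by (intro finsum_Un_disjoint) auto
  also have "(\<Oplus>x\<in>Pair a ` T. f x) = (\<Oplus>t\<in>T. f (a, t))"
    using insert by (intro finsum_reindex) (auto intro: inj_onI)
  finally show ?case using insert by simp
qed simp

lemma tensor_power_presentation: "left_module K V \<Longrightarrow> multilinear_presentation K V (lists_of_length V n)"
  by (intro multilinear_presentation.intro multilinear_presentation_axioms.intro slot_closed_lists_of_length)

context
  fixes K :: "('k, 'p) ring_scheme" and V :: "('k, 'v, 'q) module_scheme" and n :: nat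
  assumes V: "left_module K V"
begin

interpretation P: multilinear_presentation K V "lists_of_length V n" by (rule tensor_power_presentation[OF V])

lemma left_module_tensor_power: "left_module K (tensor_power K V n)"
  unfolding tensor_power_def by (rule P.left_module_PM)

lemma pure_power_gen: "xs \<in> lists_of_length V n \<Longrightarrow> pure_power K V xs = P.gen xs"
  by (simp add: pure_power_def lists_of_length_def Let_def)

lemma pure_power_multilinear: "multilinear K V (lists_of_length V n) (tensor_power K V n) (pure_power K V)"
proof -
  have 1: "is_linear K V P.PM (\<lambda>v. pure_power K V (xs @ v # ys))" if L: "xs @ v # ys \<in> lists_of_length V n" for xs v ys
  proof -
    have "is_linear K V P.PM (\<lambda>v. P.gen (xs @ v # ys))" by (rule multilinearD(2)[OF P.gen_multilinear L])
    then show ?thesis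
      by (rule is_linear_cong[THEN iffD1, rotated 2]) (use L P.slotD(2)[OF L] V in \<open>simp_all add: pure_power_gen\<close>)
  qed
  have "pure_power K V xs \<in> carrier P.PM" if "xs \<in> lists_of_length V n" for xs
    using P.gen_closed[OF that] by (simp add: pure_power_gen[OF that])
  with 1 show ?thesis unfolding multilinear_def tensor_power_def by blast
qed

lemma tensor_power_linear_eqI:
  assumes "left_module K U" "is_linear K (tensor_power K V n) U f" "is_linear K (tensor_power K V n) U g"
    "\<And>xs. xs \<in> lists_of_length V n \<Longrightarrow> f (pure_power K V xs) = g (pure_power K V xs)" "C \<in> carrier (tensor_power K V n)"
  shows "f C = g C"
  by (rule P.linear_eqI[OF assms(1,2,3)[unfolded tensor_power_def] _ assms(5)[unfolded tensor_power_def]])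
    (simp only: assms(4) pure_power_gen[symmetric])

lemma tensor_power_lift:
  assumes "left_module K U" "multilinear K V (lists_of_length V n) U F"
  shows "is_linear K (tensor_power K V n) U (lift K U F)"
    and "xs \<in> lists_of_length V n \<Longrightarrow> lift K U F (pure_power K V xs) = F xs"
proof -
  note r = P.respects_multilinear_relations[OF assms]
  show "is_linear K (tensor_power K V n) U (lift K U F)" unfolding tensor_power_def by (rule P.lift_linear[OF assms(1) r])
  show "xs \<in> lists_of_length V n \<Longrightarrow> lift K U F (pure_power K V xs) = F xs"
    by (simp only: pure_power_gen P.lift_gen[OF assms(1) r])
qed

end

locale hamiltonian_divergence = tensor_algebra_basis K W I \<zeta> + tensor_algebra_pairing K W \<beta>
  for K :: "('k, 'p) ring_scheme" and W :: "('k, 'w, 'q) module_scheme" and I \<zeta> \<beta>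
begin

definition "coc C = div_cocycle K W (canonical_connection K W) (ham C)"

lemma coc_eq: "C \<in> carrier CW \<Longrightarrow> m \<in> carrier OA \<Longrightarrow>
    coc C m = \<ominus>\<^bsub>OA\<^esub> (\<Oplus>\<^bsub>OA\<^esub>i\<in>I. \<xi> i m \<odot>\<^bsub>OA\<^esub> dA (ham C (word [i])))"
  unfolding coc_def by (rule div_cocycle_coordinates[OF Ham_derivation])

lemma ham_closed: "C \<in> carrier CW \<Longrightarrow> x \<in> carrier W \<Longrightarrow> ham C (word [x]) \<in> carrier A"
  by (rule A.derivationsD(2)[OF Ham_derivation word_closed]) simp_all

lemma coc_linear: "C \<in> carrier CW \<Longrightarrow> is_linear EA OA OA (coc C)"
proof -
  assume C: "C \<in> carrier CW"
  have "is_linear EA OA OA (\<lambda>m. \<ominus>\<^bsub>OA\<^esub> (\<Oplus>\<^bsub>OA\<^esub>i\<in>I. \<xi> i m \<odot>\<^bsub>OA\<^esub> dA (ham C (word [i]))))"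
    by (rule is_linear_minus[OF O.left_module_axioms \<xi>_sum_linear]) (rule A.d_simps(1)[OF ham_closed[OF C basis_in]])
  then show ?thesis
    by (rule is_linear_cong[THEN iffD2, OF _ O.left_module_axioms, rotated]) (rule coc_eq[OF C])
qed

lemma coc_linear_left:
  assumes m: "m \<in> carrier OA" shows "is_linear K CW (omega_K K A) (\<lambda>C. coc C m)"
proof -
  note lO = A.left_module_omega_K
  have s: "is_linear K CW (omega_K K A) (\<lambda>C. \<Oplus>\<^bsub>omega_K K A\<^esub>i\<in>I. \<xi> i m \<odot>\<^bsub>OA\<^esub> dA (ham C (word [i])))"
  proof (rule is_linear_finsum[OF lO])
    fix i assume i: "i \<in> I"
    have "word [i] \<in> carrier A" using basis_in[OF i] by (simp add: word_closed)
    from is_linear_compose[OF is_linear_compose[OF Ham_linear[OF this] A.d_linear] A.omega_action_linear[OF \<xi>_closed[OF i m]]]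
    show "is_linear K CW (omega_K K A) (\<lambda>C. \<xi> i m \<odot>\<^bsub>OA\<^esub> dA (ham C (word [i])))" .
  qed
  have n: "\<ominus>\<^bsub>EA\<^esub> \<one>\<^bsub>EA\<^esub> \<in> carrier EA" by simp
  show ?thesis
  proof (rule is_linear_cong[THEN iffD2, OF _ A.left_module_TR is_linear_compose[OF s A.omega_action_linear[OF n]]])
    fix C assume C: "C \<in> carrier CW"
    have "(\<Oplus>\<^bsub>OA\<^esub>i\<in>I. \<xi> i m \<odot>\<^bsub>OA\<^esub> dA (ham C (word [i]))) \<in> carrier OA"
      by (intro O.M.finsum_closed funcsetI O.smult_closed \<xi>_closed[OF _ m] A.d_simps(1) ham_closed[OF C] basis_in)
    then show "coc C m = (\<ominus>\<^bsub>EA\<^esub> \<one>\<^bsub>EA\<^esub>) \<odot>\<^bsub>OA\<^esub> (\<Oplus>\<^bsub>omega_K K A\<^esub>i\<in>I. \<xi> i m \<odot>\<^bsub>OA\<^esub> dA (ham C (word [i])))"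
      unfolding coc_eq[OF C m] omega_K_smult(2) by (rule O.smult_l_minus_one[symmetric])
  qed
qed

text \<open>The coordinates of \<open>dx\<close> are scalars and expand \<open>x\<close> again.\<close>

lemma coc_letter:
  assumes C: "C \<in> carrier CW" and x: "x \<in> carrier W"
  shows "coc C (dl x) = \<ominus>\<^bsub>OA\<^esub> dA (ham C (word [x]))"
proof -
  have h: "is_linear K W (omega_K K A) (\<lambda>x. dA (ham C (word [x])))"
    by (rule is_linear_compose[OF is_linear_compose[OF letter_linear A.derivationsD(1)[OF Ham_derivation[OF C]]] A.d_linear])
  show ?thesis unfolding coc_eq[OF C dl_closed[OF x]] letters_expand_omega[OF h x] ..
qed

lemma cocs_linear: "set Cs \<subseteq> carrier CW \<Longrightarrow> is_linear EA OA OA (foldr coc Cs)"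
proof (induction Cs)
  case Nil
  then show ?case using is_linear_id[of EA OA] by (simp add: id_def)
next
  case (Cons C Cs)
  then show ?case using is_linear_compose[OF Cons.IH coc_linear] by (simp add: o_def)
qed

abbreviation "tE \<equiv> trace_class K EA"
abbreviation "TE \<equiv> trace_space K EA"

lemma Div_eq:
  assumes Cs: "set Cs \<subseteq> carrier CW"
  shows "Div K W (canonical_connection K W) (map ham Cs) = (\<Oplus>\<^bsub>TE\<^esub>i\<in>I. tE (\<xi> i (foldr coc Cs (dl i))))"
proof -
  let ?\<phi> = "foldr (compose (carrier OA)) (map (div_cocycle K W (canonical_connection K W)) (map ham Cs)) (\<lambda>m \<in> carrier OA. m)"
  have \<phi>: "?\<phi> = (\<lambda>m \<in> carrier OA. foldr coc Cs m)" using Cs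
  proof (induction Cs)
    case (Cons C Cs)
    then show ?case using is_linearD(1)[OF cocs_linear] by (auto simp: compose_def coc_def[symmetric] fun_eq_iff restrict_def)
  qed (simp add: restrict_def fun_eq_iff)
  note l = cocs_linear[OF Cs]
  have "Div K W (canonical_connection K W) (map ham Cs) = (\<Oplus>\<^bsub>TE\<^esub>i\<in>I. tE (\<xi> i ((\<lambda>m \<in> carrier OA. foldr coc Cs m) (dl i))))"
    unfolding Div_def Let_def \<phi>
    by (rule C.module_trace_coordinates[OF is_linear_restrict[OF O.left_module_axioms l] restrict_extensional])
  also have "\<dots> = (\<Oplus>\<^bsub>TE\<^esub>i\<in>I. tE (\<xi> i (foldr coc Cs (dl i))))"
  proof -
    interpret TE: left_module K TE by (rule E.left_module_TR)
    show ?thesis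
      by (rule TE.finsum_cong'[OF refl])
        (simp_all add: dl_closed basis_in is_linearD(1)[OF E.tc_linear] \<xi>_closed is_linearD(1)[OF l])
  qed
  finally show ?thesis .
qed

abbreviation "TP \<equiv> tensor_power K CW"
abbreviation "cw \<equiv> cyclic_word K W"
abbreviation "split_tr \<equiv> env_trace_split K A"

lemma lTP: "left_module K (TP n)" by (rule left_module_tensor_power[OF A.left_module_TR])

lemma cw_closed: "u \<in> LW \<Longrightarrow> cw u \<in> carrier CW"
  unfolding cyclic_word_def by (rule is_linearD(1)[OF A.tc_linear word_closed])

text \<open>Reversing a product of pure tensors reverses the products of their first and of their second
  factors, and neither reversal changes the trace class. So the map to the tensor square is
  symmetric on products and descends to the trace space.\<close>

lemma
  shows split_linear: "is_linear K TE (TP 2) split_tr"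
    and split_pure: "a \<in> carrier A \<Longrightarrow> b \<in> carrier A \<Longrightarrow>
      split_tr (tE (e a b)) = pure_power K CW [trace_class K A a, trace_class K A b]"
proof -
  let ?F = "\<lambda>(a, b). pure_power K CW [trace_class K A a, trace_class K A b]"
  note pm = pure_power_multilinear[OF A.left_module_TR, of 2]
  have tcc: "trace_class K A a \<in> carrier CW" if "a \<in> carrier A" for a by (rule is_linearD(1)[OF A.tc_linear that])
  have L: "[x, y] \<in> lists_of_length CW 2" if "x \<in> carrier CW" "y \<in> carrier CW" for x y
    using that by (simp add: lists_of_length_def)
  have bil: "is_bilinear K A A (TP 2) (\<lambda>a b. ?F (a, b))"
    unfolding is_bilinear_def prod.case
  proof (intro conjI ballI)
    fix a assume a: "a \<in> carrier A"
    have z: "\<zero>\<^bsub>A\<^esub> \<in> carrier A" by simp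
    show "is_linear K A (TP 2) (\<lambda>b. pure_power K CW [trace_class K A a, trace_class K A b])"
      using is_linear_compose[OF A.tc_linear multilinearD(2)[OF pm, of "[trace_class K A a]" "trace_class K A \<zero>\<^bsub>A\<^esub>" "[]"]]
        L[OF tcc[OF a] tcc[OF z]] by simp
    show "is_linear K A (TP 2) (\<lambda>b. pure_power K CW [trace_class K A b, trace_class K A a])"
      using is_linear_compose[OF A.tc_linear multilinearD(2)[OF pm, of "[]" "trace_class K A \<zero>\<^bsub>A\<^esub>" "[trace_class K A a]"]]
        L[OF tcc[OF z] tcc[OF a]] by simp
  qed
  let ?s = "lift K (TP 2) ?F"
  have ls: "is_linear K EA (TP 2) ?s" by (rule A.E_lift_linear[OF lTP bil])
  have sp: "?s (e a b) = ?F (a, b)" if "a \<in> carrier A" "b \<in> carrier A" for a b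
    by (rule A.E_lift_pure[OF lTP bil that])
  have sym: "?s (x \<otimes>\<^bsub>EA\<^esub> y) = ?s (y \<otimes>\<^bsub>EA\<^esub> x)" if x: "x \<in> carrier EA" and y: "y \<in> carrier EA" for x y
  proof -
    note m = is_bilinearD[OF E.mult_bilinear]
    have 1: "?s (e a b \<otimes>\<^bsub>EA\<^esub> e a' b') = ?s (e a' b' \<otimes>\<^bsub>EA\<^esub> e a b)"
      if "a \<in> carrier A" "b \<in> carrier A" "a' \<in> carrier A" "b' \<in> carrier A" for a b a' b'
      using that A.tc_commute[of a a'] A.tc_commute[of b b'] by (simp add: A.ep_mult sp)
    have "?s (e a b \<otimes>\<^bsub>EA\<^esub> y) = ?s (y \<otimes>\<^bsub>EA\<^esub> e a b)" if ab: "a \<in> carrier A" "b \<in> carrier A" for a b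
      by (rule A.E_linear_eqI[OF lTP is_linear_compose[OF m(1)[OF A.ep_simps(1)[OF ab]] ls]
            is_linear_compose[OF m(2)[OF A.ep_simps(1)[OF ab]] ls] 1[OF ab] y])
    then show ?thesis
      by (rule A.E_linear_eqI[OF lTP is_linear_compose[OF m(2)[OF y] ls] is_linear_compose[OF m(1)[OF y] ls] _ x])
  qed
  have eq: "split_tr = (\<lambda>C. ?s (SOME b. b \<in> C))" by (simp add: env_trace_split_def fun_eq_iff)
  show "is_linear K TE (TP 2) split_tr"
    unfolding eq by (rule E.trace_descend_linear[OF lTP ls sym])
  show "split_tr (tE (e a b)) = pure_power K CW [trace_class K A a, trace_class K A b]"
    if "a \<in> carrier A" "b \<in> carrier A"
  proof -
    have "split_tr (tE (e a b)) = ?s (e a b)"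
      unfolding eq by (rule E.trace_descend[OF lTP ls sym A.ep_simps(1)[OF that]])
    then show ?thesis using sp[OF that] by simp
  qed
qed

text \<open>The multilinear map whose linear extension is \<open>\<delta>\<^sub>k\<close>.\<close>

definition "dv Cs = split_tr (Div K W (canonical_connection K W) (map ham Cs))"

lemma dv_eq:
  assumes Cs: "set Cs \<subseteq> carrier CW"
  shows "dv Cs = (\<Oplus>\<^bsub>TP 2\<^esub>i\<in>I. split_tr (tE (\<xi> i (foldr coc Cs (dl i)))))"
proof -
  interpret s: linear_map K TE "TP 2" split_tr by (intro linear_mapI E.left_module_TR lTP split_linear)
  show ?thesis unfolding dv_def Div_eq[OF Cs]
    by (rule s.map_finsum)
      (simp add: dl_closed basis_in is_linearD(1)[OF E.tc_linear] \<xi>_closed is_linearD(1)[OF cocs_linear[OF Cs]])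
qed

lemma dv_multilinear: "multilinear K CW (lists_of_length CW n) (TP 2) dv"
  unfolding multilinear_def
proof (intro conjI allI impI funcsetI)
  interpret P2: left_module K "TP 2" by (rule lTP)
  fix Cs assume "Cs \<in> lists_of_length CW n"
  then have Cs: "set Cs \<subseteq> carrier CW" by (auto simp: lists_of_length_def)
  show "dv Cs \<in> carrier (TP 2)" unfolding dv_eq[OF Cs]
    by (intro P2.finsum_closed funcsetI is_linearD(1)[OF split_linear] is_linearD(1)[OF E.tc_linear]
        \<xi>_closed is_linearD(1)[OF cocs_linear[OF Cs]] dl_closed basis_in)
next
  fix xs v ys assume "xs @ v # ys \<in> lists_of_length CW n"
  then have xs: "set xs \<subseteq> carrier CW" and ys: "set ys \<subseteq> carrier CW" by (auto simp: lists_of_length_def)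
  have "is_linear K CW (TP 2) (\<lambda>v. \<Oplus>\<^bsub>TP 2\<^esub>i\<in>I. split_tr (tE (\<xi> i (foldr coc xs (coc v (foldr coc ys (dl i)))))))"
  proof (rule is_linear_finsum[OF lTP])
    fix i assume i: "i \<in> I"
    have m: "foldr coc ys (dl i) \<in> carrier OA" by (rule is_linearD(1)[OF cocs_linear[OF ys] dl_closed[OF basis_in[OF i]]])
    have x: "is_linear K (omega_K K A) (omega_K K A) (foldr coc xs)"
      unfolding omega_K_def by (rule E.restrict_scalars_linear[OF cocs_linear[OF xs]])
    have z: "is_linear K (omega_K K A) EA (\<xi> i)" unfolding omega_K_def by (rule C.\<xi>_K_linear[OF i])
    show "is_linear K CW (TP 2) (\<lambda>v. split_tr (tE (\<xi> i (foldr coc xs (coc v (foldr coc ys (dl i)))))))"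
      by (rule is_linear_compose[OF is_linear_compose[OF is_linear_compose[OF is_linear_compose[OF coc_linear_left[OF m] x] z] E.tc_linear] split_linear])
  qed
  then show "is_linear K CW (TP 2) (\<lambda>v. dv (xs @ v # ys))"
    by (rule is_linear_cong[THEN iffD2, OF _ A.left_module_TR, rotated]) (use xs ys in \<open>simp add: dv_eq\<close>)
qed

lemma delta_linear: "is_linear K (TP n) (TP 2) (delta K W \<beta> (canonical_connection K W) n)"
  unfolding delta_def dv_def[symmetric]
  by (rule is_linear_restrict[OF lTP tensor_power_lift(1)[OF A.left_module_TR lTP dv_multilinear]])

lemma delta_pure:
  assumes "Cs \<in> lists_of_length CW n"
  shows "delta K W \<beta> (canonical_connection K W) n (pure_power K CW Cs) = dv Cs"
  unfolding delta_def dv_def[symmetric]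
  using multilinearD(1)[OF pure_power_multilinear[OF A.left_module_TR] assms]
    tensor_power_lift(2)[OF A.left_module_TR lTP dv_multilinear assms] by simp

end

section \<open>The divergence on cyclic words\<close>

lemma (in left_module) smult_l_minus: "a \<in> carrier R \<Longrightarrow> x \<in> carrier M \<Longrightarrow> (\<ominus>\<^bsub>R\<^esub> a) \<odot>\<^bsub>M\<^esub> x = \<ominus>\<^bsub>M\<^esub> (a \<odot>\<^bsub>M\<^esub> x)"
proof -
  assume a: "a \<in> carrier R" and x: "x \<in> carrier M"
  have "(\<ominus>\<^bsub>R\<^esub> a) \<odot>\<^bsub>M\<^esub> x \<oplus>\<^bsub>M\<^esub> a \<odot>\<^bsub>M\<^esub> x = \<zero>\<^bsub>M\<^esub>"
    using a x by (simp flip: smult_l_distr add: R.l_neg)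
  then show ?thesis using a x by (metis M.minus_equality R.a_inv_closed smult_closed)
qed

lemma (in comm_monoid) finprod_lessThan_Suc_shift:
  assumes "\<And>i. i < Suc n \<Longrightarrow> f i \<in> carrier G"
  shows "(\<Otimes>i\<in>{..<Suc n}. f i) = f 0 \<otimes> (\<Otimes>i\<in>{..<n}. f (Suc i))"
proof -
  have s: "{..<Suc n} = insert 0 (Suc ` {..<n})" by (rule lessThan_Suc_eq_insert_0)
  have "(\<Otimes>i\<in>{..<Suc n}. f i) = f 0 \<otimes> (\<Otimes>i\<in>Suc ` {..<n}. f i)"
    unfolding s using assms by (intro finprod_insert) auto
  also have "(\<Otimes>i\<in>Suc ` {..<n}. f i) = (\<Otimes>i\<in>{..<n}. f (Suc i))"
    using assms by (intro finprod_reindex) auto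
  finally show ?thesis .
qed

lemma in_listset: "l \<in> listset As \<longleftrightarrow> length l = length As \<and> (\<forall>i < length As. l ! i \<in> As ! i)"
proof (induction As arbitrary: l)
  case (Cons A As)
  have "l \<in> listset (A # As) \<longleftrightarrow> (\<exists>x xs. l = x # xs \<and> x \<in> A \<and> xs \<in> listset As)" by (simp add: set_Cons_def)
  also have "\<dots> \<longleftrightarrow> length l = length (A # As) \<and> (\<forall>i < length (A # As). l ! i \<in> (A # As) ! i)"
    by (cases l) (auto simp: Cons.IH less_Suc_eq_0_disj)
  finally show ?case .
qed auto

text \<open>The choices made by one flow and one differential: \<open>s\<close> is the position of the letter that is
  paired, and \<open>p\<close> the position, in the word \<open>rot u s\<close> that is left, of the letter that is
  differentiated.\<close>

definition steps :: "'w list \<Rightarrow> (nat \<times> nat) set"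
  where "steps u = {..<length u} \<times> {..<length u - 1}"

text \<open>The letter differentiated in the first word of a chain. An empty chain leaves the generator \<open>x\<close> to
  which the composite is applied; the result depends on \<open>x\<close> in this case only.\<close>

fun head_letter :: "('w list \<times> nat \<times> nat) list \<Rightarrow> 'w \<Rightarrow> 'w" where
  "head_letter [] x = x"
| "head_letter ((u, s, p) # ps) x = rot u s ! p"

text \<open>The segments on the two sides of the differentiated letters, multiplied in the enveloping algebra.
  The endomorphism of the first word is applied last, which puts its coefficient on the right; the
  second factor of the enveloping algebra carries the opposite product, so there the order is
  reversed.\<close>

fun inner_word :: "('w list \<times> nat \<times> nat) list \<Rightarrow> 'w list" where
  "inner_word [] = []"
| "inner_word ((u, s, p) # ps) = inner_word ps @ take p (rot u s)"

fun outer_word :: "('w list \<times> nat \<times> nat) list \<Rightarrow> 'w list" where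
  "outer_word [] = []"
| "outer_word ((u, s, p) # ps) = drop (Suc p) (rot u s) @ outer_word ps"

lemma length_rot: "s < length u \<Longrightarrow> length (rot u s) = length u - 1"
  by (simp add: rot_def)

context hamiltonian_divergence
begin

interpretation OK: left_module K "omega_K K A" by (rule A.left_module_omega_K)

lemma a_inv_omega_K: "a_inv (omega_K K A) = a_inv OA"
  by (rule ext) (simp add: a_inv_def m_inv_def A.omega_K_simps)

fun weight :: "('w list \<times> nat \<times> nat) list \<Rightarrow> 'w \<Rightarrow> 'k" where
  "weight [] x = \<one>\<^bsub>K\<^esub>"
| "weight ((u, s, p) # ps) x = (\<ominus>\<^bsub>K\<^esub> \<beta> (u ! s) (head_letter ps x)) \<otimes>\<^bsub>K\<^esub> weight ps x"

definition "eb ps = e (word (inner_word ps)) (word (outer_word ps))"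

definition "valid ps \<longleftrightarrow> (\<forall>(u, s, p) \<in> set ps. u \<in> LW \<and> s < length u \<and> p < length u - 1)"

lemma valid_Cons: "valid ((u, s, p) # ps) \<longleftrightarrow> (u \<in> LW \<and> s < length u \<and> p < length u - 1) \<and> valid ps"
  by (simp add: valid_def)

lemma rot_parts:
  assumes "u \<in> LW" "s < length u" "p < length u - 1"
  shows "rot u s ! p \<in> carrier W" "take p (rot u s) \<in> LW" "drop (Suc p) (rot u s) \<in> LW"
  using LW_parts[OF rot_closed[OF assms(1)]] assms(2,3) by (simp_all add: length_rot)

lemma head_letter_closed: "valid ps \<Longrightarrow> x \<in> carrier W \<Longrightarrow> head_letter ps x \<in> carrier W"
  by (cases "(ps, x)" rule: head_letter.cases) (simp_all add: valid_Cons rot_parts)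

lemma weight_closed: "valid ps \<Longrightarrow> x \<in> carrier W \<Longrightarrow> weight ps x \<in> carrier K"
proof (induction ps x rule: weight.induct)
  case (2 u s p ps x)
  then show ?case using LW_parts(3)[of u s] by (simp add: valid_Cons head_letter_closed \<beta>_closed)
qed simp

lemma inner_closed: "valid ps \<Longrightarrow> inner_word ps \<in> LW"
  by (induction ps rule: inner_word.induct) (simp_all add: valid_Cons rot_parts del: in_lists_conv_set)

lemma outer_closed: "valid ps \<Longrightarrow> outer_word ps \<in> LW"
  by (induction ps rule: outer_word.induct) (simp_all add: valid_Cons rot_parts del: in_lists_conv_set)

lemma eb_closed: "valid ps \<Longrightarrow> eb ps \<in> carrier EA"
  unfolding eb_def by (intro A.ep_simps(1) word_closed inner_closed outer_closed)

text \<open>The cocycle of a flow \<open>f\<close> maps \<open>dx\<close> to \<open>- d(f x)\<close>. The flow of a word replaces \<open>x\<close> by the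
  cut-open words, and \<open>d\<close> of a word is the sum over its letters.\<close>

lemma coc_word_letter:
  assumes u: "u \<in> LW" and x: "x \<in> carrier W"
  shows "coc (cw u) (dl x) = (\<Oplus>\<^bsub>OA\<^esub>q\<in>steps u.
    (weight [(u, q)] x \<odot>\<^bsub>EA\<^esub> eb [(u, q)]) \<odot>\<^bsub>OA\<^esub> dl (rot u (fst q) ! snd q))"
proof -
  let ?N = "\<lambda>a. (\<ominus>\<^bsub>K\<^esub> \<one>\<^bsub>K\<^esub>) \<odot>\<^bsub>omega_K K A\<^esub> dA a"
  have N: "is_linear K A (omega_K K A) ?N"
    by (rule is_linear_smult[OF K.cring_axioms A.left_module_omega_K A.d_linear]) simp
  interpret N: linear_map K A "omega_K K A" ?N by (intro linear_mapI A.B.left_module_axioms A.left_module_omega_K N)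
  have fc: "flow_letter u x \<in> carrier A" by (rule is_linearD(1)[OF flow_letter_linear[OF u] x])
  have b: "\<beta> (u ! s) x \<in> carrier K" if "s < length u" for s by (rule \<beta>_closed[OF LW_parts(3)[OF u that] x])
  have rc: "word (rot u s) \<in> carrier A" for s by (rule word_closed[OF rot_closed[OF u]])
  have dc: "dA (word (rot u s)) \<in> carrier (omega_K K A)" for s
    using A.d_simps(1)[OF rc] by (simp add: A.omega_K_simps)
  let ?t = "\<lambda>s p. (weight [(u, s, p)] x \<odot>\<^bsub>EA\<^esub> eb [(u, s, p)]) \<odot>\<^bsub>OA\<^esub> dl (rot u s ! p)"
  have v: "valid [(u, s, p)]" if "s < length u" "p < length u - 1" for s p
    using that u by (simp add: valid_def del: in_lists_conv_set)
  have tc: "?t s p \<in> carrier OA" if "s < length u" "p < length u - 1" for s p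
    using weight_closed[OF v[OF that] x] eb_closed[OF v[OF that]] dl_closed[OF rot_parts(1)[OF u that]] by simp
  have 1: "?N (\<beta> (u ! s) x \<odot>\<^bsub>A\<^esub> word (rot u s)) = (\<Oplus>\<^bsub>OA\<^esub>p\<in>{..<length u - 1}. ?t s p)" if s: "s < length u" for s
  proof -
    let ?e = "\<lambda>p. e (word (take p (rot u s))) (word (drop (Suc p) (rot u s)))"
    have ec: "?e p \<in> carrier EA" for p
      by (intro A.ep_simps(1) word_closed LW_parts(1,2)[OF rot_closed[OF u]])
    have lc: "dl (rot u s ! p) \<in> carrier OA" if "p < length u - 1" for p
      by (rule dl_closed[OF rot_parts(1)[OF u s that]])
    have ed: "?e p \<odot>\<^bsub>OA\<^esub> dl (rot u s ! p) \<in> carrier (omega_K K A)" if "p < length u - 1" for p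
      using O.smult_closed[OF ec lc[OF that]] by (simp add: A.omega_K_simps)
    have "?N (\<beta> (u ! s) x \<odot>\<^bsub>A\<^esub> word (rot u s)) = \<beta> (u ! s) x \<odot>\<^bsub>omega_K K A\<^esub> ?N (word (rot u s))"
      by (rule is_linearD(3)[OF N b[OF s] rc])
    also have "\<dots> = (\<ominus>\<^bsub>K\<^esub> \<beta> (u ! s) x) \<odot>\<^bsub>omega_K K A\<^esub> dA (word (rot u s))"
      using b[OF s] dc[of s] by (simp add: K.r_minus flip: OK.smult_assoc1)
    also have "dA (word (rot u s)) = (\<Oplus>\<^bsub>omega_K K A\<^esub>p\<in>{..<length u - 1}. ?e p \<odot>\<^bsub>OA\<^esub> dl (rot u s ! p))"
      using d_word[OF rot_closed[OF u, of s]] s by (simp add: length_rot omega_K_smult(2))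
    also have "(\<ominus>\<^bsub>K\<^esub> \<beta> (u ! s) x) \<odot>\<^bsub>omega_K K A\<^esub> \<dots>
        = (\<Oplus>\<^bsub>omega_K K A\<^esub>p\<in>{..<length u - 1}. (\<ominus>\<^bsub>K\<^esub> \<beta> (u ! s) x) \<odot>\<^bsub>omega_K K A\<^esub> (?e p \<odot>\<^bsub>OA\<^esub> dl (rot u s ! p)))"
      by (rule OK.finsum_smult) (use b[OF s] ed in auto)
    also have "\<dots> = (\<Oplus>\<^bsub>OA\<^esub>p\<in>{..<length u - 1}. ?t s p)"
      unfolding omega_K_smult(2)
    proof (rule O.M.finsum_cong'[OF refl])
      show "(\<lambda>p. ?t s p) \<in> {..<length u - 1} \<rightarrow> carrier OA" using tc[OF s] by (intro funcsetI) simp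
      fix p assume p: "p \<in> {..<length u - 1}"
      have w: "weight [(u, s, p)] x = \<ominus>\<^bsub>K\<^esub> \<beta> (u ! s) x" using b[OF s] by simp
      have "eb [(u, s, p)] = ?e p" by (simp add: eb_def)
      then show "(\<ominus>\<^bsub>K\<^esub> \<beta> (u ! s) x) \<odot>\<^bsub>omega_K K A\<^esub> (?e p \<odot>\<^bsub>OA\<^esub> dl (rot u s ! p)) = ?t s p"
        unfolding w using E.smult_one_smult(1)[OF O.left_module_axioms _ ec lc, of "\<ominus>\<^bsub>K\<^esub> \<beta> (u ! s) x" p p] b[OF s] p
        by (simp add: omega_K_def)
    qed
    finally show ?thesis .
  qed
  have "coc (cw u) (dl x) = \<ominus>\<^bsub>OA\<^esub> dA (flow_letter u x)"
    unfolding coc_letter[OF cw_closed[OF u] x] Ham_cyclic_word[OF u x] ..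
  also have "\<dots> = ?N (flow_letter u x)"
    using OK.smult_l_minus_one[of "dA (flow_letter u x)"] A.d_simps(1)[OF fc] by (simp add: a_inv_omega_K A.omega_K_simps)
  also have "\<dots> = (\<Oplus>\<^bsub>omega_K K A\<^esub>s\<in>{..<length u}. ?N (\<beta> (u ! s) x \<odot>\<^bsub>A\<^esub> word (rot u s)))"
    unfolding flow_letter_def by (rule N.map_finsum) (use b rc in auto)
  also have "\<dots> = (\<Oplus>\<^bsub>OA\<^esub>s\<in>{..<length u}. \<Oplus>\<^bsub>OA\<^esub>p\<in>{..<length u - 1}. ?t s p)"
    unfolding omega_K_smult(2)
  proof (rule O.M.finsum_cong'[OF refl])
    show "(\<lambda>s. \<Oplus>\<^bsub>OA\<^esub>p\<in>{..<length u - 1}. ?t s p) \<in> {..<length u} \<rightarrow> carrier OA"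
      by (intro funcsetI O.M.finsum_closed tc) simp_all
  qed (simp only: lessThan_iff 1)
  also have "\<dots> = (\<Oplus>\<^bsub>OA\<^esub>q\<in>steps u. ?t (fst q) (snd q))"
    unfolding steps_def by (subst O.M.finsum_product) (simp_all only: finite_lessThan lessThan_iff fst_conv snd_conv tc)
  finally show ?thesis unfolding prod.collapse .
qed

lemma cws_closed: "set us \<subseteq> LW \<Longrightarrow> set (map cw us) \<subseteq> carrier CW"
  unfolding set_map by (rule image_subsetI) (rule cw_closed, erule (1) subsetD)

lemma finite_steps: "finite (steps u)" by (simp add: steps_def)

lemma finite_listset_steps: "finite (listset (map steps us))"
proof (induction us)
  case (Cons u us)
  have "listset (map steps (u # us)) = (\<lambda>(q, l). q # l) ` (steps u \<times> listset (map steps us))"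
    by (auto simp: set_Cons_def)
  then show ?case by (simp only: finite_imageI finite_cartesian_product finite_steps Cons.IH)
qed simp

lemma valid_zip:
  assumes "set us \<subseteq> LW" "l \<in> listset (map steps us)" shows "valid (zip us l)"
  using assms
proof (induction us arbitrary: l)
  case (Cons u us)
  from Cons.prems(2) obtain q l' where l: "l = q # l'" "q \<in> steps u" "l' \<in> listset (map steps us)"
    by (auto simp: set_Cons_def)
  obtain s p where q: "q = (s, p)" by (cases q)
  show ?case using Cons.IH[OF _ l(3)] Cons.prems(1) l(2) unfolding l(1) q by (simp add: valid_Cons steps_def)
qed (simp add: valid_def)

text \<open>The letter differentiated in one word is the argument of the endomorphism applied next, hence is
  paired with a letter of the preceding word. The coefficient moves out of that endomorphism by
  linearity over the enveloping algebra and multiplies the new coefficient from the left.\<close>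

lemma cocs_words_letter:
  assumes us: "set us \<subseteq> LW" and x: "x \<in> carrier W"
  shows "foldr coc (map cw us) (dl x) = (\<Oplus>\<^bsub>OA\<^esub>l\<in>listset (map steps us).
    (weight (zip us l) x \<odot>\<^bsub>EA\<^esub> eb (zip us l)) \<odot>\<^bsub>OA\<^esub> dl (head_letter (zip us l) x))"
  using us
proof (induction us)
  case Nil
  have "eb [] = \<one>\<^bsub>EA\<^esub>" by (simp add: eb_def word_one[symmetric] A.ep_one)
  then show ?case using dl_closed[OF x] by simp
next
  case (Cons u us)
  then have u: "u \<in> LW" and us: "set us \<subseteq> LW" by simp_all
  let ?J = "listset (map steps us)"
  let ?b = "\<lambda>ps. weight ps x \<odot>\<^bsub>EA\<^esub> eb ps" and ?y = "\<lambda>ps. dl (head_letter ps x)"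
  interpret c: linear_map EA OA OA "coc (cw u)" by (intro linear_mapI O.left_module_axioms coc_linear cw_closed u)
  have bc: "?b ps \<in> carrier EA" and yc: "?y ps \<in> carrier OA" if "valid ps" for ps
    using weight_closed[OF that x] eb_closed[OF that] dl_closed[OF head_letter_closed[OF that x]] by simp_all
  note v = valid_zip[OF us]
  have step: "?b (zip us l) \<odot>\<^bsub>OA\<^esub> coc (cw u) (?y (zip us l))
      = (\<Oplus>\<^bsub>OA\<^esub>q\<in>steps u. ?b ((u, q) # zip us l) \<odot>\<^bsub>OA\<^esub> ?y ((u, q) # zip us l))" if l: "l \<in> ?J" for l
  proof -
    let ?z = "head_letter (zip us l) x"
    have z: "?z \<in> carrier W" by (rule head_letter_closed[OF v[OF l] x])
    let ?t = "\<lambda>q. (weight [(u, q)] ?z \<odot>\<^bsub>EA\<^esub> eb [(u, q)]) \<odot>\<^bsub>OA\<^esub> dl (rot u (fst q) ! snd q)"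
    have vq: "valid [(u, q)]" "fst q < length u" "snd q < length u - 1" if "q \<in> steps u" for q
      using that u by (auto simp: valid_def steps_def)
    have wc: "weight [(u, q)] ?z \<odot>\<^bsub>EA\<^esub> eb [(u, q)] \<in> carrier EA" if "q \<in> steps u" for q
      using weight_closed[OF vq(1)[OF that] z] eb_closed[OF vq(1)[OF that]] by simp
    have lc: "dl (rot u (fst q) ! snd q) \<in> carrier OA" if "q \<in> steps u" for q
      by (rule dl_closed[OF rot_parts(1)[OF u vq(2,3)[OF that]]])
    have m: "?b (zip us l) \<otimes>\<^bsub>EA\<^esub> (weight [(u, q)] ?z \<odot>\<^bsub>EA\<^esub> eb [(u, q)]) = ?b ((u, q) # zip us l)" if q: "q \<in> steps u" for q
    proof -
      obtain s p where sp: "q = (s, p)" by (cases q)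
      have sl: "s < length u" "p < length u - 1" using vq(2,3)[OF q] by (simp_all add: sp)
      have b: "\<beta> (u ! s) ?z \<in> carrier K" by (rule \<beta>_closed[OF LW_parts(3)[OF u sl(1)] z])
      have e1: "eb (zip us l) \<otimes>\<^bsub>EA\<^esub> eb [(u, q)] = eb ((u, q) # zip us l)"
        using inner_closed[OF v[OF l]] outer_closed[OF v[OF l]] rot_parts(2,3)[OF u sl]
        by (simp add: eb_def sp A.ep_mult word_closed word_mult del: in_lists_conv_set)
      have "?b (zip us l) \<otimes>\<^bsub>EA\<^esub> (weight [(u, q)] ?z \<odot>\<^bsub>EA\<^esub> eb [(u, q)])
          = (weight [(u, q)] ?z \<otimes>\<^bsub>K\<^esub> weight (zip us l) x) \<odot>\<^bsub>EA\<^esub> (eb (zip us l) \<otimes>\<^bsub>EA\<^esub> eb [(u, q)])"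
        using weight_closed[OF v[OF l] x] eb_closed[OF v[OF l]] weight_closed[OF vq(1)[OF q] z] eb_closed[OF vq(1)[OF q]]
        by (simp add: E.smult_mult_left E.smult_mult_right E.B.smult_assoc1 del: weight.simps)
      also have "weight [(u, q)] ?z \<otimes>\<^bsub>K\<^esub> weight (zip us l) x = weight ((u, q) # zip us l) x"
        using b by (simp add: sp)
      finally show ?thesis unfolding e1 .
    qed
    have "coc (cw u) (?y (zip us l)) = (\<Oplus>\<^bsub>OA\<^esub>q\<in>steps u. ?t q)"
      by (rule coc_word_letter[OF u z])
    then have "?b (zip us l) \<odot>\<^bsub>OA\<^esub> coc (cw u) (?y (zip us l)) = ?b (zip us l) \<odot>\<^bsub>OA\<^esub> (\<Oplus>\<^bsub>OA\<^esub>q\<in>steps u. ?t q)" by (rule arg_cong)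
    also have "\<dots> = (\<Oplus>\<^bsub>OA\<^esub>q\<in>steps u. ?b (zip us l) \<odot>\<^bsub>OA\<^esub> ?t q)"
      by (rule O.finsum_smult[OF bc[OF v[OF l]]]) (intro funcsetI O.smult_closed wc lc)
    also have "\<dots> = (\<Oplus>\<^bsub>OA\<^esub>q\<in>steps u. ?b ((u, q) # zip us l) \<odot>\<^bsub>OA\<^esub> ?y ((u, q) # zip us l))"
    proof (rule O.M.finsum_cong'[OF refl])
      show "(\<lambda>q. ?b ((u, q) # zip us l) \<odot>\<^bsub>OA\<^esub> ?y ((u, q) # zip us l)) \<in> steps u \<rightarrow> carrier OA"
      proof (intro funcsetI O.smult_closed bc yc)
        show "valid ((u, q) # zip us l)" if "q \<in> steps u" for q
          using vq(1)[OF that] v[OF l] by (simp add: valid_def)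
        then show "valid ((u, q) # zip us l)" if "q \<in> steps u" for q using that .
      qed
      fix q assume q: "q \<in> steps u"
      have y: "dl (rot u (fst q) ! snd q) = ?y ((u, q) # zip us l)" by (cases q) simp
      show "?b (zip us l) \<odot>\<^bsub>OA\<^esub> ?t q = ?b ((u, q) # zip us l) \<odot>\<^bsub>OA\<^esub> ?y ((u, q) # zip us l)"
        unfolding y[symmetric] m[OF q, symmetric]
        by (rule O.smult_assoc1[OF bc[OF v[OF l]] wc[OF q] lc[OF q], symmetric])
    qed
    finally show ?thesis .
  qed
  have vC: "valid ((u, q) # zip us l)" if "q \<in> steps u" "l \<in> ?J" for q l
  proof -
    have "q # l \<in> listset (map steps (u # us))" using that by (cases q) (simp add: set_Cons_def)
    from valid_zip[OF Cons.prems this] show ?thesis by simp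
  qed
  have tc: "?b ((u, q) # zip us l) \<odot>\<^bsub>OA\<^esub> ?y ((u, q) # zip us l) \<in> carrier OA" if "q \<in> steps u" "l \<in> ?J" for q l
    by (rule O.smult_closed[OF bc[OF vC[OF that]] yc[OF vC[OF that]]])
  have "foldr coc (map cw (u # us)) (dl x) = coc (cw u) (\<Oplus>\<^bsub>OA\<^esub>l\<in>?J. ?b (zip us l) \<odot>\<^bsub>OA\<^esub> ?y (zip us l))"
    using Cons.IH[OF us] by simp
  also have "\<dots> = (\<Oplus>\<^bsub>OA\<^esub>l\<in>?J. coc (cw u) (?b (zip us l) \<odot>\<^bsub>OA\<^esub> ?y (zip us l)))"
    by (rule c.map_finsum) (intro funcsetI O.smult_closed bc yc v)
  also have "\<dots> = (\<Oplus>\<^bsub>OA\<^esub>l\<in>?J. \<Oplus>\<^bsub>OA\<^esub>q\<in>steps u. ?b ((u, q) # zip us l) \<odot>\<^bsub>OA\<^esub> ?y ((u, q) # zip us l))"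
  proof (rule O.M.finsum_cong'[OF refl])
    show "(\<lambda>l. \<Oplus>\<^bsub>OA\<^esub>q\<in>steps u. ?b ((u, q) # zip us l) \<odot>\<^bsub>OA\<^esub> ?y ((u, q) # zip us l)) \<in> ?J \<rightarrow> carrier OA"
      by (intro funcsetI O.M.finsum_closed tc)
    fix l assume l: "l \<in> ?J"
    show "coc (cw u) (?b (zip us l) \<odot>\<^bsub>OA\<^esub> ?y (zip us l))
        = (\<Oplus>\<^bsub>OA\<^esub>q\<in>steps u. ?b ((u, q) # zip us l) \<odot>\<^bsub>OA\<^esub> ?y ((u, q) # zip us l))"
      unfolding step[OF l, symmetric] by (rule is_linearD(3)[OF coc_linear[OF cw_closed[OF u]] bc[OF v[OF l]] yc[OF v[OF l]]])
  qed
  also have "\<dots> = (\<Oplus>\<^bsub>OA\<^esub>q\<in>steps u. \<Oplus>\<^bsub>OA\<^esub>l\<in>?J. ?b ((u, q) # zip us l) \<odot>\<^bsub>OA\<^esub> ?y ((u, q) # zip us l))"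
    by (rule O.M.finsum_swap[OF tc finite_listset_steps finite_steps])
  also have "\<dots> = (\<Oplus>\<^bsub>OA\<^esub>z\<in>steps u \<times> ?J. ?b ((u, fst z) # zip us (snd z)) \<odot>\<^bsub>OA\<^esub> ?y ((u, fst z) # zip us (snd z)))"
    by (subst O.M.finsum_product[OF finite_steps finite_listset_steps]) (simp_all only: fst_conv snd_conv tc)
  also have "\<dots> = (\<Oplus>\<^bsub>OA\<^esub>l\<in>(\<lambda>z. fst z # snd z) ` (steps u \<times> ?J). ?b (zip (u # us) l) \<odot>\<^bsub>OA\<^esub> ?y (zip (u # us) l))"
    by (subst O.M.finsum_reindex) (auto intro!: inj_onI tc simp del: weight.simps head_letter.simps)
  also have "(\<lambda>z. fst z # snd z) ` (steps u \<times> ?J) = listset (map steps (u # us))"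
    by (auto simp: set_Cons_def image_iff)
  finally show ?case .
qed

text \<open>Only the last factor of the weight involves \<open>x\<close>, through the pairing with a letter of the last
  word.\<close>

lemma weight_linear:
  assumes "valid ps" "ps \<noteq> []" "b \<in> carrier EA" shows "is_linear K W EA (\<lambda>x. weight ps x \<odot>\<^bsub>EA\<^esub> b)"
  using assms(1,2)
proof (induction ps)
  case (Cons q ps)
  obtain u s p where q: "q = (u, s, p)" by (cases q)
  have u: "u \<in> LW" "s < length u" and v: "valid ps" using Cons.prems by (simp_all add: q valid_Cons del: in_lists_conv_set)
  note us = LW_parts(3)[OF u]
  show ?case
  proof (cases ps)
    case Nil
    have l: "is_linear K W EA (\<lambda>x. \<ominus>\<^bsub>EA\<^esub> (\<beta> (u ! s) x \<odot>\<^bsub>EA\<^esub> b))"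
      by (rule is_linear_minus[OF E.B.left_module_axioms \<beta>_linear(1)[OF E.B.left_module_axioms assms(3) us]])
    show ?thesis
      by (rule is_linear_cong[THEN iffD2, OF _ W.left_module_axioms l])
        (simp add: q Nil us \<beta>_closed E.B.smult_l_minus assms(3))
  next
    case (Cons q' ps')
    then have ne: "ps \<noteq> []" by simp
    have h: "head_letter ps x = head_letter ps \<zero>\<^bsub>W\<^esub>" for x by (cases q') (simp add: Cons)
    have c: "\<ominus>\<^bsub>K\<^esub> \<beta> (u ! s) (head_letter ps \<zero>\<^bsub>W\<^esub>) \<in> carrier K"
      using head_letter_closed[OF v W.M.zero_closed] us by (simp add: \<beta>_closed)
    have l: "is_linear K W EA (\<lambda>x. (\<ominus>\<^bsub>K\<^esub> \<beta> (u ! s) (head_letter ps \<zero>\<^bsub>W\<^esub>)) \<odot>\<^bsub>EA\<^esub> (weight ps x \<odot>\<^bsub>EA\<^esub> b))"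
      by (rule is_linear_smult[OF K.cring_axioms E.B.left_module_axioms Cons.IH[OF v ne] c])
    show ?thesis
    proof (rule is_linear_cong[THEN iffD2, OF _ W.left_module_axioms l])
      fix x assume x: "x \<in> carrier W"
      show "weight (q # ps) x \<odot>\<^bsub>EA\<^esub> b = (\<ominus>\<^bsub>K\<^esub> \<beta> (u ! s) (head_letter ps \<zero>\<^bsub>W\<^esub>)) \<odot>\<^bsub>EA\<^esub> (weight ps x \<odot>\<^bsub>EA\<^esub> b)"
        unfolding q weight.simps h[of x] by (rule E.B.smult_assoc1[OF c weight_closed[OF v x] assms(3)])
    qed
  qed
qed simp

text \<open>The trace sums, over the basis, the coefficient of \<open>di\<close> in the image of \<open>di\<close>. This coefficient
  is the coordinate at \<open>i\<close> of the letter differentiated in the first word, and the weight is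
  linear in \<open>i\<close> through the last word, so the sum substitutes the former into the latter and
  closes the chain. In the weight the letter differentiated in the first word appears as
  \<open>head_letter\<close> of the whole chain, with zero as an arbitrary argument, since the chain is
  nonempty.\<close>

theorem dv_words:
  assumes us: "set us \<subseteq> LW" "us \<noteq> []"
  shows "dv (map cw us) = (\<Oplus>\<^bsub>TP 2\<^esub>l\<in>listset (map steps us).
    weight (zip us l) (head_letter (zip us l) \<zero>\<^bsub>W\<^esub>) \<odot>\<^bsub>TP 2\<^esub>
      pure_power K CW [cw (inner_word (zip us l)), cw (outer_word (zip us l))])"
proof -
  interpret P2: left_module K "TP 2" by (rule lTP)
  let ?J = "listset (map steps us)" and ?\<sigma> = "\<lambda>b. split_tr (tE b)"
  let ?y = "\<lambda>l. head_letter (zip us l) \<zero>\<^bsub>W\<^esub>"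
  have \<sigma>: "is_linear K EA (TP 2) ?\<sigma>" by (rule is_linear_compose[OF E.tc_linear split_linear])
  note v = valid_zip[OF us(1)]
  have ne: "zip us l \<noteq> []" if "l \<in> ?J" for l using that us(2) by (cases us) (auto simp: set_Cons_def)
  have h: "head_letter (zip us l) x = ?y l" if "l \<in> ?J" for l x
    using ne[OF that] by (cases "(zip us l, x)" rule: head_letter.cases) auto
  have yc: "?y l \<in> carrier W" if "l \<in> ?J" for l by (rule head_letter_closed[OF v[OF that] W.M.zero_closed])
  have wl: "is_linear K W (TP 2) (\<lambda>x. ?\<sigma> (weight (zip us l) x \<odot>\<^bsub>EA\<^esub> eb (zip us l)))" if "l \<in> ?J" for l
    by (rule is_linear_compose[OF weight_linear[OF v[OF that] ne[OF that] eb_closed[OF v[OF that]]] \<sigma>])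
  have cs: "set (map cw us) \<subseteq> carrier CW" by (rule cws_closed[OF us(1)])
  have c1: "\<zeta> i (?y l) \<odot>\<^bsub>TP 2\<^esub> ?\<sigma> (weight (zip us l) i \<odot>\<^bsub>EA\<^esub> eb (zip us l)) \<in> carrier (TP 2)" if "i \<in> I" "l \<in> ?J" for i l
    by (rule P2.smult_closed[OF \<zeta>_closed[OF that(1) yc[OF that(2)]] is_linearD(1)[OF wl[OF that(2)] basis_in[OF that(1)]]])
  have 1: "?\<sigma> (\<xi> i (foldr coc (map cw us) (dl i)))
      = (\<Oplus>\<^bsub>TP 2\<^esub>l\<in>?J. \<zeta> i (?y l) \<odot>\<^bsub>TP 2\<^esub> ?\<sigma> (weight (zip us l) i \<odot>\<^bsub>EA\<^esub> eb (zip us l)))" if i: "i \<in> I" for i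
  proof -
    have z: "is_linear K (omega_K K A) EA (\<xi> i)" unfolding omega_K_def by (rule C.\<xi>_K_linear[OF i])
    interpret s: linear_map K "omega_K K A" "TP 2" "\<lambda>m. ?\<sigma> (\<xi> i m)"
      by (intro linear_mapI A.left_module_omega_K lTP is_linear_compose[OF z \<sigma>])
    let ?b = "\<lambda>l. weight (zip us l) i \<odot>\<^bsub>EA\<^esub> eb (zip us l)"
    have bc: "?b l \<in> carrier EA" if "l \<in> ?J" for l
      using weight_closed[OF v[OF that] basis_in[OF i]] eb_closed[OF v[OF that]] by simp
    have "foldr coc (map cw us) (dl i) = (\<Oplus>\<^bsub>omega_K K A\<^esub>l\<in>?J. ?b l \<odot>\<^bsub>OA\<^esub> dl (head_letter (zip us l) i))"
      unfolding cocs_words_letter[OF us(1) basis_in[OF i]] omega_K_smult(2) ..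
    then have "?\<sigma> (\<xi> i (foldr coc (map cw us) (dl i))) = ?\<sigma> (\<xi> i (\<Oplus>\<^bsub>omega_K K A\<^esub>l\<in>?J. ?b l \<odot>\<^bsub>OA\<^esub> dl (head_letter (zip us l) i)))"
      by (simp only:)
    also have "\<dots> = (\<Oplus>\<^bsub>TP 2\<^esub>l\<in>?J. ?\<sigma> (\<xi> i (?b l \<odot>\<^bsub>OA\<^esub> dl (head_letter (zip us l) i))))"
      by (rule s.map_finsum) (unfold A.omega_K_simps, intro funcsetI O.smult_closed bc dl_closed head_letter_closed v basis_in[OF i])
    also have "\<dots> = (\<Oplus>\<^bsub>TP 2\<^esub>l\<in>?J. \<zeta> i (?y l) \<odot>\<^bsub>TP 2\<^esub> ?\<sigma> (?b l))"
    proof (rule P2.finsum_cong'[OF refl])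
      show "(\<lambda>l. \<zeta> i (?y l) \<odot>\<^bsub>TP 2\<^esub> ?\<sigma> (?b l)) \<in> ?J \<rightarrow> carrier (TP 2)" by (intro funcsetI c1[OF i])
      fix l assume l: "l \<in> ?J"
      have zc: "\<zeta> i (?y l) \<in> carrier K" by (rule \<zeta>_closed[OF i yc[OF l]])
      have "\<xi> i (?b l \<odot>\<^bsub>OA\<^esub> dl (?y l)) = ?b l \<otimes>\<^bsub>EA\<^esub> (\<zeta> i (?y l) \<odot>\<^bsub>EA\<^esub> \<one>\<^bsub>EA\<^esub>)"
        using C.\<xi>_simps(3)[OF i bc[OF l] dl_closed[OF yc[OF l]]] by (simp only: \<xi>_letter[OF i yc[OF l]])
      also have "\<dots> = \<zeta> i (?y l) \<odot>\<^bsub>EA\<^esub> ?b l" using zc bc[OF l] by (simp add: E.smult_mult_right)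
      finally show "?\<sigma> (\<xi> i (?b l \<odot>\<^bsub>OA\<^esub> dl (head_letter (zip us l) i))) = \<zeta> i (?y l) \<odot>\<^bsub>TP 2\<^esub> ?\<sigma> (?b l)"
        unfolding h[OF l, of i] by (simp only: is_linearD(3)[OF \<sigma> zc bc[OF l]])
    qed
    finally show ?thesis .
  qed
  have "dv (map cw us) = (\<Oplus>\<^bsub>TP 2\<^esub>i\<in>I. \<Oplus>\<^bsub>TP 2\<^esub>l\<in>?J. \<zeta> i (?y l) \<odot>\<^bsub>TP 2\<^esub> ?\<sigma> (weight (zip us l) i \<odot>\<^bsub>EA\<^esub> eb (zip us l)))"
    unfolding dv_eq[OF cs] by (rule P2.finsum_cong'[OF refl _ 1]) (intro funcsetI P2.finsum_closed c1)
  also have "\<dots> = (\<Oplus>\<^bsub>TP 2\<^esub>l\<in>?J. \<Oplus>\<^bsub>TP 2\<^esub>i\<in>I. \<zeta> i (?y l) \<odot>\<^bsub>TP 2\<^esub> ?\<sigma> (weight (zip us l) i \<odot>\<^bsub>EA\<^esub> eb (zip us l)))"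
    by (rule P2.finsum_swap[OF c1 finite_basis finite_listset_steps])
  also have "\<dots> = (\<Oplus>\<^bsub>TP 2\<^esub>l\<in>?J. weight (zip us l) (?y l) \<odot>\<^bsub>TP 2\<^esub>
      pure_power K CW [cw (inner_word (zip us l)), cw (outer_word (zip us l))])"
  proof (rule P2.finsum_cong'[OF refl])
    have \<sigma>e: "?\<sigma> (eb (zip us l)) = pure_power K CW [cw (inner_word (zip us l)), cw (outer_word (zip us l))]" if "l \<in> ?J" for l
      unfolding eb_def cyclic_word_def
      by (rule split_pure[OF word_closed[OF inner_closed[OF v[OF that]]] word_closed[OF outer_closed[OF v[OF that]]]])
    show "(\<lambda>l. weight (zip us l) (?y l) \<odot>\<^bsub>TP 2\<^esub> pure_power K CW [cw (inner_word (zip us l)), cw (outer_word (zip us l))])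
        \<in> ?J \<rightarrow> carrier (TP 2)"
    proof (rule funcsetI)
      fix l assume l: "l \<in> ?J"
      show "weight (zip us l) (?y l) \<odot>\<^bsub>TP 2\<^esub> pure_power K CW [cw (inner_word (zip us l)), cw (outer_word (zip us l))] \<in> carrier (TP 2)"
        unfolding \<sigma>e[OF l, symmetric] by (rule P2.smult_closed[OF weight_closed[OF v[OF l] yc[OF l]] is_linearD(1)[OF \<sigma> eb_closed[OF v[OF l]]]])
    qed
    fix l assume l: "l \<in> ?J"
    show "(\<Oplus>\<^bsub>TP 2\<^esub>i\<in>I. \<zeta> i (?y l) \<odot>\<^bsub>TP 2\<^esub> ?\<sigma> (weight (zip us l) i \<odot>\<^bsub>EA\<^esub> eb (zip us l)))
        = weight (zip us l) (?y l) \<odot>\<^bsub>TP 2\<^esub> pure_power K CW [cw (inner_word (zip us l)), cw (outer_word (zip us l))]"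
      unfolding letter_expand[OF lTP wl[OF l] yc[OF l], symmetric]
      by (simp only: is_linearD(3)[OF \<sigma> weight_closed[OF v[OF l] yc[OF l]] eb_closed[OF v[OF l]]] \<sigma>e[OF l])
  qed
  finally show ?thesis .
qed

lemma cw_commute: "u \<in> LW \<Longrightarrow> w \<in> LW \<Longrightarrow> cw (u @ w) = cw (w @ u)"
  unfolding cyclic_word_def using A.tc_commute[OF word_closed word_closed, of u w] by (simp only: word_mult)

text \<open>Linear maps on the space of cyclic words are determined by their values on words, and in a tensor
  power the entries are replaced by words one after the other.\<close>

lemma CW_linear_eqI:
  assumes "left_module K U" "is_linear K CW U f" "is_linear K CW U h" "\<And>u. u \<in> LW \<Longrightarrow> f (cw u) = h (cw u)" "C \<in> carrier CW"
  shows "f C = h C"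
proof -
  obtain a where a: "a \<in> carrier A" "C = trace_class K A a" using assms(5) unfolding A.carrier_TR by (elim imageE)
  show ?thesis unfolding a(2)
    by (rule A_linear_eqI[OF assms(1) is_linear_compose[OF A.tc_linear assms(2)] is_linear_compose[OF A.tc_linear assms(3)] _ a(1)])
      (rule assms(4)[unfolded cyclic_word_def])
qed

lemma TP_linear_eqI:
  assumes U: "left_module K U" and f: "is_linear K (TP n) U f" and h: "is_linear K (TP n) U h"
    and eq: "\<And>us. length us = n \<Longrightarrow> set us \<subseteq> LW \<Longrightarrow> f (pure_power K CW (map cw us)) = h (pure_power K CW (map cw us))"
    and x: "x \<in> carrier (TP n)"
  shows "f x = h x"
proof (rule tensor_power_linear_eqI[OF A.left_module_TR U f h _ x])
  note pm = pure_power_multilinear[OF A.left_module_TR, of n]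
  have gen: "f (pure_power K CW (map cw us @ Cs)) = h (pure_power K CW (map cw us @ Cs))"
    if "set us \<subseteq> LW" "set Cs \<subseteq> carrier CW" "length us + length Cs = n" for us Cs
    using that
  proof (induction Cs arbitrary: us)
    case Nil
    then show ?case using eq[of us] by simp
  next
    case (Cons C Cs)
    have L: "map cw us @ C # Cs \<in> lists_of_length CW n"
      using Cons.prems cws_closed[OF Cons.prems(1)] by (auto simp: lists_of_length_def)
    show ?case
    proof (rule CW_linear_eqI[OF U is_linear_compose[OF multilinearD(2)[OF pm L] f] is_linear_compose[OF multilinearD(2)[OF pm L] h]])
      show "C \<in> carrier CW" using Cons.prems by simp
      fix u assume "u \<in> LW"
      then show "f (pure_power K CW (map cw us @ cw u # Cs)) = h (pure_power K CW (map cw us @ cw u # Cs))"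
        using Cons.IH[of "us @ [u]"] Cons.prems by simp
    qed
  qed
  fix Cs assume "Cs \<in> lists_of_length CW n"
  then show "f (pure_power K CW Cs) = h (pure_power K CW Cs)"
    using gen[of "[]" Cs] by (auto simp: lists_of_length_def)
qed

end

section \<open>The cycle graph\<close>

lemma cycle_graph_simps:
  "half_edges (cycle_graph k) = Out ` {1..k} \<union> Inc ` {1..k}"
  "tau0 (cycle_graph k) (Out i) = Inc i" "tau0 (cycle_graph k) (Inc i) = Out i"
  "tau1 (cycle_graph k) (Out i) = Inc (cycle_next k i)"
  "sources (cycle_graph k) = Out ` {1..k}"
  "vertex_label (cycle_graph k) (Out i) = i" "vertex_label (cycle_graph k) (Inc i) = i"
  "boundary_label (cycle_graph k) (Out i) = 1" "boundary_label (cycle_graph k) (Inc i) = 2"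
  by (simp_all add: cycle_graph_def)

lemma vertex_word_cycle:
  "vertex_word (cycle_graph k) ws (Out i) = ws ! (i - 1)" "vertex_word (cycle_graph k) ws (Inc i) = ws ! (i - 1)"
  by (simp_all add: vertex_word_def cycle_graph_simps)

text \<open>At a vertex with two half-edges every arrangement preserves the cyclic order, so a placement only
  has to be injective.\<close>

lemma placements_cycle:
  "placements (cycle_graph k) ws =
    {q \<in> (\<Pi>\<^sub>E h \<in> half_edges (cycle_graph k). {..<length (vertex_word (cycle_graph k) ws h)}).
      \<forall>i \<in> {1..k}. q (Out i) \<noteq> q (Inc i)}"
proof -
  let ?G = "cycle_graph k"
  have V: "{h' \<in> half_edges ?G. vertex_label ?G h' = vertex_label ?G h} = {Out i, Inc i}"
    if "h = Out i \<or> h = Inc i" "i \<in> {1..k}" for h i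
    using that by (auto simp: cycle_graph_simps)
  \<comment> \<open>A cyclic order involves three half-edges.\<close>
  have c: "\<not> (0 < a \<and> a < b \<and> b < card {h' \<in> half_edges ?G. vertex_label ?G h' = vertex_label ?G h})"
    if h: "h \<in> half_edges ?G" for h and a b :: nat
  proof -
    obtain i where "h = Out i \<or> h = Inc i" "i \<in> {1..k}" using h by (auto simp: cycle_graph_simps)
    from V[OF this] show ?thesis by simp arith
  qed
  have inj: "(\<forall>h \<in> half_edges ?G. inj_on q {h' \<in> half_edges ?G. vertex_label ?G h' = vertex_label ?G h})
      \<longleftrightarrow> (\<forall>i \<in> {1..k}. q (Out i) \<noteq> q (Inc i))" for q :: "cycle_half_edge \<Rightarrow> nat"
  proof (intro iffI ballI)
    fix i assume a: "\<forall>h \<in> half_edges ?G. inj_on q {h' \<in> half_edges ?G. vertex_label ?G h' = vertex_label ?G h}" and i: "i \<in> {1..k}"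
    have o: "Out i = Out i \<or> Out i = Inc i" and m: "Out i \<in> half_edges ?G" using i by (simp_all add: cycle_graph_simps(1))
    have "inj_on q {Out i, Inc i}" using bspec[OF a m] unfolding V[OF o i] .
    then show "q (Out i) \<noteq> q (Inc i)" by simp
  next
    fix h assume a: "\<forall>i \<in> {1..k}. q (Out i) \<noteq> q (Inc i)" and h: "h \<in> half_edges ?G"
    obtain i where i: "h = Out i \<or> h = Inc i" "i \<in> {1..k}" using h by (auto simp: cycle_graph_simps)
    show "inj_on q {h' \<in> half_edges ?G. vertex_label ?G h' = vertex_label ?G h}"
      unfolding V[OF i] using a i(2) by simp
  qed
  show ?thesis unfolding placements_def inj using c by blast
qed

text \<open>A step \<open>(s, p)\<close> at a word of length \<open>r\<close> marks position \<open>s\<close> and the position \<open>p\<close> places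
  further on in the word read cyclically from \<open>s + 1\<close>; conversely \<open>p\<close> is recovered as a distance
  modulo \<open>r\<close>. The remaining \<open>r - 2 - p\<close> letters lie on the way back from the second position to
  \<open>s\<close>.\<close>

lemma step_position:
  fixes s p r :: nat
  assumes "s < r" "p < r - 1"
  defines "t \<equiv> (s + 1 + p) mod r"
  shows "t < r" "t \<noteq> s" "(t + r - s - 1) mod r = p" "(s + r - t - 1) mod r = r - 2 - p"
proof -
  consider "s + 1 + p < r" | "s + 1 + p \<ge> r" by linarith
  then have "(t = s + 1 + p \<and> s + 1 + p < r) \<or> (t = s + 1 + p - r \<and> s + 1 + p \<ge> r)"
  proof cases
    case 2
    then have "t = (s + 1 + p - r) mod r" unfolding t_def by (simp add: le_mod_geq)
    with 2 assms show ?thesis by (auto simp: t_def)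
  qed (simp add: t_def)
  then have "t < r \<and> t \<noteq> s \<and> (t + r - s - 1) mod r = p \<and> (s + r - t - 1) mod r = r - 2 - p"
  proof (elim disjE conjE)
    assume a: "t = s + 1 + p" "s + 1 + p < r"
    have e: "t + r - s - 1 = p + r" "s + r - t - 1 = r - 2 - p" using a by simp_all
    show ?thesis unfolding e using a assms(1,2) by simp
  next
    assume a: "t = s + 1 + p - r" "s + 1 + p \<ge> r"
    have e: "t + r - s - 1 = p" "s + r - t - 1 = (r - 2 - p) + r" using a assms(1,2) by simp_all
    have m: "(r - 2 - p + r) mod r = r - 2 - p" using assms(1,2) by (subst mod_add_self2) simp
    show ?thesis unfolding e m using a assms(1,2) by auto
  qed
  then show "t < r" "t \<noteq> s" "(t + r - s - 1) mod r = p" "(s + r - t - 1) mod r = r - 2 - p"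
    by blast+
qed

lemma step_of_positions:
  fixes s t r :: nat
  assumes "s < r" "t < r" "t \<noteq> s"
  shows "(t + r - s - 1) mod r < r - 1" "(s + 1 + (t + r - s - 1) mod r) mod r = t"
proof -
  have "(t + r - s - 1) mod r < r - 1 \<and> (s + 1 + (t + r - s - 1) mod r) mod r = t"
  proof (cases "s < t")
    case True
    have e: "t + r - s - 1 = (t - s - 1) + r" using True by arith
    have m: "(t - s - 1 + r) mod r = t - s - 1" unfolding mod_add_self2 by (rule mod_less) (use assms in arith)
    have n: "s + 1 + (t - s - 1) = t" using True by arith
    show ?thesis unfolding e m n mod_less[OF assms(2)] using True assms(2) by arith
  next
    case False
    have m: "(t + r - s - 1) mod r = t + r - s - 1" by (rule mod_less) (use False assms in arith)
    have n: "s + 1 + (t + r - s - 1) = t + r" using False assms by arith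
    show ?thesis unfolding m n mod_add_self2 mod_less[OF assms(2)] using False assms by arith
  qed
  then show "(t + r - s - 1) mod r < r - 1" "(s + 1 + (t + r - s - 1) mod r) mod r = t" by (rule conjunct1, rule conjunct2)
qed

lemma nth_rot: "s < length u \<Longrightarrow> j < length u - 1 \<Longrightarrow> rot u s ! j = u ! ((s + 1 + j) mod length u)"
proof -
  assume s: "s < length u" and j: "j < length u - 1"
  consider "s + 1 + j < length u" | "s + 1 + j \<ge> length u" by linarith
  then show ?thesis
  proof cases
    case 1
    then have "j < length u - Suc s" by simp
    with 1 show ?thesis by (simp add: rot_def nth_append)
  next
    case 2
    have m: "(s + 1 + j) mod length u = s + 1 + j - length u"
    proof -
      have "(s + 1 + j) mod length u = (s + 1 + j - length u) mod length u" by (rule le_mod_geq[OF 2])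
      also have "\<dots> = s + 1 + j - length u" by (rule mod_less) (use s j in arith)
      finally show ?thesis .
    qed
    have nj: "\<not> j < length u - Suc s" and x: "j - (length u - Suc s) = s + 1 + j - length u" using 2 s j by arith+
    have l: "s + 1 + j - length u < s" using 2 s j by arith
    show ?thesis unfolding m rot_def nth_append length_drop x using nj l by (simp only: if_False nth_take)
  qed
qed

text \<open>The paired letter carries the outgoing half-edge and the differentiated one the incoming half-edge.
  Vertices are numbered from one, positions in lists from zero.\<close>

definition placement_of :: "nat \<Rightarrow> 'w list list \<Rightarrow> (nat \<times> nat) list \<Rightarrow> cycle_half_edge \<Rightarrow> nat"
  where "placement_of k us l = (\<lambda>h \<in> half_edges (cycle_graph k). case h of
      Out i \<Rightarrow> fst (l ! (i - 1))
    | Inc i \<Rightarrow> (fst (l ! (i - 1)) + 1 + snd (l ! (i - 1))) mod length (us ! (i - 1)))"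

lemma placement_of_simps:
  assumes "i \<in> {1..k}"
  shows "placement_of k us l (Out i) = fst (l ! (i - 1))"
    "placement_of k us l (Inc i) = (fst (l ! (i - 1)) + 1 + snd (l ! (i - 1))) mod length (us ! (i - 1))"
  using assms by (simp_all add: placement_of_def cycle_graph_simps)

lemma in_steps: "q \<in> steps u \<longleftrightarrow> fst q < length u \<and> snd q < length u - 1"
  by (cases q) (simp add: steps_def)

lemma in_listset_steps: "l \<in> listset (map steps us) \<longleftrightarrow> length l = length us \<and>
    (\<forall>i < length us. fst (l ! i) < length (us ! i) \<and> snd (l ! i) < length (us ! i) - 1)"
  by (auto simp: in_listset in_steps)

text \<open>Two distinct positions of a cyclic word are the same as a position and a nonzero cyclic distance
  from it.\<close>

lemma bij_betw_placements:
  assumes k: "length us = k"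
  shows "bij_betw (placement_of k us) (listset (map steps us)) (placements (cycle_graph k) us)"
proof (rule bij_betw_byWitness[where f' = "\<lambda>q. map (\<lambda>i. (q (Out (Suc i)),
    (q (Inc (Suc i)) + length (us ! i) - q (Out (Suc i)) - 1) mod length (us ! i))) [0..<k]"])
  let ?R = "\<lambda>q. map (\<lambda>i. (q (Out (Suc i)),
    (q (Inc (Suc i)) + length (us ! i) - q (Out (Suc i)) - 1) mod length (us ! i))) [0..<k]"
  let ?Q = "placement_of k us"
  show "\<forall>l \<in> listset (map steps us). ?R (?Q l) = l"
  proof
    fix l assume l: "l \<in> listset (map steps us)"
    show "?R (?Q l) = l"
    proof (rule nth_equalityI)
      show "length (?R (?Q l)) = length l" using l k by (simp add: in_listset_steps)
      fix i assume "i < length (?R (?Q l))"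
      then have i: "i < k" by simp
      then have b: "fst (l ! i) < length (us ! i)" "snd (l ! i) < length (us ! i) - 1"
        using l k by (simp_all add: in_listset_steps)
      show "?R (?Q l) ! i = l ! i"
        using i step_position(3)[OF b] by (simp add: placement_of_simps prod_eq_iff)
    qed
  qed
  have P: "q \<in> placements (cycle_graph k) us \<longleftrightarrow> q \<in> extensional (half_edges (cycle_graph k)) \<and>
      (\<forall>i \<in> {1..k}. q (Out i) < length (us ! (i - 1)) \<and> q (Inc i) < length (us ! (i - 1)) \<and> q (Out i) \<noteq> q (Inc i))" for q
  proof -
    have "(\<forall>h \<in> half_edges (cycle_graph k). q h \<in> {..<length (vertex_word (cycle_graph k) us h)}) \<longleftrightarrow>
        (\<forall>i \<in> {1..k}. q (Out i) < length (us ! (i - 1))) \<and> (\<forall>i \<in> {1..k}. q (Inc i) < length (us ! (i - 1)))"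
      by (simp add: cycle_graph_simps(1) ball_Un vertex_word_cycle)
    then show ?thesis
      unfolding placements_cycle PiE_def Int_iff mem_Collect_eq Pi_iff ball_conj_distrib by blast
  qed
  have sk: "i - 1 < k \<and> Suc (i - 1) = i" if "i \<in> {1..k}" for i using that by auto
  show "\<forall>q \<in> placements (cycle_graph k) us. ?Q (?R q) = q"
  proof
    fix q assume q: "q \<in> placements (cycle_graph k) us"
    show "?Q (?R q) = q"
    proof (rule extensionalityI[where A = "half_edges (cycle_graph k)"])
      show "?Q (?R q) \<in> extensional (half_edges (cycle_graph k))" unfolding placement_of_def by (rule restrict_extensional)
      show "q \<in> extensional (half_edges (cycle_graph k))" using q P by simp
      fix h assume "h \<in> half_edges (cycle_graph k)"
      then obtain i where i: "i \<in> {1..k}" and h: "h = Out i \<or> h = Inc i" by (auto simp: cycle_graph_simps(1))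
      have b: "q (Out i) < length (us ! (i - 1))" "q (Inc i) < length (us ! (i - 1))" "q (Inc i) \<noteq> q (Out i)"
        using bspec[OF conjunct2[OF q[unfolded P]] i] by auto
      show "?Q (?R q) h = q h"
        using h step_of_positions(2)[OF b] sk[OF i] by (auto simp: placement_of_simps[OF i])
    qed
  qed
  show "?Q ` listset (map steps us) \<subseteq> placements (cycle_graph k) us"
  proof (rule image_subsetI)
    fix l assume l: "l \<in> listset (map steps us)"
    have "?Q l (Out i) < length (us ! (i - 1)) \<and> ?Q l (Inc i) < length (us ! (i - 1)) \<and> ?Q l (Out i) \<noteq> ?Q l (Inc i)"
      if i: "i \<in> {1..k}" for i
    proof -
      have b: "fst (l ! (i - 1)) < length (us ! (i - 1))" "snd (l ! (i - 1)) < length (us ! (i - 1)) - 1"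
        using l k sk[OF i] by (simp_all add: in_listset_steps)
      show ?thesis using step_position(1,2)[OF b] b by (simp add: placement_of_simps[OF i])
    qed
    moreover have "?Q l \<in> extensional (half_edges (cycle_graph k))" unfolding placement_of_def by (rule restrict_extensional)
    ultimately show "?Q l \<in> placements (cycle_graph k) us" unfolding P by simp
  qed
  show "?R ` placements (cycle_graph k) us \<subseteq> listset (map steps us)"
  proof (rule image_subsetI)
    fix q assume q: "q \<in> placements (cycle_graph k) us"
    have "q (Out (Suc i)) < length (us ! i) \<and>
        (q (Inc (Suc i)) + length (us ! i) - q (Out (Suc i)) - 1) mod length (us ! i) < length (us ! i) - 1" if i: "i < k" for i
    proof -
      have b: "q (Out (Suc i)) < length (us ! i)" "q (Inc (Suc i)) < length (us ! i)" "q (Inc (Suc i)) \<noteq> q (Out (Suc i))"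
        using bspec[OF conjunct2[OF q[unfolded P]], of "Suc i"] i by auto
      show ?thesis using step_of_positions(1)[OF b] b(1) by simp
    qed
    then show "?R q \<in> listset (map steps us)" by (simp add: in_listset_steps k)
  qed
qed

text \<open>The letters from the outgoing half-edge to the incoming one precede the differentiated letter in the
  cut-open word, and those on the way back follow it.\<close>

lemma letters_after_cycle:
  assumes l: "l \<in> listset (map steps us)" and k: "length us = k" and i: "i < k"
  defines "q \<equiv> placement_of k us l"
  shows "letters_after (cycle_graph k) us q (Out (Suc i)) = take (snd (l ! i)) (rot (us ! i) (fst (l ! i)))"
    and "letters_after (cycle_graph k) us q (Inc (Suc i)) = drop (Suc (snd (l ! i))) (rot (us ! i) (fst (l ! i)))"
proof -
  let ?u = "us ! i" and ?s = "fst (l ! i)" and ?p = "snd (l ! i)"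
  let ?r = "length ?u" and ?t = "(?s + 1 + ?p) mod length ?u"
  have b: "?s < ?r" "?p < ?r - 1" using l k i by (simp_all add: in_listset_steps)
  note sp = step_position[OF b]
  have q: "q (Out (Suc i)) = ?s" "q (Inc (Suc i)) = ?t"
    using i by (simp_all add: q_def placement_of_simps)
  have lr: "length (rot ?u ?s) = ?r - 1" by (rule length_rot[OF b(1)])
  have "letters_after (cycle_graph k) us q (Out (Suc i)) = map (\<lambda>j. ?u ! ((?s + 1 + j) mod ?r)) [0..<?p]"
    unfolding letters_after_def Let_def vertex_word_cycle cycle_graph_simps q diff_Suc_1 sp(3) ..
  also have "\<dots> = take ?p (rot ?u ?s)"
    by (rule nth_equalityI) (use b lr in \<open>simp_all add: nth_rot\<close>)
  finally show "letters_after (cycle_graph k) us q (Out (Suc i)) = take ?p (rot ?u ?s)" .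
  have "letters_after (cycle_graph k) us q (Inc (Suc i)) = map (\<lambda>j. ?u ! ((?t + 1 + j) mod ?r)) [0..<?r - 2 - ?p]"
    unfolding letters_after_def Let_def vertex_word_cycle cycle_graph_simps q diff_Suc_1 sp(4) ..
  also have "\<dots> = drop (Suc ?p) (rot ?u ?s)"
  proof (rule nth_equalityI)
    show "length (map (\<lambda>j. ?u ! ((?t + 1 + j) mod ?r)) [0..<?r - 2 - ?p]) = length (drop (Suc ?p) (rot ?u ?s))"
      using lr by simp
    fix j assume "j < length (map (\<lambda>j. ?u ! ((?t + 1 + j) mod ?r)) [0..<?r - 2 - ?p])"
    then have j: "j < ?r - 2 - ?p" by simp
    have m: "(?t + 1 + j) mod ?r = (?s + 1 + (Suc ?p + j)) mod ?r"
      by (metis (no_types, lifting) add.assoc add.commute mod_add_left_eq plus_1_eq_Suc)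
    have "drop (Suc ?p) (rot ?u ?s) ! j = ?u ! ((?s + 1 + (Suc ?p + j)) mod ?r)"
    proof -
      have "Suc ?p + j < ?r - 1" using j by simp
      from nth_rot[OF b(1) this] show ?thesis using lr b by (subst nth_drop) simp_all
    qed
    then show "map (\<lambda>j. ?u ! ((?t + 1 + j) mod ?r)) [0..<?r - 2 - ?p] ! j = drop (Suc ?p) (rot ?u ?s) ! j"
      using j by (simp only: nth_map_upt add_0 diff_zero m)
  qed
  finally show "letters_after (cycle_graph k) us q (Inc (Suc i)) = drop (Suc ?p) (rot ?u ?s)" .
qed

lemma inner_word_zip:
  "length l = length us \<Longrightarrow> inner_word (zip us l) =
    concat (map (\<lambda>i. take (snd (l ! i)) (rot (us ! i) (fst (l ! i)))) (rev [0..<length us]))"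
proof (induction us arbitrary: l)
  case (Cons u us)
  then obtain q l' where l: "l = q # l'" "length l' = length us" by (cases l) auto
  obtain s p where q: "q = (s, p)" by (cases q)
  have "rev [0..<length (u # us)] = map Suc (rev [0..<length us]) @ [0]"
    by (simp only: list.size(4) add_0_right upt_conv_Cons[of 0] zero_less_Suc add_Suc_right map_Suc_upt[symmetric] rev.simps rev_map One_nat_def)
  then show ?case using Cons.IH[OF l(2)] by (simp add: l(1) q o_def del: upt_Suc)
qed simp

lemma outer_word_zip:
  "length l = length us \<Longrightarrow> outer_word (zip us l) =
    concat (map (\<lambda>i. drop (Suc (snd (l ! i))) (rot (us ! i) (fst (l ! i)))) [0..<length us])"
proof (induction us arbitrary: l)
  case (Cons u us)
  then obtain q l' where l: "l = q # l'" "length l' = length us" by (cases l) auto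
  obtain s p where q: "q = (s, p)" by (cases q)
  have "[0..<length (u # us)] = 0 # map Suc [0..<length us]"
    by (simp only: list.size(4) add_0_right upt_conv_Cons[of 0] zero_less_Suc add_Suc_right map_Suc_upt One_nat_def)
  then show ?case using Cons.IH[OF l(2)] by (simp add: l(1) q o_def del: upt_Suc)
qed simp

lemma upt_split: "i \<le> j \<Longrightarrow> j \<le> k \<Longrightarrow> [i..<k] = [i..<j] @ [j..<k]"
  using upt_add_eq_append[of i j "k - j"] by simp

lemma boundary_step_Out_wrap:
  assumes "1 \<le> i" "i \<le> j" "j < k + i"
  shows "(boundary_step (cycle_graph k) ^^ j) (Out i) = Out (k + i - j)"
proof -
  have j: "j = (j - i) + Suc (i - 1)" using assms by simp
  have "(boundary_step (cycle_graph k) ^^ Suc (i - 1)) (Out i) = Out k"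
    unfolding funpow.simps o_apply
    using boundary_step_Out_funpow[of "i - 1" i k] assms(1) by (simp add: boundary_step_Out cycle_prev_def)
  then have "(boundary_step (cycle_graph k) ^^ j) (Out i) = (boundary_step (cycle_graph k) ^^ (j - i)) (Out k)"
    by (subst j) (simp only: funpow_add o_apply)
  also have "\<dots> = Out (k - (j - i))" using assms by (intro boundary_step_Out_funpow) simp
  finally show ?thesis using assms by simp
qed

lemma boundary_step_Inc_wrap:
  assumes "1 \<le> i" "i \<le> k" "k < i + j" "j < k"
  shows "(boundary_step (cycle_graph k) ^^ j) (Inc i) = Inc (i + j - k)"
proof -
  have j: "j = (j - Suc (k - i)) + Suc (k - i)" using assms by simp
  have "(boundary_step (cycle_graph k) ^^ Suc (k - i)) (Inc i) = Inc 1"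
    using boundary_step_Inc_funpow[of i "k - i" k] assms(2) by (simp add: boundary_step_Inc cycle_next_def)
  then have "(boundary_step (cycle_graph k) ^^ j) (Inc i) = (boundary_step (cycle_graph k) ^^ (j - Suc (k - i))) (Inc 1)"
    by (subst j) (simp only: funpow_add o_apply)
  also have "\<dots> = Inc (1 + (j - Suc (k - i)))" using assms by (intro boundary_step_Inc_funpow) simp
  also have "1 + (j - Suc (k - i)) = i + j - k" using assms by simp
  finally show ?thesis .
qed

text \<open>The starting half-edge of a boundary component is arbitrary; up to rotation the words read along
  the two boundary components are the inner and the outer word.\<close>

lemma boundary_word_inner:
  assumes k: "k \<ge> 1" and f: "\<And>i. i < k \<Longrightarrow> letters_after (cycle_graph k) us q (Out (Suc i)) = f i"
  shows "\<exists>a b. boundary_word (cycle_graph k) us q 1 = a @ b \<and> concat (map f (rev [0..<k])) = b @ a"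
proof -
  let ?G = "cycle_graph k"
  \<comment> \<open>The half-edge at which the reading of the boundary starts; the boundary then visits the vertices in
  decreasing order.\<close>
  define h where "h = (SOME h. h \<in> half_edges ?G \<and> boundary_label ?G h = 1)"
  have "Out k \<in> half_edges ?G \<and> boundary_label ?G (Out k) = 1" using k by (simp add: cycle_graph_simps)
  then have "h \<in> half_edges ?G \<and> boundary_label ?G h = 1" unfolding h_def by (rule someI)
  then obtain i where h: "h = Out i" and i: "1 \<le> i" "i \<le> k" by (auto simp: cycle_graph_simps)
  have "{h \<in> half_edges ?G. boundary_label ?G h = 1} = Out ` {1..k}" by (auto simp: cycle_graph_simps)
  then have card: "card {h \<in> half_edges ?G. boundary_label ?G h = 1} = k"
    by (simp add: card_image inj_on_def)
  let ?F = "\<lambda>j. letters_after ?G us q ((boundary_step ?G ^^ j) (Out i))"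
  have s1: "[0..<k] = [0..<i] @ [i..<k]" using i by (intro upt_split) simp_all
  have A: "map ?F [0..<i] = map f (rev [0..<i])"
  proof (rule nth_equalityI)
    fix j assume "j < length (map ?F [0..<i])"
    then have j: "j < i" by simp
    have "?F j = f (i - Suc j)"
      using f[of "i - Suc j"] j i boundary_step_Out_funpow[OF j, of k] by (simp add: Suc_diff_Suc)
    then show "map ?F [0..<i] ! j = map f (rev [0..<i]) ! j" using j by (simp add: rev_nth)
  qed simp
  have B: "map ?F [i..<k] = map f (rev [i..<k])"
  proof (rule nth_equalityI)
    fix j assume "j < length (map ?F [i..<k])"
    then have j: "j < k - i" by simp
    have "?F (i + j) = f (k - Suc j)"
      using f[of "k - Suc j"] j i boundary_step_Out_wrap[of i "i + j" k] by (simp add: Suc_diff_Suc)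
    then show "map ?F [i..<k] ! j = map f (rev [i..<k]) ! j" using j by (simp add: rev_nth)
  qed simp
  have "boundary_word ?G us q 1 = concat (map ?F [0..<k])"
    unfolding boundary_word_def Let_def h_def[symmetric] card h ..
  then have "boundary_word ?G us q 1 = concat (map f (rev [0..<i])) @ concat (map f (rev [i..<k]))"
    unfolding s1 map_append concat_append A B .
  moreover have "concat (map f (rev [0..<k])) = concat (map f (rev [i..<k])) @ concat (map f (rev [0..<i]))"
    unfolding s1 by simp
  ultimately show ?thesis by blast
qed

lemma boundary_word_outer:
  assumes k: "k \<ge> 1" and f: "\<And>i. i < k \<Longrightarrow> letters_after (cycle_graph k) us q (Inc (Suc i)) = f i"
  shows "\<exists>a b. boundary_word (cycle_graph k) us q 2 = a @ b \<and> concat (map f [0..<k]) = b @ a"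
proof -
  let ?G = "cycle_graph k"
  \<comment> \<open>Along the outer boundary the vertices are visited in increasing order.\<close>
  define h where "h = (SOME h. h \<in> half_edges ?G \<and> boundary_label ?G h = 2)"
  have "Inc k \<in> half_edges ?G \<and> boundary_label ?G (Inc k) = 2" using k by (simp add: cycle_graph_simps)
  then have "h \<in> half_edges ?G \<and> boundary_label ?G h = 2" unfolding h_def by (rule someI)
  then obtain i where h: "h = Inc i" and i: "1 \<le> i" "i \<le> k" by (auto simp: cycle_graph_simps)
  have "{h \<in> half_edges ?G. boundary_label ?G h = 2} = Inc ` {1..k}" by (auto simp: cycle_graph_simps)
  then have card: "card {h \<in> half_edges ?G. boundary_label ?G h = 2} = k"
    by (simp add: card_image inj_on_def)
  let ?F = "\<lambda>j. letters_after ?G us q ((boundary_step ?G ^^ j) (Inc i))" and ?m = "Suc (k - i)"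
  have s1: "[0..<k] = [0..<?m] @ [?m..<k]" using i by (intro upt_split) simp_all
  have s2: "[0..<k] = [0..<i - 1] @ [i - 1..<k]" using i by (intro upt_split) simp_all
  have A: "map ?F [0..<?m] = map f [i - 1..<k]"
  proof (rule nth_equalityI)
    show "length (map ?F [0..<?m]) = length (map f [i - 1..<k])" using i by simp
    fix j assume "j < length (map ?F [0..<?m])"
    then have j: "j < ?m" by simp
    have "?F j = f (i - 1 + j)"
      using f[of "i - 1 + j"] j i boundary_step_Inc_funpow[of i j k] by simp
    then show "map ?F [0..<?m] ! j = map f [i - 1..<k] ! j" using j i by (simp del: upt_Suc)
  qed
  have B: "map ?F [?m..<k] = map f [0..<i - 1]"
  proof (rule nth_equalityI)
    show "length (map ?F [?m..<k]) = length (map f [0..<i - 1])" using i by simp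
    fix j assume "j < length (map ?F [?m..<k])"
    then have j: "j < i - 1" using i by simp
    have "?F (?m + j) = f j"
      using f[of j] j i boundary_step_Inc_wrap[of i k "?m + j"] by simp
    then show "map ?F [?m..<k] ! j = map f [0..<i - 1] ! j" using j i by simp
  qed
  have "boundary_word ?G us q 2 = concat (map ?F [0..<k])"
    unfolding boundary_word_def Let_def h_def[symmetric] card h ..
  then have "boundary_word ?G us q 2 = concat (map f [i - 1..<k]) @ concat (map f [0..<i - 1])"
    unfolding s1 map_append concat_append A B .
  moreover have "concat (map f [0..<k]) = concat (map f [0..<i - 1]) @ concat (map f [i - 1..<k])"
    unfolding s2 by simp
  ultimately show ?thesis by blast
qed

context hamiltonian_divergence
begin

lemma weight_zip:
  assumes "length l = length us" "valid (zip us l)" "x \<in> carrier W"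
  shows "weight (zip us l) x = (\<Otimes>\<^bsub>K\<^esub>i\<in>{..<length us}. \<ominus>\<^bsub>K\<^esub> \<beta> (us ! i ! fst (l ! i))
    (if Suc i < length us then rot (us ! Suc i) (fst (l ! Suc i)) ! snd (l ! Suc i) else x))"
  using assms(1,2)
proof (induction us arbitrary: l)
  case (Cons u us)
  then obtain q l' where l: "l = q # l'" "length l' = length us" by (cases l) auto
  obtain s p where q: "q = (s, p)" by (cases q)
  let ?f = "\<lambda>us l i. \<ominus>\<^bsub>K\<^esub> \<beta> (us ! i ! fst (l ! i))
    (if Suc i < length us then rot (us ! Suc i) (fst (l ! Suc i)) ! snd (l ! Suc i) else x)"
  have v: "valid (zip us l')" and u: "u \<in> LW" "s < length u" 
    using Cons.prems(2) by (simp_all add: l(1) q valid_Cons del: in_lists_conv_set)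
  have vi: "us ! i \<in> LW \<and> fst (l' ! i) < length (us ! i) \<and> snd (l' ! i) < length (us ! i) - 1" if "i < length us" for i
  proof -
    have "(us ! i, l' ! i) \<in> set (zip us l')" using that l(2) by (auto simp: set_zip)
    then show ?thesis using v unfolding valid_def by (auto simp del: in_lists_conv_set)
  qed
  have c: "?f (u # us) l i \<in> carrier K" if "i < Suc (length us)" for i
  proof -
    have "(u # us) ! i ! fst (l ! i) \<in> carrier W"
      using that u vi by (cases i) (auto simp: l(1) q LW_parts(3) simp del: in_lists_conv_set)
    moreover have "rot (us ! i) (fst (l' ! i)) ! snd (l' ! i) \<in> carrier W" if "i < length us" for i
      using vi[OF that] by (intro rot_parts(1)) auto
    ultimately show ?thesis using assms(3) by (simp add: \<beta>_closed l(1))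
  qed
  have hd: "head_letter (zip us l') x = (if 0 < length us then rot (us ! 0) (fst (l' ! 0)) ! snd (l' ! 0) else x)"
    using l(2) by (cases us; cases l') auto
  have "(\<Otimes>\<^bsub>K\<^esub>i\<in>{..<length (u # us)}. ?f (u # us) l i) = ?f (u # us) l 0 \<otimes>\<^bsub>K\<^esub> (\<Otimes>\<^bsub>K\<^esub>i\<in>{..<length us}. ?f (u # us) l (Suc i))"
    unfolding list.size(4) add_Suc_right add_0_right using c by (intro K.finprod_lessThan_Suc_shift) simp
  also have "?f (u # us) l 0 = \<ominus>\<^bsub>K\<^esub> \<beta> (u ! s) (head_letter (zip us l') x)"
    by (simp add: l(1) q hd)
  also have "(\<Otimes>\<^bsub>K\<^esub>i\<in>{..<length us}. ?f (u # us) l (Suc i)) = (\<Otimes>\<^bsub>K\<^esub>i\<in>{..<length us}. ?f us l' i)"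
    by (simp add: l(1) cong: if_cong)
  also have "\<dots> = weight (zip us l') x" using Cons.IH[OF l(2) v] by simp
  finally show ?case by (simp add: l(1) q)
qed simp

text \<open>Each of the \<open>k\<close> words contributes a sign to the weight of a closed chain. The scalars that remain
  are the pairings along the edges: the paired letter of a word with the differentiated letter of
  the next word, where the first word follows the last.\<close>

lemma weight_placement:
  assumes us: "set us \<subseteq> LW" and k: "length us = k" "k \<ge> 1" and l: "l \<in> listset (map steps us)"
  shows "(\<ominus>\<^bsub>K\<^esub> \<one>\<^bsub>K\<^esub>) [^]\<^bsub>K\<^esub> k \<otimes>\<^bsub>K\<^esub> weight (zip us l) (head_letter (zip us l) \<zero>\<^bsub>W\<^esub>)
    = placement_weight K \<beta> (cycle_graph k) us (placement_of k us l)"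
proof -
  let ?y = "head_letter (zip us l) \<zero>\<^bsub>W\<^esub>" and ?Q = "placement_of k us l"
  let ?H = "\<lambda>i. rot (us ! i) (fst (l ! i)) ! snd (l ! i)"
  have v: "valid (zip us l)" by (rule valid_zip[OF us l])
  have yc: "?y \<in> carrier W" by (rule head_letter_closed[OF v W.M.zero_closed])
  have li: "length l = length us" and b: "fst (l ! i) < length (us ! i)" "snd (l ! i) < length (us ! i) - 1" if "i < k" for i
    using l that k by (simp_all add: in_listset_steps)
  have ll: "length l = length us" using l by (simp add: in_listset_steps)
  have uL: "us ! i \<in> LW" if "i < k" for i using us k that by (metis nth_mem subsetD)
  have y0: "?y = ?H 0" using k ll by (cases us; cases l) auto
  let ?z = "\<lambda>i. if Suc i < k then ?H (Suc i) else ?y"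
  let ?g = "\<lambda>i. \<beta> (us ! i ! fst (l ! i)) (?z i)"
  have zc: "?z i \<in> carrier W" for i
  proof (cases "Suc i < k")
    case True
    show ?thesis using rot_parts(1)[OF uL[OF True] b[OF True]] True by simp
  qed (simp add: yc)
  have gc: "?g i \<in> carrier K" if "i < k" for i
    using zc LW_parts(3)[OF uL[OF that] b(1)[OF that]] by (intro \<beta>_closed)
  have "weight (zip us l) ?y = (\<Otimes>\<^bsub>K\<^esub>i\<in>{..<k}. \<ominus>\<^bsub>K\<^esub> ?g i)"
    using weight_zip[OF ll v yc] unfolding k(1) .
  also have "\<dots> = (\<Otimes>\<^bsub>K\<^esub>i\<in>{..<k}. (\<ominus>\<^bsub>K\<^esub> \<one>\<^bsub>K\<^esub>) \<otimes>\<^bsub>K\<^esub> ?g i)"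
    using gc by (intro K.finprod_cong') (auto simp: K.l_minus)
  also have "\<dots> = (\<Otimes>\<^bsub>K\<^esub>i\<in>{..<k}. \<ominus>\<^bsub>K\<^esub> \<one>\<^bsub>K\<^esub>) \<otimes>\<^bsub>K\<^esub> (\<Otimes>\<^bsub>K\<^esub>i\<in>{..<k}. ?g i)"
    using gc by (intro K.finprod_multf) auto
  also have "(\<Otimes>\<^bsub>K\<^esub>i\<in>{..<k}. \<ominus>\<^bsub>K\<^esub> \<one>\<^bsub>K\<^esub>) = (\<ominus>\<^bsub>K\<^esub> \<one>\<^bsub>K\<^esub>) [^]\<^bsub>K\<^esub> k"
    using K.finprod_const[of "\<ominus>\<^bsub>K\<^esub> \<one>\<^bsub>K\<^esub>" "{..<k}"] by simp
  finally have w: "weight (zip us l) ?y = (\<ominus>\<^bsub>K\<^esub> \<one>\<^bsub>K\<^esub>) [^]\<^bsub>K\<^esub> k \<otimes>\<^bsub>K\<^esub> (\<Otimes>\<^bsub>K\<^esub>i\<in>{..<k}. ?g i)" .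
  have m: "(\<ominus>\<^bsub>K\<^esub> \<one>\<^bsub>K\<^esub>) \<in> carrier K" by simp
  have sq: "(\<ominus>\<^bsub>K\<^esub> \<one>\<^bsub>K\<^esub>) [^]\<^bsub>K\<^esub> k \<otimes>\<^bsub>K\<^esub> (\<ominus>\<^bsub>K\<^esub> \<one>\<^bsub>K\<^esub>) [^]\<^bsub>K\<^esub> k = \<one>\<^bsub>K\<^esub>"
    using K.nat_pow_distrib[OF m m, of k] by (simp add: K.l_minus)
  have P: "(\<Otimes>\<^bsub>K\<^esub>i\<in>{..<k}. ?g i) \<in> carrier K" using gc by (intro K.finprod_closed) auto
  have "(\<ominus>\<^bsub>K\<^esub> \<one>\<^bsub>K\<^esub>) [^]\<^bsub>K\<^esub> k \<otimes>\<^bsub>K\<^esub> weight (zip us l) ?y = (\<Otimes>\<^bsub>K\<^esub>i\<in>{..<k}. ?g i)"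
    unfolding w using P sq m by (simp flip: K.m_assoc)
  also have "\<dots> = (\<Otimes>\<^bsub>K\<^esub>h\<in>(\<lambda>i. Out (Suc i)) ` {..<k}.
      \<beta> (vertex_word (cycle_graph k) us h ! ?Q h) (vertex_word (cycle_graph k) us (tau1 (cycle_graph k) h) ! ?Q (tau1 (cycle_graph k) h)))"
  proof -
    have e: "\<beta> (vertex_word (cycle_graph k) us (Out (Suc i)) ! ?Q (Out (Suc i)))
        (vertex_word (cycle_graph k) us (tau1 (cycle_graph k) (Out (Suc i))) ! ?Q (tau1 (cycle_graph k) (Out (Suc i)))) = ?g i"
      if i: "i < k" for i
    proof -
      \<comment> \<open>The index of the next word around the cycle.\<close>
      define i' where "i' = (if Suc i < k then Suc i else 0)"
      have n: "cycle_next k (Suc i) = Suc i'" and i': "i' < k" using i by (auto simp: cycle_next_def i'_def)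
      have "?z i = ?H i'" by (simp add: i'_def y0)
      also have "\<dots> = us ! i' ! ?Q (Inc (Suc i'))"
        using nth_rot[OF b[OF i']] i' by (simp add: placement_of_simps)
      finally show ?thesis using i by (simp add: cycle_graph_simps vertex_word_cycle n placement_of_simps(1))
    qed
    let ?W = "\<lambda>h. \<beta> (vertex_word (cycle_graph k) us h ! ?Q h)
        (vertex_word (cycle_graph k) us (tau1 (cycle_graph k) h) ! ?Q (tau1 (cycle_graph k) h))"
    have "(\<Otimes>\<^bsub>K\<^esub>i\<in>{..<k}. ?g i) = (\<Otimes>\<^bsub>K\<^esub>i\<in>{..<k}. ?W (Out (Suc i)))"
      by (rule K.finprod_cong'[OF refl]) (intro funcsetI, simp_all only: lessThan_iff e gc)
    also have "\<dots> = (\<Otimes>\<^bsub>K\<^esub>h\<in>(\<lambda>i. Out (Suc i)) ` {..<k}. ?W h)"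
    proof (rule K.finprod_reindex[symmetric])
      show "?W \<in> (\<lambda>i. Out (Suc i)) ` {..<k} \<rightarrow> carrier K"
        by (rule funcsetI, erule imageE) (simp only: lessThan_iff e gc)
      show "inj_on (\<lambda>i. Out (Suc i)) {..<k}" by (rule inj_onI) simp
    qed
    finally show ?thesis .
  qed
  also have "(\<lambda>i. Out (Suc i)) ` {..<k} = sources (cycle_graph k)"
  proof -
    have "{1..k} = Suc ` {..<k}" by (simp add: image_Suc_lessThan)
    then show ?thesis by (simp add: cycle_graph_simps image_image)
  qed
  finally show ?thesis unfolding placement_weight_def .
qed

text \<open>Under the bijection between steps and placements the summands agree one by one; a boundary word and
  the product of segments are rotations of each other, hence define the same cyclic word.\<close>

lemma operation_value_cycle:
  assumes us: "set us \<subseteq> LW" and k: "length us = k" "k \<ge> 1"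
  shows "operation_value K W \<beta> (cycle_graph k) us = (\<ominus>\<^bsub>K\<^esub> \<one>\<^bsub>K\<^esub>) [^]\<^bsub>K\<^esub> k \<odot>\<^bsub>TP 2\<^esub> dv (map cw us)"
proof -
  interpret P2: left_module K "TP 2" by (rule lTP)
  let ?G = "cycle_graph k" and ?J = "listset (map steps us)" and ?Q = "placement_of k us"
  let ?w = "\<lambda>l. weight (zip us l) (head_letter (zip us l) \<zero>\<^bsub>W\<^esub>)"
  let ?p = "\<lambda>l. pure_power K CW [cw (inner_word (zip us l)), cw (outer_word (zip us l))]"
  let ?c = "(\<ominus>\<^bsub>K\<^esub> \<one>\<^bsub>K\<^esub>) [^]\<^bsub>K\<^esub> k"
  let ?V = "\<lambda>q. placement_weight K \<beta> ?G us q \<odot>\<^bsub>TP 2\<^esub>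
      pure_power K CW (map (\<lambda>l. cw (boundary_word ?G us q l)) [1..<Suc 2])"
  have v: "valid (zip us l)" if "l \<in> ?J" for l by (rule valid_zip[OF us that])
  have ic: "inner_word (zip us l) \<in> LW" "outer_word (zip us l) \<in> LW" if "l \<in> ?J" for l
    by (rule inner_closed[OF v[OF that]], rule outer_closed[OF v[OF that]])
  have pc: "?p l \<in> carrier (TP 2)" if "l \<in> ?J" for l
    by (rule multilinearD(1)[OF pure_power_multilinear[OF A.left_module_TR]])
      (unfold lists_of_length_def, use cw_closed[OF ic(1)[OF that]] cw_closed[OF ic(2)[OF that]] in simp)
  have wc: "?w l \<in> carrier K" if "l \<in> ?J" for l
    by (rule weight_closed[OF v[OF that] head_letter_closed[OF v[OF that] W.M.zero_closed]])
  have cc: "?c \<in> carrier K" by simp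
  have V: "?V (?Q l) = ?c \<odot>\<^bsub>TP 2\<^esub> (?w l \<odot>\<^bsub>TP 2\<^esub> ?p l)" if l: "l \<in> ?J" for l
  proof -
    have ll: "length l = length us" using l by (simp add: in_listset_steps)
    have upt: "[1..<Suc 2] = [1, 2]" by (simp add: upt_rec)
    note la = letters_after_cycle[OF l k(1)]
    obtain a b where ab: "boundary_word ?G us (?Q l) 1 = a @ b" "inner_word (zip us l) = b @ a"
      using boundary_word_inner[OF k(2) la(1)] unfolding inner_word_zip[OF ll] k(1) by blast
    obtain a' b' where ab': "boundary_word ?G us (?Q l) 2 = a' @ b'" "outer_word (zip us l) = b' @ a'"
      using boundary_word_outer[OF k(2) la(2)] unfolding outer_word_zip[OF ll] k(1) by blast
    have "cw (a @ b) = cw (b @ a)" "cw (a' @ b') = cw (b' @ a')"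
      using ic[OF l] unfolding ab(2) ab'(2) by (auto intro!: cw_commute simp del: in_lists_conv_set)
    then have "map (\<lambda>i. cw (boundary_word ?G us (?Q l) i)) [1..<Suc 2] = [cw (inner_word (zip us l)), cw (outer_word (zip us l))]"
      unfolding upt using ab ab' by simp
    then show ?thesis
      unfolding weight_placement[OF us k l, symmetric] P2.smult_assoc1[OF cc wc[OF l] pc[OF l], symmetric] by simp
  qed
  have Vc: "?V (?Q l) \<in> carrier (TP 2)" if "l \<in> ?J" for l
    unfolding V[OF that] by (intro P2.smult_closed cc wc pc that)
  have "operation_value K W \<beta> ?G us = (\<Oplus>\<^bsub>TP 2\<^esub>q\<in>placements ?G us. ?V q)"
    unfolding operation_value_def directed_labelled_ribbon_graph_cycle_graph(3)[OF k(2)] ..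
  also have "placements ?G us = ?Q ` ?J" using bij_betw_placements[OF k(1)] by (simp add: bij_betw_def)
  also have "(\<Oplus>\<^bsub>TP 2\<^esub>q\<in>?Q ` ?J. ?V q) = (\<Oplus>\<^bsub>TP 2\<^esub>l\<in>?J. ?V (?Q l))"
  proof (rule P2.M.finsum_reindex)
    show "?V \<in> ?Q ` ?J \<rightarrow> carrier (TP 2)" by (rule funcsetI, erule imageE) (simp only: Vc)
    show "inj_on ?Q ?J" using bij_betw_placements[OF k(1)] by (simp add: bij_betw_def)
  qed
  also have "\<dots> = (\<Oplus>\<^bsub>TP 2\<^esub>l\<in>?J. ?c \<odot>\<^bsub>TP 2\<^esub> (?w l \<odot>\<^bsub>TP 2\<^esub> ?p l))"
    by (rule P2.M.finsum_cong'[OF refl _ V]) (intro funcsetI P2.smult_closed cc wc pc)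
  also have "\<dots> = ?c \<odot>\<^bsub>TP 2\<^esub> (\<Oplus>\<^bsub>TP 2\<^esub>l\<in>?J. ?w l \<odot>\<^bsub>TP 2\<^esub> ?p l)"
    by (rule P2.finsum_smult[OF cc, symmetric]) (intro funcsetI P2.smult_closed wc pc)
  also have "(\<Oplus>\<^bsub>TP 2\<^esub>l\<in>?J. ?w l \<odot>\<^bsub>TP 2\<^esub> ?p l) = dv (map cw us)"
    by (rule dv_words[OF us, symmetric]) (use k in auto)
  finally show ?thesis .
qed

text \<open>The graph operation is the unique linear map with prescribed values on words, and the left-hand side
  is linear and has these values.\<close>

theorem delta_eq_graph_operation:
  assumes k: "k \<ge> 1"
  shows "(\<lambda>x \<in> carrier (TP k). (\<ominus>\<^bsub>K\<^esub> \<one>\<^bsub>K\<^esub>) [^]\<^bsub>K\<^esub> k \<odot>\<^bsub>TP 2\<^esub> delta K W \<beta> (canonical_connection K W) k x)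
    = graph_operation K W \<beta> (cycle_graph k)"
proof -
  let ?L = "\<lambda>x \<in> carrier (TP k). (\<ominus>\<^bsub>K\<^esub> \<one>\<^bsub>K\<^esub>) [^]\<^bsub>K\<^esub> k \<odot>\<^bsub>TP 2\<^esub> delta K W \<beta> (canonical_connection K W) k x"
  have lin: "is_linear K (TP k) (TP 2) ?L"
    by (rule is_linear_restrict[OF lTP is_linear_smult[OF K.cring_axioms lTP delta_linear]]) simp
  have L: "map cw us \<in> lists_of_length CW k" if "length us = k" "set us \<subseteq> LW" for us
    using that(1) cws_closed[OF that(2)] by (auto simp: lists_of_length_def)
  have val: "?L (pure_power K CW (map cw us)) = operation_value K W \<beta> (cycle_graph k) us"
    if u: "length us = k" "set us \<subseteq> LW" for us
    using multilinearD(1)[OF pure_power_multilinear[OF A.left_module_TR] L[OF u]]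
    by (simp only: restrict_apply' delta_pure[OF L[OF u]] operation_value_cycle[OF u(2,1) k])
  show ?thesis
    unfolding graph_operation_def directed_labelled_ribbon_graph_cycle_graph(2,3)[OF k]
  proof (rule the_equality[symmetric])
    show "?L \<in> linear_maps K (TP k) (TP 2) \<and>
      (\<forall>ws. length ws = k \<and> set ws \<subseteq> LW \<longrightarrow> ?L (pure_power K CW (map cw ws)) = operation_value K W \<beta> (cycle_graph k) ws)"
      unfolding linear_maps_iff using val by (intro conjI lin restrict_extensional allI impI) blast
    fix \<Phi> assume \<Phi>: "\<Phi> \<in> linear_maps K (TP k) (TP 2) \<and>
      (\<forall>ws. length ws = k \<and> set ws \<subseteq> LW \<longrightarrow> \<Phi> (pure_power K CW (map cw ws)) = operation_value K W \<beta> (cycle_graph k) ws)"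
    then have l: "is_linear K (TP k) (TP 2) \<Phi>" and e: "\<Phi> \<in> extensional (carrier (TP k))"
      by (simp_all add: linear_maps_iff)
    show "\<Phi> = ?L"
    proof (rule extensionalityI[OF e restrict_extensional])
      fix x assume x: "x \<in> carrier (TP k)"
      show "\<Phi> x = ?L x"
      proof (rule TP_linear_eqI[OF lTP l lin _ x])
        fix us assume u: "length us = k" "set us \<subseteq> LW"
        show "\<Phi> (pure_power K CW (map cw us)) = ?L (pure_power K CW (map cw us))"
          unfolding val[OF u] using \<Phi> u by simp
      qed
    qed
  qed
qed

end

theorem theorem3p4:
  fixes K :: "('k, 'p) ring_scheme" and W :: "('k, 'w, 'q) module_scheme"
    and \<beta> :: "'w \<Rightarrow> 'w \<Rightarrow> 'k" and k :: nat
  assumes "field K"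
    and char_zero: "\<And>n::nat. n > 0 \<Longrightarrow> [n] \<cdot>\<^bsub>K\<^esub> \<one>\<^bsub>K\<^esub> \<noteq> \<zero>\<^bsub>K\<^esub>"
    and "module K W"
    and finite_dim: "\<exists>S. finite S \<and> S \<subseteq> carrier W \<and> submodule_generated K W S = carrier W"
    and pairing_closed: "\<And>u v. u \<in> carrier W \<Longrightarrow> v \<in> carrier W \<Longrightarrow> \<beta> u v \<in> carrier K"
    and pairing_add_left: "\<And>u u' v. u \<in> carrier W \<Longrightarrow> u' \<in> carrier W \<Longrightarrow> v \<in> carrier W \<Longrightarrow>
      \<beta> (u \<oplus>\<^bsub>W\<^esub> u') v = \<beta> u v \<oplus>\<^bsub>K\<^esub> \<beta> u' v"
    and pairing_smult_left: "\<And>c u v. c \<in> carrier K \<Longrightarrow> u \<in> carrier W \<Longrightarrow> v \<in> carrier W \<Longrightarrow>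
      \<beta> (c \<odot>\<^bsub>W\<^esub> u) v = c \<otimes>\<^bsub>K\<^esub> \<beta> u v"
    and pairing_add_right: "\<And>u v v'. u \<in> carrier W \<Longrightarrow> v \<in> carrier W \<Longrightarrow> v' \<in> carrier W \<Longrightarrow>
      \<beta> u (v \<oplus>\<^bsub>W\<^esub> v') = \<beta> u v \<oplus>\<^bsub>K\<^esub> \<beta> u v'"
    and pairing_smult_right: "\<And>c u v. c \<in> carrier K \<Longrightarrow> u \<in> carrier W \<Longrightarrow> v \<in> carrier W \<Longrightarrow>
      \<beta> u (c \<odot>\<^bsub>W\<^esub> v) = c \<otimes>\<^bsub>K\<^esub> \<beta> u v"
    and skew_symmetric: "\<And>u v. u \<in> carrier W \<Longrightarrow> v \<in> carrier W \<Longrightarrow> \<beta> u v = \<ominus>\<^bsub>K\<^esub> \<beta> v u"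
    and "k \<ge> 1"
  shows "(\<lambda>x \<in> carrier (tensor_power K (cyclic_words K W) k).
            ((\<ominus>\<^bsub>K\<^esub> \<one>\<^bsub>K\<^esub>) [^]\<^bsub>K\<^esub> k)
              \<odot>\<^bsub>tensor_power K (cyclic_words K W) 2\<^esub>
            delta K W \<beta> (canonical_connection K W) k x)
         = graph_operation K W \<beta> (cycle_graph k)"
proof -
  have W: "left_module K W" by (rule module.left_module[OF \<open>module K W\<close>])
  obtain S where S: "finite S" "S \<subseteq> carrier W" "submodule_generated K W S = carrier W" using finite_dim by auto
  obtain I \<zeta> where "tensor_algebra_basis K W I \<zeta>" by (rule dual_basis_exists[OF \<open>field K\<close> W S])
  then interpret B: tensor_algebra_basis K W I \<zeta> .
  interpret hamiltonian_divergence K W I \<zeta> \<beta>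
    by (intro hamiltonian_divergence.intro tensor_algebra_pairing.intro tensor_algebra_pairing_axioms.intro
        B.tensor_algebra_basis_axioms B.tensor_algebra_axioms)
      (fact pairing_closed pairing_add_left pairing_smult_left pairing_add_right pairing_smult_right)+
  show ?thesis by (rule delta_eq_graph_operation[OF \<open>k \<ge> 1\<close>])
qed

end
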